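(* Let $T>0$ and let $\Omega\subset\mathbb{R}^d$ be open and bounded with $C^2$ boundary. Let $f\in W^{1,\infty}_{\mathrm{loc}}(\mathbb{R};\mathbb{R}^d)$; let $b\in W^{1,\infty}_{\mathrm{loc}}(\mathbb{R};\mathbb{R})$ be non-decreasing with weak derivative $b'\in BV_{\mathrm{loc}}(\mathbb{R})$; let $u^c\in (C^2\cap L^\infty)(Q^c)$ have an extension $\overline{u}^c\in (C^2\cap L^\infty)([0,T]\times\mathbb{R}^d)$; and let $u_0\in L^\infty(\Omega)$. Let $\mu$ and $(\mu_n)_{n\in\mathbb{N}}$ be symmetric Lévy measures on $\mathbb{R}^d$ such that $\int_{\mathbb{R}^d}(|z|^2\wedge1)\,\mathrm{d}|\mu_n-\mu|(z)\to0$ as $n\to\infty$, let $\mathcal{L}_n$ and $m_n$ be the operator and the multiplier associated with $\mu_n$, and let $u_n$ be the entropy solution of $$\begin{cases}\partial_t u_n+\mathrm{div}\big(f(u_n)\big)=\mathcal{L}_n[b(u_n)] & \text{in } Q=(0,T)\times\Omega,\\ u_n=u^c & \text{in } Q^c=(0,T)\times\Omega^c,\\ u_n(0,\cdot)=u_0 & \text{on }\Omega.\end{cases}$$ Assume that $$\liminf_{|\xi|,n\to\infty}m_n(\xi)=\infty.$$ Then $(b(u_n))_{n\in\mathbb{N}}\subset L^2(Q)$ is precompact.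
   Context: Sets: $\Omega^c=\mathbb{R}^d\setminus\Omega$, $Q=(0,T)\times\Omega$, $Q^c=(0,T)\times\Omega^c$, $\Gamma=(0,T)\times\partial\Omega$, $M=(0,T)\times\mathbb{R}^d$; $\mathrm{d}\sigma$ is the $(d-1)$-dimensional Hausdorff measure on $\partial\Omega$. Write $(a)^+=\max\{a,0\}$, $(a)^-=(-a)^+$; $\mathrm{sgn}^\pm(a)=\pm1$ if $\pm a>0$ and $0$ otherwise; $a\wedge b=\min\{a,b\}$. A symmetric Lévy measure on $\mathbb{R}^d$ is a nonnegative Borel measure $\mu$ with $\mu(E)=\mu(-E)$ for all Borel $E$, $\mu(\{0\})=0$ and $\int_{\mathbb{R}^d}(|z|^2\wedge1)\,\mathrm{d}\mu(z)<\infty$. Its associated operator is $\mathcal{L}[\phi](x)=\lim_{\epsilon\to0}\int_{|z|>\epsilon}(\phi(x+z)-\phi(x))\,\mathrm{d}\mu(z)$ for $\phi\in C_c^\infty(\mathbb{R}^d)$. For $r>0$, $\mathcal{L}^{\ge r}$ and $\mathcal{L}^{<r}$ are defined in the same way with the integration restricted to $\{|z|\ge r\}$ and $\{|z|<r\}$; they act in the $x$-variable, and $\mathcal{L}^{\ge r}$ extends to a bounded operator on $L^\infty(\mathbb{R}^d)$. The associated multiplier is $m(\xi)=\int_{\mathbb{R}^d}(1-\cos(\xi\cdot z))\,\mathrm{d}\mu(z)$, $\xi\in\mathbb{R}^d$. The condition $\liminf_{|\xi|,n\to\infty}m_n(\xi)=\infty$ means $\lim_{R\to\infty}\inf\{m_n(\xi):|\xi|\ge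 R,\ n\ge R\}=\infty$. The measure $|\mu_n-\mu|$ is the total variation measure of $\mu_n-\mu$; equivalently, $(|z|^2\wedge1)\,\mathrm{d}|\mu_n-\mu|$ is the total variation of the finite signed measure $(|z|^2\wedge1)\,\mathrm{d}\mu_n-(|z|^2\wedge1)\,\mathrm{d}\mu$. For $u,k\in\mathbb{R}$ let $F^\pm(u,k)=\mathrm{sgn}^\pm(u-k)(f(u)-f(k))$. Entropy solution: $u\in L^\infty(M)$ is an entropy solution of $\partial_tu+\mathrm{div}(f(u))=\mathcal{L}[b(u)]$ in $Q$, $u=u^c$ in $Q^c$, $u(0,\cdot)=u_0$ on $\Omega$, if (a) for both choices of sign $\pm$, for all $r>0$, and for all $k\in\mathbb{R}$ and $0\le\varphi\in C_c^\infty([0,T)\times\mathbb{R}^d)$ satisfying $(b(u^c)-b(k))^\pm\varphi=0$ in $Q^c$, $$-\int_Q\Big((u-k)^\pm\partial_t\varphi+F^\pm(u,k)\cdot\nabla\varphi\Big)\mathrm{d}x\,\mathrm{d}t-\int_Q\mathcal{L}^{\ge r}[b(u)]\,\mathrm{sgn}^\pm(u-k)\varphi\,\mathrm{d}x\,\mathrm{d}t-\int_M(b(u)-b(k))^\pm\mathcal{L}^{<r}[\varphi]\,\mathrm{d}x\,\mathrm{d}t$$ $$\le\int_\Omega(u_0-k)^\pm\varphi(0,\cdot)\,\mathrm{d}x+L_f\int_\Gamma(\overline{u}^c-k)^\pm\varphi\,\mathrm{d}\sigma(x)\,\mathrm{d}t,$$ and (b) $u=u^c$ a.e. in $Q^c$.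 Here $L_f$ is the Lipschitz constant of $f$ on the smallest compact interval containing $k$ and the essential ranges of $u$, $u_0$, $u^c$. Entropy solutions are unique. *)

theory Defs
  imports "HOL-Analysis.Analysis"
begin

text \<open>
  Conventions.  The space \<open>\<real>\<^sup>d\<close> is a type \<open>'a :: euclidean_space\<close> with \<open>d = DIM('a)\<close>; space-time
  points are pairs \<open>(t, x) :: real \<times> 'a\<close>.  Functions on a subset are total functions whose values
  off that subset are never used.  Elements of \<open>L\<^sup>\<infinity>\<close> and \<open>L\<^sup>2\<close> are given by Borel measurable
  representatives, so that they can be integrated against arbitrary Borel measures.  A sign
  \<open>\<plusminus>\<close> is encoded as a real number \<open>s \<in> {1, - 1}\<close>.
\<close>

section \<open>Function spaces\<close>

subsection \<open>Continuously differentiable functions and test functions\<close>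

text \<open>
  The derivatives are taken within \<open>S\<close>.  For open \<open>S\<close> this is the usual class \<open>C\<^sup>k(S)\<close>; for sets such
  as \<open>[0,T] \<times> \<real>\<^sup>d\<close> it asks for derivatives that are continuous up to the boundary.
\<close>

primrec Ck_on :: "nat \<Rightarrow> 'a::euclidean_space set \<Rightarrow> ('a \<Rightarrow> real) \<Rightarrow> bool" where
  "Ck_on 0 S f \<longleftrightarrow> continuous_on S f"
| "Ck_on (Suc k) S f \<longleftrightarrow>
     (\<exists>D :: 'a \<Rightarrow> 'a. (\<forall>x\<in>S. (f has_derivative (\<lambda>h. D x \<bullet> h)) (at x within S)) \<and>
                    (\<forall>i\<in>Basis. Ck_on k S (\<lambda>x. D x \<bullet> i)))"

text \<open>
  The space \<open>C\<^sub>c\<^sup>\<infinity>(S)\<close>, its elements being extended by \<open>0\<close> off \<open>S\<close>.  The set \<open>S\<close> need not be open: a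
  member of \<open>C\<^sub>c\<^sup>\<infinity>([0,T) \<times> \<real>\<^sup>d)\<close> need not vanish at \<open>t = 0\<close>.
\<close>

definition test_function_on :: "'a::euclidean_space set \<Rightarrow> ('a \<Rightarrow> real) \<Rightarrow> bool" where
  "test_function_on S \<phi> \<longleftrightarrow>
     (\<forall>k. Ck_on k S \<phi>) \<and> (\<exists>K. compact K \<and> K \<subseteq> S \<and> (\<forall>x. x \<notin> K \<longrightarrow> \<phi> x = 0))"

definition gradient :: "('a::euclidean_space \<Rightarrow> real) \<Rightarrow> 'a \<Rightarrow> 'a" where
  "gradient g x = (\<Sum>i\<in>Basis. frechet_derivative g (at x) i *\<^sub>R i)"

subsection \<open>Weak derivatives of functions on the real line\<close>

definition locally_integrable :: "(real \<Rightarrow> 'b::euclidean_space) \<Rightarrow> bool" where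
  "locally_integrable f \<longleftrightarrow>
     f \<in> borel_measurable borel \<and> (\<forall>K. compact K \<longrightarrow> set_integrable lborel K f)"

definition weak_derivative ::
    "(real \<Rightarrow> 'b::euclidean_space) \<Rightarrow> (real \<Rightarrow> 'b) \<Rightarrow> bool" where
  "weak_derivative f g \<longleftrightarrow> locally_integrable f \<and> locally_integrable g \<and>
     (\<forall>\<phi>. test_function_on UNIV \<phi> \<longrightarrow>
        (LINT x|lborel. deriv \<phi> x *\<^sub>R f x) = - (LINT x|lborel. \<phi> x *\<^sub>R g x))"

definition Linf_loc :: "(real \<Rightarrow> 'b::euclidean_space) \<Rightarrow> bool" where
  "Linf_loc f \<longleftrightarrow> f \<in> borel_measurable borel \<and>
     (\<forall>K. compact K \<longrightarrow> (\<exists>C. AE x in lborel. x \<in> K \<longrightarrow> norm (f x) \<le> C))"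

text \<open>
  Every class in \<open>W\<^sup>1\<^sup>,\<^sup>\<infinity>\<^sub>l\<^sub>o\<^sub>c(\<real>)\<close> has exactly one continuous representative.  Since the members are
  evaluated pointwise below, that representative is the one meant here.
\<close>

definition W1inf_loc :: "(real \<Rightarrow> 'b::euclidean_space) \<Rightarrow> bool" where
  "W1inf_loc f \<longleftrightarrow> continuous_on UNIV f \<and> Linf_loc f \<and> (\<exists>g. weak_derivative f g \<and> Linf_loc g)"

definition BV_loc :: "(real \<Rightarrow> real) \<Rightarrow> bool" where
  "BV_loc g \<longleftrightarrow> locally_integrable g \<and>
     (\<forall>V. open V \<and> bounded V \<longrightarrow>
        bdd_above {LINT x|lborel. g x * deriv \<phi> x |\<phi>.
                     test_function_on V \<phi> \<and> (\<forall>x. \<bar>\<phi> x\<bar> \<le> 1)})"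

subsection \<open>Essentially bounded functions\<close>

definition Linf :: "'a::euclidean_space set \<Rightarrow> ('a \<Rightarrow> real) \<Rightarrow> bool" where
  "Linf S u \<longleftrightarrow> u \<in> borel_measurable (restrict_space lborel S) \<and>
     (\<exists>C. AE x in restrict_space lborel S. \<bar>u x\<bar> \<le> C)"

definition essential_range :: "'a::euclidean_space set \<Rightarrow> ('a \<Rightarrow> real) \<Rightarrow> real set" where
  "essential_range S u =
     {y. \<forall>e>0. emeasure (restrict_space lborel S) {x \<in> S. \<bar>u x - y\<bar> < e} > 0}"

subsection \<open>The metric space of square integrable functions\<close>

definition L2_fun :: "'m measure \<Rightarrow> ('m \<Rightarrow> real) set" where
  "L2_fun M = {g. g \<in> borel_measurable M \<and> integrable M (\<lambda>x. (g x)\<^sup>2)}"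

definition L2_class :: "'m measure \<Rightarrow> ('m \<Rightarrow> real) \<Rightarrow> ('m \<Rightarrow> real) set" where
  "L2_class M g = {h \<in> L2_fun M. AE x in M. h x = g x}"

definition L2_space :: "'m measure \<Rightarrow> ('m \<Rightarrow> real) set set" where
  "L2_space M = L2_class M ` L2_fun M"

definition L2_dist :: "'m measure \<Rightarrow> ('m \<Rightarrow> real) set \<Rightarrow> ('m \<Rightarrow> real) set \<Rightarrow> real" where
  "L2_dist M A B = sqrt (LINT x|M. ((SOME g. g \<in> A) x - (SOME h. h \<in> B) x)\<^sup>2)"

definition L2_topology :: "'m measure \<Rightarrow> ('m \<Rightarrow> real) set topology" where
  "L2_topology M = Metric_space.mtopology (L2_space M) (L2_dist M)"

definition L2_precompact :: "'m measure \<Rightarrow> ('m \<Rightarrow> real) set \<Rightarrow> bool" where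
  "L2_precompact M S \<longleftrightarrow> S \<subseteq> L2_fun M \<and>
     compactin (L2_topology M) (L2_topology M closure_of (L2_class M ` S))"

lemma L2_mult_integrable:
  assumes "f \<in> L2_fun M" "g \<in> L2_fun M"
  shows "integrable M (\<lambda>x. f x * g x)"
proof (rule Bochner_Integration.integrable_bound)
  show "integrable M (\<lambda>x. (f x)\<^sup>2 + (g x)\<^sup>2)"
    using assms by (auto simp: L2_fun_def)
  show "(\<lambda>x. f x * g x) \<in> borel_measurable M"
    using assms by (auto simp: L2_fun_def)
  have "\<bar>a * b\<bar> \<le> a\<^sup>2 + b\<^sup>2" for a b :: real
  proof -
    have "0 \<le> (\<bar>a\<bar> - \<bar>b\<bar>)\<^sup>2" by simp
    then have "2 * (\<bar>a\<bar> * \<bar>b\<bar>) \<le> a\<^sup>2 + b\<^sup>2" by (simp add: power2_diff)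
    moreover have "0 \<le> \<bar>a\<bar> * \<bar>b\<bar>" by simp
    ultimately show ?thesis unfolding abs_mult by linarith
  qed
  then show "AE x in M. norm (f x * g x) \<le> norm ((f x)\<^sup>2 + (g x)\<^sup>2)"
    by auto
qed

lemma L2_diff: "f \<in> L2_fun M \<Longrightarrow> g \<in> L2_fun M \<Longrightarrow> (\<lambda>x. f x - g x) \<in> L2_fun M"
  using L2_mult_integrable[of f M g]
  by (auto simp: L2_fun_def power2_diff mult.assoc intro!: Bochner_Integration.integrable_diff
      Bochner_Integration.integrable_add)

lemma L2_triangle:
  assumes a: "a \<in> L2_fun M" and b: "b \<in> L2_fun M"
  shows "sqrt (LINT x|M. (a x + b x)\<^sup>2) \<le> sqrt (LINT x|M. (a x)\<^sup>2) + sqrt (LINT x|M. (b x)\<^sup>2)"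
proof -
  define A B C where "A = (LINT x|M. (a x)\<^sup>2)" and "B = (LINT x|M. (b x)\<^sup>2)"
    and "C = (LINT x|M. a x * b x)"
  note ab = L2_mult_integrable[OF a b]
  have ia: "integrable M (\<lambda>x. (a x)\<^sup>2)" and ib: "integrable M (\<lambda>x. (b x)\<^sup>2)"
    using a b by (auto simp: L2_fun_def)
  have expand: "(LINT x|M. (p * a x + q * b x)\<^sup>2) = p\<^sup>2 * A + q\<^sup>2 * B + 2 * p * q * C" for p q
  proof -
    have "(LINT x|M. (p * a x + q * b x)\<^sup>2) =
        (LINT x|M. p\<^sup>2 * (a x)\<^sup>2 + q\<^sup>2 * (b x)\<^sup>2 + 2 * p * q * (a x * b x))"
      by (rule arg_cong[where f = "integral\<^sup>L M"]) (auto simp: power2_sum power_mult_distrib algebra_simps)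
    also have "\<dots> = p\<^sup>2 * A + q\<^sup>2 * B + 2 * p * q * C"
      using ia ib ab by (simp add: A_def B_def C_def)
    finally show ?thesis .
  qed
  have A0: "0 \<le> A" and B0: "0 \<le> B" by (simp_all add: A_def B_def)
  have nn: "0 \<le> p\<^sup>2 * A + q\<^sup>2 * B + 2 * p * q * C" for p q
    unfolding expand[symmetric] by simp
  have CS: "C \<le> sqrt A * sqrt B"
  proof (cases "A = 0 \<or> B = 0")
    case True
    then have "C \<le> 0"
    proof
      assume "A = 0"
      with nn[of "- (B + 1)" 1] have "2 * (B + 1) * C \<le> B" by (simp add: algebra_simps)
      moreover have "B < 2 * (B + 1) * C" if "C > 0" "B = 0" using that by simp
      moreover have "C \<le> 0" if "B > 0"
      proof (rule ccontr)
        assume "\<not> C \<le> 0"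
        with nn[of "- (B / C)" 1] \<open>A = 0\<close> that show False by (simp add: field_simps)
      qed
      ultimately show ?thesis using B0 by force
    next
      assume "B = 0"
      have "C \<le> 0" if "A > 0"
      proof (rule ccontr)
        assume "\<not> C \<le> 0"
        with nn[of 1 "- (A / C)"] \<open>B = 0\<close> that show False by (simp add: field_simps)
      qed
      moreover have "C \<le> 0" if "A = 0"
        using nn[of 1 "- 1"] \<open>B = 0\<close> that by simp
      ultimately show ?thesis using A0 by force
    qed
    then show ?thesis using A0 B0 by (meson order_trans mult_nonneg_nonneg real_sqrt_ge_zero)
  next
    case False
    then have p: "sqrt A > 0" "sqrt B > 0" using A0 B0 by auto
    have "0 \<le> 2 * (sqrt A * sqrt B) * (sqrt A * sqrt B - C)"
      using nn[of "sqrt B" "- sqrt A"] A0 B0 by (simp add: algebra_simps)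
    moreover have "0 < 2 * (sqrt A * sqrt B)" using p by simp
    ultimately have "0 \<le> sqrt A * sqrt B - C"
      by (metis zero_le_mult_iff not_le)
    then show ?thesis by simp
  qed
  have "A + B + 2 * C \<le> (sqrt A + sqrt B)\<^sup>2"
    using CS A0 B0 by (simp add: power2_sum)
  then have "sqrt (A + B + 2 * C) \<le> sqrt A + sqrt B"
    using A0 B0 by (intro real_le_lsqrt) auto
  then show ?thesis
    using expand[of 1 1] by (simp add: A_def B_def)
qed

lemma Metric_space_L2: "Metric_space (L2_space M) (L2_dist M)"
proof
  have rep: "(SOME g. g \<in> A) \<in> A" "A = L2_class M (SOME g. g \<in> A)" "(SOME g. g \<in> A) \<in> L2_fun M"
    if A: "A \<in> L2_space M" for A
  proof -
    obtain f where f: "f \<in> L2_fun M" "A = L2_class M f"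
      using A by (auto simp: L2_space_def)
    then have "f \<in> A" by (auto simp: L2_class_def)
    then show *: "(SOME g. g \<in> A) \<in> A" by (rule someI[where P = "\<lambda>g. g \<in> A"])
    then show "(SOME g. g \<in> A) \<in> L2_fun M" using f by (auto simp: L2_class_def)
    have ae: "AE x in M. (SOME g. g \<in> A) x = f x" using * f by (auto simp: L2_class_def)
    show "A = L2_class M (SOME g. g \<in> A)"
    proof (intro set_eqI iffI)
      fix h assume "h \<in> A"
      then have "h \<in> L2_fun M" and "AE x in M. h x = f x" using f by (auto simp: L2_class_def)
      with ae show "h \<in> L2_class M (SOME g. g \<in> A)"
        unfolding L2_class_def by auto
    next
      fix h assume "h \<in> L2_class M (SOME g. g \<in> A)"
      then have "h \<in> L2_fun M" and "AE x in M. h x = (SOME g. g \<in> A) x" by (auto simp: L2_class_def)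
      with ae have "h \<in> L2_class M f" unfolding L2_class_def by auto
      then show "h \<in> A" using f by simp
    qed
  qed
  show "0 \<le> L2_dist M A B" for A B by (simp add: L2_dist_def)
  show "L2_dist M A B = L2_dist M B A" for A B
    by (simp add: L2_dist_def power2_commute)
  show "L2_dist M A B = 0 \<longleftrightarrow> A = B" if A: "A \<in> L2_space M" and B: "B \<in> L2_space M" for A B
  proof
    define g h where "g = (SOME g. g \<in> A)" and "h = (SOME g. g \<in> B)"
    note d = L2_diff[OF rep(3)[OF A] rep(3)[OF B], folded g_def h_def]
    assume "L2_dist M A B = 0"
    then have "(LINT x|M. (g x - h x)\<^sup>2) = 0" by (simp add: L2_dist_def g_def h_def)
    then have "AE x in M. (g x - h x)\<^sup>2 = 0"
      using d by (subst (asm) integral_nonneg_eq_0_iff_AE) (auto simp: L2_fun_def)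
    then have ae: "AE x in M. g x = h x" by simp
    have "L2_class M g = L2_class M h"
      unfolding L2_class_def using ae by (auto elim: AE_mp)
    then show "A = B" using rep(2)[OF A] rep(2)[OF B] by (simp add: g_def h_def)
  qed (simp add: L2_dist_def)
  show "L2_dist M A C \<le> L2_dist M A B + L2_dist M B C"
    if A: "A \<in> L2_space M" and B: "B \<in> L2_space M" and C: "C \<in> L2_space M" for A B C
    using L2_triangle[OF L2_diff[OF rep(3)[OF A] rep(3)[OF B]] L2_diff[OF rep(3)[OF B] rep(3)[OF C]]]
    by (simp add: L2_dist_def)
qed

section \<open>The domain and its surface measure\<close>

text \<open>
  Near each boundary point \<open>\<Omega>\<close> lies on one side of the graph of a \<open>C\<^sup>2\<close> function over the hyperplane
  orthogonal to a unit vector \<open>\<nu>\<close>.  Only the values of \<open>\<gamma>\<close> on that hyperplane matter; a \<open>C\<^sup>2\<close> function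
  on the hyperplane extends to a \<open>C\<^sup>2\<close> function on the whole space by composition with the
  orthogonal projection.
\<close>

definition C2_boundary :: "'a::euclidean_space set \<Rightarrow> bool" where
  "C2_boundary \<Omega> \<longleftrightarrow>
     (\<forall>x0 \<in> frontier \<Omega>. \<exists>\<rho>>0. \<exists>\<nu> \<gamma>. norm \<nu> = 1 \<and> Ck_on 2 UNIV \<gamma> \<and>
        \<Omega> \<inter> ball x0 \<rho> = {x \<in> ball x0 \<rho>. \<gamma> (x - (x \<bullet> \<nu>) *\<^sub>R \<nu>) < x \<bullet> \<nu>})"

text \<open>
  The normalisation makes the \<open>n\<close>-dimensional measure in \<open>\<real>\<^sup>n\<close> equal to Lebesgue measure.  Nonempty
  sets of diameter \<open>0\<close> contribute \<open>0 ^ 0 = 1\<close> for \<open>n = 0\<close>, which gives counting measure.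
\<close>

definition hausdorff_outer :: "nat \<Rightarrow> 'a::euclidean_space set \<Rightarrow> ennreal" where
  "hausdorff_outer n A =
     (SUP \<delta>\<in>{0<..}. INF C \<in> {C :: nat \<Rightarrow> 'a set.
          A \<subseteq> (\<Union>j. C j) \<and> (\<forall>j. bounded (C j) \<and> diameter (C j) \<le> \<delta>)}.
        (\<Sum>j. if C j = {} then 0 else ennreal (unit_ball_vol (real n) * (diameter (C j) / 2) ^ n)))"

definition hausdorff_measure :: "nat \<Rightarrow> 'a::euclidean_space measure" where
  "hausdorff_measure n = measure_of UNIV (sets borel) (hausdorff_outer n)"

definition surface_measure :: "'a::euclidean_space set \<Rightarrow> 'a measure" where
  "surface_measure \<Omega> = restrict_space (hausdorff_measure (DIM('a) - 1)) (frontier \<Omega>)"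

definition lateral_measure :: "real \<Rightarrow> 'a::euclidean_space set \<Rightarrow> (real \<times> 'a) measure" where
  "lateral_measure T \<Omega> = restrict_space lborel {0<..<T} \<Otimes>\<^sub>M surface_measure \<Omega>"

section \<open>Levy measures and operators\<close>

definition symmetric_levy_measure :: "'a::euclidean_space measure \<Rightarrow> bool" where
  "symmetric_levy_measure \<mu> \<longleftrightarrow> sets \<mu> = sets borel \<and>
     (\<forall>E\<in>sets borel. emeasure \<mu> (uminus ` E) = emeasure \<mu> E) \<and>
     emeasure \<mu> {0} = 0 \<and>
     (\<integral>\<^sup>+z. ennreal (min ((norm z)\<^sup>2) 1) \<partial>\<mu>) < \<infinity>"

text \<open>
  The total variation measure \<open>\<bar>\<mu> - \<nu>\<bar>\<close> of the difference of two \<open>\<sigma>\<close>-finite measures.  The difference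
  itself may be undefined on sets of infinite measure, so the pieces of a partition are
  restricted to sets on which both measures are finite.
\<close>

definition variation_diff :: "'m measure \<Rightarrow> 'm measure \<Rightarrow> 'm measure" where
  "variation_diff \<mu> \<nu> = measure_of (space \<mu>) (sets \<mu>)
     (\<lambda>E. SUP P \<in> {P. finite P \<and> disjoint P \<and> P \<subseteq> sets \<mu> \<and> \<Union>P \<subseteq> E \<and>
                      (\<forall>A\<in>P. emeasure \<mu> A < \<infinity> \<and> emeasure \<nu> A < \<infinity>)}.
        (\<Sum>A\<in>P. ennreal \<bar>measure \<mu> A - measure \<nu> A\<bar>))"

text \<open>
  The operator with the jumps restricted to \<open>J\<close>: \<open>J = UNIV\<close> gives \<open>\<L>\<close>, \<open>J = {z. r \<le> norm z}\<close> gives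
  \<open>\<L>\<^sup>\<ge>\<^sup>r\<close> and \<open>J = {z. norm z < r}\<close> gives \<open>\<L>\<^sup><\<^sup>r\<close>.  In the second case the integral does not
  depend on \<open>\<epsilon> < r\<close>, and the formula is also the extension to bounded functions.
\<close>

definition levy_operator ::
    "'a::euclidean_space measure \<Rightarrow> 'a set \<Rightarrow> ('a \<Rightarrow> real) \<Rightarrow> 'a \<Rightarrow> real" where
  "levy_operator \<mu> J \<phi> x =
     Lim (at_right 0) (\<lambda>\<epsilon>. LINT z:J \<inter> {z. \<epsilon> < norm z}|\<mu>. \<phi> (x + z) - \<phi> x)"

definition levy_multiplier :: "'a::euclidean_space measure \<Rightarrow> 'a \<Rightarrow> real" where
  "levy_multiplier \<mu> \<xi> = (LINT z|\<mu>. 1 - cos (\<xi> \<bullet> z))"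

section \<open>Entropy solutions\<close>

definition signed_part :: "real \<Rightarrow> real \<Rightarrow> real" where
  "signed_part s a = max (s * a) 0"

definition signed_sgn :: "real \<Rightarrow> real \<Rightarrow> real" where
  "signed_sgn s a = (if s * a > 0 then s else 0)"

definition entropy_flux ::
    "real \<Rightarrow> (real \<Rightarrow> 'a::euclidean_space) \<Rightarrow> real \<Rightarrow> real \<Rightarrow> 'a" where
  "entropy_flux s f v k = signed_sgn s (v - k) *\<^sub>R (f v - f k)"

definition lipschitz_constant :: "(real \<Rightarrow> 'a::euclidean_space) \<Rightarrow> real set \<Rightarrow> real" where
  "lipschitz_constant f I = Inf {C. C-lipschitz_on I f}"

text \<open>
  The hull below is the smallest compact interval containing \<open>k\<close> and the three essential ranges,
  which are compact because the functions are essentially bounded.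
\<close>

definition flux_constant ::
    "real \<Rightarrow> 'a::euclidean_space set \<Rightarrow> (real \<Rightarrow> 'a) \<Rightarrow> (real \<times> 'a \<Rightarrow> real) \<Rightarrow> ('a \<Rightarrow> real) \<Rightarrow>
     (real \<times> 'a \<Rightarrow> real) \<Rightarrow> real \<Rightarrow> real" where
  "flux_constant T \<Omega> f uc u0 u k =
     lipschitz_constant f
       (convex hull (insert k
          (essential_range ({0<..<T} \<times> UNIV) u \<union> essential_range \<Omega> u0 \<union>
           essential_range ({0<..<T} \<times> (- \<Omega>)) uc)))"

definition entropy_solution ::
    "real \<Rightarrow> 'a::euclidean_space set \<Rightarrow> (real \<Rightarrow> 'a) \<Rightarrow> (real \<Rightarrow> real) \<Rightarrow> 'a measure \<Rightarrow>
     (real \<times> 'a \<Rightarrow> real) \<Rightarrow> (real \<times> 'a \<Rightarrow> real) \<Rightarrow> ('a \<Rightarrow> real) \<Rightarrow> (real \<times> 'a \<Rightarrow> real) \<Rightarrow> bool" where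
  "entropy_solution T \<Omega> f b \<mu> uc uc_ext u0 u \<longleftrightarrow>
     Linf ({0<..<T} \<times> UNIV) u \<and>
     (\<forall>s\<in>{1, - 1}. \<forall>r>0. \<forall>k. \<forall>\<phi>.
        test_function_on ({0..<T} \<times> UNIV) \<phi> \<and> (\<forall>p. 0 \<le> \<phi> p) \<and>
        (\<forall>p \<in> {0<..<T} \<times> (- \<Omega>). signed_part s (b (uc p) - b k) * \<phi> p = 0) \<longrightarrow>
        - (LINT (t, x):{0<..<T} \<times> \<Omega>|lborel.
              signed_part s (u (t, x) - k) * deriv (\<lambda>\<tau>. \<phi> (\<tau>, x)) t +
              entropy_flux s f (u (t, x)) k \<bullet> gradient (\<lambda>y. \<phi> (t, y)) x)
        - (LINT (t, x):{0<..<T} \<times> \<Omega>|lborel.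
              levy_operator \<mu> {z. r \<le> norm z} (\<lambda>y. b (u (t, y))) x *
              signed_sgn s (u (t, x) - k) * \<phi> (t, x))
        - (LINT (t, x):{0<..<T} \<times> UNIV|lborel.
              signed_part s (b (u (t, x)) - b k) *
              levy_operator \<mu> {z. norm z < r} (\<lambda>y. \<phi> (t, y)) x)
        \<le> (LINT x:\<Omega>|lborel. signed_part s (u0 x - k) * \<phi> (0, x))
          + flux_constant T \<Omega> f uc u0 u k *
            (LINT p|lateral_measure T \<Omega>. signed_part s (uc_ext p - k) * \<phi> p)) \<and>
     (AE p in lborel. p \<in> {0<..<T} \<times> (- \<Omega>) \<longrightarrow> u p = uc p)"

end

theory Submission
  imports Defs "HOL-Probability.Probability" "HOL-Complex_Analysis.Great_Picard" "HOL-Real_Asymp.Real_Asymp"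
begin

text \<open>
  A maximum principle bounds all \<open>u\<^sub>n\<close> by one constant, so layers near the boundary of \<open>Q\<close> contribute
  little and it suffices to find compactness of \<open>\<phi> b(u\<^sub>n)\<close> for cut-offs \<open>\<phi>\<close> supported inside \<open>Q\<close>.
  The entropy inequalities, averaged over levels \<open>k\<close> that are equidistant in \<open>b(k)\<close>, give an energy
  estimate: the integral of \<open>m\<^sub>n(\<xi>) |F(\<phi> b(u\<^sub>n))(\<tau>, \<xi>)|\<^sup>2\<close>, with \<open>F\<close> the Fourier transform, is bounded uniformly in
  \<open>n\<close>. As the multipliers \<open>m\<^sub>n\<close> diverge, high spatial frequencies are uniformly negligible.
  The equation tested with \<open>\<phi>\<close> times waves \<open>1 + cos(\<omega> \<bullet> p + c)\<close> shows that \<open>F(\<phi> u\<^sub>n)\<close> decays like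
  \<open>1/|\<tau>|\<close> for bounded \<open>\<xi>\<close>. Time regularity is thus available for \<open>u\<^sub>n\<close> and space regularity for \<open>b(u\<^sub>n)\<close>. Since
  \<open>b\<close> is monotone, the difference of \<open>b(u\<^sub>n)\<close> and \<open>b(u\<^sub>m)\<close> is controlled by the pairing of
  \<open>\<phi> (b(u\<^sub>n) - b(u\<^sub>m))\<close> with \<open>\<phi> (u\<^sub>n - u\<^sub>m)\<close>, which Plancherel's theorem moves to frequency space:
  there it is small at high frequencies by the two estimates, and at low frequencies because, along a
  subsequence, \<open>F(\<phi> u\<^sub>n)\<close> converges pointwise.
\<close>

section \<open>Smooth test functions\<close>

text \<open>The function \<open>b\<close> may be constant on intervals. On the corresponding values
  nothing damps spatial oscillations of the solutions, while the equation gives no direct control of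
  the time derivative of \<open>b(u)\<close>; so neither family has regularity in both variables,
  and only the pairing of the two can be controlled. Cut-offs supported inside \<open>Q\<close> make
  every level k admissible and remove the initial and boundary terms; the price is the thin
  remainder near the boundary. The decay in \<tau> has a constant growing like |\<xi>|^2. This is
  harmless because it serves only on a slab |\<xi>| < R that is fixed beforehand by the multipliers.
  All constants must be free of n. They depend on the Levy measure only through a bound \<Lambda>
  for the integral of min(|z|^2, 1), and the convergence in total variation supplies one \<Lambda>
  for the whole sequence. Working on all of space-time with products such as
  \<open>\<phi> p * v n p\<close> lets one Fourier transform serve both variables: the multiplier
  sees \<open>snd \<omega>\<close>, the time estimate sees \<open>fst \<omega>\<close>.\<close>

definition flat :: "nat \<Rightarrow> real \<Rightarrow> real" where
  "flat m x = (if x > 0 then exp (- (1 / x)) / x ^ m else 0)"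

lemma flat_nonneg: "0 \<le> flat m x"
  by (simp add: flat_def)

lemma flat_pos_iff: "0 < flat m x \<longleftrightarrow> 0 < x"
  by (simp add: flat_def)

lemma flat_zero_iff: "flat m x = 0 \<longleftrightarrow> x \<le> 0"
  by (auto simp: flat_def)

text \<open>The powers in the denominator keep the family closed under differentiation. At 0 the
  difference quotient tends to 0 since the exponential beats every power.\<close>

lemma flat_has_derivative:
  "(flat m has_field_derivative flat (m + 2) x - real m * flat (m + 1) x) (at x)"
proof -
  consider "x > 0" | "x < 0" | "x = 0" by linarith
  then show ?thesis
  proof cases
    case 1
    have "((\<lambda>x. exp (- (1 / x)) / x ^ m) has_field_derivative
            flat (m + 2) x - real m * flat (m + 1) x) (at x)"
      using 1 by (auto intro!: derivative_eq_intros simp: flat_def divide_simps)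
         (cases m; simp add: algebra_simps power2_eq_square)
    then show ?thesis
      by (rule has_field_derivative_transform_within_open[of _ _ _ "{0<..}"])
        (use 1 in \<open>auto simp: flat_def\<close>)
  next
    case 2
    have "((\<lambda>x. 0) has_field_derivative flat (m + 2) x - real m * flat (m + 1) x) (at x)"
      using 2 by (simp add: flat_def)
    then show ?thesis
      by (rule has_field_derivative_transform_within_open[of _ _ _ "{..<0}"])
        (use 2 in \<open>auto simp: flat_def\<close>)
  next
    case 3
    have "((\<lambda>h. flat m h / h) \<longlongrightarrow> 0) (at_right 0)"
    proof (rule Lim_transform_eventually)
      show "((\<lambda>h::real. exp (- (1 / h)) / h ^ (m+1)) \<longlongrightarrow> 0) (at_right 0)"
        by real_asymp
      show "\<forall>\<^sub>F h in at_right 0. exp (- (1 / h)) / h ^ (m+1) = flat m h / h"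
        by (auto simp: flat_def eventually_at_right_less intro!: eventually_mono[OF eventually_at_right_less[of 0]])
    qed
    moreover have "((\<lambda>h. flat m h / h) \<longlongrightarrow> 0) (at_left 0)"
    proof (rule Lim_transform_eventually)
      show "((\<lambda>h::real. 0::real) \<longlongrightarrow> 0) (at_left 0)" by simp
      show "\<forall>\<^sub>F h in at_left 0. (0::real) = flat m h / h"
        by (rule eventually_mono[OF eventually_at_leftI[of "-1" 0 "\<lambda>h. h < 0"]]) (auto simp: flat_def)
    qed
    ultimately have "((\<lambda>h. flat m h / h) \<longlongrightarrow> 0) (at 0)"
      by (simp add: filterlim_split_at)
    then show ?thesis
      using 3 by (simp add: DERIV_def flat_def[of _ 0])
  qed
qed

text \<open>
  A family closed under products and partial derivatives: every member is \<open>C\<^sup>k\<close> for all \<open>k\<close>, and it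
  is rich enough to contain all test functions needed below.
\<close>

inductive smooth_fun :: "('b::euclidean_space \<Rightarrow> real) \<Rightarrow> bool" where
  const: "smooth_fun (\<lambda>x. c)"
| add: "smooth_fun f \<Longrightarrow> smooth_fun g \<Longrightarrow> smooth_fun (\<lambda>x. f x + g x)"
| mult: "smooth_fun f \<Longrightarrow> smooth_fun g \<Longrightarrow> smooth_fun (\<lambda>x. f x * g x)"
| inverse: "smooth_fun f \<Longrightarrow> (\<And>x. f x \<noteq> 0) \<Longrightarrow> smooth_fun (\<lambda>x. inverse (f x))"
| flat: "smooth_fun (\<lambda>x. flat m (a \<bullet> x + c))"
| sin: "smooth_fun (\<lambda>x. sin (a \<bullet> x + c))"

lemma smooth_fun_diff: "smooth_fun f \<Longrightarrow> smooth_fun g \<Longrightarrow> smooth_fun (\<lambda>x. f x - g x)"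
  using smooth_fun.add[OF _ smooth_fun.mult[OF smooth_fun.const[of "-1"]], of f g] by simp

lemma smooth_fun_cos: "smooth_fun (\<lambda>x. cos (a \<bullet> x + c))"
  using smooth_fun.sin[of a "c + pi / 2"] by (simp add: sin_add add.assoc[symmetric])

lemma smooth_fun_prod: "(\<And>i. i \<in> I \<Longrightarrow> smooth_fun (f i)) \<Longrightarrow> smooth_fun (\<lambda>x. \<Prod>i\<in>I. f i x)"
  by (induction I rule: infinite_finite_induct) (auto intro: smooth_fun.const smooth_fun.mult)

text \<open>Each generator has partial derivatives in the class: \<open>flat\<close> by its two-term
  derivative, \<open>sin\<close> through \<open>cos\<close>, inverses through products of inverses.
  Iteration then yields \<open>Ck_on k\<close> for every k.\<close>

lemma smooth_fun_gradient:
  assumes "smooth_fun f"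
  shows "\<exists>D. (\<forall>x. (f has_derivative (\<lambda>h. D x \<bullet> h)) (at x)) \<and> (\<forall>i. smooth_fun (\<lambda>x. D x \<bullet> i))"
  using assms
proof induction
  case (const c)
  show ?case by (rule exI[of _ "\<lambda>_. 0"]) (auto intro: smooth_fun.const)
next
  case (add f g)
  then obtain D E where
    "\<And>x. (f has_derivative (\<lambda>h. D x \<bullet> h)) (at x)" "\<And>i. smooth_fun (\<lambda>x. D x \<bullet> i)"
    "\<And>x. (g has_derivative (\<lambda>h. E x \<bullet> h)) (at x)" "\<And>i. smooth_fun (\<lambda>x. E x \<bullet> i)" by auto
  then show ?case
    by (intro exI[of _ "\<lambda>x. D x + E x"])
      (auto simp: inner_add_left intro!: smooth_fun.add has_derivative_add)
next
  case (mult f g)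
  then obtain D E where
    "\<And>x. (f has_derivative (\<lambda>h. D x \<bullet> h)) (at x)" "\<And>i. smooth_fun (\<lambda>x. D x \<bullet> i)"
    "\<And>x. (g has_derivative (\<lambda>h. E x \<bullet> h)) (at x)" "\<And>i. smooth_fun (\<lambda>x. E x \<bullet> i)" by auto
  with mult(1,2) show ?case
    by (intro exI[of _ "\<lambda>x. f x *\<^sub>R E x + g x *\<^sub>R D x"])
      (auto simp: inner_add_left mult.commute intro!: smooth_fun.intros(2,3) derivative_eq_intros)
next
  case (inverse f)
  then obtain D where
    D: "\<And>x. (f has_derivative (\<lambda>h. D x \<bullet> h)) (at x)" "\<And>i. smooth_fun (\<lambda>x. D x \<bullet> i)" by auto
  have "smooth_fun (\<lambda>x. ((-1) * (inverse (f x) * inverse (f x))) * (D x \<bullet> i))" for i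
    by (intro smooth_fun.intros(1,3,4) inverse D)
  moreover have "((\<lambda>x. inverse (f x)) has_derivative
      (\<lambda>h. (((-1) * (inverse (f x) * inverse (f x))) *\<^sub>R D x) \<bullet> h)) (at x)" for x
    using Deriv.has_derivative_inverse[OF inverse(2)[of x] D(1)[of x]]
    by (simp add: mult.assoc mult.left_commute mult.commute)
  ultimately show ?case
    by (intro exI[of _ "\<lambda>x. ((-1) * (inverse (f x) * inverse (f x))) *\<^sub>R D x"]) simp
next
  case (flat m a c)
  have "((\<lambda>x. flat m (a \<bullet> x + c)) has_derivative
     (\<lambda>h. ((flat (m + 2) (a \<bullet> x + c) - real m * flat (m + 1) (a \<bullet> x + c)) *\<^sub>R a) \<bullet> h)) (at x)" for x
    by (rule has_derivative_eq_rhs[OF has_derivative_compose[of "\<lambda>x. a \<bullet> x + c" "\<lambda>h. a \<bullet> h" x UNIV "flat m",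
          OF _ flat_has_derivative[unfolded has_field_derivative_def]]])
       (auto intro!: derivative_eq_intros)
  then show ?case
    by (intro exI[of _ "\<lambda>x. (flat (m + 2) (a \<bullet> x + c) - real m * flat (m + 1) (a \<bullet> x + c)) *\<^sub>R a"])
      (auto intro!: smooth_fun.intros(1,3,5) smooth_fun_diff)
next
  case (sin a c)
  have "((\<lambda>x. sin (a \<bullet> x + c)) has_derivative (\<lambda>h. (cos (a \<bullet> x + c) *\<^sub>R a) \<bullet> h)) (at x)" for x
    by (auto intro!: derivative_eq_intros)
  then show ?case
    by (intro exI[of _ "\<lambda>x. cos (a \<bullet> x + c) *\<^sub>R a"])
      (auto intro!: smooth_fun.intros(1,3) smooth_fun_cos)
qed

lemma smooth_fun_continuous: "smooth_fun f \<Longrightarrow> continuous_on S f"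
  using smooth_fun_gradient[of f]
  by (meson has_derivative_continuous continuous_at_imp_continuous_on)

lemma smooth_fun_Ck: "smooth_fun f \<Longrightarrow> Ck_on k S f"
proof (induction k arbitrary: f)
  case 0
  then show ?case by (simp add: smooth_fun_continuous)
next
  case (Suc k)
  then show ?case
    using smooth_fun_gradient[of f] by (simp, meson has_derivative_at_withinI)
qed

lemma Ck_on_cong:
  assumes "Ck_on k S f" "\<And>x. x \<in> S \<Longrightarrow> f x = g x"
  shows "Ck_on k S g"
proof (cases k)
  case 0
  with assms show ?thesis by (simp cong: continuous_on_cong)
next
  case (Suc m)
  with assms(1) obtain D where "\<And>x. x \<in> S \<Longrightarrow> (f has_derivative (\<lambda>h. D x \<bullet> h)) (at x within S)"
     "\<And>i. i \<in> Basis \<Longrightarrow> Ck_on m S (\<lambda>x. D x \<bullet> i)" by auto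
  with Suc show ?thesis
    using assms(2) by (auto intro!: exI[of _ D] has_derivative_transform[of _ S g f])
qed

text \<open>\<open>L'\<close> is the adjoint of \<open>L\<close>; it turns a generator composed with
  \<open>L\<close> into a generator of the same kind. The instances needed are the two projections
  of space-time.\<close>

lemma smooth_fun_affine:
  fixes L :: "'c::euclidean_space \<Rightarrow> 'b::euclidean_space"
  assumes "smooth_fun f" and L': "\<And>a x. a \<bullet> L x = L' a \<bullet> x"
  shows "smooth_fun (\<lambda>x. f (L x))"
  using assms(1)
  by induction (auto simp: L' intro: smooth_fun.intros)

lemma smooth_fun_fst: "smooth_fun f \<Longrightarrow> smooth_fun (\<lambda>p :: 'b::euclidean_space \<times> 'c::euclidean_space. f (fst p))"
  by (rule smooth_fun_affine[where L' = "\<lambda>a. (a, 0)"]) (auto simp: inner_prod_def)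

lemma smooth_fun_snd: "smooth_fun f \<Longrightarrow> smooth_fun (\<lambda>p :: 'b::euclidean_space \<times> 'c::euclidean_space. f (snd p))"
  by (rule smooth_fun_affine[where L' = "\<lambda>a. (0, a)"]) (auto simp: inner_prod_def)

text \<open>Second derivatives belong to the class and have the same support, hence are bounded; the
  mean value theorem turns this into a Lipschitz bound for the gradient, which the small jumps of a
  Levy operator require.\<close>

lemma smooth_compact_support_bounds:
  fixes f :: "'b::euclidean_space \<Rightarrow> real"
  assumes f: "smooth_fun f" and K: "compact K" "\<And>x. x \<notin> K \<Longrightarrow> f x = 0"
  obtains D C where "\<And>x. (f has_derivative (\<lambda>h. D x \<bullet> h)) (at x)" "\<And>i. smooth_fun (\<lambda>x. D x \<bullet> i)"
    "C > 0" "\<And>x. \<bar>f x\<bar> \<le> C" "\<And>x. norm (D x) \<le> C" "\<And>x y. norm (D x - D y) \<le> C * norm (x - y)"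
    "\<And>x. x \<notin> K \<Longrightarrow> D x = 0"
proof -
  have bnd: "\<exists>C. \<forall>x. \<bar>g x\<bar> \<le> C" if "smooth_fun g" "\<And>x. x \<notin> K \<Longrightarrow> g x = 0" for g :: "'b \<Rightarrow> real"
  proof -
    have "compact (g ` K)" using that K smooth_fun_continuous by (intro compact_continuous_image) auto
    then obtain C where "\<forall>y\<in>g ` K. norm y \<le> C" using compact_imp_bounded bounded_iff by metis
    then have "\<bar>g x\<bar> \<le> max C 0" for x using that(2)[of x] by (cases "x \<in> K") force+
    then show ?thesis by blast
  qed
  \<comment> \<open>Off the compact set the function vanishes on a neighbourhood, so its gradient
    vanishes there too and the boundedness argument applies again to the derivatives.\<close>
  have grad0: "E x = 0" if "x \<notin> K" "\<And>x. (g has_derivative (\<lambda>h. E x \<bullet> h)) (at x)" "\<And>x. x \<notin> K \<Longrightarrow> g x = 0"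
    for x E and g :: "'b \<Rightarrow> real"
  proof -
    have "((\<lambda>_. 0) has_derivative (\<lambda>h. E x \<bullet> h)) (at x)"
      by (rule has_derivative_transform_within_open[OF that(2), of "-K"]) (use that K in \<open>auto simp: compact_imp_closed\<close>)
    then have "(\<lambda>h. E x \<bullet> h) = (\<lambda>_. 0)"
      using has_derivative_unique has_derivative_const by blast
    then show ?thesis by (metis inner_eq_zero_iff)
  qed
  obtain D where D: "\<And>x. (f has_derivative (\<lambda>h. D x \<bullet> h)) (at x)" "\<And>i. smooth_fun (\<lambda>x. D x \<bullet> i)"
    using smooth_fun_gradient[OF f] by blast
  have D0: "D x = 0" if "x \<notin> K" for x using grad0[OF that D(1)] K(2) by blast
  have "\<forall>i. \<exists>E. (\<forall>x. ((\<lambda>x. D x \<bullet> i) has_derivative (\<lambda>h. E x \<bullet> h)) (at x)) \<and> (\<forall>j. smooth_fun (\<lambda>x. E x \<bullet> j))"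
    using smooth_fun_gradient[OF D(2)] by blast
  then obtain E where E: "\<And>i x. ((\<lambda>x. D x \<bullet> i) has_derivative (\<lambda>h. E i x \<bullet> h)) (at x)"
     "\<And>i j. smooth_fun (\<lambda>x. E i x \<bullet> j)" by metis
  have E0: "E i x = 0" if "x \<notin> K" for i x
    using grad0[OF that, of "\<lambda>x. D x \<bullet> i" "E i"] E(1) D0 by simp
  obtain C0 where C0: "\<And>x. \<bar>f x\<bar> \<le> C0" using bnd[OF f K(2)] by blast
  have "\<forall>i. \<exists>C. \<forall>x. \<bar>D x \<bullet> i\<bar> \<le> C" using bnd[OF D(2)] D0 by simp
  then obtain C1 where C1: "\<And>i x. \<bar>D x \<bullet> i\<bar> \<le> C1 i" by metis
  have "\<forall>i j. \<exists>C. \<forall>x. \<bar>E i x \<bullet> j\<bar> \<le> C" using bnd[OF E(2)] E0 by simp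
  then obtain C2 where C2: "\<And>i j x. \<bar>E i x \<bullet> j\<bar> \<le> C2 i j" by metis
  have nE: "norm (E i x) \<le> (\<Sum>j\<in>Basis. C2 i j)" for i x
    using norm_le_l1[of "E i x"] C2 by (meson order_trans sum_mono)
  have lip: "\<bar>D x \<bullet> i - D y \<bullet> i\<bar> \<le> (\<Sum>j\<in>Basis. C2 i j) * norm (x - y)" for i x y
  proof -
    have "norm (D x \<bullet> i - D y \<bullet> i) \<le> (\<Sum>j\<in>Basis. C2 i j) * norm (x - y)"
    proof (rule differentiable_bound[of UNIV])
      show "((\<lambda>x. D x \<bullet> i) has_derivative (\<lambda>h. E i x \<bullet> h)) (at x within UNIV)" for x using E by simp
      show "onorm (\<lambda>h. E i x \<bullet> h) \<le> (\<Sum>j\<in>Basis. C2 i j)" for x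
        by (rule onorm_le) (use order_trans[OF Cauchy_Schwarz_ineq2 mult_right_mono[OF nE norm_ge_zero]] in simp)
    qed auto
    then show ?thesis by simp
  qed
  define A B where "A = (\<Sum>i\<in>Basis. C1 i)" and "B = (\<Sum>i\<in>Basis. \<Sum>j\<in>Basis. C2 i j)"
  have A: "norm (D x) \<le> A" for x
    unfolding A_def using norm_le_l1[of "D x"] C1 by (meson order_trans sum_mono)
  have B: "norm (D x - D y) \<le> B * norm (x - y)" for x y
  proof -
    have "norm (D x - D y) \<le> (\<Sum>i\<in>Basis. \<bar>(D x - D y) \<bullet> i\<bar>)" by (rule norm_le_l1)
    also have "\<dots> \<le> (\<Sum>i\<in>Basis. (\<Sum>j\<in>Basis. C2 i j) * norm (x - y))"
      by (rule sum_mono) (use lip in \<open>simp add: inner_diff_left\<close>)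
    finally show ?thesis by (simp add: B_def sum_distrib_right)
  qed
  define C where "C = \<bar>C0\<bar> + \<bar>A\<bar> + \<bar>B\<bar> + 1"
  show ?thesis
  proof (rule that[of D C])
    show "norm (D x - D y) \<le> C * norm (x - y)" for x y
      by (rule order_trans[OF B mult_right_mono]) (auto simp: C_def)
    show "\<bar>f x\<bar> \<le> C" for x using C0[of x] by (simp add: C_def)
    show "norm (D x) \<le> C" for x using A[of x] by (simp add: C_def)
  qed (use D D0 in \<open>auto simp: C_def\<close>)
qed

section \<open>Translations and the Fourier transform\<close>

lemma integrable_lborel_shift_iff:
  fixes f :: "'b::euclidean_space \<Rightarrow> 'c::{banach, second_countable_topology}"
  assumes "f \<in> borel_measurable borel"
  shows "integrable lborel (\<lambda>x. f (x + z)) \<longleftrightarrow> integrable lborel f"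
  using integrable_distr_eq[of "(+) z" lborel borel f] assms by (simp add: lborel_distr_plus add.commute)

lemma integral_lborel_shift:
  fixes f :: "'b::euclidean_space \<Rightarrow> 'c::{banach, second_countable_topology}"
  assumes "f \<in> borel_measurable borel"
  shows "(LINT x|lborel. f (x + z)) = (LINT x|lborel. f x)"
  using integral_distr[of "(+) z" lborel borel f] assms by (simp add: lborel_distr_plus add.commute)

lemma AE_lborel_shift:
  fixes P :: "'b::euclidean_space \<Rightarrow> bool"
  assumes "AE x in lborel. P x"
  shows "AE x in lborel. P (x + z)"
proof -
  obtain N where N: "{x. \<not> P x} \<subseteq> N" "N \<in> sets borel" "emeasure lborel N = 0"
    using assms by (auto elim!: AE_E)
  have "AE x in distr lborel borel ((+) z). x \<notin> N"
    using N by (intro AE_I'[of N]) (auto simp: null_sets_def lborel_distr_plus)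
  then have "AE x in lborel. z + x \<notin> N"
    using N by (subst (asm) AE_distr_iff) auto
  then show ?thesis using N(1) by (auto simp: add.commute)
qed

lemma integral_lborel_scale:
  fixes f :: "'b::euclidean_space \<Rightarrow> 'c::{banach, second_countable_topology}"
  assumes [measurable]: "f \<in> borel_measurable borel" and c: "c > 0"
  shows "c ^ DIM('b) *\<^sub>R (LINT x|lborel. f (t + c *\<^sub>R x)) = (LINT x|lborel. f x)"
proof -
  have "(LINT x|lborel. f x) = (LINT x|density (distr lborel borel (\<lambda>x. t + c *\<^sub>R x)) (\<lambda>_. \<bar>c\<bar>^DIM('b)). f x)"
    using c by (subst lborel_affine[of c t]) auto
  also have "\<dots> = c ^ DIM('b) *\<^sub>R (LINT x|lborel. f (t + c *\<^sub>R x))"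
    using c by (subst integral_density) (auto simp: integral_distr)
  finally show ?thesis by simp
qed

text \<open>Continuity of translations in L1, by induction over integrable functions. It later
  yields the continuity of autocorrelations in Plancherel's theorem.\<close>

lemma integral_abs_shift_tendsto_0:
  fixes f :: "'b::euclidean_space \<Rightarrow> real"
  assumes "integrable lborel f"
  shows "((\<lambda>z. LINT x|lborel. \<bar>f (x + z) - f x\<bar>) \<longlongrightarrow> 0) (at 0)"
  using assms
proof induction
  case (base A c)
  then have A[measurable]: "A \<in> sets borel" and fin: "emeasure lborel A < \<infinity>" by auto
  have "((\<lambda>z. LINT x|lborel. \<bar>indicator A (x + z) - indicator A x :: real\<bar>) \<longlongrightarrow> 0) (at 0)"
  proof (rule tendstoI)
    fix e :: real assume "e > 0"
    \<comment> \<open>Outer regularity replaces \<open>A\<close> by an open set, whose points stay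
      inside under small shifts. The error e/5 enters both halves of the symmetric difference
      together with e/5 from the limit, so the total stays below 4e/5.\<close>
    obtain U where U: "open U" "A \<subseteq> U" "emeasure lebesgue (U - A) < ennreal (e / 5)"
      by (rule sets_lebesgue_outer_open[of A "e/5"]) (use A \<open>e > 0\<close> in \<open>simp_all add: sets_completionI_sets\<close>)
    have U'[measurable]: "U \<in> sets borel" using U by simp
    have UA: "emeasure lborel (U - A) < ennreal (e / 5)" using U by simp
    have "emeasure lborel U \<le> emeasure lborel A + emeasure lborel (U - A)"
      using emeasure_subadditive[of A lborel "U - A"] U(2) by (simp add: Un_absorb1)
    also have "\<dots> < \<infinity>" using fin order.strict_trans[OF UA, of \<infinity>] by (simp add: less_top[symmetric])
    finally have finU: "emeasure lborel U < \<infinity>" .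
    have iA: "integrable lborel (indicator A :: _ \<Rightarrow> real)" "integrable lborel (indicator U :: _ \<Rightarrow> real)"
      using fin finU by auto
    have iA': "integrable lborel (\<lambda>x. indicator A (x + z) :: real)"
         "integrable lborel (\<lambda>x. indicator U (x + z) :: real)" for z
      using iA by (simp_all add: integrable_lborel_shift_iff)
    have lim: "((\<lambda>z. LINT x|lborel. indicator U x * (1 - indicator U (x + z)) :: real) \<longlongrightarrow> 0) (at 0)"
      unfolding tendsto_at_iff_sequentially comp_def
    proof (intro allI impI)
      fix X :: "nat \<Rightarrow> 'b" assume X: "\<forall>i. X i \<in> UNIV - {0}" "X \<longlonglongrightarrow> 0"
      have "(\<lambda>i. LINT x|lborel. indicator U x * (1 - indicator U (x + X i)) :: real) \<longlonglongrightarrow> (LINT x|(lborel :: 'b measure). 0 :: real)"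
      proof (rule Bochner_Integration.integral_dominated_convergence[where w = "indicator U :: _ \<Rightarrow> real"])
        show "AE x in lborel. (\<lambda>i. indicator U x * (1 - indicator U (x + X i)) :: real) \<longlonglongrightarrow> 0"
        proof (intro AE_I2)
          fix x
          have "(\<lambda>i. x + X i) \<longlonglongrightarrow> x + 0" using X by (intro tendsto_intros)
          then have "\<forall>\<^sub>F i in sequentially. x + X i \<in> U" if "x \<in> U"
            using topological_tendstoD[of "\<lambda>i. x + X i" x sequentially U] U(1) that by simp
          then show "(\<lambda>i. indicator U x * (1 - indicator U (x + X i)) :: real) \<longlonglongrightarrow> 0"
            by (cases "x \<in> U") (auto intro: tendsto_eventually elim!: eventually_mono)
        qed
      qed (use iA in \<open>auto simp: indicator_def\<close>)
      then show "(\<lambda>i. LINT x|lborel. indicator U x * (1 - indicator U (x + X i)) :: real) \<longlonglongrightarrow> 0" by simp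
    qed
    have lim': "((\<lambda>z. LINT x|lborel. indicator U x * (1 - indicator U (x + - z)) :: real) \<longlongrightarrow> 0) (at 0)"
    proof -
      have "filterlim (\<lambda>z::'b. - z) (at 0) (at 0)"
        by (rule filterlim_atI) (auto intro!: tendsto_eq_intros simp: eventually_at_filter)
      from filterlim_compose[OF lim this] show ?thesis by simp
    qed
    have mUA: "measure lborel (U - A) \<le> e / 5"
      unfolding measure_def by (rule enn2real_leI) (use UA \<open>e > 0\<close> in auto)
    have one: "(LINT x|lborel. indicator A x * (1 - indicator A (x + z)) :: real)
       \<le> (LINT x|lborel. indicator U x * (1 - indicator U (x + z))) + e / 5" for z
    proof -
      have i1: "integrable lborel (\<lambda>x. indicator A x * (1 - indicator A (x + z)) :: real)"
        by (rule Bochner_Integration.integrable_bound[OF iA(1)]) (auto simp: indicator_def)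
      have i2: "integrable lborel (\<lambda>x. indicator U x * (1 - indicator U (x + z)) :: real)"
        by (rule Bochner_Integration.integrable_bound[OF iA(2)]) (auto simp: indicator_def)
      have i3: "integrable lborel (\<lambda>x. indicator (U - A) (x + z) :: real)"
        using order.strict_trans[OF UA, of \<infinity>] U' by (auto simp: integrable_lborel_shift_iff)
      have "(LINT x|lborel. indicator A x * (1 - indicator A (x + z)) :: real)
         \<le> (LINT x|lborel. indicator U x * (1 - indicator U (x + z)) + indicator (U - A) (x + z))"
        by (rule integral_mono) (use i1 i2 i3 U(2) in \<open>auto simp: indicator_def\<close>)
      also have "\<dots> = (LINT x|lborel. indicator U x * (1 - indicator U (x + z))) + measure lborel (U - A)"
        using i2 i3 integral_lborel_shift[of "indicator (U - A) :: _ \<Rightarrow> real" z] by simp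
      finally show ?thesis using mUA by linarith
    qed
    \<comment> \<open>The second half of the symmetric difference is the first one with the shift
      reversed, after a translation of the variable.\<close>
    have two: "(LINT x|lborel. \<bar>indicator A (x + z) - indicator A x :: real\<bar>) =
       (LINT x|lborel. indicator A x * (1 - indicator A (x + z))) +
       (LINT x|lborel. indicator A x * (1 - indicator A (x + - z)))" for z
    proof -
      have i1: "integrable lborel (\<lambda>x. indicator A x * (1 - indicator A (x + z)) :: real)" for z
        by (rule Bochner_Integration.integrable_bound[OF iA(1)]) (auto simp: indicator_def)
      have i2: "integrable lborel (\<lambda>x. indicator A (x + z) * (1 - indicator A x) :: real)"
        by (rule Bochner_Integration.integrable_bound[OF iA'(1)[of z]]) (auto simp: indicator_def)
      have "(LINT x|lborel. \<bar>indicator A (x + z) - indicator A x :: real\<bar>) =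
        (LINT x|lborel. indicator A x * (1 - indicator A (x + z)) + indicator A (x + z) * (1 - indicator A x))"
        by (rule Bochner_Integration.integral_cong) (auto simp: indicator_def)
      also have "\<dots> = (LINT x|lborel. indicator A x * (1 - indicator A (x + z))) +
         (LINT x|lborel. indicator A (x + z) * (1 - indicator A x))"
        using i1 i2 by simp
      also have "(LINT x|lborel. indicator A (x + z) * (1 - indicator A x) :: real) =
         (LINT x|lborel. indicator A x * (1 - indicator A (x + - z)))"
        using integral_lborel_shift[of "\<lambda>x. indicator A x * (1 - indicator A (x + - z)) :: real" z] by simp
      finally show ?thesis .
    qed
    have "\<forall>\<^sub>F z in at 0. (LINT x|lborel. indicator U x * (1 - indicator U (x + z)) :: real) < e / 5"
         "\<forall>\<^sub>F z in at 0. (LINT x|lborel. indicator U x * (1 - indicator U (x + - z)) :: real) < e / 5"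
      using order_tendstoD(2)[OF lim, of "e/5"] order_tendstoD(2)[OF lim', of "e/5"] \<open>e > 0\<close> by auto
    then show "\<forall>\<^sub>F z in at 0. dist (LINT x|lborel. \<bar>indicator A (x + z) - indicator A x :: real\<bar>) 0 < e"
    proof eventually_elim
      case (elim z)
      have "(LINT x|lborel. \<bar>indicator A (x + z) - indicator A x :: real\<bar>) < e"
        using two[of z] one[of z] one[of "- z"] elim \<open>e > 0\<close> by linarith
      then show ?case by (simp add: dist_real_def abs_of_nonneg integral_nonneg)
    qed
  qed
  from tendsto_mult_left[OF this, of "\<bar>c\<bar>"]
  have "((\<lambda>z. LINT x|lborel. \<bar>c\<bar> * \<bar>indicator A (x + z) - indicator A x :: real\<bar>) \<longlongrightarrow> 0) (at 0)"
    by simp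
  then show ?case by (simp add: abs_mult[symmetric] algebra_simps)
next
  case (add f g)
  note [measurable] = borel_measurable_integrable[OF add(1)] borel_measurable_integrable[OF add(2)]
  have i: "integrable lborel (\<lambda>x. f (x + z))" "integrable lborel (\<lambda>x. g (x + z))" for z
    using add by (simp_all add: integrable_lborel_shift_iff borel_measurable_integrable)
  show ?case
  proof (rule tendsto_sandwich[OF _ _ tendsto_const])
    show "((\<lambda>z. (LINT x|lborel. \<bar>f (x + z) - f x\<bar>) + (LINT x|lborel. \<bar>g (x + z) - g x\<bar>)) \<longlongrightarrow> 0) (at 0)"
      using tendsto_add[OF add(3,4)] by simp
    have "(LINT x|lborel. \<bar>f (x + z) + g (x + z) - (f x + g x)\<bar>) \<le>
       (LINT x|lborel. \<bar>f (x + z) - f x\<bar>) + (LINT x|lborel. \<bar>g (x + z) - g x\<bar>)" for z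
    proof -
      have "(LINT x|lborel. \<bar>f (x + z) + g (x + z) - (f x + g x)\<bar>) \<le>
         (LINT x|lborel. \<bar>f (x + z) - f x\<bar> + \<bar>g (x + z) - g x\<bar>)"
        by (rule integral_mono) (use i add in auto)
      also have "\<dots> = (LINT x|lborel. \<bar>f (x + z) - f x\<bar>) + (LINT x|lborel. \<bar>g (x + z) - g x\<bar>)"
        using i add by (intro Bochner_Integration.integral_add) auto
      finally show ?thesis .
    qed
    then show "\<forall>\<^sub>F z in at 0. (LINT x|lborel. \<bar>f (x + z) + g (x + z) - (f x + g x)\<bar>) \<le>
       (LINT x|lborel. \<bar>f (x + z) - f x\<bar>) + (LINT x|lborel. \<bar>g (x + z) - g x\<bar>)" by simp
  qed (auto intro: always_eventually)
next
  case (lim f s)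
  have pt: "(\<lambda>i. s i x) \<longlonglongrightarrow> f x" and bd: "\<bar>s i x\<bar> \<le> 2 * \<bar>f x\<bar>"
    and P: "((\<lambda>z. LINT x|lborel. \<bar>s i (x + z) - s i x\<bar>) \<longlongrightarrow> 0) (at 0)" for x i
    using lim by auto
  have f: "integrable lborel f" and s: "\<And>i. integrable lborel (s i)" using lim by auto
  have [measurable]: "f \<in> borel_measurable borel" "\<And>i. s i \<in> borel_measurable borel"
    using f s by (auto dest: borel_measurable_integrable)
  have i: "integrable lborel (\<lambda>x. f (x + z))" "integrable lborel (\<lambda>x. s i (x + z))" for z i
    using f s by (simp_all add: integrable_lborel_shift_iff)
  have "(\<lambda>i. LINT x|lborel. \<bar>s i x - f x\<bar>) \<longlonglongrightarrow> (LINT x|(lborel :: 'b measure). 0 :: real)"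
  proof (rule Bochner_Integration.integral_dominated_convergence[where w = "\<lambda>x. 3 * \<bar>f x\<bar>"])
    show "AE x in lborel. (\<lambda>i. \<bar>s i x - f x\<bar>) \<longlonglongrightarrow> 0"
    proof (intro AE_I2)
      fix x show "(\<lambda>i. \<bar>s i x - f x\<bar>) \<longlonglongrightarrow> 0"
        using pt[of x] by (intro tendsto_rabs_zero LIM_zero)
    qed
    show "AE x in lborel. norm \<bar>s i x - f x\<bar> \<le> 3 * \<bar>f x\<bar>" for i
    proof (intro AE_I2)
      fix x show "norm \<bar>s i x - f x\<bar> \<le> 3 * \<bar>f x\<bar>" unfolding real_norm_def
        using bd[of i x] by linarith
    qed
  qed (use f in auto)
  then have L: "(\<lambda>i. LINT x|lborel. \<bar>s i x - f x\<bar>) \<longlonglongrightarrow> 0" by simp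
  show ?case
  proof (rule tendstoI)
    fix e :: real assume "e > 0"
    then obtain i where i1: "(LINT x|lborel. \<bar>s i x - f x\<bar>) < e / 3"
      using order_tendstoD(2)[OF L, of "e/3"] by (auto simp: eventually_sequentially)
    have bound: "(LINT x|lborel. \<bar>f (x + z) - f x\<bar>) \<le> (LINT x|lborel. \<bar>s i (x + z) - s i x\<bar>) + 2 * (e / 3)" for z
    proof -
      have "(LINT x|lborel. \<bar>f (x + z) - f x\<bar>) \<le>
        (LINT x|lborel. \<bar>s i (x + z) - s i x\<bar> + \<bar>s i (x + z) - f (x + z)\<bar> + \<bar>s i x - f x\<bar>)"
        by (rule integral_mono) (use i f s in auto)
      also have "\<dots> = (LINT x|lborel. \<bar>s i (x + z) - s i x\<bar>) + (LINT x|lborel. \<bar>s i (x + z) - f (x + z)\<bar>)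
          + (LINT x|lborel. \<bar>s i x - f x\<bar>)"
        using i f s by simp
      also have "(LINT x|lborel. \<bar>s i (x + z) - f (x + z)\<bar>) = (LINT x|lborel. \<bar>s i x - f x\<bar>)"
        by (rule integral_lborel_shift) simp
      finally show ?thesis using i1 by linarith
    qed
    have "\<forall>\<^sub>F z in at 0. (LINT x|lborel. \<bar>s i (x + z) - s i x\<bar>) < e / 3"
      using order_tendstoD(2)[OF P, of "e/3" i] \<open>e > 0\<close> by simp
    then show "\<forall>\<^sub>F z in at 0. dist (LINT x|lborel. \<bar>f (x + z) - f x\<bar>) 0 < e"
    proof eventually_elim
      case (elim z)
      then have "(LINT x|lborel. \<bar>f (x + z) - f x\<bar>) < e" using bound[of z] by linarith
      then show ?case by (simp add: dist_real_def abs_of_nonneg integral_nonneg)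
    qed
  qed
qed

lemma integrable_tensor:
  fixes f :: "'b \<Rightarrow> 'd::{real_normed_field, banach, second_countable_topology}"
  assumes "sigma_finite_measure M" "sigma_finite_measure N" and f: "integrable M f" and g: "integrable N g"
  shows "integrable (M \<Otimes>\<^sub>M N) (\<lambda>(x, y). f x * g y)"
proof -
  interpret M: sigma_finite_measure M by fact
  interpret N: sigma_finite_measure N by fact
  interpret pair_sigma_finite M N ..
  have [measurable]: "f \<in> borel_measurable M" "g \<in> borel_measurable N" using f g by auto
  show ?thesis
    using f g by (intro Fubini_integrable) (auto simp: norm_mult split_beta')
qed

section \<open>Gaussians and their Fourier transform\<close>

definition gauss :: "'b::euclidean_space \<Rightarrow> real" where
  "gauss x = exp (- (norm x)\<^sup>2 / 2)"

lemma gauss_measurable [measurable]: "gauss \<in> borel_measurable borel"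
  unfolding gauss_def by measurable

lemma gauss_pos: "0 < gauss x"
  by (simp add: gauss_def)

lemma gauss_uminus: "gauss (- x) = gauss x"
  by (simp add: gauss_def)

lemma cis_sum: "cis (\<Sum>i\<in>I. f i) = (\<Prod>i\<in>I. cis (f i))"
  by (induction I rule: infinite_finite_induct) (auto simp: cis_mult[symmetric])

lemma gauss_prod: "gauss (x :: 'b::euclidean_space) = (\<Prod>i\<in>Basis. exp (- (x \<bullet> i)\<^sup>2 / 2))"
proof -
  have "(norm x)\<^sup>2 = (\<Sum>i\<in>Basis. (x \<bullet> i)\<^sup>2)"
    unfolding power2_norm_eq_inner by (subst euclidean_inner) (simp add: power2_eq_square)
  then show ?thesis
    by (simp add: gauss_def exp_sum[symmetric] sum_divide_distrib sum_negf)
qed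

lemma one_minus_cos_le: "1 - cos x \<le> x\<^sup>2 / 2" for x :: real
proof -
  have "1 - cos x = 2 * (sin (x / 2))\<^sup>2"
    using cos_double_sin[of "x / 2"] by simp
  also have "\<dots> \<le> 2 * (x / 2)\<^sup>2"
    using abs_sin_x_le_abs_x[of "x / 2"] unfolding abs_le_square_iff by simp
  finally show ?thesis by (simp add: power_divide)
qed

lemma norm_cis_diff_le: "cmod (cis a - cis b) \<le> \<bar>a - b\<bar>"
proof -
  have "(cmod (cis a - cis b))\<^sup>2 = (cos a - cos b)\<^sup>2 + (sin a - sin b)\<^sup>2"
    by (simp add: cmod_power2)
  also have "\<dots> = ((sin a)\<^sup>2 + (cos a)\<^sup>2) + ((sin b)\<^sup>2 + (cos b)\<^sup>2) - 2 * (cos a * cos b + sin a * sin b)"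
    by (simp only: power2_diff) (simp add: algebra_simps)
  also have "\<dots> = 2 * (1 - cos (a - b))"
    by (simp add: cos_diff)
  also have "\<dots> \<le> \<bar>a - b\<bar>\<^sup>2"
    using one_minus_cos_le[of "a - b"] by simp
  finally show ?thesis by (rule power2_le_imp_le) simp
qed

text \<open>Up to the factor sqrt (2 pi) this is the characteristic function of the standard normal
  distribution.\<close>

lemma gauss_1d:
  "integrable lborel (\<lambda>x::real. exp (- x\<^sup>2 / 2))"
  "(LINT x|lborel. cis (t * x) * of_real (exp (- x\<^sup>2 / 2))) = of_real (sqrt (2 * pi) * exp (- t\<^sup>2 / 2))"
proof -
  have eq: "exp (- x\<^sup>2 / 2) = sqrt (2 * pi) * std_normal_density x" for x :: real
    by (simp add: std_normal_density_def)
  have "integrable lborel std_normal_density" by simp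
  then show i: "integrable lborel (\<lambda>x::real. exp (- x\<^sup>2 / 2))"
    unfolding eq by simp
  have "complex_of_real (exp (- t\<^sup>2 / 2)) = char std_normal_distribution t"
    by (simp add: char_std_normal_distribution)
  also have "\<dots> = (LINT x|lborel. std_normal_density x *\<^sub>R iexp (t * x))"
    unfolding char_def by (subst integral_density) auto
  also have "of_real (sqrt (2 * pi)) * \<dots> =
     (LINT x|lborel. of_real (sqrt (2 * pi)) * (std_normal_density x *\<^sub>R iexp (t * x)))"
    by (rule integral_mult_right_zero[symmetric])
  also have "\<dots> = (LINT x|lborel. cis (t * x) * of_real (exp (- x\<^sup>2 / 2)))"
    unfolding eq by (rule Bochner_Integration.integral_cong) (auto simp: cis_conv_exp scaleR_conv_of_real)
  finally show "(LINT x|lborel. cis (t * x) * of_real (exp (- x\<^sup>2 / 2))) = of_real (sqrt (2 * pi) * exp (- t\<^sup>2 / 2))"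
    by simp
qed

interpretation lborel_product: product_sigma_finite "\<lambda>_. lborel :: real measure" ..

text \<open>Lebesgue measure is the image of a product measure over the coordinates, so integrals of
  products of coordinate functions factorise.\<close>

lemma
  fixes f :: "'b::euclidean_space \<Rightarrow> real \<Rightarrow> complex"
  assumes f: "\<And>i. i \<in> Basis \<Longrightarrow> integrable lborel (f i)"
  shows integral_lborel_prod_Basis: "(LINT x|lborel. (\<Prod>i\<in>Basis. f i (x \<bullet> i))) = (\<Prod>i\<in>Basis. (LINT y|lborel. f i y))"
    and integrable_lborel_prod_Basis: "integrable lborel (\<lambda>x::'b. \<Prod>i\<in>Basis. f i (x \<bullet> i))"
proof -
  have [measurable]: "f i \<in> borel_measurable borel" if "i \<in> Basis" for i
    using f[OF that] by auto
  have in_b: "(\<Sum>b\<in>Basis. x b *\<^sub>R b) \<bullet> i = x i" if "i \<in> Basis" for x :: "'b \<Rightarrow> real" and i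
    using that by (simp add: inner_sum_left_Basis)
  have T: "(\<lambda>x. \<Sum>b\<in>Basis. x b *\<^sub>R b) \<in> (\<Pi>\<^sub>M b\<in>(Basis::'b set). lborel) \<rightarrow>\<^sub>M borel" by measurable
  have m: "(\<lambda>x::'b. \<Prod>i\<in>Basis. f i (x \<bullet> i)) \<in> borel_measurable borel" by measurable
  show "(LINT x|lborel. (\<Prod>i\<in>Basis. f i (x \<bullet> i))) = (\<Prod>i\<in>Basis. (LINT y|lborel. f i y))"
    apply (subst lborel_eq)
    apply (subst integral_distr[OF T m])
    using lborel_product.product_integral_prod[OF finite_Basis, of f] f
    by (simp add: in_b cong: prod.cong)
  show "integrable lborel (\<lambda>x::'b. \<Prod>i\<in>Basis. f i (x \<bullet> i))"
    apply (subst lborel_eq)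
    apply (subst integrable_distr_eq[OF T m])
    using lborel_product.product_integrable_prod[OF finite_Basis, of f] f
    by (simp add: in_b cong: prod.cong)
qed

lemma
  fixes p :: "'b::euclidean_space"
  shows gauss_fourier: "(LINT x|lborel. cis (p \<bullet> x) * of_real (gauss x)) = of_real (sqrt (2 * pi) ^ DIM('b) * gauss p)"
    and integrable_gauss: "integrable lborel (gauss :: 'b \<Rightarrow> real)"
    and integral_gauss: "(LINT x|lborel. gauss (x :: 'b)) = sqrt (2 * pi) ^ DIM('b)"
proof -
  define f where "f p i y = cis (p \<bullet> i * y) * complex_of_real (exp (- y\<^sup>2 / 2))" for p i :: 'b and y :: real
  have [measurable]: "f p i \<in> borel_measurable borel" for i p
    unfolding f_def cis_conv_exp by measurable
  have fi: "integrable lborel (f p i)" for i p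
    by (rule Bochner_Integration.integrable_bound[OF gauss_1d(1)]) (auto simp: f_def norm_mult)
  have eq: "cis (p \<bullet> x) * of_real (gauss x) = (\<Prod>i\<in>Basis. f p i (x \<bullet> i))" for x p
    by (simp add: f_def gauss_prod prod.distrib euclidean_inner[of p x] cis_sum)
  have fint: "integral\<^sup>L lborel (f p i) = of_real (sqrt (2 * pi) * exp (- (p \<bullet> i)\<^sup>2 / 2))" for p i
    unfolding f_def by (rule gauss_1d(2))
  have F: "(LINT x|lborel. cis (p \<bullet> x) * of_real (gauss x)) = of_real (sqrt (2 * pi) ^ DIM('b) * gauss p)" for p :: 'b
    unfolding eq integral_lborel_prod_Basis[of "f p", OF fi]
    by (simp add: fint gauss_prod prod.distrib)
  then show "(LINT x|lborel. cis (p \<bullet> x) * of_real (gauss x)) = of_real (sqrt (2 * pi) ^ DIM('b) * gauss p)" .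
  have "integrable lborel (\<lambda>x::'b. cis (0 \<bullet> x) * of_real (gauss x))"
    unfolding eq using integrable_lborel_prod_Basis[of "f 0", OF fi] .
  then show "integrable lborel (gauss :: 'b \<Rightarrow> real)"
    by (simp add: complex_of_real_integrable_eq)
  have "complex_of_real (LINT x|lborel. gauss (x :: 'b)) = of_real (sqrt (2 * pi) ^ DIM('b))"
    using F[of 0] by (simp add: gauss_def)
  then show "(LINT x|lborel. gauss (x :: 'b)) = sqrt (2 * pi) ^ DIM('b)"
    unfolding of_real_eq_iff .
qed

text \<open>As s tends to 0 the right-hand side concentrates at z = 0; this approximate identity is
  what recovers Plancherel's formula.\<close>

lemma gauss_fourier_scaled:
  fixes z :: "'b::euclidean_space"
  assumes s: "s > 0"
  shows "(LINT p|lborel. cis (p \<bullet> z) * of_real (gauss (s *\<^sub>R p)))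
     = of_real (sqrt (2 * pi) ^ DIM('b) * (gauss (z /\<^sub>R s) / s ^ DIM('b)))"
proof -
  have m: "(\<lambda>p. cis (p \<bullet> (z /\<^sub>R s)) * complex_of_real (gauss p)) \<in> borel_measurable borel"
    unfolding cis_conv_exp by measurable
  have "(s ^ DIM('b)) *\<^sub>R (LINT p|lborel. cis (p \<bullet> z) * complex_of_real (gauss (s *\<^sub>R p))) =
     (LINT p|lborel. cis (p \<bullet> (z /\<^sub>R s)) * complex_of_real (gauss p))"
    using integral_lborel_scale[OF m s, of 0] s
    by (simp add: mult.assoc[symmetric])
  also have "\<dots> = of_real (sqrt (2 * pi) ^ DIM('b) * gauss (z /\<^sub>R s))"
    using gauss_fourier[of "z /\<^sub>R s"] by (simp add: inner_commute)
  finally show ?thesis using s by (simp add: field_simps scaleR_conv_of_real)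
qed

text \<open>Only used for integrable functions; note the sign convention.\<close>

definition fourier :: "('b::euclidean_space \<Rightarrow> real) \<Rightarrow> 'b \<Rightarrow> complex" where
  "fourier g p = (LINT q|lborel. cis (p \<bullet> q) * of_real (g q))"

lemma cis_measurable [measurable (raw)]:
  "f \<in> borel_measurable M \<Longrightarrow> (\<lambda>x. cis (f x)) \<in> borel_measurable M"
  unfolding cis_conv_exp by measurable

lemma fourier_integrable:
  assumes "integrable lborel g"
  shows "integrable lborel (\<lambda>q. cis (p \<bullet> q) * complex_of_real (g q))"
  by (rule Bochner_Integration.integrable_bound[OF assms]) (use assms in \<open>auto simp: norm_mult\<close>)

lemma fourier_measurable [measurable]:
  assumes "integrable lborel g"
  shows "fourier g \<in> borel_measurable borel"
proof -
  have [measurable]: "g \<in> borel_measurable borel" using assms by auto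
  show ?thesis unfolding fourier_def by measurable
qed

lemma norm_fourier_le: "norm (fourier g p) \<le> (LINT q|lborel. \<bar>g q\<bar>)"
  unfolding fourier_def by (rule order_trans[OF integral_norm_bound]) (simp add: norm_mult)

lemma fourier_diff:
  assumes "integrable lborel f" "integrable lborel g"
  shows "fourier (\<lambda>x. f x - g x) p = fourier f p - fourier g p"
  unfolding fourier_def
  by (subst Bochner_Integration.integral_diff[symmetric])
    (use fourier_integrable[OF assms(1)] fourier_integrable[OF assms(2)] in \<open>auto simp: algebra_simps\<close>)

lemma fourier_add:
  assumes "integrable lborel f" "integrable lborel g"
  shows "fourier (\<lambda>x. f x + g x) p = fourier f p + fourier g p"
  unfolding fourier_def
  by (subst Bochner_Integration.integral_add[symmetric])
    (use fourier_integrable[OF assms(1)] fourier_integrable[OF assms(2)] in \<open>auto simp: algebra_simps\<close>)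

lemma fourier_shift:
  fixes g :: "'b::euclidean_space \<Rightarrow> real"
  assumes "integrable lborel g"
  shows "fourier (\<lambda>x. g (x + z)) p = cis (- (p \<bullet> z)) * fourier g p"
proof -
  have [measurable]: "g \<in> borel_measurable borel" using assms by auto
  have "cis (p \<bullet> z) * fourier (\<lambda>x. g (x + z)) p = (LINT q|lborel. cis (p \<bullet> (q + z)) * of_real (g (q + z)))"
    unfolding fourier_def integral_mult_right_zero[symmetric]
    by (rule Bochner_Integration.integral_cong) (auto simp: inner_add_right cis_mult[symmetric])
  also have "\<dots> = fourier g p"
    unfolding fourier_def by (rule integral_lborel_shift) measurable
  finally have "cis (- (p \<bullet> z)) * (cis (p \<bullet> z) * fourier (\<lambda>x. g (x + z)) p) = cis (- (p \<bullet> z)) * fourier g p" by simp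
  then show ?thesis by (simp add: mult.assoc[symmetric] cis_mult)
qed

text \<open>Since |cis (- t) - 1|^2 = 2 (1 - cos t), integrating over z against a Levy measure
  produces twice its multiplier. This links spatial increments with
  \<open>levy_multiplier\<close>.\<close>

lemma norm_fourier_shift_diff:
  fixes g :: "'b::euclidean_space \<Rightarrow> real"
  assumes g: "integrable lborel g"
  shows "(cmod (fourier (\<lambda>x. g (x + z) - g x) p))\<^sup>2 = 2 * (1 - cos (p \<bullet> z)) * (cmod (fourier g p))\<^sup>2"
proof -
  have "integrable lborel (\<lambda>x. g (x + z))"
    using g by (subst integrable_lborel_shift_iff) auto
  then have "fourier (\<lambda>x. g (x + z) - g x) p = (cis (- (p \<bullet> z)) - 1) * fourier g p"
    using g by (simp add: fourier_diff fourier_shift algebra_simps)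
  moreover have "(cmod (cis (- t) - 1))\<^sup>2 = 2 * (1 - cos t)" for t
    using sin_cos_squared_add[of t] by (simp only: cmod_power2) (simp add: power2_eq_square algebra_simps)
  ultimately show ?thesis by (simp add: norm_mult power_mult_distrib)
qed

text \<open>Bounded support makes the transform Lipschitz with a constant independent of the
  frequency. Hence convergence at a dense set of frequencies extends to all of them.\<close>

lemma fourier_lipschitz:
  fixes g :: "'b::euclidean_space \<Rightarrow> real"
  assumes g: "integrable lborel g" and R: "\<And>q. g q \<noteq> 0 \<Longrightarrow> norm q \<le> R"
  shows "norm (fourier g p - fourier g p') \<le> norm (p - p') * R * (LINT q|lborel. \<bar>g q\<bar>)"
proof -
  have "fourier g p - fourier g p' = (LINT q|lborel. (cis (p \<bullet> q) - cis (p' \<bullet> q)) * of_real (g q))"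
    unfolding fourier_def
    by (subst Bochner_Integration.integral_diff[symmetric])
      (use fourier_integrable[OF g] in \<open>auto simp: algebra_simps\<close>)
  also have "norm \<dots> \<le> (LINT q|lborel. norm (p - p') * R * \<bar>g q\<bar>)"
  proof (rule Bochner_Integration.integral_norm_bound_integral)
    show "integrable lborel (\<lambda>q. (cis (p \<bullet> q) - cis (p' \<bullet> q)) * complex_of_real (g q))"
      using Bochner_Integration.integrable_diff[OF fourier_integrable[OF g, of p] fourier_integrable[OF g, of p']]
      by (simp add: algebra_simps)
    show "integrable lborel (\<lambda>q. norm (p - p') * R * \<bar>g q\<bar>)" using g by auto
    fix q
    show "cmod ((cis (p \<bullet> q) - cis (p' \<bullet> q)) * complex_of_real (g q)) \<le> norm (p - p') * R * \<bar>g q\<bar>"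
    proof (cases "g q = 0")
      case False
      have "cmod (cis (p \<bullet> q) - cis (p' \<bullet> q)) \<le> \<bar>(p - p') \<bullet> q\<bar>"
        using norm_cis_diff_le[of "p \<bullet> q" "p' \<bullet> q"] by (simp add: inner_diff_left)
      also have "\<dots> \<le> norm (p - p') * R"
        using Cauchy_Schwarz_ineq2[of "p - p'" q] R[OF False] by (meson mult_left_mono norm_ge_zero order_trans)
      finally show ?thesis by (auto simp: norm_mult intro: mult_right_mono)
    qed simp
  qed
  also have "\<dots> = norm (p - p') * R * (LINT q|lborel. \<bar>g q\<bar>)" by simp
  finally show ?thesis .
qed

section \<open>Plancherel's theorem by Gaussian regularisation\<close>

lemma gauss_nonneg [simp]: "0 \<le> gauss x"
  by (rule gauss_pos[THEN less_imp_le])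

lemma abs_gauss [simp]: "\<bar>gauss x\<bar> = gauss x"
  by simp

lemma integral_tensor:
  fixes f :: "'b \<Rightarrow> 'd::{real_normed_field, banach, second_countable_topology}"
  assumes "sigma_finite_measure M" "sigma_finite_measure N" and f: "integrable M f" and g: "integrable N g"
  shows "(\<integral>(x, y). f x * g y \<partial>(M \<Otimes>\<^sub>M N)) = integral\<^sup>L M f * integral\<^sup>L N g"
proof -
  interpret M: sigma_finite_measure M by fact
  interpret N: sigma_finite_measure N by fact
  interpret pair_sigma_finite M N ..
  show ?thesis
    using integral_fst[of "\<lambda>x y. f x * g y"] integrable_tensor[OF assms] by (simp add: split_beta')
qed

lemma integrable_lborel_scale:
  fixes f :: "'b::euclidean_space \<Rightarrow> 'c::{banach, second_countable_topology}"
  assumes f: "integrable lborel f" and c: "c > 0"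
  shows "integrable lborel (\<lambda>x. f (c *\<^sub>R x))"
proof -
  have [measurable]: "f \<in> borel_measurable borel" using f by auto
  have "integrable (density (distr lborel borel (\<lambda>x. 0 + c *\<^sub>R x)) (\<lambda>_. ennreal (\<bar>c\<bar>^DIM('b)))) f"
    using f c by (subst (asm) lborel_affine[of c 0]) (auto simp: ennreal_power)
  then have "integrable lborel (\<lambda>x. \<bar>c\<bar>^DIM('b) *\<^sub>R f (c *\<^sub>R x))"
    by (subst (asm) integrable_density) (auto simp: integrable_distr_eq)
  from integrable_scaleR_right[OF this, of "inverse (\<bar>c\<bar>^DIM('b))"] show ?thesis using c by simp
qed

text \<open>The Gaussian weight makes the triple integral in p, x, y absolutely convergent. Its two
  orders of integration give a weighted norm of the transform and a Gaussian average of the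
  autocorrelation of \<open>g\<close>.\<close>

lemma plancherel_gauss:
  fixes g :: "'b::euclidean_space \<Rightarrow> real"
  assumes g: "integrable lborel g" and B: "\<And>x. \<bar>g x\<bar> \<le> B" and s: "s > 0"
  shows "(LINT p|lborel. (cmod (fourier g p))\<^sup>2 * gauss (s *\<^sub>R p)) =
    sqrt (2 * pi) ^ DIM('b) * (LINT v|lborel. gauss v * (LINT x|lborel. g x * g (x + s *\<^sub>R v)))"
proof -
  define c where "c = sqrt (2 * pi) ^ DIM('b)"
  have [measurable]: "g \<in> borel_measurable borel" using g by auto
  have gs: "integrable lborel (\<lambda>p::'b. gauss (s *\<^sub>R p))"
    by (rule integrable_lborel_scale[OF integrable_gauss s])
  have gg: "integrable lborel (\<lambda>(x, y). g x * g y)"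
    using integrable_tensor[OF sigma_finite_lborel sigma_finite_lborel g g] by (simp add: lborel_prod)
  define F where "F p q = cis (p \<bullet> (fst q - snd q)) * of_real (gauss (s *\<^sub>R p)) * complex_of_real (g (fst q) * g (snd q))"
    for p :: 'b and q :: "'b \<times> 'b"
  have "(\<lambda>x. F (fst x) (snd x)) \<in> borel_measurable borel"
    unfolding F_def borel_prod[symmetric] by measurable
  then have Fm[measurable]: "case_prod F \<in> borel_measurable (lborel \<Otimes>\<^sub>M lborel)"
    by (simp add: lborel_prod split_beta')
  have Fint: "integrable (lborel \<Otimes>\<^sub>M lborel) (case_prod F)"
    by (rule Bochner_Integration.integrable_bound[OF integrable_tensor[OF sigma_finite_lborel sigma_finite_lborel gs gg]])
      (auto simp: F_def norm_mult split_beta abs_mult)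
  have left: "(LINT q|lborel. F p q) = of_real ((cmod (fourier g p))\<^sup>2 * gauss (s *\<^sub>R p))" for p
  proof -
    have "cnj (fourier g p) = (LINT y|lborel. cnj (cis (p \<bullet> y) * of_real (g y)))"
      unfolding fourier_def by (rule Bochner_Integration.integral_cnj[symmetric])
    also have "\<dots> = (LINT y|lborel. cis (- (p \<bullet> y)) * of_real (g y))"
      by (simp add: cis_cnj)
    finally have cnj: "cnj (fourier g p) = (LINT y|lborel. cis (- (p \<bullet> y)) * of_real (g y))" .
    have i2: "integrable lborel (\<lambda>y. cis (- (p \<bullet> y)) * complex_of_real (g y))"
      using fourier_integrable[OF g, of "- p"] by simp
    have cd: "cis (p \<bullet> x) * cis (- (p \<bullet> y)) = cis (p \<bullet> (x - y))" for x y
      by (simp add: cis_mult inner_diff_right)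
    have "fourier g p * cnj (fourier g p) =
      (\<integral>(x, y). (cis (p \<bullet> x) * of_real (g x)) * (cis (- (p \<bullet> y)) * of_real (g y)) \<partial>(lborel \<Otimes>\<^sub>M lborel))"
      unfolding cnj unfolding fourier_def
      by (rule integral_tensor[symmetric, OF sigma_finite_lborel sigma_finite_lborel fourier_integrable[OF g] i2])
    also have "\<dots> = (LINT q|lborel. cis (p \<bullet> (fst q - snd q)) * complex_of_real (g (fst q) * g (snd q)))"
      unfolding lborel_prod
      by (rule Bochner_Integration.integral_cong) (auto simp: cd[symmetric])
    finally have *: "(LINT q|lborel. cis (p \<bullet> (fst q - snd q)) * complex_of_real (g (fst q) * g (snd q))) = of_real ((cmod (fourier g p))\<^sup>2)"
      by (simp only: complex_norm_square)
    have "(LINT q|lborel. F p q) = (LINT q|lborel. of_real (gauss (s *\<^sub>R p)) * (cis (p \<bullet> (fst q - snd q)) * complex_of_real (g (fst q) * g (snd q))))"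
      by (rule Bochner_Integration.integral_cong) (auto simp: F_def)
    also have "\<dots> = of_real (gauss (s *\<^sub>R p)) * (LINT q|lborel. cis (p \<bullet> (fst q - snd q)) * complex_of_real (g (fst q) * g (snd q)))"
      by (rule integral_mult_right_zero)
    finally show ?thesis unfolding * by simp
  qed
  define G where "G q = c * (gauss ((fst q - snd q) /\<^sub>R s) / s ^ DIM('b)) * (g (fst q) * g (snd q))" for q :: "'b \<times> 'b"
  have right: "(LINT p|lborel. F p q) = of_real (G q)" for q
  proof -
    have "(LINT p|lborel. F p q) = (LINT p|lborel. cis (p \<bullet> (fst q - snd q)) * of_real (gauss (s *\<^sub>R p))) * complex_of_real (g (fst q) * g (snd q))"
      unfolding F_def by (rule integral_mult_left_zero)
    then show ?thesis
      unfolding gauss_fourier_scaled[OF s] by (simp add: G_def c_def)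
  qed
  have Gint: "integrable lborel G"
    using lborel_pair.integrable_snd[OF Fint] by (simp add: right complex_of_real_integrable_eq)
  have "complex_of_real (LINT p|lborel. (cmod (fourier g p))\<^sup>2 * gauss (s *\<^sub>R p)) = (LINT p|lborel. (LINT q|lborel. F p q))"
    unfolding left by (rule integral_complex_of_real[symmetric])
  also have "\<dots> = (LINT q|lborel. (LINT p|lborel. F p q))"
    using lborel_pair.integral_fst[OF Fint] lborel_pair.integral_snd[OF Fint] by simp
  also have "\<dots> = complex_of_real (LINT q|lborel. G q)"
    unfolding right by (rule integral_complex_of_real)
  finally have "(LINT p|lborel. (cmod (fourier g p))\<^sup>2 * gauss (s *\<^sub>R p)) = (LINT q|lborel. G q)"
    unfolding of_real_eq_iff .
  also have "\<dots> = (LINT x|lborel. (LINT y|lborel. G (x, y)))"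
    using lborel_pair.integral_fst'[of G] Gint by (simp add: lborel_prod)
  also have "\<dots> = (LINT x|lborel. c * (LINT v|lborel. gauss v * (g x * g (x + s *\<^sub>R v))))"
  proof (rule Bochner_Integration.integral_cong)
    fix x :: 'b
    have m: "(\<lambda>y. G (x, y)) \<in> borel_measurable borel" by (simp add: G_def)
    \<comment> \<open>Substituting y = x + s v turns the kernel of width s into a fixed
      Gaussian.\<close>
    have "(LINT y|lborel. G (x, y)) = (LINT v|lborel. s ^ DIM('b) * G (x, x + s *\<^sub>R v))"
      using integral_lborel_scale[OF m s, of x] by simp
    also have "\<dots> = (LINT v|lborel. c * (gauss v * (g x * g (x + s *\<^sub>R v))))"
      by (rule Bochner_Integration.integral_cong) (use s gauss_uminus in \<open>auto simp: G_def field_simps\<close>)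
    finally show "(LINT y|lborel. G (x, y)) = c * (LINT v|lborel. gauss v * (g x * g (x + s *\<^sub>R v)))" by simp
  qed simp
  also have "\<dots> = c * (LINT x|lborel. (LINT v|lborel. gauss v * (g x * g (x + s *\<^sub>R v))))" by simp
  also have "(LINT x|lborel. (LINT v|lborel. gauss v * (g x * g (x + s *\<^sub>R v)))) =
     (LINT v|lborel. (LINT x|lborel. gauss v * (g x * g (x + s *\<^sub>R v))))"
  proof (rule lborel_pair.Fubini_integral[symmetric])
    have "integrable lborel (\<lambda>x. B * \<bar>g x\<bar>)" using g by auto
    from integrable_tensor[OF sigma_finite_lborel sigma_finite_lborel this integrable_gauss]
    show "integrable (lborel \<Otimes>\<^sub>M lborel) (\<lambda>(x, v). gauss v * (g x * g (x + s *\<^sub>R v)))"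
    proof (rule Bochner_Integration.integrable_bound)
      have "\<bar>g x\<bar> * \<bar>g y\<bar> \<le> \<bar>B\<bar> * \<bar>g x\<bar>" for x y
        using B[of y] mult_right_mono[of "\<bar>g y\<bar>" "\<bar>B\<bar>" "\<bar>g x\<bar>"] by (simp add: mult.commute)
      then show "AE x in lborel \<Otimes>\<^sub>M lborel. norm (case x of (x, v) \<Rightarrow> gauss v * (g x * g (x + s *\<^sub>R v)))
          \<le> norm (case x of (x, y) \<Rightarrow> B * \<bar>g x\<bar> * gauss y)"
        by (intro AE_I2) (auto simp: split_beta abs_mult mult.commute[of _ "gauss _"] intro!: mult_left_mono)
    qed measurable
  qed
  also have "\<dots> = (LINT v|lborel. gauss v * (LINT x|lborel. g x * g (x + s *\<^sub>R v)))" by simp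
  finally show ?thesis by (simp add: c_def)
qed

text \<open>The nonnegative integral on the left makes square integrability of the transform part of
  the conclusion. The proof lets the width of the Gaussian in \<open>plancherel_gauss\<close> tend
  to 0.\<close>

theorem plancherel:
  fixes g :: "'b::euclidean_space \<Rightarrow> real"
  assumes g: "integrable lborel g" and B: "\<And>x. \<bar>g x\<bar> \<le> B"
  shows "(\<integral>\<^sup>+p. ennreal ((cmod (fourier g p))\<^sup>2) \<partial>lborel) = ennreal ((2 * pi) ^ DIM('b) * (LINT x|lborel. (g x)\<^sup>2))"
proof -
  define c where "c = sqrt (2 * pi) ^ DIM('b)"
  have [measurable]: "g \<in> borel_measurable borel" using g by auto
  have B0: "0 \<le> B" using B[of 0] by simp
  define s where "s k = 1 / (real k + 1)" for k
  have s: "s k > 0" for k by (simp add: s_def)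
  have s0: "s \<longlonglongrightarrow> 0" unfolding s_def using LIMSEQ_inverse_real_of_nat by (simp add: inverse_eq_divide add.commute)
  \<comment> \<open>The autocorrelation of \<open>g\<close>. It is continuous at 0 because
    \<open>g\<close> is bounded and translations are continuous in L1.\<close>
  define a where "a z = (LINT x|lborel. g x * g (x + z))" for z
  have i1: "integrable lborel (\<lambda>x. g x * g (x + z))" for z
  proof (rule Bochner_Integration.integrable_bound)
    show "integrable lborel (\<lambda>x. B * g x)" using g by simp
    show "AE x in lborel. norm (g x * g (x + z)) \<le> norm (B * g x)"
      using B B0 mult_mono[OF B order_refl] by (auto simp: abs_mult mult.commute[of B] intro!: mult_left_mono)
  qed simp
  have i2: "integrable lborel (\<lambda>x. \<bar>g (x + z) - g x\<bar>)" for z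
    using g by (auto simp: integrable_lborel_shift_iff)
  have ai: "\<bar>a z - a 0\<bar> \<le> B * (LINT x|lborel. \<bar>g (x + z) - g x\<bar>)" for z
  proof -
    have "a z - a 0 = (LINT x|lborel. g x * g (x + z) - g x * g (x + 0))"
      unfolding a_def using i1[of z] i1[of 0] by (intro Bochner_Integration.integral_diff[symmetric])
    also have "\<bar>\<dots>\<bar> \<le> (LINT x|lborel. B * \<bar>g (x + z) - g x\<bar>)"
      unfolding real_norm_def[symmetric]
    proof (rule Bochner_Integration.integral_norm_bound_integral)
      show "integrable lborel (\<lambda>x. g x * g (x + z) - g x * g (x + 0))" using i1[of z] i1[of 0] by simp
      show "norm (g x * g (x + z) - g x * g (x + 0)) \<le> B * norm (g (x + z) - g x)" for x
        using mult_right_mono[OF B[of x], of "\<bar>g (x + z) - g x\<bar>"] by (simp add: right_diff_distrib[symmetric] abs_mult)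
    qed (use i2[of z] in simp)
    finally show ?thesis by simp
  qed
  have a_lim: "(a \<longlongrightarrow> a 0) (at 0)"
  proof -
    have "((\<lambda>z. a z - a 0) \<longlongrightarrow> 0) (at 0)"
      by (rule Lim_null_comparison[OF _ tendsto_mult_right_zero[OF integral_abs_shift_tendsto_0[OF g], of B]])
        (use ai in \<open>auto intro: always_eventually\<close>)
    then show ?thesis by (simp add: LIM_zero_iff)
  qed
  have a_bd: "\<bar>a z\<bar> \<le> B * (LINT x|lborel. \<bar>g x\<bar>)" for z
  proof -
    have "\<bar>a z\<bar> \<le> (LINT x|lborel. B * \<bar>g x\<bar>)"
      unfolding a_def real_norm_def[symmetric]
    proof (rule Bochner_Integration.integral_norm_bound_integral[OF i1])
      show "norm (g x * g (x + z)) \<le> B * norm (g x)" for x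
        using mult_right_mono[OF B[of "x + z"], of "\<bar>g x\<bar>"] by (simp add: abs_mult mult.commute)
    qed (use g in simp)
    then show ?thesis by simp
  qed
  have [measurable]: "a \<in> borel_measurable borel" unfolding a_def by measurable
  define A where "A k = (LINT p|lborel. (cmod (fourier g p))\<^sup>2 * gauss (s k *\<^sub>R p))" for k
  have "(\<lambda>k. LINT v|lborel. gauss v * a (s k *\<^sub>R v)) \<longlonglongrightarrow> (LINT v|(lborel :: 'b measure). gauss v * a 0)"
  proof (rule Bochner_Integration.integral_dominated_convergence[where w = "\<lambda>v. gauss v * (B * (LINT x|lborel. \<bar>g x\<bar>))"])
    show "integrable lborel (\<lambda>v::'b. gauss v * (B * (LINT x|lborel. \<bar>g x\<bar>)))"
      using integrable_gauss[where 'b = 'b] by simp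
    show "AE v in lborel. (\<lambda>k. gauss v * a (s k *\<^sub>R v)) \<longlonglongrightarrow> gauss v * a 0"
    proof (intro AE_I2 tendsto_mult tendsto_const)
      fix v :: 'b
      have "(\<lambda>k. s k *\<^sub>R v) \<longlonglongrightarrow> 0" using tendsto_scaleR[OF s0 tendsto_const[of v]] by simp
      moreover have "(a \<longlongrightarrow> a 0) (nhds 0)" using a_lim by (simp add: tendsto_at_iff_tendsto_nhds)
      ultimately show "(\<lambda>k. a (s k *\<^sub>R v)) \<longlonglongrightarrow> a 0" by (rule filterlim_compose[rotated])
    qed
    show "AE v in lborel. norm (gauss v * a (s k *\<^sub>R v)) \<le> gauss v * (B * (LINT x|lborel. \<bar>g x\<bar>))" for k
      using a_bd
      by (intro AE_I2) (auto simp: abs_mult intro!: mult_left_mono)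
  qed simp_all
  then have "(\<lambda>k. c * (LINT v|lborel. gauss v * a (s k *\<^sub>R v))) \<longlonglongrightarrow> c * (c * a 0)"
    by (intro tendsto_mult tendsto_const) (simp add: integral_gauss c_def)
  moreover have "A = (\<lambda>k. c * (LINT v|lborel. gauss v * a (s k *\<^sub>R v)))"
    unfolding A_def a_def c_def by (rule ext, rule plancherel_gauss[OF g B s])
  moreover have "c * (c * a 0) = (2 * pi) ^ DIM('b) * (LINT x|lborel. (g x)\<^sup>2)"
  proof -
    have "c * c = (2 * pi) ^ DIM('b)" unfolding c_def power_mult_distrib[symmetric] real_sqrt_mult_self by simp
    moreover have "a 0 = (LINT x|lborel. (g x)\<^sup>2)" by (simp add: a_def power2_eq_square)
    ultimately show ?thesis by (simp only: mult.assoc[symmetric])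
  qed
  ultimately have A: "A \<longlonglongrightarrow> (2 * pi) ^ DIM('b) * (LINT x|lborel. (g x)\<^sup>2)" by simp
  have [measurable]: "fourier g \<in> borel_measurable borel" using g by (rule fourier_measurable)
  define I where "I k = (\<integral>\<^sup>+p. ennreal ((cmod (fourier g p))\<^sup>2 * gauss (s k *\<^sub>R p)) \<partial>lborel)" for k
  have "I k = ennreal (A k)" for k
    unfolding I_def A_def
  proof (rule nn_integral_eq_integral)
    have "integrable lborel (\<lambda>p::'b. (LINT q|lborel. \<bar>g q\<bar>)\<^sup>2 * gauss (s k *\<^sub>R p))"
      using integrable_lborel_scale[OF integrable_gauss[where 'b = 'b] s[of k]] by simp
    then show "integrable lborel (\<lambda>p. (cmod (fourier g p))\<^sup>2 * gauss (s k *\<^sub>R p))"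
      by (rule Bochner_Integration.integrable_bound)
        (simp, intro AE_I2, simp add: abs_mult mult_right_mono power_mono norm_fourier_le)
  qed auto
  then have IA: "I = (\<lambda>k. ennreal (A k))" by (rule ext)
  \<comment> \<open>One sequence, two limits: dominated convergence on the autocorrelation side
    here, monotone convergence on the frequency side next.\<close>
  have I1: "I \<longlonglongrightarrow> ennreal ((2 * pi) ^ DIM('b) * (LINT x|lborel. (g x)\<^sup>2))"
    unfolding IA by (rule tendsto_ennrealI[OF A])
  have I2: "I \<longlonglongrightarrow> (\<integral>\<^sup>+p. ennreal ((cmod (fourier g p))\<^sup>2) \<partial>lborel)"
    unfolding I_def
  proof (rule nn_integral_LIMSEQ)
    show "incseq (\<lambda>k p. ennreal ((cmod (fourier g p))\<^sup>2 * gauss (s k *\<^sub>R p)))"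
    proof (intro monoI le_funI ennreal_leI mult_left_mono)
      fix j k :: nat and p :: 'b assume "j \<le> k"
      then have "s k \<le> s j" unfolding s_def by (intro divide_left_mono) auto
      then have "norm (s k *\<^sub>R p) \<le> norm (s j *\<^sub>R p)" using s[of k] by (simp add: mult_right_mono)
      then have "(norm (s k *\<^sub>R p))\<^sup>2 \<le> (norm (s j *\<^sub>R p))\<^sup>2" by (intro power_mono) auto
      then show "gauss (s j *\<^sub>R p) \<le> gauss (s k *\<^sub>R p)" unfolding gauss_def by simp
    qed simp
    fix p :: 'b
    have "(\<lambda>k. gauss (s k *\<^sub>R p)) \<longlonglongrightarrow> exp (- (norm (0 *\<^sub>R p))\<^sup>2 / 2)"
      unfolding gauss_def by (intro tendsto_intros s0) simp_all
    then have "(\<lambda>k. (cmod (fourier g p))\<^sup>2 * gauss (s k *\<^sub>R p)) \<longlonglongrightarrow> (cmod (fourier g p))\<^sup>2 * 1"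
      by (intro tendsto_intros) simp
    then show "(\<lambda>k. ennreal ((cmod (fourier g p))\<^sup>2 * gauss (s k *\<^sub>R p))) \<longlonglongrightarrow> ennreal ((cmod (fourier g p))\<^sup>2)"
      by (intro tendsto_ennrealI) simp
  qed simp
  show ?thesis by (rule LIMSEQ_unique[OF I2 I1])
qed

section \<open>Symmetric Levy measures\<close>

definition variation_families :: "'m measure \<Rightarrow> 'm measure \<Rightarrow> 'm set \<Rightarrow> 'm set set set" where
  "variation_families \<mu> \<nu> E = {P. finite P \<and> disjoint P \<and> P \<subseteq> sets \<mu> \<and> \<Union>P \<subseteq> E \<and>
                      (\<forall>A\<in>P. emeasure \<mu> A < \<infinity> \<and> emeasure \<nu> A < \<infinity>)}"

definition variation_on :: "'m measure \<Rightarrow> 'm measure \<Rightarrow> 'm set \<Rightarrow> ennreal" where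
  "variation_on \<mu> \<nu> E = (SUP P \<in> variation_families \<mu> \<nu> E. (\<Sum>A\<in>P. ennreal \<bar>measure \<mu> A - measure \<nu> A\<bar>))"

lemma variation_diff_altdef:
  "variation_diff \<mu> \<nu> = measure_of (space \<mu>) (sets \<mu>) (variation_on \<mu> \<nu>)"
  by (simp add: variation_diff_def variation_on_def[abs_def] variation_families_def)

lemma variation_families_empty: "{} \<in> variation_families \<mu> \<nu> E"
  by (simp add: variation_families_def)

lemma variation_on_upper:
  "P \<in> variation_families \<mu> \<nu> E \<Longrightarrow> (\<Sum>A\<in>P. ennreal \<bar>measure \<mu> A - measure \<nu> A\<bar>) \<le> variation_on \<mu> \<nu> E"
  unfolding variation_on_def by (rule SUP_upper)

lemma variation_on_mono: "E \<subseteq> F \<Longrightarrow> variation_on \<mu> \<nu> E \<le> variation_on \<mu> \<nu> F"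
  unfolding variation_on_def by (rule SUP_subset_mono) (auto simp: variation_families_def)

lemma variation_on_empty: "variation_on \<mu> \<nu> {} = 0"
proof -
  have "(\<Sum>A\<in>P. ennreal \<bar>measure \<mu> A - measure \<nu> A\<bar>) = 0" if "P \<in> variation_families \<mu> \<nu> {}" for P
    using that by (intro sum.neutral) (auto simp: variation_families_def)
  then show ?thesis
    unfolding variation_on_def using variation_families_empty[of \<mu> \<nu> "{}"] by (auto intro!: SUP_eq_const)
qed

text \<open>Families inside disjoint sets can be united. The only piece they may share is the empty
  set, which contributes 0, so the sum over the union is the sum of the sums.\<close>

lemma variation_on_superadditive:
  assumes "E \<inter> F = {}"
  shows "variation_on \<mu> \<nu> E + variation_on \<mu> \<nu> F \<le> variation_on \<mu> \<nu> (E \<union> F)"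
proof -
  let ?s = "\<lambda>P. \<Sum>A\<in>P. ennreal \<bar>measure \<mu> A - measure \<nu> A\<bar>"
  have one: "?s P + ?s R \<le> variation_on \<mu> \<nu> (E \<union> F)"
    if P: "P \<in> variation_families \<mu> \<nu> E" and R: "R \<in> variation_families \<mu> \<nu> F" for P R
  proof -
    have int: "P \<inter> R \<subseteq> {{}}"
      using assms P R unfolding variation_families_def by blast
    have "?s (P \<union> R) + ?s (P \<inter> R) = ?s P + ?s R"
      using P R by (intro sum.union_inter) (auto simp: variation_families_def)
    moreover have "?s (P \<inter> R) = 0"
      using int by (intro sum.neutral) auto
    moreover have "disjoint (P \<union> R)"
    proof (intro disjoint_union)
      show "\<Union>P \<inter> \<Union>R = {}" using P R assms unfolding variation_families_def by blast
    qed (use P R in \<open>auto simp: variation_families_def\<close>)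
    then have "P \<union> R \<in> variation_families \<mu> \<nu> (E \<union> F)"
      using P R by (auto simp: variation_families_def)
    ultimately show ?thesis using variation_on_upper[of "P \<union> R" \<mu> \<nu> "E \<union> F"] by (metis add_0_right)
  qed
  have ne: "variation_families \<mu> \<nu> E \<noteq> {}" "variation_families \<mu> \<nu> F \<noteq> {}" 
    using variation_families_empty by fast+
  have "?s P + variation_on \<mu> \<nu> F \<le> variation_on \<mu> \<nu> (E \<union> F)" if P: "P \<in> variation_families \<mu> \<nu> E" for P
    using one[OF P] unfolding variation_on_def[of \<mu> \<nu> F]
    by (subst ennreal_SUP_add_right[OF ne(2)]) (auto intro: SUP_least)
  then show ?thesis
    unfolding variation_on_def[of \<mu> \<nu> E]
    by (subst ennreal_SUP_add_left[OF ne(1), symmetric]) (auto intro: SUP_least)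
qed

lemma ennreal_abs_le_suminf:
  assumes "f sums (a::real)" "summable (\<lambda>i. \<bar>f i\<bar>)"
  shows "ennreal \<bar>a\<bar> \<le> (\<Sum>i. ennreal \<bar>f i\<bar>)"
proof -
  have "\<bar>a\<bar> \<le> (\<Sum>i. \<bar>f i\<bar>)"
    using summable_rabs[OF assms(2)] sums_unique[OF assms(1)] by simp
  then have "ennreal \<bar>a\<bar> \<le> ennreal (\<Sum>i. \<bar>f i\<bar>)" by (rule ennreal_leI)
  also have "\<dots> = (\<Sum>i. ennreal \<bar>f i\<bar>)"
    using assms(2) by (intro suminf_ennreal2[symmetric]) auto
  finally show ?thesis .
qed

text \<open>\<open>variation_diff\<close> is built with \<open>measure_of\<close>, so its values can
  be computed only once this is known. One inequality is superadditivity; for the other, every piece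
  of a family is cut along the sets \<open>A i\<close>.\<close>

lemma variation_on_countably_additive:
  assumes sets: "sets \<nu> = sets \<mu>"
  shows "countably_additive (sets \<mu>) (variation_on \<mu> \<nu>)"
proof (rule countably_additiveI)
  fix A :: "nat \<Rightarrow> 'a set"
  assume A: "range A \<subseteq> sets \<mu>" "disjoint_family A" "(\<Union>i. A i) \<in> sets \<mu>"
  show "(\<Sum>i. variation_on \<mu> \<nu> (A i)) = variation_on \<mu> \<nu> (\<Union>i. A i)"
  proof (rule antisym)
    have "(\<Sum>i<n. variation_on \<mu> \<nu> (A i)) \<le> variation_on \<mu> \<nu> (\<Union>i<n. A i)" for n
    proof (induction n)
      case 0 then show ?case by (simp add: variation_on_empty)
    next
      case (Suc n)
      have "A i \<inter> A n = {}" if "i < n" for i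
        using A(2) that by (simp add: disjoint_family_on_def)
      then have "(\<Union>i<n. A i) \<inter> A n = {}" by blast
      from variation_on_superadditive[OF this] Suc show ?case
        by (simp add: lessThan_Suc Un_commute add.commute)
          (meson add_left_mono add_right_mono order_trans)
    qed
    also have "variation_on \<mu> \<nu> (\<Union>i<n. A i) \<le> variation_on \<mu> \<nu> (\<Union>i. A i)" for n
      by (rule variation_on_mono) auto
    finally show "(\<Sum>i. variation_on \<mu> \<nu> (A i)) \<le> variation_on \<mu> \<nu> (\<Union>i. A i)"
      by (intro suminf_le_const) auto
  next
    show "variation_on \<mu> \<nu> (\<Union>i. A i) \<le> (\<Sum>i. variation_on \<mu> \<nu> (A i))"
      unfolding variation_on_def[of \<mu> \<nu> "\<Union>i. A i"]
    proof (rule SUP_least)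
      fix P assume P: "P \<in> variation_families \<mu> \<nu> (\<Union>i. A i)"
      let ?d = "\<lambda>B. ennreal \<bar>measure \<mu> B - measure \<nu> B\<bar>"
      have fin: "finite P" and dis: "disjoint P" and sub: "\<And>B. B \<in> P \<Longrightarrow> B \<subseteq> (\<Union>i. A i)"
        and B\<mu>: "\<And>B. B \<in> P \<Longrightarrow> B \<in> sets \<mu>" and B\<nu>: "\<And>B. B \<in> P \<Longrightarrow> B \<in> sets \<nu>"
        and f\<mu>: "\<And>B. B \<in> P \<Longrightarrow> emeasure \<mu> B < \<infinity>" and f\<nu>: "\<And>B. B \<in> P \<Longrightarrow> emeasure \<nu> B < \<infinity>"
        using P sets by (auto simp: variation_families_def)
      have cut: "?d B \<le> (\<Sum>i. ?d (B \<inter> A i))" if B: "B \<in> P" for B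
      proof -
        have U: "(\<Union>i. B \<inter> A i) = B" using sub[OF B] by auto
        have dj: "disjoint_family (\<lambda>i. B \<inter> A i)" using A(2) by (auto simp: disjoint_family_on_def)
        have "(\<lambda>i. measure \<mu> (B \<inter> A i)) sums measure \<mu> (\<Union>i. B \<inter> A i)"
          by (rule measure_UNION) (use A B\<mu>[OF B] f\<mu>[OF B] dj U in auto)
        then have s1: "(\<lambda>i. measure \<mu> (B \<inter> A i)) sums measure \<mu> B" by (simp only: U)
        have "(\<lambda>i. measure \<nu> (B \<inter> A i)) sums measure \<nu> (\<Union>i. B \<inter> A i)"
          by (rule measure_UNION) (use A B\<nu>[OF B] f\<nu>[OF B] dj U sets in auto)
        then have s2: "(\<lambda>i. measure \<nu> (B \<inter> A i)) sums measure \<nu> B" by (simp only: U)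
        have "summable (\<lambda>i. \<bar>measure \<mu> (B \<inter> A i) - measure \<nu> (B \<inter> A i)\<bar>)"
          by (rule summable_comparison_test'[OF summable_add[OF sums_summable[OF s1] sums_summable[OF s2]], of 0])
            (use measure_nonneg in \<open>simp add: abs_le_iff add_increasing add_increasing2\<close>)
        then show ?thesis
          by (rule ennreal_abs_le_suminf[OF sums_diff[OF s1 s2]])
      qed
      have "(\<Sum>B\<in>P. ?d B) \<le> (\<Sum>B\<in>P. \<Sum>i. ?d (B \<inter> A i))"
        by (rule sum_mono) (rule cut)
      also have "\<dots> = (\<Sum>i. \<Sum>B\<in>P. ?d (B \<inter> A i))"
        by (rule suminf_sum[symmetric]) auto
      also have "\<dots> \<le> (\<Sum>i. variation_on \<mu> \<nu> (A i))"
      proof (intro suminf_le allI)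
        fix i
        \<comment> \<open>Two distinct pieces can have the same trace on \<open>A i\<close> only if
          that trace is empty, so reindexing the sum by traces loses nothing.\<close>
        have zero: "?d (B \<inter> A i) = 0" if "B \<in> P" "C \<in> P" "B \<noteq> C" "B \<inter> A i = C \<inter> A i" for B C
        proof -
          have "B \<inter> C = {}" using dis that by (auto simp: disjoint_def)
          then have "B \<inter> A i = {}" using that by blast
          then show ?thesis by simp
        qed
        have "(\<Sum>B\<in>P. ?d (B \<inter> A i)) = (\<Sum>B\<in>(\<lambda>B. B \<inter> A i) ` P. ?d B)"
          using sum.reindex_nontrivial[OF fin, of "\<lambda>B. B \<inter> A i" ?d] zero by simp
        also have "\<dots> \<le> variation_on \<mu> \<nu> (A i)"
        proof (rule variation_on_upper)
          have "disjoint ((\<lambda>B. B \<inter> A i) ` P)"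
            using dis unfolding disjoint_def by blast
          moreover have "emeasure \<mu> (B \<inter> A i) < \<infinity>" "emeasure \<nu> (B \<inter> A i) < \<infinity>" if "B \<in> P" for B
            using emeasure_mono[of "B \<inter> A i" B \<mu>] emeasure_mono[of "B \<inter> A i" B \<nu>] B\<mu>[OF that] B\<nu>[OF that]
              f\<mu>[OF that] f\<nu>[OF that] by (auto intro: le_less_trans)
          ultimately show "(\<lambda>B. B \<inter> A i) ` P \<in> variation_families \<mu> \<nu> (A i)"
            using fin A(1) B\<mu> by (auto simp: variation_families_def)
        qed
        finally show "(\<Sum>B\<in>P. ?d (B \<inter> A i)) \<le> variation_on \<mu> \<nu> (A i)" .
      qed auto
      finally show "(\<Sum>B\<in>P. ?d B) \<le> (\<Sum>i. variation_on \<mu> \<nu> (A i))" .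
    qed
  qed
qed

lemma sets_variation_diff [measurable_cong]: "sets (variation_diff \<mu> \<nu>) = sets \<mu>"
  by (simp add: variation_diff_altdef)

lemma emeasure_variation_diff:
  assumes "sets \<nu> = sets \<mu>" "E \<in> sets \<mu>"
  shows "emeasure (variation_diff \<mu> \<nu>) E = variation_on \<mu> \<nu> E"
  by (rule emeasure_measure_of[OF variation_diff_altdef])
    (use assms variation_on_countably_additive[OF assms(1)] sets.space_closed
      in \<open>auto simp: variation_on_empty positive_def sets_variation_diff\<close>)

text \<open>Where both measures are finite, the family consisting of a single piece already gives
  the inequality; the exhaustion by \<open>S\<close> carries it over to sets of infinite
  measure.\<close>

lemma emeasure_le_add_variation:
  assumes sets: "sets \<nu> = sets \<mu>" and E: "E \<in> sets \<mu>"
    and S: "range S \<subseteq> sets \<mu>" "incseq S" "(\<Union>j. S j) = space \<mu>"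
    and fin: "\<And>j::nat. emeasure \<mu> (S j) < \<infinity>" "\<And>j. emeasure \<nu> (S j) < \<infinity>"
  shows "emeasure \<mu> E \<le> emeasure \<nu> E + emeasure (variation_diff \<mu> \<nu>) E"
proof -
  have part: "emeasure \<mu> (E \<inter> S j) \<le> emeasure \<nu> E + emeasure (variation_diff \<mu> \<nu>) E" for j
  proof -
    have m: "E \<inter> S j \<in> sets \<mu>" "E \<inter> S j \<in> sets \<nu>" using E S(1) sets by auto
    have f: "emeasure \<mu> (E \<inter> S j) < \<infinity>" "emeasure \<nu> (E \<inter> S j) < \<infinity>"
      using emeasure_mono[of "E \<inter> S j" "S j" \<mu>] emeasure_mono[of "E \<inter> S j" "S j" \<nu>] S(1) sets fin[of j]
      by (auto intro: le_less_trans)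
    have "{E \<inter> S j} \<in> variation_families \<mu> \<nu> E"
      using m f by (auto simp: variation_families_def)
    from variation_on_upper[OF this]
    have v: "ennreal \<bar>measure \<mu> (E \<inter> S j) - measure \<nu> (E \<inter> S j)\<bar> \<le> emeasure (variation_diff \<mu> \<nu>) E"
      using emeasure_variation_diff[OF sets E] by simp
    have "emeasure \<mu> (E \<inter> S j) = ennreal (measure \<mu> (E \<inter> S j))"
      using f(1) by (intro emeasure_eq_ennreal_measure) auto
    also have "\<dots> \<le> ennreal (measure \<nu> (E \<inter> S j) + \<bar>measure \<mu> (E \<inter> S j) - measure \<nu> (E \<inter> S j)\<bar>)"
      by (rule ennreal_leI) simp
    also have "\<dots> = emeasure \<nu> (E \<inter> S j) + ennreal \<bar>measure \<mu> (E \<inter> S j) - measure \<nu> (E \<inter> S j)\<bar>"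
      using f(2) by (subst ennreal_plus) (auto simp: emeasure_eq_ennreal_measure)
    also have "\<dots> \<le> emeasure \<nu> E + emeasure (variation_diff \<mu> \<nu>) E"
      using E sets by (intro add_mono v emeasure_mono) auto
    finally show ?thesis .
  qed
  have U: "(\<Union>j. E \<inter> S j) = E" using S(3) sets.sets_into_space[OF E] by auto
  have "range (\<lambda>j. E \<inter> S j) \<subseteq> sets \<mu>" using S(1) E by auto
  moreover have "incseq (\<lambda>j. E \<inter> S j)" using S(2) unfolding incseq_def by blast
  ultimately have "emeasure \<mu> E = (SUP j. emeasure \<mu> (E \<inter> S j))"
    by (subst SUP_emeasure_incseq) (simp_all only: U)
  also have "\<dots> \<le> emeasure \<nu> E + emeasure (variation_diff \<mu> \<nu>) E"
    by (rule SUP_least) (rule part)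
  finally show ?thesis .
qed

lemma nn_integral_le_add:
  assumes sets: "sets N = sets M" "sets K = sets M"
    and le: "\<And>E. E \<in> sets M \<Longrightarrow> emeasure M E \<le> emeasure N E + emeasure K E"
    and f: "f \<in> borel_measurable M"
  shows "(\<integral>\<^sup>+x. f x \<partial>M) \<le> (\<integral>\<^sup>+x. f x \<partial>N) + (\<integral>\<^sup>+x. f x \<partial>K)"
  using f
proof (induction rule: borel_measurable_induct)
  case (cong f g)
  have "space N = space M" "space K = space M" using sets_eq_imp_space_eq[OF sets(1)] sets_eq_imp_space_eq[OF sets(2)] by auto
  with cong nn_integral_cong[of N f g] nn_integral_cong[of K f g] nn_integral_cong[of M f g] show ?case by simp
next
  case (set A)
  then show ?case using le sets by simp
next
  case (mult u c)
  note [measurable_cong] = sets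
  show ?case using mult by (simp add: nn_integral_cmult distrib_left[symmetric] mult_left_mono)
next
  case (add u v)
  note [measurable_cong] = sets
  have "(\<integral>\<^sup>+x. v x \<partial>M) + (\<integral>\<^sup>+x. u x \<partial>M) \<le>
     ((\<integral>\<^sup>+x. v x \<partial>N) + (\<integral>\<^sup>+x. v x \<partial>K)) + ((\<integral>\<^sup>+x. u x \<partial>N) + (\<integral>\<^sup>+x. u x \<partial>K))"
    using add by (intro add_mono)
  with add show ?case by (simp add: nn_integral_add algebra_simps)
next
  case (seq U)
  note [measurable_cong] = sets
  have "(\<integral>\<^sup>+x. (SUP i. U i) x \<partial>M) = (SUP i. \<integral>\<^sup>+x. U i x \<partial>M)"
    using seq by (simp add: nn_integral_monotone_convergence_SUP image_image)
  also have "\<dots> \<le> (\<integral>\<^sup>+x. (SUP i. U i) x \<partial>N) + (\<integral>\<^sup>+x. (SUP i. U i) x \<partial>K)"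
  proof (rule SUP_least)
    fix i
    have "(\<integral>\<^sup>+x. U i x \<partial>N) \<le> (\<integral>\<^sup>+x. (SUP i. U i) x \<partial>N)" "(\<integral>\<^sup>+x. U i x \<partial>K) \<le> (\<integral>\<^sup>+x. (SUP i. U i) x \<partial>K)"
      by (intro nn_integral_mono le_funD[OF SUP_upper] UNIV_I)+
    then show "(\<integral>\<^sup>+x. U i x \<partial>M) \<le> (\<integral>\<^sup>+x. (SUP i. U i) x \<partial>N) + (\<integral>\<^sup>+x. (SUP i. U i) x \<partial>K)"
      using seq.IH[of i] add_mono order_trans by blast
  qed
  finally show ?case .
qed

section \<open>Integration against one symmetric Levy measure\<close>

locale levy_bound =
  fixes \<nu> :: "'a::euclidean_space measure" and \<Lambda> :: real
  assumes levy: "symmetric_levy_measure \<nu>"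
    and nn_bound: "(\<integral>\<^sup>+z. ennreal (min ((norm z)\<^sup>2) 1) \<partial>\<nu>) \<le> ennreal \<Lambda>"
    and \<Lambda>_nonneg: "0 \<le> \<Lambda>"
begin

lemma sets_\<nu> [measurable_cong, simp]: "sets \<nu> = sets borel"
  using levy by (simp add: symmetric_levy_measure_def)

lemma space_\<nu> [simp]: "space \<nu> = UNIV"
  using sets_eq_imp_space_eq[OF sets_\<nu>] by simp

lemma integrable_min: "integrable \<nu> (\<lambda>z. min ((norm z)\<^sup>2) 1)"
  using nn_bound by (intro integrableI_nonneg) (auto simp: ennreal_less_top le_less_trans)

lemma integral_min: "(LINT z|\<nu>. min ((norm z)\<^sup>2) 1) \<le> \<Lambda>"
  using nn_bound nn_integral_eq_integral[OF integrable_min] \<Lambda>_nonneg by (simp add: ennreal_le_iff)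

lemma integrable_levy:
  assumes f: "f \<in> borel_measurable borel" and le: "\<And>z. \<bar>f z\<bar> \<le> C * min ((norm z)\<^sup>2) 1"
  shows "integrable \<nu> f" and "\<bar>LINT z|\<nu>. f z\<bar> \<le> C * \<Lambda>"
proof -
  \<comment> \<open>At a vector of norm 1 the bound reads |f z| \<le> C.\<close>
  have "0 \<le> C" using le[of "SOME z. norm z = 1"] vector_choose_size[of 1] 
    by (metis (mono_tags, lifting) abs_ge_zero min.idem mult.right_neutral one_power2 order_trans someI_ex zero_le_one)
  have i: "integrable \<nu> (\<lambda>z. C * min ((norm z)\<^sup>2) 1)" using integrable_min by simp
  show *: "integrable \<nu> f"
    by (rule Bochner_Integration.integrable_bound[OF i]) (use f le in \<open>auto intro: order_trans[OF _ abs_ge_self]\<close>)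
  have "\<bar>LINT z|\<nu>. f z\<bar> \<le> (LINT z|\<nu>. C * min ((norm z)\<^sup>2) 1)"
    using Bochner_Integration.integral_norm_bound_integral[OF * i] le by simp
  also have "\<dots> \<le> C * \<Lambda>" using integral_min \<open>0 \<le> C\<close> by (simp add: mult_left_mono)
  finally show "\<bar>LINT z|\<nu>. f z\<bar> \<le> C * \<Lambda>" .
qed

lemma min_ge_indicator:
  assumes "r > 0"
  shows "indicator {z::'a. r \<le> norm z} z \<le> (1 / min (r\<^sup>2) 1) * min ((norm z)\<^sup>2) 1"
proof (cases "r \<le> norm z")
  case True
  then have "min (r\<^sup>2) 1 \<le> min ((norm z)\<^sup>2) 1" using assms by (intro min.mono power_mono) auto
  moreover have "min (r\<^sup>2) 1 > 0" using assms by simp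
  ultimately show ?thesis using True by (simp add: field_simps)
next
  case False
  then show ?thesis by (simp add: divide_nonneg_nonneg)
qed

lemma
  assumes "r > 0"
  shows emeasure_ge_finite: "emeasure \<nu> {z. r \<le> norm z} < \<infinity>"
    and measure_ge: "measure \<nu> {z. r \<le> norm z} \<le> (1 / min (r\<^sup>2) 1) * \<Lambda>"
proof -
  have le: "\<bar>indicator {z::'a. r \<le> norm z} z :: real\<bar> \<le> (1 / min (r\<^sup>2) 1) * min ((norm z)\<^sup>2) 1" for z
    using min_ge_indicator[OF assms] by simp
  have "integrable \<nu> (indicator {z::'a. r \<le> norm z} :: _ \<Rightarrow> real)"
    by (rule integrable_levy(1)[OF _ le]) measurable
  then show "emeasure \<nu> {z. r \<le> norm z} < \<infinity>" by (simp add: integrable_indicator_iff)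
  show "measure \<nu> {z. r \<le> norm z} \<le> (1 / min (r\<^sup>2) 1) * \<Lambda>"
    using integrable_levy(2)[OF _ le] by simp
qed

lemma emeasure_0: "emeasure \<nu> {0} = 0"
  using levy by (simp add: symmetric_levy_measure_def)

text \<open>The origin, a null set, is added so that these sets cover the space while keeping finite
  measure.\<close>

definition exhaust :: "nat \<Rightarrow> 'a set" where
  "exhaust j = {0} \<union> {z. 1 / (real j + 1) \<le> norm z}"

lemma exhaust_props: "range exhaust \<subseteq> sets borel" "incseq exhaust" "(\<Union>j. exhaust j) = UNIV"
  "emeasure \<nu> (exhaust j) < \<infinity>"
proof -
  show "range exhaust \<subseteq> sets borel" by (auto simp: exhaust_def)
  have "1 / (real n + 1) \<le> 1 / (real m + 1)" if "m \<le> n" for m n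
    using that by (intro divide_left_mono) auto
  then show "incseq exhaust" by (force simp: incseq_def exhaust_def)
  have "\<exists>j. 1 / (real j + 1) \<le> norm z" if z: "z \<noteq> 0" for z :: 'a
  proof -
    obtain n where "inverse (real (Suc n)) < norm z" using reals_Archimedean[of "norm z"] z by auto
    then show ?thesis by (intro exI[of _ n]) (simp add: inverse_eq_divide add.commute)
  qed
  then show "(\<Union>j. exhaust j) = UNIV" by (auto simp: exhaust_def)
  have "emeasure \<nu> (exhaust j) \<le> emeasure \<nu> {0} + emeasure \<nu> {z. 1 / (real j + 1) \<le> norm z}"
    unfolding exhaust_def by (rule emeasure_subadditive) auto
  also have "\<dots> < \<infinity>" using emeasure_0 emeasure_ge_finite[of "1 / (real j + 1)"] by simp
  finally show "emeasure \<nu> (exhaust j) < \<infinity>" .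
qed

lemma sigma_finite_\<nu>: "sigma_finite_measure \<nu>"
proof
  show "\<exists>A. countable A \<and> A \<subseteq> sets \<nu> \<and> \<Union>A = space \<nu> \<and> (\<forall>a\<in>A. emeasure \<nu> a \<noteq> \<infinity>)"
    using exhaust_props by (intro exI[of _ "range exhaust"]) (auto simp: less_top)
qed

lemma distr_uminus: "distr \<nu> borel uminus = \<nu>"
proof (rule measure_eqI)
  fix E assume "E \<in> sets (distr \<nu> borel uminus)"
  then have E: "E \<in> sets borel" by simp
  have "uminus -` E = uminus ` E" by (auto simp: image_iff) (metis minus_minus)
  then show "emeasure (distr \<nu> borel uminus) E = emeasure \<nu> E"
    using E levy by (simp add: emeasure_distr symmetric_levy_measure_def)
qed simp

lemma integral_uminus:
  fixes f :: "'a \<Rightarrow> real"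
  assumes "f \<in> borel_measurable borel"
  shows "(LINT z|\<nu>. f (- z)) = (LINT z|\<nu>. f z)"
  using integral_distr[of uminus \<nu> borel f] assms by (simp add: distr_uminus)

text \<open>The part of the measure carried by jumps of length at least r, kept as a measure on the
  whole space. It is finite, so Fubini's theorem with Lebesgue measure is available.\<close>

definition tail :: "real \<Rightarrow> 'a measure" where
  "tail r = density \<nu> (\<lambda>z. ennreal (indicator {z. r \<le> norm z} z))"

lemma sets_tail [measurable_cong, simp]: "sets (tail r) = sets borel"
  and space_tail [simp]: "space (tail r) = UNIV"
  by (simp_all add: tail_def)

lemma finite_measure_tail:
  assumes "r > 0" shows "finite_measure (tail r)"
proof
  have "emeasure (tail r) UNIV = emeasure \<nu> {z. r \<le> norm z}"
    unfolding tail_def by (subst emeasure_density) (auto simp: ennreal_indicator)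
  then show "emeasure (tail r) (space (tail r)) \<noteq> \<infinity>"
    using emeasure_ge_finite[OF assms] by simp
qed

lemma measure_tail:
  assumes "r > 0" shows "measure (tail r) UNIV \<le> (1 / min (r\<^sup>2) 1) * \<Lambda>"
proof -
  have "emeasure (tail r) UNIV = emeasure \<nu> {z. r \<le> norm z}"
    unfolding tail_def by (subst emeasure_density) (auto simp: ennreal_indicator)
  then show ?thesis using measure_ge[OF assms] by (simp add: measure_def)
qed

lemma integral_tail:
  fixes f :: "'a \<Rightarrow> real"
  assumes "f \<in> borel_measurable borel"
  shows "(LINT z|tail r. f z) = (LINT z:{z. r \<le> norm z}|\<nu>. f z)"
  unfolding tail_def set_lebesgue_integral_def using assms by (subst integral_density) auto

text \<open>The truncation at \<epsilon> is void once \<epsilon> < r, so the defining limit is that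
  of an eventually constant function.\<close>

lemma levy_operator_large:
  assumes r: "r > 0" and w: "w \<in> borel_measurable borel"
  shows "levy_operator \<nu> {z. r \<le> norm z} w x = (LINT z|tail r. w (x + z) - w x)"
proof -
  have [measurable]: "w \<in> borel_measurable borel" by fact
  have "\<forall>\<^sub>F \<epsilon> in at_right 0. (LINT z:{z. r \<le> norm z} \<inter> {z. \<epsilon> < norm z}|\<nu>. w (x + z) - w x) = (LINT z|tail r. w (x + z) - w x)"
  proof (rule eventually_mono)
    show "\<forall>\<^sub>F \<epsilon> in at_right 0. \<epsilon> < r"
      by (rule eventually_at_rightI[OF _ r]) simp
  next
    fix \<epsilon> assume "\<epsilon> < r"
    then have "{z::'a. r \<le> norm z} \<inter> {z. \<epsilon> < norm z} = {z. r \<le> norm z}" by auto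
    then show "(LINT z:{z. r \<le> norm z} \<inter> {z. \<epsilon> < norm z}|\<nu>. w (x + z) - w x) = (LINT z|tail r. w (x + z) - w x)"
      by (simp add: integral_tail)
  qed
  then show ?thesis
    unfolding levy_operator_def by (intro tendsto_Lim tendsto_eventually) auto
qed

text \<open>Symmetry of the measure removes the linear Taylor term on every annulus. The remainder
  is of order |z|^2, which the measure integrates near the origin; r \<le> 1 keeps |z|^2 below the
  minimum with 1.\<close>

lemma levy_operator_small:
  assumes r: "0 < r" "r \<le> 1" and [measurable]: "\<phi> \<in> borel_measurable borel"
    and le: "\<And>z. norm z < 1 \<Longrightarrow> \<bar>\<phi> (x + z) - \<phi> x - d \<bullet> z\<bar> \<le> C * (norm z)\<^sup>2" and C: "0 \<le> C"
  shows "\<bar>levy_operator \<nu> {z. norm z < r} \<phi> x\<bar> \<le> C * \<Lambda>"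
proof -
  define h where "h z = \<phi> (x + z) - \<phi> x - d \<bullet> z" for z
  have [measurable]: "h \<in> borel_measurable borel" unfolding h_def by measurable
  define A where "A \<epsilon> = {z::'a. norm z < r} \<inter> {z. \<epsilon> < norm z}" for \<epsilon>
  have [measurable]: "A \<epsilon> \<in> sets borel" for \<epsilon> unfolding A_def by measurable
  have bd: "\<bar>indicator (A \<epsilon>) z * h z\<bar> \<le> C * min ((norm z)\<^sup>2) 1" if "0 \<le> \<epsilon>" for \<epsilon> z
  proof (cases "z \<in> A \<epsilon>")
    case True
    then have "norm z < 1" using r by (auto simp: A_def)
    moreover then have "(norm z)\<^sup>2 \<le> 1" by (simp add: power_le_one)
    ultimately show ?thesis using True le[of z] by (simp add: h_def min_absorb1)
  qed (use C in simp)
  have eq: "(LINT z:A \<epsilon>|\<nu>. \<phi> (x + z) - \<phi> x) = (LINT z|\<nu>. indicator (A \<epsilon>) z * h z)" if e: "\<epsilon> > 0" for \<epsilon>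
  proof -
    \<comment> \<open>Away from the origin the linear term is integrable by itself, so that it may
      be split off and shown to vanish.\<close>
    have le2: "\<bar>indicator (A \<epsilon>) z * (d \<bullet> z)\<bar> \<le> (norm d * (1 / min (\<epsilon>\<^sup>2) 1)) * min ((norm z)\<^sup>2) 1" for z
    proof (cases "z \<in> A \<epsilon>")
      case True
      then have z: "norm z \<le> 1" "\<epsilon> \<le> norm z" using r by (auto simp: A_def)
      have "\<bar>d \<bullet> z\<bar> \<le> norm d * 1"
        using Cauchy_Schwarz_ineq2[of d z] z(1) by (meson mult_left_mono norm_ge_zero order_trans)
      also have "\<dots> \<le> norm d * ((1 / min (\<epsilon>\<^sup>2) 1) * min ((norm z)\<^sup>2) 1)"
        using min_ge_indicator[OF e, of z] z(2) by (intro mult_left_mono) auto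
      finally show ?thesis using True by (simp add: mult.assoc)
    qed simp
    have i1: "integrable \<nu> (\<lambda>z. indicator (A \<epsilon>) z * (d \<bullet> z))"
      by (rule integrable_levy(1)[OF _ le2]) measurable
    have i2: "integrable \<nu> (\<lambda>z. indicator (A \<epsilon>) z * h z)"
      by (rule integrable_levy(1)[OF _ bd]) (use e in auto)
    have "(LINT z|\<nu>. indicator (A \<epsilon>) z * (d \<bullet> z)) = (LINT z|\<nu>. indicator (A \<epsilon>) (- z) * (d \<bullet> (- z)))"
      by (rule integral_uminus[symmetric]) measurable
    also have "\<dots> = - (LINT z|\<nu>. indicator (A \<epsilon>) z * (d \<bullet> z))"
      by (simp add: A_def indicator_def)
    finally have zero: "(LINT z|\<nu>. indicator (A \<epsilon>) z * (d \<bullet> z)) = 0" by simp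
    have "(LINT z:A \<epsilon>|\<nu>. \<phi> (x + z) - \<phi> x) = (LINT z|\<nu>. indicator (A \<epsilon>) z * h z + indicator (A \<epsilon>) z * (d \<bullet> z))"
      unfolding set_lebesgue_integral_def
      by (rule Bochner_Integration.integral_cong) (auto simp: h_def algebra_simps)
    also have "\<dots> = (LINT z|\<nu>. indicator (A \<epsilon>) z * h z)"
      using i1 i2 zero by simp
    finally show ?thesis .
  qed
  \<comment> \<open>\<open>A 0\<close> is the punctured ball; dominated convergence identifies the
    integral over it as the limit.\<close>
  have "((\<lambda>\<epsilon>. LINT z:A \<epsilon>|\<nu>. \<phi> (x + z) - \<phi> x) \<longlongrightarrow> (LINT z|\<nu>. indicator (A 0) z * h z)) (at_right 0)"
    unfolding tendsto_at_iff_sequentially comp_def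
  proof (intro allI impI)
    fix E :: "nat \<Rightarrow> real" assume E: "\<forall>i. E i \<in> {0<..} - {0}" "E \<longlonglongrightarrow> 0"
    have "(\<lambda>i. LINT z|\<nu>. indicator (A (E i)) z * h z) \<longlonglongrightarrow> (LINT z|\<nu>. indicator (A 0) z * h z)"
    proof (rule Bochner_Integration.integral_dominated_convergence[where w = "\<lambda>z. C * min ((norm z)\<^sup>2) 1"])
      show "AE z in \<nu>. (\<lambda>i. indicator (A (E i)) z * h z) \<longlonglongrightarrow> indicator (A 0) z * h z"
      proof (intro AE_I2 tendsto_mult tendsto_const tendsto_eventually)
        fix z :: 'a
        show "\<forall>\<^sub>F i in sequentially. indicator (A (E i)) z = (indicator (A 0) z :: real)"
        proof (cases "z = 0")
          case True
          then show ?thesis using E(1) by (auto simp: A_def indicator_def less_imp_le not_less)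
        next
          case False
          then have "\<forall>\<^sub>F i in sequentially. E i < norm z"
            using order_tendstoD(2)[OF E(2)] by simp
          then show ?thesis by eventually_elim (use False in \<open>auto simp: A_def indicator_def\<close>)
        qed
      qed
      show "AE z in \<nu>. norm (indicator (A (E i)) z * h z) \<le> C * min ((norm z)\<^sup>2) 1" for i
        using bd[of "E i"] E(1) by (auto simp: less_imp_le)
    qed (use integrable_min in auto)
    moreover have "(LINT z:A (E i)|\<nu>. \<phi> (x + z) - \<phi> x) = (LINT z|\<nu>. indicator (A (E i)) z * h z)" for i
      using E(1) by (intro eq) auto
    ultimately show "(\<lambda>i. LINT z:A (E i)|\<nu>. \<phi> (x + z) - \<phi> x) \<longlonglongrightarrow> (LINT z|\<nu>. indicator (A 0) z * h z)" by simp
  qed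
  then have "levy_operator \<nu> {z. norm z < r} \<phi> x = (LINT z|\<nu>. indicator (A 0) z * h z)"
    unfolding levy_operator_def A_def by (intro tendsto_Lim) auto
  then show ?thesis
    using integrable_levy(2)[OF _ bd[OF order_refl]] by simp
qed

lemma levy_operator_zero:
  assumes "\<And>z. z \<in> J \<Longrightarrow> \<phi> (x + z) = \<phi> x"
  shows "levy_operator \<nu> J \<phi> x = 0"
proof -
  have "(LINT z:J \<inter> {z. \<epsilon> < norm z}|\<nu>. \<phi> (x + z) - \<phi> x) = 0" for \<epsilon>
  proof -
    have "(LINT z:J \<inter> {z. \<epsilon> < norm z}|\<nu>. \<phi> (x + z) - \<phi> x) = (LINT z|\<nu>. 0)"
      unfolding set_lebesgue_integral_def
      by (rule Bochner_Integration.integral_cong) (use assms in \<open>auto simp: indicator_def\<close>)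
    then show ?thesis by simp
  qed
  then show ?thesis unfolding levy_operator_def by (intro tendsto_Lim) auto
qed

lemma nn_integral_multiplier:
  "(\<integral>\<^sup>+z. ennreal (1 - cos (\<xi> \<bullet> z)) \<partial>\<nu>) = ennreal (levy_multiplier \<nu> \<xi>)"
  unfolding levy_multiplier_def
proof (rule nn_integral_eq_integral)
  \<comment> \<open>Short jumps use 1 - cos x \<le> x^2 / 2, long jumps the trivial bound 2.\<close>
  have "\<bar>1 - cos (\<xi> \<bullet> z)\<bar> \<le> ((norm \<xi>)\<^sup>2 + 2) * min ((norm z)\<^sup>2) 1" for z
  proof -
    have nn: "0 \<le> 1 - cos (\<xi> \<bullet> z)" by simp
    show ?thesis
    proof (cases "norm z \<le> 1")
      case True
      then have "(norm z)\<^sup>2 \<le> 1" by (simp add: power_le_one)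
      have "1 - cos (\<xi> \<bullet> z) \<le> (\<xi> \<bullet> z)\<^sup>2 / 2" by (rule one_minus_cos_le)
      also have "\<dots> \<le> (norm \<xi> * norm z)\<^sup>2"
      proof -
        have "(\<xi> \<bullet> z)\<^sup>2 \<le> (norm \<xi> * norm z)\<^sup>2"
          using power_mono[OF Cauchy_Schwarz_ineq2[of \<xi> z], of 2] by simp
        moreover have "0 \<le> (\<xi> \<bullet> z)\<^sup>2" by simp
        ultimately show ?thesis by linarith
      qed
      also have "\<dots> \<le> ((norm \<xi>)\<^sup>2 + 2) * (norm z)\<^sup>2" by (simp add: power_mult_distrib algebra_simps)
      finally show ?thesis using nn \<open>(norm z)\<^sup>2 \<le> 1\<close> by (simp add: min_absorb1)
    next
      case False
      then have "1 \<le> (norm z)\<^sup>2" by (simp add: one_le_power)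
      moreover have "1 - cos (\<xi> \<bullet> z) \<le> (norm \<xi>)\<^sup>2 + 2"
        using cos_ge_minus_one[of "\<xi> \<bullet> z"] zero_le_power2[of "norm \<xi>"] by linarith
      ultimately show ?thesis using nn by (simp add: min_absorb2 del: diff_ge_0_iff_ge)
    qed
  qed
  then show "integrable \<nu> (\<lambda>z. 1 - cos (\<xi> \<bullet> z))" by (rule integrable_levy(1)[rotated]) measurable
qed simp

lemma multiplier_nonneg: "0 \<le> levy_multiplier \<nu> \<xi>"
  unfolding levy_multiplier_def by (rule Bochner_Integration.integral_nonneg) simp

end

text \<open>From \<mu>n \<le> \<mu> + |\<mu>n - \<mu>| all but finitely many integrals are at most
  \<open>I \<mu> + 1\<close>; the finitely many others are simply added.\<close>

lemma levy_uniform_bound: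
  fixes \<mu> :: "'a::euclidean_space measure"
  assumes levy: "symmetric_levy_measure \<mu>" "\<And>n. symmetric_levy_measure (\<mu>n n)"
    and conv: "(\<lambda>n. \<integral>\<^sup>+z. ennreal (min ((norm z)\<^sup>2) 1) \<partial>variation_diff (\<mu>n n) \<mu>) \<longlonglongrightarrow> 0"
  shows "\<exists>\<Lambda>. \<forall>n::nat. levy_bound (\<mu>n n) \<Lambda>"
proof -
  define I where "I \<nu> = (\<integral>\<^sup>+z. ennreal (min ((norm z)\<^sup>2) 1) \<partial>\<nu>)" for \<nu> :: "'a measure"
  have fin: "I \<nu> < \<infinity>" if "symmetric_levy_measure \<nu>" for \<nu>
    using that by (simp add: I_def symmetric_levy_measure_def)
  have loc: "levy_bound \<nu> (enn2real (I \<nu>))" if "symmetric_levy_measure \<nu>" for \<nu>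
    by unfold_locales (use that fin[OF that] in \<open>auto simp: I_def[symmetric] ennreal_enn2real_if\<close>)
  have le: "I (\<mu>n n) \<le> I \<mu> + I (variation_diff (\<mu>n n) \<mu>)" for n
  proof -
    interpret A: levy_bound "\<mu>n n" "enn2real (I (\<mu>n n))" by (rule loc) (rule levy)
    interpret B: levy_bound \<mu> "enn2real (I \<mu>)" by (rule loc) (rule levy)
    have "emeasure (\<mu>n n) E \<le> emeasure \<mu> E + emeasure (variation_diff (\<mu>n n) \<mu>) E" if "E \<in> sets (\<mu>n n)" for E
      by (rule emeasure_le_add_variation[where S = A.exhaust])
        (use that A.exhaust_props B.exhaust_props(4) in auto)
    then show ?thesis
      unfolding I_def by (intro nn_integral_le_add) (auto simp: sets_variation_diff)
  qed
  have "\<forall>\<^sub>F n in sequentially. I (variation_diff (\<mu>n n) \<mu>) < 1"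
    using conv unfolding I_def by (rule order_tendstoD) simp
  then obtain N where N: "\<And>n. n \<ge> N \<Longrightarrow> I (variation_diff (\<mu>n n) \<mu>) < 1"
    by (auto simp: eventually_sequentially)
  define L where "L = I \<mu> + 1 + (\<Sum>n<N. I (\<mu>n n))"
  have L: "I (\<mu>n n) \<le> L" for n
  proof (cases "n < N")
    case True
    then have "I (\<mu>n n) \<le> (\<Sum>n<N. I (\<mu>n n))" by (intro member_le_sum) auto
    also have "\<dots> \<le> L" by (simp add: L_def)
    finally show ?thesis .
  next
    case False
    then have "I (\<mu>n n) \<le> I \<mu> + 1"
      using le[of n] N[of n] by (meson add_left_mono less_imp_le not_less order_trans)
    also have "\<dots> \<le> L" by (simp add: L_def)
    finally show ?thesis .
  qed
  have "L < \<infinity>" using fin levy by (simp add: L_def less_top)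
  then have "levy_bound (\<mu>n n) (enn2real L)" for n
    using levy(2)[of n] L[of n] by unfold_locales (auto simp: I_def[symmetric] ennreal_enn2real_if)
  then show ?thesis by blast
qed

section \<open>Entropy solutions and the maximum principle\<close>

text \<open>If \<open>f\<close> is not integrable its integral is 0 by convention, and the bound is
  trivial. This settles the terms containing \<open>levy_operator\<close> without discussing their
  measurability.\<close>

lemma abs_integral_le:
  fixes f :: "'m \<Rightarrow> real"
  assumes "AE x in M. \<bar>f x\<bar> \<le> g x" "integrable M g"
  shows "\<bar>LINT x|M. f x\<bar> \<le> (LINT x|M. g x)"
proof (cases "integrable M f")
  case True
  have "\<bar>LINT x|M. f x\<bar> \<le> (LINT x|M. \<bar>f x\<bar>)" by (rule integral_abs_bound)
  also have "\<dots> \<le> (LINT x|M. g x)" using True assms by (intro integral_mono_AE) auto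
  finally show ?thesis .
next
  case False
  have "0 \<le> (LINT x|M. g x)"
    by (rule integral_nonneg_AE) (use assms(1) in \<open>auto elim: eventually_mono\<close>)
  then show ?thesis using False by (simp add: not_integrable_integral_eq)
qed

lemma space_lateral_measure: "space (lateral_measure T \<Omega>) = {0<..<T} \<times> frontier \<Omega>"
  by (simp add: lateral_measure_def surface_measure_def hausdorff_measure_def space_pair_measure space_restrict_space)

locale entropy_sol = levy_bound \<nu> \<Lambda>
  for \<nu> :: "'a::euclidean_space measure" and \<Lambda> +
  fixes T :: real and \<Omega> :: "'a set" and f :: "real \<Rightarrow> 'a" and b :: "real \<Rightarrow> real"
    and uc uc_ext :: "real \<times> 'a \<Rightarrow> real" and u0 :: "'a \<Rightarrow> real" and u :: "real \<times> 'a \<Rightarrow> real" and K :: real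
  assumes T_pos: "0 < T" and open_\<Omega>: "open \<Omega>"
    and b_cont: "continuous_on UNIV b" and b_mono: "mono b"
    and sol: "entropy_solution T \<Omega> f b \<nu> uc uc_ext u0 u"
    and u_bound: "AE p in lborel. fst p \<in> {0<..<T} \<longrightarrow> \<bar>u p\<bar> \<le> K" and K_nonneg: "0 \<le> K"
begin

text \<open>The everywhere bounded Borel representative of \<open>u\<close>.\<close>

definition v :: "real \<times> 'a \<Rightarrow> real" where
  "v p = (if fst p \<in> {0<..<T} then max (- K) (min K (u p)) else 0)"

definition W :: "real \<times> 'a \<Rightarrow> real" where
  "W p = b (v p)"

text \<open>The large-jump operator in the form found in \<open>levy_operator_large\<close>, acting
  in x at fixed time.\<close>

definition jump :: "real \<Rightarrow> (real \<times> 'a \<Rightarrow> real) \<Rightarrow> real \<times> 'a \<Rightarrow> real" where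
  "jump r g p = (LINT z|tail r. g (p + (0, z)) - g p)"

abbreviation Q :: "(real \<times> 'a) set" where
  "Q \<equiv> {0<..<T} \<times> \<Omega>"

lemma b_measurable [measurable]: "b \<in> borel_measurable borel"
  using b_cont by (rule borel_measurable_continuous_onI)

lemma Q_measurable [measurable]: "Q \<in> sets borel"
  using open_\<Omega> by (intro borel_open open_Times) auto

text \<open>Agrees with \<open>u\<close> at every point of the strip, whereas \<open>v\<close>
  agrees only almost everywhere. The spatial sections in the entropy inequality are first rewritten
  with this Borel function; the passage to \<open>v\<close> happens under the integral.\<close>

definition u' :: "real \<times> 'a \<Rightarrow> real" where
  "u' p = (if fst p \<in> {0<..<T} then u p else 0)"

lemma u'_measurable [measurable]: "u' \<in> borel_measurable borel"
proof -
  have o: "open ({0<..<T} \<times> (UNIV :: 'a set))" by (intro open_Times) auto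
  have "u \<in> borel_measurable (restrict_space lborel ({0<..<T} \<times> UNIV))"
    using sol by (simp add: entropy_solution_def Linf_def)
  then have "(\<lambda>p. indicator ({0<..<T} \<times> UNIV) p *\<^sub>R u p) \<in> borel_measurable lborel"
    using o by (subst (asm) borel_measurable_restrict_space_iff) auto
  moreover have "(\<lambda>p. indicator ({0<..<T} \<times> UNIV) p *\<^sub>R u p) = u'"
    by (auto simp: u'_def fun_eq_iff indicator_def)
  ultimately show ?thesis by simp
qed

lemma v_altdef: "v p = max (- K) (min K (u' p))"
  using K_nonneg by (simp add: v_def u'_def)

lemma v_measurable [measurable]: "v \<in> borel_measurable borel"
  unfolding v_altdef[abs_def] by measurable

lemma W_measurable [measurable]: "W \<in> borel_measurable borel"
  unfolding W_def by measurable

lemma v_bound: "\<bar>v p\<bar> \<le> K"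
  using K_nonneg by (auto simp: v_def)

lemma v_eq_u': "AE p in lborel. u' p = v p"
  using u_bound by eventually_elim (auto simp: u'_def v_def)

lemma v_eq_u: "AE p in lborel. fst p \<in> {0<..<T} \<longrightarrow> u p = v p"
  using u_bound by eventually_elim (auto simp: v_def)

definition bmax :: real where "bmax = max \<bar>b K\<bar> \<bar>b (- K)\<bar>"

lemma b_bound: "\<bar>y\<bar> \<le> K \<Longrightarrow> \<bar>b y\<bar> \<le> bmax"
  using monoD[OF b_mono, of "- K" y] monoD[OF b_mono, of y K] unfolding bmax_def by linarith

lemma W_bound: "\<bar>W p\<bar> \<le> bmax"
  unfolding W_def by (rule b_bound[OF v_bound])

lemma jump_measurable:
  assumes "r > 0" and [measurable]: "g \<in> borel_measurable borel"
  shows "jump r g \<in> borel_measurable borel"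
proof -
  interpret finite_measure "tail r" by (rule finite_measure_tail) fact
  have "(\<lambda>(p, z). g (p + (0, z)) - g p) \<in> borel_measurable (borel \<Otimes>\<^sub>M tail r)"
    by measurable
  from borel_measurable_lebesgue_integral[OF this] show ?thesis
    by (simp add: jump_def[abs_def])
qed

lemma integrable_jump_integrand:
  fixes g :: "real \<times> 'a \<Rightarrow> real"
  assumes "r > 0" and [measurable]: "g \<in> borel_measurable borel" and g: "\<And>p. \<bar>g p\<bar> \<le> B"
  shows "integrable (tail r) (\<lambda>z. g (p + (0, z)) - g p)"
proof -
  interpret finite_measure "tail r" by (rule finite_measure_tail) fact
  have "\<bar>g (p + (0, z)) - g p\<bar> \<le> 2 * B" for z
    using g[of p] g[of "p + (0, z)"] by linarith
  then show ?thesis by (intro integrable_const_bound[of _ "2 * B"]) auto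
qed

lemma jump_bound:
  fixes g :: "real \<times> 'a \<Rightarrow> real"
  assumes r: "r > 0" and [measurable]: "g \<in> borel_measurable borel" and g: "\<And>p. \<bar>g p\<bar> \<le> B"
  shows "\<bar>jump r g p\<bar> \<le> 2 * B * ((1 / min (r\<^sup>2) 1) * \<Lambda>)"
proof -
  interpret finite_measure "tail r" by (rule finite_measure_tail) fact
  have le: "\<bar>g (p + (0, z)) - g p\<bar> \<le> 2 * B" for z
    using g[of p] g[of "p + (0, z)"] by linarith
  have "0 \<le> B" using g[of p] by linarith
  have "\<bar>jump r g p\<bar> \<le> (LINT z|tail r. 2 * B)"
    unfolding jump_def by (rule abs_integral_le) (use le in auto)
  also have "\<dots> = 2 * B * measure (tail r) UNIV" by simp
  also have "\<dots> \<le> 2 * B * ((1 / min (r\<^sup>2) 1) * \<Lambda>)"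
    using measure_tail[OF r] \<open>0 \<le> B\<close> by (intro mult_left_mono) auto
  finally show ?thesis .
qed

text \<open>The operator reads values at all translates of p, so the exceptional set has to be moved
  along: for each z its translate is null, and Fubini's theorem exchanges "for all z, almost every
  p" with "for almost every p, almost every z".\<close>

lemma jump_AE_eq:
  assumes r: "r > 0"
  shows "AE p in lborel. jump r (\<lambda>p. b (u' p)) p = jump r W p"
proof -
  interpret F: finite_measure "tail r" by (rule finite_measure_tail[OF r])
  interpret P: pair_sigma_finite "tail r" "lborel :: (real \<times> 'a) measure" ..
  have "AE z in tail r. AE p in lborel. u' (p + (0, z)) = v (p + (0, z))"
    by (rule AE_I2, rule AE_lborel_shift[OF v_eq_u'])
  moreover have m: "{x \<in> space (tail r \<Otimes>\<^sub>M lborel). u' (snd x + (0, fst x)) = v (snd x + (0, fst x))}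
      \<in> sets (tail r \<Otimes>\<^sub>M lborel)"
    by measurable
  ultimately have "AE p in lborel. AE z in tail r. u' (p + (0, z)) = v (p + (0, z))"
    by (subst P.AE_commute[OF m, symmetric])
  then show ?thesis
    using v_eq_u'
  proof eventually_elim
    case (elim p)
    show ?case
      unfolding jump_def W_def
      by (rule integral_cong_AE) (use elim in \<open>auto elim: eventually_mono\<close>)
  qed
qed

text \<open>Both later uses, comparison with constants and interior estimates, choose tests for
  which the initial and lateral terms vanish. The large-jump term is rewritten with \<open>W\<close>
  and \<open>v\<close>; the other two are left for the caller, who knows the test.\<close>

lemma entropy_inequality:
  assumes s: "s \<in> {1, - 1}" and r: "0 < r"
    and test: "test_function_on ({0..<T} \<times> UNIV) \<phi>" "\<And>p. 0 \<le> \<phi> p"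
    and [measurable]: "\<phi> \<in> borel_measurable borel"
    and ext: "\<And>p. p \<in> {0<..<T} \<times> (- \<Omega>) \<Longrightarrow> signed_part s (b (uc p) - b k) * \<phi> p = 0"
    and init: "AE x in lborel. x \<in> \<Omega> \<longrightarrow> signed_part s (u0 x - k) * \<phi> (0, x) = 0"
    and lateral: "\<And>p. p \<in> {0<..<T} \<times> frontier \<Omega> \<Longrightarrow> signed_part s (uc_ext p - k) * \<phi> p = 0"
  shows "- (LINT p|lborel. indicator Q p * (jump r W p * signed_sgn s (v p - k) * \<phi> p))
    \<le> (LINT (t, x):Q|lborel.
              signed_part s (u (t, x) - k) * deriv (\<lambda>\<tau>. \<phi> (\<tau>, x)) t +
              entropy_flux s f (u (t, x)) k \<bullet> gradient (\<lambda>y. \<phi> (t, y)) x)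
     + (LINT (t, x):{0<..<T} \<times> UNIV|lborel.
              signed_part s (b (u (t, x)) - b k) *
              levy_operator \<nu> {z. norm z < r} (\<lambda>y. \<phi> (t, y)) x)"
proof -
  have Z1: "(LINT x:\<Omega>|lborel. signed_part s (u0 x - k) * \<phi> (0, x)) = 0"
    unfolding set_lebesgue_integral_def
    by (rule integral_eq_zero_AE) (use init in \<open>auto elim!: eventually_mono simp: indicator_def\<close>)
  have Z2: "(LINT p|lateral_measure T \<Omega>. signed_part s (uc_ext p - k) * \<phi> p) = 0"
    by (rule integral_eq_zero_AE, rule AE_I2) (use lateral in \<open>auto simp: space_lateral_measure\<close>)
  have J: "levy_operator \<nu> {z. r \<le> norm z} (\<lambda>y. b (u (t, y))) x = jump r (\<lambda>p. b (u' p)) (t, x)"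
    if "t \<in> {0<..<T}" for t x
  proof -
    have "(\<lambda>y. b (u (t, y))) = (\<lambda>y. b (u' (t, y)))" using that by (auto simp: u'_def)
    moreover have "(\<lambda>y. b (u' (t, y))) \<in> borel_measurable borel" by measurable
    ultimately show ?thesis
      using levy_operator_large[OF r, of "\<lambda>y. b (u' (t, y))" x] by (simp add: jump_def)
  qed
  have sgn_m [measurable]: "(\<lambda>p. signed_sgn s (g p - k)) \<in> borel_measurable borel"
    if [measurable]: "g \<in> borel_measurable borel" for g :: "real \<times> 'a \<Rightarrow> real"
    unfolding signed_sgn_def by measurable
  note [measurable] = jump_measurable[OF r]
  have "(LINT (t, x):Q|lborel. levy_operator \<nu> {z. r \<le> norm z} (\<lambda>y. b (u (t, y))) x *
              signed_sgn s (u (t, x) - k) * \<phi> (t, x)) =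
     (LINT p|lborel. indicator Q p * (jump r (\<lambda>p. b (u' p)) p * signed_sgn s (u' p - k) * \<phi> p))"
    unfolding set_lebesgue_integral_def
    by (rule Bochner_Integration.integral_cong) (auto simp: indicator_def J u'_def)
  also have "\<dots> = (LINT p|lborel. indicator Q p * (jump r W p * signed_sgn s (v p - k) * \<phi> p))"
  proof (rule integral_cong_AE)
    show "AE p in lborel. indicator Q p * (jump r (\<lambda>p. b (u' p)) p * signed_sgn s (u' p - k) * \<phi> p) =
        indicator Q p * (jump r W p * signed_sgn s (v p - k) * \<phi> p)"
      using jump_AE_eq[OF r] v_eq_u' by eventually_elim simp
  qed measurable
  finally have I2: "(LINT (t, x):Q|lborel. levy_operator \<nu> {z. r \<le> norm z} (\<lambda>y. b (u (t, y))) x *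
              signed_sgn s (u (t, x) - k) * \<phi> (t, x)) =
     (LINT p|lborel. indicator Q p * (jump r W p * signed_sgn s (v p - k) * \<phi> p))" .
  have "\<forall>p \<in> {0<..<T} \<times> (- \<Omega>). signed_part s (b (uc p) - b k) * \<phi> p = 0" using ext by blast
  with sol s r test have "- (LINT (t, x):{0<..<T} \<times> \<Omega>|lborel.
              signed_part s (u (t, x) - k) * deriv (\<lambda>\<tau>. \<phi> (\<tau>, x)) t +
              entropy_flux s f (u (t, x)) k \<bullet> gradient (\<lambda>y. \<phi> (t, y)) x)
        - (LINT (t, x):{0<..<T} \<times> \<Omega>|lborel.
              levy_operator \<nu> {z. r \<le> norm z} (\<lambda>y. b (u (t, y))) x *
              signed_sgn s (u (t, x) - k) * \<phi> (t, x))
        - (LINT (t, x):{0<..<T} \<times> UNIV|lborel.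
              signed_part s (b (u (t, x)) - b k) *
              levy_operator \<nu> {z. norm z < r} (\<lambda>y. \<phi> (t, y)) x)
        \<le> (LINT x:\<Omega>|lborel. signed_part s (u0 x - k) * \<phi> (0, x))
          + flux_constant T \<Omega> f uc u0 u k *
            (LINT p|lateral_measure T \<Omega>. signed_part s (uc_ext p - k) * \<phi> p)"
    unfolding entropy_solution_def by blast
  then show ?thesis unfolding Z1 Z2 I2 by simp
qed

end

section \<open>Cut-offs and comparison with constants\<close>

lemma integrable_bounded_support:
  fixes g :: "'b::euclidean_space \<Rightarrow> real"
  assumes "g \<in> borel_measurable borel" "\<And>x. \<bar>g x\<bar> \<le> B" "bounded S" "\<And>x. x \<notin> S \<Longrightarrow> g x = 0"
  shows "integrable lborel g"
proof -
  obtain a c where S: "S \<subseteq> cbox a c" using bounded_subset_cbox_symmetric[OF assms(3)] by blast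
  show ?thesis
  proof (rule Bochner_Integration.integrable_bound)
    show "integrable lborel (\<lambda>x. B * indicator (cbox a c) x)"
      by (intro integrable_mult_right integrable_real_indicator) (auto simp: emeasure_lborel_cbox_eq)
    have "\<bar>g x\<bar> \<le> \<bar>B * indicator (cbox a c) x\<bar>" for x
      using assms(2)[of x] assms(4)[of x] S by (cases "x \<in> S") (auto simp: indicator_def)
    then show "AE x in lborel. norm (g x) \<le> norm (B * indicator (cbox a c) x)" by simp
  qed (use assms in simp)
qed

text \<open>The usual smooth transition from 0 for y \<le> 0 to 1 for y \<ge> 1; the denominator
  never vanishes since y and 1 - y are not both nonpositive.\<close>

definition step :: "real \<Rightarrow> real" where
  "step y = flat 0 y * inverse (flat 0 y + flat 0 (1 - y))"

lemma step_denominator: "flat 0 y + flat 0 (1 - y) > 0"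
proof (cases "y > 0")
  case True
  then show ?thesis by (intro add_pos_nonneg) (simp_all add: flat_pos_iff flat_nonneg)
next
  case False
  then show ?thesis by (intro add_nonneg_pos) (simp_all add: flat_pos_iff flat_nonneg)
qed

lemma smooth_fun_step: "smooth_fun (\<lambda>x. step (a \<bullet> x + c))"
proof -
  have eq: "1 - (a \<bullet> x + c) = (- a) \<bullet> x + (1 - c)" for x by (simp add: inner_minus_left)
  have 1: "smooth_fun (\<lambda>x. flat 0 (1 - (a \<bullet> x + c)))"
    using smooth_fun.flat[of 0 "- a" "1 - c"] by (simp only: eq)
  show ?thesis
    unfolding step_def
    by (intro smooth_fun.mult smooth_fun.inverse smooth_fun.add smooth_fun.flat 1)
      (metis step_denominator less_irrefl)
qed

lemma step_nonneg: "0 \<le> step y"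
  unfolding step_def using flat_nonneg step_denominator[of y] by (simp add: less_imp_le)

lemma step_eq_0: "y \<le> 0 \<Longrightarrow> step y = 0"
  by (simp add: step_def flat_zero_iff)

lemma step_eq_1:
  assumes "1 \<le> y" shows "step y = 1"
proof -
  have "flat 0 (1 - y) = 0" "flat 0 y \<noteq> 0" using assms by (auto simp: flat_zero_iff)
  then show ?thesis by (simp add: step_def)
qed

lemma signed_part_nonneg: "0 \<le> signed_part s a"
  by (simp add: signed_part_def)

lemma signed_part_measurable [measurable]: "signed_part s \<in> borel_measurable borel"
  unfolding signed_part_def[abs_def] by measurable

lemma signed_sgn_measurable [measurable]: "signed_sgn s \<in> borel_measurable borel"
  unfolding signed_sgn_def[abs_def] by measurable

context entropy_sol
begin

lemma fst_borel_measurable [measurable]: "fst \<in> borel_measurable (borel :: (real \<times> 'a) measure)"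
  by (intro borel_measurable_continuous_onI continuous_intros)

text \<open>For each z translation invariance cancels the two terms; finiteness of
  \<open>tail r\<close> justifies the exchange of integrals.\<close>

lemma integral_jump_zero:
  assumes r: "r > 0" and H: "integrable lborel H"
  shows "integrable lborel (jump r H)" and "(LINT p|lborel. jump r H p) = 0"
proof -
  interpret F: finite_measure "tail r" by (rule finite_measure_tail[OF r])
  interpret P: pair_sigma_finite "tail r" "lborel :: (real \<times> 'a) measure" ..
  have [measurable]: "H \<in> borel_measurable borel" using H by auto
  have "integrable (tail r \<Otimes>\<^sub>M lborel) (\<lambda>(z, p). H (p + (0, z)))"
  proof (rule P.Fubini_integrable)
    have "(LINT p|lborel. norm (H (p + (0, z)))) = (LINT p|lborel. norm (H p))" for z :: 'a
      by (rule integral_lborel_shift) simp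
    then show "integrable (tail r) (\<lambda>z. LINT p|lborel. norm (case (z, p) of (z, p) \<Rightarrow> H (p + (0, z))))" by simp
    show "AE z in tail r. integrable lborel (\<lambda>p. case (z, p) of (z, p) \<Rightarrow> H (p + (0, z)))"
      using H by (simp add: integrable_lborel_shift_iff)
  qed measurable
  moreover have "integrable (tail r \<Otimes>\<^sub>M lborel) (\<lambda>(z, p). H p)"
    by (rule P.Fubini_integrable) (use H in auto)
  ultimately have i: "integrable (tail r \<Otimes>\<^sub>M lborel) (\<lambda>(z, p). H (p + (0, z)) - H p)"
    using Bochner_Integration.integrable_diff by (fastforce simp: split_beta')
  show "integrable lborel (jump r H)"
    using P.integrable_snd[OF i] by (simp add: jump_def[abs_def])
  have "(LINT p|lborel. jump r H p) = (LINT z|tail r. LINT p|lborel. H (p + (0, z)) - H p)"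
    unfolding jump_def by (rule P.Fubini_integral[OF i])
  also have "\<dots> = (LINT z|tail r. 0)"
  proof (rule Bochner_Integration.integral_cong)
    fix z
    have "integrable lborel (\<lambda>p. H (p + (0, z)))" using H by (simp add: integrable_lborel_shift_iff)
    then show "(LINT p|lborel. H (p + (0, z)) - H p) = 0"
      using H integral_lborel_shift[of H "(0, z)"] by simp
  qed simp
  finally show "(LINT p|lborel. jump r H p) = 0" by simp
qed

text \<open>With r = 1 and a test that is constant in x around \<Omega>, only the time derivative
  survives on the right, where it appears with negative sign. The jump term is controlled by a Kato
  inequality, \<open>J p \<le> jump 1 H p\<close>, and \<open>jump 1 H\<close> has integral 0. So
  the nonnegative \<open>h\<close> has integral 0.\<close>

lemma max_principle_aux:
  assumes bd: "bounded \<Omega>" and s: "s \<in> {1, - 1}"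
    and ext: "\<And>p. fst p \<in> {0<..<T} \<Longrightarrow> s * (uc_ext p - k) \<le> 0"
    and ext_eq: "\<And>p. p \<in> {0<..<T} \<times> (- \<Omega>) \<Longrightarrow> uc_ext p = uc p"
    and init: "AE x in lborel. x \<in> \<Omega> \<longrightarrow> s * (u0 x - k) \<le> 0"
    and T': "0 < T'" "T' < T"
  shows "AE p in lborel. p \<in> Q \<and> fst p < T' \<longrightarrow> s * (v p - k) \<le> 0"
proof -
  obtain R where R: "\<And>x. x \<in> \<Omega> \<Longrightarrow> norm x < R"
    using bounded_pos_less[of \<Omega>] bd by auto
  \<comment> \<open>Equal to 1 on the ball of radius R + 1, so that jumps shorter than 1 starting in
    \<Omega> do not notice the cut-off.\<close>
  define \<eta> where "\<eta> x = (\<Prod>i\<in>Basis. step (i \<bullet> x + (R + 2)) * step ((- i) \<bullet> x + (R + 2)))" for x :: 'a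
  have \<eta>s: "smooth_fun \<eta>"
    unfolding \<eta>_def by (intro smooth_fun_prod smooth_fun.mult smooth_fun_step)
  have \<eta>0: "0 \<le> \<eta> x" for x unfolding \<eta>_def by (intro prod_nonneg ballI mult_nonneg_nonneg step_nonneg)
  have \<eta>1: "\<eta> x = 1" if "norm x < R + 1" for x
  proof -
    have "\<bar>i \<bullet> x\<bar> \<le> R + 1" if "i \<in> Basis" for i
      using Basis_le_norm[OF that, of x] \<open>norm x < R + 1\<close> by (simp add: inner_commute)
    then have "step (i \<bullet> x + (R + 2)) * step ((- i) \<bullet> x + (R + 2)) = 1" if "i \<in> Basis" for i
      using that by (subst (1 2) step_eq_1) (force simp: inner_minus_left abs_le_iff)+
    then show ?thesis by (simp add: \<eta>_def)
  qed
  have \<eta>out: "\<eta> x = 0" if x: "x \<notin> cbox (- (R + 2) *\<^sub>R One) ((R + 2) *\<^sub>R One)" for x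
  proof -
    obtain i where i: "i \<in> Basis" "x \<bullet> i < - (R + 2) \<or> R + 2 < x \<bullet> i"
      using x by (auto simp: mem_box not_le)
    then have "step (i \<bullet> x + (R + 2)) * step ((- i) \<bullet> x + (R + 2)) = 0"
      by (auto simp: inner_commute intro: step_eq_0)
    then show ?thesis unfolding \<eta>_def using i(1) by (meson finite_Basis prod_zero_iff)
  qed
  define g where "g p = flat 0 (T' - fst p) * \<eta> (snd p)" for p :: "real \<times> 'a"
  have gs: "smooth_fun g"
  proof -
    have "smooth_fun (\<lambda>t::real. flat 0 ((- 1) \<bullet> t + T'))" by (rule smooth_fun.flat)
    then have "smooth_fun (\<lambda>p::real \<times> 'a. flat 0 ((- 1) \<bullet> fst p + T'))" by (rule smooth_fun_fst)
    then show ?thesis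
      unfolding g_def using smooth_fun.mult smooth_fun_snd[OF \<eta>s] by fastforce
  qed
  \<comment> \<open>Set to 0 for negative times to have compact support in
    \<open>{0..<T} \<times> UNIV\<close>; on that set it coincides with the smooth \<open>g\<close>.
    It does not vanish at t = 0, where the comparison of the initial datum takes over.\<close>
  define \<phi> where "\<phi> p = (if fst p < 0 then 0 else g p)" for p
  have gm [measurable]: "g \<in> borel_measurable borel"
    using smooth_fun_continuous[OF gs] by (rule borel_measurable_continuous_onI)
  have "{p :: real \<times> 'a. fst p < 0} \<in> sets borel"
    by (intro borel_open open_Collect_less continuous_intros)
  then have [measurable]: "\<phi> \<in> borel_measurable borel"
    unfolding \<phi>_def by (intro measurable_If gm) auto
  have g0: "0 \<le> g p" for p unfolding g_def by (intro mult_nonneg_nonneg flat_nonneg \<eta>0)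
  have test: "test_function_on ({0..<T} \<times> UNIV) \<phi>"
    unfolding test_function_on_def
  proof (intro conjI allI)
    show "Ck_on k ({0..<T} \<times> UNIV) \<phi>" for k
      by (rule Ck_on_cong[OF smooth_fun_Ck[OF gs]]) (auto simp: \<phi>_def)
    show "\<exists>K. compact K \<and> K \<subseteq> {0..<T} \<times> UNIV \<and> (\<forall>x. x \<notin> K \<longrightarrow> \<phi> x = 0)"
    proof (intro exI conjI allI impI)
      show "compact ({0..T'} \<times> cbox (- (R + 2) *\<^sub>R One) ((R + 2) *\<^sub>R One :: 'a))"
        by (intro compact_Times compact_Icc compact_cbox)
      fix p assume "p \<notin> {0..T'} \<times> cbox (- (R + 2) *\<^sub>R One) ((R + 2) *\<^sub>R One :: 'a)"
      then show "\<phi> p = 0" using \<eta>out by (cases p) (auto simp: \<phi>_def g_def flat_zero_iff not_le)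
    qed (use T' in auto)
  qed
  have sp0: "signed_part s a = 0" if "s * a \<le> 0" for a using that by (simp add: signed_part_def)
  have bsgn: "s * (b x - b k) \<le> 0" if "s * (x - k) \<le> 0" for x
    using that s monoD[OF b_mono, of x k] monoD[OF b_mono, of k x] by auto
  have bsgn': "0 \<le> s * (b x - b k)" if "0 \<le> s * (x - k)" for x
    using that s monoD[OF b_mono, of x k] monoD[OF b_mono, of k x] by auto
  have ucs: "s * (uc p - k) \<le> 0" if "p \<in> {0<..<T} \<times> (- \<Omega>)" for p
    using ext[of p] ext_eq[OF that] that by auto
  have outside: "AE p in lborel. p \<in> {0<..<T} \<times> (- \<Omega>) \<longrightarrow> s * (u p - k) \<le> 0"
  proof -
    have "AE p in lborel. p \<in> {0<..<T} \<times> (- \<Omega>) \<longrightarrow> u p = uc p"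
      using sol by (simp add: entropy_solution_def)
    then show ?thesis by eventually_elim (use ucs in auto)
  qed
  have E: "- (LINT p|lborel. indicator Q p * (jump 1 W p * signed_sgn s (v p - k) * \<phi> p))
    \<le> (LINT (t, x):Q|lborel.
              signed_part s (u (t, x) - k) * deriv (\<lambda>\<tau>. \<phi> (\<tau>, x)) t +
              entropy_flux s f (u (t, x)) k \<bullet> gradient (\<lambda>y. \<phi> (t, y)) x)
     + (LINT (t, x):{0<..<T} \<times> UNIV|lborel.
              signed_part s (b (u (t, x)) - b k) *
              levy_operator \<nu> {z. norm z < 1} (\<lambda>y. \<phi> (t, y)) x)"
  proof (rule entropy_inequality[OF s _ test])
    show "0 \<le> \<phi> p" for p by (simp add: \<phi>_def g0)
    show "signed_part s (b (uc p) - b k) * \<phi> p = 0" if "p \<in> {0<..<T} \<times> (- \<Omega>)" for p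
      using sp0[OF bsgn[OF ucs[OF that]]] by simp
    show "AE x in lborel. x \<in> \<Omega> \<longrightarrow> signed_part s (u0 x - k) * \<phi> (0, x) = 0"
      using init by eventually_elim (auto simp: sp0)
    show "signed_part s (uc_ext p - k) * \<phi> p = 0" if "p \<in> {0<..<T} \<times> frontier \<Omega>" for p
      using sp0[OF ext[of p]] that by auto
  qed auto
  \<comment> \<open>Starting in \<Omega> short jumps do not change the test; at the other points of
    the strip the signed part of \<open>b(u) - b(k)\<close> is 0 by the exterior datum and
    monotonicity of \<open>b\<close>.\<close>
  have I3: "(LINT (t, x):{0<..<T} \<times> UNIV|lborel.
              signed_part s (b (u (t, x)) - b k) *
              levy_operator \<nu> {z. norm z < 1} (\<lambda>y. \<phi> (t, y)) x) = 0"
    unfolding set_lebesgue_integral_def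
  proof (rule integral_eq_zero_AE)
    have inside: "levy_operator \<nu> {z. norm z < 1} (\<lambda>y. \<phi> (t, y)) x = 0" if "x \<in> \<Omega>" for t x
    proof (rule levy_operator_zero)
      fix z :: 'a assume "z \<in> {z. norm z < 1}"
      then have "norm (x + z) < R + 1" "norm x < R + 1"
        using R[OF that] norm_triangle_ineq[of x z] norm_ge_zero[of z] by auto
      then show "\<phi> (t, x + z) = \<phi> (t, x)" by (simp add: \<phi>_def g_def \<eta>1)
    qed
    show "AE p in lborel. indicator ({0<..<T} \<times> UNIV) p *\<^sub>R (case p of (t, x) \<Rightarrow>
        signed_part s (b (u (t, x)) - b k) * levy_operator \<nu> {z. norm z < 1} (\<lambda>y. \<phi> (t, y)) x) = 0"
      using outside
    proof eventually_elim
      case (elim p)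
      then show ?case
        using inside[of "snd p" "fst p"] sp0[OF bsgn, of "u p"]
        by (cases p) (auto simp: indicator_def)
    qed
  qed
  \<comment> \<open>The factor \<open>flat 2 (T' - t)\<close> is minus the time derivative of the
    weight \<open>flat 0 (T' - t)\<close>, and it is positive exactly for t < T'.\<close>
  define h where "h p = indicator Q p * (signed_part s (v p - k) * flat 2 (T' - fst p))" for p
  have flat_m [measurable]: "flat m \<in> borel_measurable borel" for m
    unfolding flat_def by measurable
  have [measurable]: "h \<in> borel_measurable borel" unfolding h_def by measurable
  have h0: "0 \<le> h p" for p unfolding h_def by (intro mult_nonneg_nonneg signed_part_nonneg flat_nonneg) auto
  have bQ: "bounded Q" using bd by (intro bounded_Times) auto
  have flat_bd: "\<exists>B. \<forall>t\<in>{0..T}. flat m (T' - t) \<le> B" for m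
  proof -
    have "continuous_on {0..T} (\<lambda>t. flat m (T' - t))"
      using smooth_fun_continuous[OF smooth_fun.flat[of m "-1::real" T'], of "{0..T}"] by simp
    then have "compact ((\<lambda>t. flat m (T' - t)) ` {0..T})" by (intro compact_continuous_image) auto
    then obtain B where "\<forall>y\<in>(\<lambda>t. flat m (T' - t)) ` {0..T}. norm y \<le> B"
      using compact_imp_bounded bounded_iff by metis
    then show ?thesis by (auto simp: abs_le_iff)
  qed
  obtain B2 where B2: "\<And>t. t \<in> {0..T} \<Longrightarrow> flat 2 (T' - t) \<le> B2" using flat_bd by blast
  obtain B0 where B0: "\<And>t. t \<in> {0..T} \<Longrightarrow> flat 0 (T' - t) \<le> B0" using flat_bd by blast
  have spv: "signed_part s (v p - k) \<le> K + \<bar>k\<bar>" for p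
    using s v_bound[of p] by (auto simp: signed_part_def)
  have hi: "integrable lborel h"
  proof (rule integrable_bounded_support[OF _ _ bQ])
    show "\<bar>h p\<bar> \<le> (K + \<bar>k\<bar>) * \<bar>B2\<bar>" for p
    proof (cases "p \<in> Q")
      case True
      then have "h p \<le> (K + \<bar>k\<bar>) * \<bar>B2\<bar>"
        unfolding h_def using spv[of p] B2[of "fst p"] K_nonneg
        by (auto intro!: mult_mono simp: flat_nonneg)
      then show ?thesis using h0[of p] by simp
    qed (use K_nonneg in \<open>simp add: h_def\<close>)
  qed (auto simp: h_def)
  have I1: "(LINT (t, x):Q|lborel.
              signed_part s (u (t, x) - k) * deriv (\<lambda>\<tau>. \<phi> (\<tau>, x)) t +
              entropy_flux s f (u (t, x)) k \<bullet> gradient (\<lambda>y. \<phi> (t, y)) x) = - (LINT p|lborel. h p)"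
  proof -
    have d: "deriv (\<lambda>\<tau>. \<phi> (\<tau>, x)) t = - flat 2 (T' - t)" if "x \<in> \<Omega>" "t > 0" for x t
    proof (rule DERIV_imp_deriv)
      have "((\<lambda>\<tau>. flat 0 (T' - \<tau>)) has_field_derivative - flat 2 (T' - t)) (at t)"
      proof -
        have "((-) T' has_real_derivative - 1) (at t)" by (auto intro!: derivative_eq_intros)
        from DERIV_chain2[OF flat_has_derivative[of 0 "T' - t"] this] show ?thesis by (simp add: numeral_2_eq_2)
      qed
      then show "((\<lambda>\<tau>. \<phi> (\<tau>, x)) has_field_derivative - flat 2 (T' - t)) (at t)"
        by (rule has_field_derivative_transform_within_open[of _ _ _ "{0<..}"])
          (use that R[of x] \<eta>1[of x] in \<open>auto simp: \<phi>_def g_def\<close>)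
    qed
    have gr: "gradient (\<lambda>y. \<phi> (t, y)) x = 0" if "x \<in> \<Omega>" "t > 0" for x t
    proof -
      have "((\<lambda>y::'a. flat 0 (T' - t)) has_derivative (\<lambda>_. 0)) (at x)" by simp
      then have "((\<lambda>y. \<phi> (t, y)) has_derivative (\<lambda>_. 0)) (at x)"
        by (rule has_derivative_transform_within_open[of _ _ _ _ "ball 0 (R + 1)"])
          (use that R[of x] in \<open>auto simp: \<phi>_def g_def \<eta>1\<close>)
      then show ?thesis by (simp add: gradient_def frechet_derivative_at[symmetric])
    qed
    have "(LINT (t, x):Q|lborel.
              signed_part s (u (t, x) - k) * deriv (\<lambda>\<tau>. \<phi> (\<tau>, x)) t +
              entropy_flux s f (u (t, x)) k \<bullet> gradient (\<lambda>y. \<phi> (t, y)) x) =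
        (LINT p|lborel. - (indicator Q p * (signed_part s (u' p - k) * flat 2 (T' - fst p))))"
      unfolding set_lebesgue_integral_def
      by (rule Bochner_Integration.integral_cong) (auto simp: indicator_def d gr u'_def)
    also have "\<dots> = (LINT p|lborel. - h p)"
    proof (rule integral_cong_AE)
      show "AE p in lborel. - (indicator Q p * (signed_part s (u' p - k) * flat 2 (T' - fst p))) = - h p"
        using v_eq_u' by eventually_elim (simp add: h_def)
    qed measurable
    finally show ?thesis by simp
  qed
  \<comment> \<open>The weighted signed part of W - b k, whose jumps dominate \<open>J\<close>.
    Cutting it off to \<open>Q\<close> costs nothing, because outside \<Omega> the signed part
    vanishes almost everywhere in the strip.\<close>
  define H where "H p = indicator Q p * (flat 0 (T' - fst p) * signed_part s (W p - b k))" for p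
  have [measurable]: "H \<in> borel_measurable borel" unfolding H_def by measurable
  have H0: "0 \<le> H p" for p unfolding H_def by (intro mult_nonneg_nonneg signed_part_nonneg flat_nonneg) auto
  have spW: "signed_part s (W p - b k) \<le> bmax + \<bar>b k\<bar>" for p
    using s W_bound[of p] by (auto simp: signed_part_def)
  have bmax0: "0 \<le> bmax" by (simp add: bmax_def)
  have Hb: "\<bar>H p\<bar> \<le> \<bar>B0\<bar> * (bmax + \<bar>b k\<bar>)" for p
  proof (cases "p \<in> Q")
    case True
    then have "H p \<le> \<bar>B0\<bar> * (bmax + \<bar>b k\<bar>)"
      unfolding H_def using spW[of p] B0[of "fst p"] signed_part_nonneg[of s]
      by (auto intro!: mult_mono)
    then show ?thesis using H0[of p] by simp
  qed (use bmax0 in \<open>simp add: H_def\<close>)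
  have Hi: "integrable lborel H"
    by (rule integrable_bounded_support[OF _ Hb bQ]) (auto simp: H_def)
  define J where "J p = indicator Q p * (jump 1 W p * signed_sgn s (v p - k) * \<phi> p)" for p
  note [measurable] = jump_measurable[OF zero_less_one W_measurable]
  have [measurable]: "J \<in> borel_measurable borel" unfolding J_def by measurable
  have \<phi>Q: "\<phi> p = flat 0 (T' - fst p)" if "p \<in> Q" for p
    using that \<eta>1[of "snd p"] R[of "snd p"] by (auto simp: \<phi>_def g_def)
  have jb: "\<bar>jump 1 W p\<bar> \<le> 2 * bmax * \<Lambda>" for p
    using jump_bound[OF zero_less_one W_measurable W_bound, of p] by simp
  have Ji: "integrable lborel J"
  proof (rule integrable_bounded_support[OF _ _ bQ])
    show "\<bar>J p\<bar> \<le> (2 * bmax * \<Lambda> * 1) * \<bar>B0\<bar>" for p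
    proof (cases "p \<in> Q")
      case True
      have "\<bar>signed_sgn s (v p - k)\<bar> \<le> 1" using s by (auto simp: signed_sgn_def)
      moreover have "\<bar>\<phi> p\<bar> \<le> \<bar>B0\<bar>" using True B0[of "fst p"] flat_nonneg[of 0 "T' - fst p"] by (auto simp: \<phi>Q)
      ultimately have "\<bar>jump 1 W p\<bar> * \<bar>signed_sgn s (v p - k)\<bar> * \<bar>\<phi> p\<bar> \<le> (2 * bmax * \<Lambda> * 1) * \<bar>B0\<bar>"
        using bmax0 \<Lambda>_nonneg by (intro mult_mono jb) auto
      then show ?thesis using True by (simp add: J_def abs_mult)
    qed (use bmax0 \<Lambda>_nonneg in \<open>simp add: J_def\<close>)
  qed (auto simp: J_def)
  have "AE p in lborel. J p \<le> jump 1 H p"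
  proof -
    interpret F: finite_measure "tail 1" by (rule finite_measure_tail) simp
    interpret P: pair_sigma_finite "tail 1" "lborel :: (real \<times> 'a) measure" ..
    \<comment> \<open>Times outside the interval are counted as good; they never occur when starting
      from \<open>Q\<close>, since jumps preserve time.\<close>
    define good where "good q \<longleftrightarrow> q \<in> Q \<or> fst q \<notin> {0<..<T} \<or> s * (W q - b k) \<le> 0" for q
    have AEgood: "AE q in lborel. good q"
      using outside v_eq_u
    proof eventually_elim
      case (elim q)
      then show ?case by (cases q) (auto simp: good_def W_def intro: bsgn)
    qed
    have "AE z in tail 1. AE p in lborel. good (p + (0, z))"
      by (rule AE_I2, rule AE_lborel_shift[OF AEgood])
    moreover have m: "{x \<in> space (tail 1 \<Otimes>\<^sub>M lborel). good (snd x + (0, fst x))} \<in> sets (tail 1 \<Otimes>\<^sub>M lborel)"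
      unfolding good_def by measurable
    ultimately have "AE p in lborel. AE z in tail 1. good (p + (0, z))"
      by (subst P.AE_commute[OF m, symmetric])
    then show ?thesis
    proof eventually_elim
      case (elim p)
      show ?case
      proof (cases "p \<in> Q")
        case False
        then have "H p = 0" "J p = 0" by (simp_all add: H_def J_def)
        moreover have "0 \<le> jump 1 H p"
          unfolding jump_def using H0 \<open>H p = 0\<close> by (intro Bochner_Integration.integral_nonneg) simp
        ultimately show ?thesis by simp
      next
        case True
        define c where "c = signed_sgn s (v p - k) * flat 0 (T' - fst p)"
        have "J p = (LINT z|tail 1. (W (p + (0, z)) - W p) * c)"
          using True by (simp add: J_def jump_def \<phi>Q c_def)
        also have "\<dots> \<le> (LINT z|tail 1. H (p + (0, z)) - H p)"
        proof (rule integral_mono_AE)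
          show "integrable (tail 1) (\<lambda>z. (W (p + (0, z)) - W p) * c)"
            using integrable_jump_integrand[OF zero_less_one W_measurable W_bound, of p] by simp
          show "integrable (tail 1) (\<lambda>z. H (p + (0, z)) - H p)"
            by (rule integrable_jump_integrand[OF zero_less_one _ Hb]) measurable
          show "AE z in tail 1. (W (p + (0, z)) - W p) * c \<le> H (p + (0, z)) - H p"
            using elim
          proof eventually_elim
            case (elim z)
            define a where "a = flat 0 (T' - fst p)"
            have a0: "0 \<le> a" by (simp add: a_def flat_nonneg)
            have fstQ: "fst p \<in> {0<..<T}" using True by auto
            have Hz: "H (p + (0, z)) = a * signed_part s (W (p + (0, z)) - b k)"
              using elim fstQ sp0 by (auto simp: H_def good_def a_def indicator_def)
            have Hp: "H p = a * signed_part s (W p - b k)" using True by (simp add: H_def a_def)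
            \<comment> \<open>Where v lies beyond k, the sign factor turns the increment of W into
              at most the increment of signed parts; elsewhere the left-hand side and
              \<open>H p\<close> are both 0.\<close>
            show ?case
            proof (cases "s * (v p - k) > 0")
              case pos: True
              have "signed_part s (W p - b k) = s * (W p - b k)"
                using bsgn'[of "v p"] pos by (simp add: signed_part_def W_def)
              moreover have "s * (W (p + (0, z)) - b k) \<le> signed_part s (W (p + (0, z)) - b k)"
                by (simp add: signed_part_def)
              ultimately have "s * (W (p + (0, z)) - W p) \<le> signed_part s (W (p + (0, z)) - b k) - signed_part s (W p - b k)"
                by (simp add: algebra_simps)
              from mult_left_mono[OF this a0] show ?thesis
                using pos by (simp add: Hz Hp c_def signed_sgn_def a_def algebra_simps)
            next
              case neg: False
              have "signed_part s (W p - b k) = 0"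
                using neg unfolding W_def by (intro sp0 bsgn) simp
              then show ?thesis using neg a0 signed_part_nonneg by (simp add: Hz Hp c_def signed_sgn_def)
            qed
          qed
        qed
        finally show ?thesis by (simp add: jump_def)
      qed
    qed
  qed
  then have "(LINT p|lborel. J p) \<le> (LINT p|lborel. jump 1 H p)"
    using Ji integral_jump_zero(1)[OF zero_less_one Hi] by (intro integral_mono_AE)
  then have "(LINT p|lborel. J p) \<le> 0" using integral_jump_zero(2)[OF zero_less_one Hi] by simp
  then have "(LINT p|lborel. h p) \<le> 0" using E unfolding I1 I3 J_def[symmetric] by simp
  then have "(LINT p|lborel. h p) = 0" using h0 by (intro antisym Bochner_Integration.integral_nonneg) auto
  then have "AE p in lborel. h p = 0" using hi h0 by (subst (asm) integral_nonneg_eq_0_iff_AE) auto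
  then show ?thesis
  proof eventually_elim
    case (elim p)
    show ?case
    proof
      assume p: "p \<in> Q \<and> fst p < T'"
      then have "flat 2 (T' - fst p) > 0" by (simp add: flat_pos_iff)
      then have "signed_part s (v p - k) = 0" using elim p by (simp add: h_def)
      then show "s * (v p - k) \<le> 0" by (simp add: signed_part_def max_def split: if_splits)
    qed
  qed
qed

text \<open>The cut-off times of \<open>max_principle_aux\<close> increase to T, which covers all of
  \<open>Q\<close>; outside \<Omega> the bound comes from the exterior datum.\<close>

lemma max_principle:
  assumes bd: "bounded \<Omega>" and s: "s \<in> {1, - 1}"
    and ext: "\<And>p. fst p \<in> {0<..<T} \<Longrightarrow> s * (uc_ext p - k) \<le> 0"
    and ext_eq: "\<And>p. p \<in> {0<..<T} \<times> (- \<Omega>) \<Longrightarrow> uc_ext p = uc p"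
    and init: "AE x in lborel. x \<in> \<Omega> \<longrightarrow> s * (u0 x - k) \<le> 0"
  shows "AE p in lborel. fst p \<in> {0<..<T} \<longrightarrow> s * (u p - k) \<le> 0"
proof -
  define T' where "T' j = T * (real j + 1) / (real j + 2)" for j
  have T': "0 < T' j" "T' j < T" for j
    unfolding T'_def using T_pos by (auto simp: field_simps intro!: divide_pos_pos mult_pos_pos add_pos_nonneg)
  have "AE p in lborel. \<forall>j. p \<in> Q \<and> fst p < T' j \<longrightarrow> s * (v p - k) \<le> 0"
    unfolding AE_all_countable using max_principle_aux[OF assms T'] by blast
  moreover have "AE p in lborel. p \<in> {0<..<T} \<times> (- \<Omega>) \<longrightarrow> u p = uc p"
    using sol by (simp add: entropy_solution_def)
  ultimately show ?thesis
    using v_eq_u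
  proof eventually_elim
    case (elim p)
    show ?case
    proof
      assume t: "fst p \<in> {0<..<T}"
      show "s * (u p - k) \<le> 0"
      proof (cases "snd p \<in> \<Omega>")
        case True
        have "(\<lambda>j. T * (real j + 1) / (real j + 2)) \<longlonglongrightarrow> T" by real_asymp
        then have "\<forall>\<^sub>F j in sequentially. fst p < T' j"
          using order_tendstoD(1)[of T' T sequentially "fst p"] t by (simp add: T'_def[abs_def])
        then obtain j where "fst p < T' j" by (auto simp: eventually_sequentially)
        then show ?thesis using elim t True by (metis mem_Times_iff)
      next
        case False
        then have "p \<in> {0<..<T} \<times> (- \<Omega>)" using t by (simp add: mem_Times_iff)
        then show ?thesis using elim ext[of p] ext_eq[of p] t by auto
      qed
    qed
  qed
qed

end

section \<open>Interior estimates\<close>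

text \<open>\<open>D\<close> is the full space-time gradient, but \<open>C\<close> bounds only
  spatial quantities. For the modulated tests below, the time component of \<open>D\<close> grows
  with the time frequency while \<open>C\<close> must not.\<close>

definition interior_test ::
    "real \<Rightarrow> 'a::euclidean_space set \<Rightarrow> (real \<times> 'a \<Rightarrow> real) \<Rightarrow> (real \<times> 'a \<Rightarrow> real \<times> 'a) \<Rightarrow> real \<Rightarrow> bool" where
  "interior_test T \<Omega> \<phi> D C \<longleftrightarrow> smooth_fun \<phi> \<and>
     (\<exists>S. compact S \<and> S \<subseteq> {0<..<T} \<times> \<Omega> \<and> (\<forall>p. p \<notin> S \<longrightarrow> \<phi> p = 0 \<and> D p = 0)) \<and>
     (\<forall>p. 0 \<le> \<phi> p \<and> \<phi> p \<le> C \<and> norm (snd (D p)) \<le> C) \<and>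
     (\<forall>p. (\<phi> has_derivative (\<lambda>h. D p \<bullet> h)) (at p)) \<and> (\<forall>i. smooth_fun (\<lambda>p. D p \<bullet> i)) \<and>
     (\<forall>t x y. norm (snd (D (t, x)) - snd (D (t, y))) \<le> C * norm (x - y))"

text \<open>The mean value theorem for g minus its linear part at x, on the ball of radius
  |z|.\<close>

lemma gradient_lipschitz_remainder:
  fixes g :: "'b::euclidean_space \<Rightarrow> real"
  assumes d: "\<And>x. (g has_derivative (\<lambda>h. E x \<bullet> h)) (at x)"
    and lip: "\<And>x y. norm (E x - E y) \<le> C * norm (x - y)" and C: "0 \<le> C"
  shows "\<bar>g (x + z) - g x - E x \<bullet> z\<bar> \<le> C * (norm z)\<^sup>2"
proof -
  have "norm ((\<lambda>y. g y - E x \<bullet> y) (x + z) - (\<lambda>y. g y - E x \<bullet> y) x) \<le> (C * norm z) * norm (x + z - x)"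
  proof (rule differentiable_bound[of "cball x (norm z)"])
    show "((\<lambda>y. g y - E x \<bullet> y) has_derivative (\<lambda>h. (E y - E x) \<bullet> h)) (at y within cball x (norm z))" for y
      by (rule has_derivative_at_withinI) (auto intro!: derivative_eq_intros d simp: inner_diff_left)
    show "onorm (\<lambda>h. (E y - E x) \<bullet> h) \<le> C * norm z" if "y \<in> cball x (norm z)" for y
    proof (rule onorm_le)
      fix h
      have "norm (E y - E x) \<le> C * norm (y - x)" by (rule lip)
      also have "\<dots> \<le> C * norm z" using that C by (intro mult_left_mono) (auto simp: dist_norm norm_minus_commute)
      finally show "norm ((E y - E x) \<bullet> h) \<le> C * norm z * norm h"
        using Cauchy_Schwarz_ineq2[of "E y - E x" h] by (metis mult_right_mono norm_ge_zero order_trans real_norm_def)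
    qed
  qed (auto simp: dist_norm)
  then show ?thesis by (simp add: algebra_simps inner_add_right power2_eq_square)
qed

text \<open>Levels up to K + 1 are needed, although |v| \<le> K: at k = K + 1 and k = - (K + 1) the
  sign of v - k is constant.\<close>

locale interior_est = entropy_sol +
  fixes \<rho> Mf :: real
  assumes f_cont: "continuous_on UNIV f" and f_bound: "\<And>y. \<bar>y\<bar> \<le> K + 1 \<Longrightarrow> norm (f y) \<le> Mf"
    and \<Omega>_ball: "\<Omega> \<subseteq> ball 0 \<rho>"
begin

text \<open>The ball is enlarged by 1 so that no jump shorter than 1 enters \<Omega> from outside
  it.\<close>

definition vol :: real where
  "vol = measure lborel ({0<..<T} \<times> ball (0::'a) (\<rho> + 1))"

definition bsup :: real where
  "bsup = max \<bar>b (K + 1)\<bar> \<bar>b (- (K + 1))\<bar>"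

lemma bsup: "\<bar>y\<bar> \<le> K + 1 \<Longrightarrow> \<bar>b y\<bar> \<le> bsup"
  using monoD[OF b_mono, of "- (K + 1)" y] monoD[OF b_mono, of y "K + 1"] unfolding bsup_def by linarith

lemma W_bsup: "\<bar>W p\<bar> \<le> bsup"
  unfolding W_def using v_bound[of p] by (intro bsup) simp

lemma bsup_nonneg: "0 \<le> bsup"
  by (simp add: bsup_def)

lemma Mf_nonneg: "0 \<le> Mf"
  using f_bound[of 0] K_nonneg norm_ge_zero[of "f 0"] by linarith

text \<open>The factor \<open>2 * Mf\<close> bounds the entropy flux, and the multiple of
  \<open>bsup * \<Lambda>\<close> leaves room for the small jumps.\<close>

definition G :: real where
  "G = (2 * Mf + 6 * bsup * \<Lambda>) * vol"

lemma vol_nonneg: "0 \<le> vol" by (simp add: vol_def)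

lemma G_nonneg: "0 \<le> G"
  unfolding G_def using Mf_nonneg bsup_nonneg \<Lambda>_nonneg vol_nonneg by simp

abbreviation big :: "(real \<times> 'a) set" where
  "big \<equiv> {0<..<T} \<times> ball (0::'a) (\<rho> + 1)"

lemma big_measurable: "big \<in> sets borel"
  by (intro borel_open open_Times) auto

lemma bounded_big: "bounded big"
  by (intro bounded_Times) auto

lemma integrable_big: "integrable lborel (indicator big :: _ \<Rightarrow> real)"
  by (rule integrable_bounded_support[OF _ _ bounded_big, of _ 1]) (use big_measurable in \<open>auto simp: indicator_def\<close>)

lemma integral_big: "(LINT p|lborel. c * indicator big p) = c * vol"
  using big_measurable by (simp add: vol_def)

lemma Q_big: "Q \<subseteq> big"
proof -
  have "norm x < \<rho> + 1" if "x \<in> \<Omega>" for x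
    using \<Omega>_ball that by fastforce
  then show ?thesis by auto
qed

lemma integral_Q_bound:
  fixes g :: "real \<times> 'a \<Rightarrow> real"
  assumes "\<And>p. p \<in> Q \<Longrightarrow> \<bar>g p\<bar> \<le> c" "\<And>p. p \<notin> Q \<Longrightarrow> g p = 0" "0 \<le> c"
  shows "\<bar>LINT p|lborel. g p\<bar> \<le> c * vol"
proof -
  have "\<bar>LINT p|lborel. g p\<bar> \<le> (LINT p|lborel. c * indicator big p)"
  proof (rule abs_integral_le)
    show "AE p in lborel. \<bar>g p\<bar> \<le> c * indicator big p"
    proof (rule AE_I2)
      fix p show "\<bar>g p\<bar> \<le> c * indicator big p"
      proof (cases "p \<in> Q")
        case True
        then have "p \<in> big" using Q_big by blast
        then show ?thesis using assms(1)[OF True] by simp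
      qed (use assms(2,3) in simp)
    qed
  qed (use integrable_big in simp)
  then show ?thesis by (simp only: integral_big)
qed

lemma integrable_Q:
  fixes g :: "real \<times> 'a \<Rightarrow> real"
  assumes "g \<in> borel_measurable borel" "\<And>p. p \<in> Q \<Longrightarrow> \<bar>g p\<bar> \<le> c" "\<And>p. p \<notin> Q \<Longrightarrow> g p = 0"
  shows "integrable lborel g"
proof (rule integrable_bounded_support[OF assms(1) _ bounded_big, of "\<bar>c\<bar>"])
  show "\<bar>g x\<bar> \<le> \<bar>c\<bar>" for x using assms(2)[of x] assms(3)[of x] by (cases "x \<in> Q") auto
  show "g x = 0" if "x \<notin> big" for x using assms(3)[of x] Q_big that by blast
qed

lemma f_measurable [measurable]: "f \<in> borel_measurable borel"
  using f_cont by (rule borel_measurable_continuous_onI)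

section \<open>The entropy inequality for interior tests\<close>

context
  fixes \<phi> D C
  assumes test: "interior_test T \<Omega> \<phi> D C"
begin

lemma test_props:
  shows test_smooth: "smooth_fun \<phi>" and test_nonneg: "0 \<le> \<phi> p" and test_le: "\<phi> p \<le> C"
    and test_snd_le: "norm (snd (D p)) \<le> C" and test_deriv: "(\<phi> has_derivative (\<lambda>h. D p \<bullet> h)) (at p)"
    and test_lip: "norm (snd (D (t, x)) - snd (D (t, y))) \<le> C * norm (x - y)"
    and test_D_smooth: "smooth_fun (\<lambda>p. D p \<bullet> i)"
  using test unfolding interior_test_def by blast+

lemma test_support: "\<exists>S. compact S \<and> S \<subseteq> Q \<and> (\<forall>p. p \<notin> S \<longrightarrow> \<phi> p = 0 \<and> D p = 0)"
  using test unfolding interior_test_def by blast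

lemma test_outside: "p \<notin> Q \<Longrightarrow> \<phi> p = 0" and test_D_outside: "p \<notin> Q \<Longrightarrow> D p = 0"
  using test_support by (metis subsetD)+

lemma C_nonneg: "0 \<le> C"
  using test_nonneg test_le order_trans by blast

lemma test_measurable [measurable]: "\<phi> \<in> borel_measurable borel"
  using smooth_fun_continuous[OF test_smooth] by (rule borel_measurable_continuous_onI)

lemma D_inner_measurable [measurable]: "(\<lambda>p. D p \<bullet> i) \<in> borel_measurable borel"
  using smooth_fun_continuous[OF test_D_smooth] by (rule borel_measurable_continuous_onI)

lemma fst_D: "fst (D p) = D p \<bullet> (1, 0)"
  by (simp add: inner_prod_def)

lemma fst_D_measurable [measurable]: "(\<lambda>p. fst (D p)) \<in> borel_measurable borel"
  unfolding fst_D by measurable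

lemma snd_D: "snd (D p) = (\<Sum>i\<in>Basis. (D p \<bullet> (0, i)) *\<^sub>R i)"
  by (simp add: inner_prod_def euclidean_representation)

lemma snd_D_measurable [measurable]: "(\<lambda>p. snd (D p)) \<in> borel_measurable borel"
  unfolding snd_D by measurable

lemma fst_D_bounded: "\<exists>B. \<forall>p. \<bar>fst (D p)\<bar> \<le> B"
proof -
  obtain S where S: "compact S" "\<And>p. p \<notin> S \<Longrightarrow> D p = 0" using test_support by blast
  have "compact ((\<lambda>p. fst (D p)) ` S)"
    unfolding fst_D using S(1) smooth_fun_continuous[OF test_D_smooth] by (intro compact_continuous_image)
  then obtain B where "\<forall>y\<in>(\<lambda>p. fst (D p)) ` S. norm y \<le> B" using compact_imp_bounded bounded_iff by metis
  then have "\<bar>fst (D p)\<bar> \<le> \<bar>B\<bar>" for p using S(2)[of p] by (cases "p \<in> S") force+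
  then show ?thesis by blast
qed

lemma space_derivative: "((\<lambda>y. \<phi> (t, y)) has_derivative (\<lambda>h. snd (D (t, x)) \<bullet> h)) (at x)"
proof -
  have "((\<lambda>y. (t, y)) has_derivative (\<lambda>h. (0, h))) (at x)" by (auto intro!: derivative_eq_intros)
  from has_derivative_compose[OF this test_deriv[of "(t, x)"]] show ?thesis
    by (simp add: inner_prod_def)
qed

lemma time_derivative: "((\<lambda>\<tau>. \<phi> (\<tau>, x)) has_field_derivative fst (D (t, x))) (at t)"
proof -
  have "((\<lambda>\<tau>. (\<tau>, x)) has_derivative (\<lambda>h. (h, 0))) (at t)" by (auto intro!: derivative_eq_intros)
  from has_derivative_compose[OF this test_deriv[of "(t, x)"]] show ?thesis
    by (simp add: inner_prod_def has_field_derivative_def mult_commute_abs)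
qed

lemma test_taylor: "\<bar>\<phi> (t, x + z) - \<phi> (t, x) - snd (D (t, x)) \<bullet> z\<bar> \<le> C * (norm z)\<^sup>2"
  by (rule gradient_lipschitz_remainder[where g = "\<lambda>y. \<phi> (t, y)" and E = "\<lambda>x. snd (D (t, x))"])
    (rule space_derivative test_lip C_nonneg)+

lemma test_on: "test_function_on ({0..<T} \<times> UNIV) \<phi>"
proof -
  obtain S where S: "compact S" "S \<subseteq> Q" "\<And>p. p \<notin> S \<Longrightarrow> \<phi> p = 0" using test_support by blast
  have "Q \<subseteq> {0..<T} \<times> UNIV" by auto
  with S show ?thesis
    unfolding test_function_on_def by (intro conjI allI smooth_fun_Ck[OF test_smooth] exI[of _ S]) auto
qed

text \<open>Flux and small jumps are absorbed into a right-hand side that is linear in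
  \<open>C\<close> and independent of r and k. The large jumps and the time derivative are kept: the
  former carry the energy estimate, the latter the time regularity.\<close>

lemma interior_inequality:
  assumes s: "s \<in> {1, - 1}" and r: "0 < r" "r \<le> 1" and k: "\<bar>k\<bar> \<le> K + 1"
  shows "- (LINT p|lborel. jump r W p * signed_sgn s (v p - k) * \<phi> p)
    - (LINT p|lborel. signed_part s (v p - k) * fst (D p)) \<le> C * G"
proof -
  have front: "frontier \<Omega> \<inter> \<Omega> = {}" using open_\<Omega> by (auto simp: frontier_def interior_open)
  have E: "- (LINT p|lborel. indicator Q p * (jump r W p * signed_sgn s (v p - k) * \<phi> p))
    \<le> (LINT (t, x):Q|lborel.
              signed_part s (u (t, x) - k) * deriv (\<lambda>\<tau>. \<phi> (\<tau>, x)) t +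
              entropy_flux s f (u (t, x)) k \<bullet> gradient (\<lambda>y. \<phi> (t, y)) x)
     + (LINT (t, x):{0<..<T} \<times> UNIV|lborel.
              signed_part s (b (u (t, x)) - b k) *
              levy_operator \<nu> {z. norm z < r} (\<lambda>y. \<phi> (t, y)) x)"
  proof (rule entropy_inequality[OF s r(1) test_on test_nonneg test_measurable])
    show "signed_part s (b (uc p) - b k) * \<phi> p = 0" if "p \<in> {0<..<T} \<times> (- \<Omega>)" for p
      using test_outside[of p] that by auto
    show "AE x in lborel. x \<in> \<Omega> \<longrightarrow> signed_part s (u0 x - k) * \<phi> (0, x) = 0"
      using test_outside by (intro AE_I2) simp
    show "signed_part s (uc_ext p - k) * \<phi> p = 0" if "p \<in> {0<..<T} \<times> frontier \<Omega>" for p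
      using test_outside[of p] that front by auto
  qed
  have J: "(LINT p|lborel. indicator Q p * (jump r W p * signed_sgn s (v p - k) * \<phi> p))
     = (LINT p|lborel. jump r W p * signed_sgn s (v p - k) * \<phi> p)"
    by (rule Bochner_Integration.integral_cong) (use test_outside in \<open>auto simp: indicator_def\<close>)
  have v1: "\<bar>v p\<bar> \<le> K + 1" for p using v_bound[of p] by simp
  have part_b: "\<bar>signed_part s (b (v p) - b k)\<bar> \<le> 2 * bsup" for p
    using s bsup[OF v1[of p]] bsup[OF k] by (auto simp: signed_part_def)
  have part_v: "\<bar>signed_part s (v p - k)\<bar> \<le> 2 * (K + 1)" for p
    using s v1[of p] k by (auto simp: signed_part_def)
  have flux: "norm (entropy_flux s f (v p) k) \<le> 2 * Mf" for p
  proof -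
    have "\<bar>signed_sgn s (v p - k)\<bar> \<le> 1" using s by (auto simp: signed_sgn_def)
    then have "norm (entropy_flux s f (v p) k) \<le> 1 * norm (f (v p) - f k)"
      unfolding entropy_flux_def norm_scaleR by (intro mult_right_mono) auto
    also have "\<dots> \<le> 2 * Mf" using norm_triangle_ineq4[of "f (v p)" "f k"] f_bound[OF v1[of p]] f_bound[OF k] by simp
    finally show ?thesis .
  qed
  have flux_m [measurable]: "(\<lambda>p. entropy_flux s f (g p) k) \<in> borel_measurable borel"
    if [measurable]: "g \<in> borel_measurable borel" for g :: "real \<times> 'a \<Rightarrow> real"
    unfolding entropy_flux_def by measurable
  have I1: "(LINT (t, x):Q|lborel.
              signed_part s (u (t, x) - k) * deriv (\<lambda>\<tau>. \<phi> (\<tau>, x)) t +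
              entropy_flux s f (u (t, x)) k \<bullet> gradient (\<lambda>y. \<phi> (t, y)) x)
     = (LINT p|lborel. signed_part s (v p - k) * fst (D p)) + (LINT p|lborel. entropy_flux s f (v p) k \<bullet> snd (D p))"
  proof -
    have d: "deriv (\<lambda>\<tau>. \<phi> (\<tau>, x)) t = fst (D (t, x))" for t x
      using time_derivative by (rule DERIV_imp_deriv)
    have gr: "gradient (\<lambda>y. \<phi> (t, y)) x = snd (D (t, x))" for t x
      unfolding gradient_def using frechet_derivative_at[OF space_derivative[of t x]]
      by (metis (no_types, lifting) euclidean_representation sum.cong)
    have "(LINT (t, x):Q|lborel.
              signed_part s (u (t, x) - k) * deriv (\<lambda>\<tau>. \<phi> (\<tau>, x)) t +
              entropy_flux s f (u (t, x)) k \<bullet> gradient (\<lambda>y. \<phi> (t, y)) x)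
      = (LINT p|lborel. signed_part s (u' p - k) * fst (D p) + entropy_flux s f (u' p) k \<bullet> snd (D p))"
      unfolding set_lebesgue_integral_def
      by (rule Bochner_Integration.integral_cong) (use test_D_outside in \<open>auto simp: indicator_def d gr u'_def\<close>)
    also have "\<dots> = (LINT p|lborel. signed_part s (v p - k) * fst (D p) + entropy_flux s f (v p) k \<bullet> snd (D p))"
    proof (rule integral_cong_AE)
      show "AE p in lborel. signed_part s (u' p - k) * fst (D p) + entropy_flux s f (u' p) k \<bullet> snd (D p) =
         signed_part s (v p - k) * fst (D p) + entropy_flux s f (v p) k \<bullet> snd (D p)"
        using v_eq_u' by eventually_elim simp
    qed measurable
    also have "\<dots> = (LINT p|lborel. signed_part s (v p - k) * fst (D p)) + (LINT p|lborel. entropy_flux s f (v p) k \<bullet> snd (D p))"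
    proof (rule Bochner_Integration.integral_add)
      obtain B where B: "\<And>p. \<bar>fst (D p)\<bar> \<le> B" using fst_D_bounded by blast
      show "integrable lborel (\<lambda>p. signed_part s (v p - k) * fst (D p))"
      proof (rule integrable_Q[of _ "(2 * (K + 1)) * B"])
        show "\<bar>signed_part s (v p - k) * fst (D p)\<bar> \<le> (2 * (K + 1)) * B" for p
          unfolding abs_mult by (rule mult_mono[OF part_v B]) (use K_nonneg in auto)
      qed (auto simp: test_D_outside)
      show "integrable lborel (\<lambda>p. entropy_flux s f (v p) k \<bullet> snd (D p))"
      proof (rule integrable_Q[of _ "(2 * Mf) * C"])
        show "\<bar>entropy_flux s f (v p) k \<bullet> snd (D p)\<bar> \<le> (2 * Mf) * C" for p
          by (rule order_trans[OF Cauchy_Schwarz_ineq2 mult_mono[OF flux test_snd_le]]) (use Mf_nonneg in auto)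
      qed (auto simp: test_D_outside)
    qed
    finally show ?thesis .
  qed
  have I1': "\<bar>LINT p|lborel. entropy_flux s f (v p) k \<bullet> snd (D p)\<bar> \<le> (2 * Mf * C) * vol"
  proof (rule integral_Q_bound)
    show "\<bar>entropy_flux s f (v p) k \<bullet> snd (D p)\<bar> \<le> 2 * Mf * C" for p
      by (rule order_trans[OF Cauchy_Schwarz_ineq2 mult_mono[OF flux test_snd_le]]) (use Mf_nonneg in auto)
  qed (use test_D_outside Mf_nonneg C_nonneg in auto)
  have I3: "\<bar>LINT (t, x):{0<..<T} \<times> UNIV|lborel.
              signed_part s (b (u (t, x)) - b k) *
              levy_operator \<nu> {z. norm z < r} (\<lambda>y. \<phi> (t, y)) x\<bar> \<le> (2 * bsup * (C * \<Lambda>)) * vol"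
  proof -
    have small: "\<bar>levy_operator \<nu> {z. norm z < r} (\<lambda>y. \<phi> (t, y)) x\<bar> \<le> C * \<Lambda>" for t x
    proof (rule levy_operator_small[OF r _ _ C_nonneg])
      show "(\<lambda>y. \<phi> (t, y)) \<in> borel_measurable borel" by measurable
      show "\<bar>\<phi> (t, x + z) - \<phi> (t, x) - snd (D (t, x)) \<bullet> z\<bar> \<le> C * (norm z)\<^sup>2" for z
        by (rule test_taylor)
    qed
    \<comment> \<open>From outside the enlarged ball no short jump reaches \<Omega>, which confines
      the integrand to \<open>big\<close>.\<close>
    have far: "levy_operator \<nu> {z. norm z < r} (\<lambda>y. \<phi> (t, y)) x = 0" if x: "x \<notin> ball 0 (\<rho> + 1)" for t x
    proof (rule levy_operator_zero)
      fix z :: 'a assume z: "z \<in> {z. norm z < r}"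
      have "norm x \<le> norm (x + z) + norm z" using norm_triangle_ineq4[of "x + z" z] by simp
      then have "x + z \<notin> \<Omega>" "x \<notin> \<Omega>" using \<Omega>_ball x z r(2) by fastforce+
      then show "\<phi> (t, x + z) = \<phi> (t, x)" using test_outside by simp
    qed
    have "\<bar>LINT (t, x):{0<..<T} \<times> UNIV|lborel.
              signed_part s (b (u (t, x)) - b k) *
              levy_operator \<nu> {z. norm z < r} (\<lambda>y. \<phi> (t, y)) x\<bar> \<le> (LINT p|lborel. (2 * bsup * (C * \<Lambda>)) * indicator big p)"
      unfolding set_lebesgue_integral_def
    proof (rule abs_integral_le)
      show "AE p in lborel. \<bar>indicator ({0<..<T} \<times> UNIV) p *\<^sub>R (case p of (t, x) \<Rightarrow>
          signed_part s (b (u (t, x)) - b k) * levy_operator \<nu> {z. norm z < r} (\<lambda>y. \<phi> (t, y)) x)\<bar>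
          \<le> (2 * bsup * (C * \<Lambda>)) * indicator big p"
        using v_eq_u
      proof eventually_elim
        case (elim p)
        obtain t x where p: "p = (t, x)" by (cases p)
        have "\<bar>signed_part s (b (u p) - b k) * levy_operator \<nu> {z. norm z < r} (\<lambda>y. \<phi> (t, y)) x\<bar> \<le> 2 * bsup * (C * \<Lambda>)"
          if "t \<in> {0<..<T}"
          unfolding abs_mult using part_b[of p] elim that p small bsup_nonneg by (intro mult_mono) auto
        then show ?case using far[of x t] by (auto simp: p indicator_def)
      qed
    qed (use integrable_big in simp)
    then show ?thesis by (simp only: integral_big)
  qed
  have "(2 * Mf * C) * vol + (2 * bsup * (C * \<Lambda>)) * vol \<le> C * G"
    unfolding G_def using mult_nonneg_nonneg[OF mult_nonneg_nonneg[OF mult_nonneg_nonneg[OF bsup_nonneg C_nonneg] \<Lambda>_nonneg] vol_nonneg]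
    by (simp add: algebra_simps)
  then show ?thesis using E I1' I3 unfolding I1 J by linarith
qed

end

end

section \<open>Time regularity\<close>

context interior_est
begin

context
  fixes \<phi> D C
  assumes test: "interior_test T \<Omega> \<phi> D C"
begin

lemma test_space_lipschitz: "\<bar>\<phi> (t, x) - \<phi> (t, y)\<bar> \<le> C * norm (x - y)"
proof -
  have "norm ((\<lambda>y. \<phi> (t, y)) x - (\<lambda>y. \<phi> (t, y)) y) \<le> C * norm (x - y)"
  proof (rule differentiable_bound[of UNIV])
    show "((\<lambda>y. \<phi> (t, y)) has_derivative (\<lambda>h. snd (D (t, x)) \<bullet> h)) (at x within UNIV)" for x
      using space_derivative[OF test] by simp
    show "onorm (\<lambda>h. snd (D (t, x)) \<bullet> h) \<le> C" for x
      by (rule onorm_le) (use order_trans[OF Cauchy_Schwarz_ineq2 mult_right_mono[OF test_snd_le[OF test] norm_ge_zero]] in simp)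
  qed auto
  then show ?thesis by simp
qed

text \<open>Entropy tests must be nonnegative, so the wave is raised to 1 + cos. The new constant
  contains \<open>snd \<omega>\<close> up to second order, from the gradient and its Lipschitz
  bound, and is free of \<open>fst \<omega>\<close>.\<close>

lemma interior_test_modulated:
  "interior_test T \<Omega> (\<lambda>p. \<phi> p * (1 + cos (\<omega> \<bullet> p + c)))
     (\<lambda>p. (1 + cos (\<omega> \<bullet> p + c)) *\<^sub>R D p - (\<phi> p * sin (\<omega> \<bullet> p + c)) *\<^sub>R \<omega>)
     (C * (2 + 2 * norm (snd \<omega>) + (norm (snd \<omega>))\<^sup>2))"
  unfolding interior_test_def
proof (intro conjI allI)
  note [simp] = C_nonneg[OF test] test_nonneg[OF test]
  define n where "n = norm (snd \<omega>)"
  have n0: "0 \<le> n" by (simp add: n_def)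
  have c1: "0 \<le> 1 + cos x" "1 + cos x \<le> 2" "\<bar>1 + cos x\<bar> \<le> 2" for x :: real
    using cos_ge_minus_one[of x] cos_le_one[of x] by linarith+
  show "smooth_fun (\<lambda>p. \<phi> p * (1 + cos (\<omega> \<bullet> p + c)))"
    by (intro smooth_fun.mult smooth_fun.add smooth_fun.const smooth_fun_cos test_smooth[OF test])
  show "\<exists>S. compact S \<and> S \<subseteq> {0<..<T} \<times> \<Omega> \<and> (\<forall>p. p \<notin> S \<longrightarrow> \<phi> p * (1 + cos (\<omega> \<bullet> p + c)) = 0 \<and>
      (1 + cos (\<omega> \<bullet> p + c)) *\<^sub>R D p - (\<phi> p * sin (\<omega> \<bullet> p + c)) *\<^sub>R \<omega> = 0)"
    using test_support[OF test] by (metis diff_zero mult_zero_left scaleR_zero_left scaleR_zero_right)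
  show "0 \<le> \<phi> p * (1 + cos (\<omega> \<bullet> p + c))" for p using c1 by simp
  show "\<phi> p * (1 + cos (\<omega> \<bullet> p + c)) \<le> C * (2 + 2 * norm (snd \<omega>) + (norm (snd \<omega>))\<^sup>2)" for p
  proof -
    have "\<phi> p * (1 + cos (\<omega> \<bullet> p + c)) \<le> C * 2" using c1 test_le[OF test] by (intro mult_mono) auto
    also have "\<dots> \<le> C * (2 + 2 * n + n\<^sup>2)" using n0 by (intro mult_left_mono) auto
    finally show ?thesis by (simp add: n_def)
  qed
  show "norm (snd ((1 + cos (\<omega> \<bullet> p + c)) *\<^sub>R D p - (\<phi> p * sin (\<omega> \<bullet> p + c)) *\<^sub>R \<omega>))
      \<le> C * (2 + 2 * norm (snd \<omega>) + (norm (snd \<omega>))\<^sup>2)" for p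
  proof -
    have "norm (snd ((1 + cos (\<omega> \<bullet> p + c)) *\<^sub>R D p - (\<phi> p * sin (\<omega> \<bullet> p + c)) *\<^sub>R \<omega>)) \<le>
       norm ((1 + cos (\<omega> \<bullet> p + c)) *\<^sub>R snd (D p)) + norm ((\<phi> p * sin (\<omega> \<bullet> p + c)) *\<^sub>R snd \<omega>)"
      by (simp only: snd_diff snd_scaleR norm_triangle_ineq4)
    also have "\<dots> = \<bar>1 + cos (\<omega> \<bullet> p + c)\<bar> * norm (snd (D p)) + \<phi> p * \<bar>sin (\<omega> \<bullet> p + c)\<bar> * n"
      by (simp add: abs_mult n_def)
    also have "\<dots> \<le> 2 * C + C * 1 * n"
      using c1 test_le[OF test] test_snd_le[OF test] n0 by (intro add_mono mult_mono) auto
    also have "\<dots> \<le> C * (2 + 2 * n + n\<^sup>2)" using n0 by (simp add: algebra_simps)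
    finally show ?thesis by (simp add: n_def)
  qed
  show "((\<lambda>p. \<phi> p * (1 + cos (\<omega> \<bullet> p + c))) has_derivative
      (\<lambda>h. ((1 + cos (\<omega> \<bullet> p + c)) *\<^sub>R D p - (\<phi> p * sin (\<omega> \<bullet> p + c)) *\<^sub>R \<omega>) \<bullet> h)) (at p)" for p
    by (auto intro!: derivative_eq_intros test_deriv[OF test] simp: inner_diff_left algebra_simps)
  show "smooth_fun (\<lambda>p. ((1 + cos (\<omega> \<bullet> p + c)) *\<^sub>R D p - (\<phi> p * sin (\<omega> \<bullet> p + c)) *\<^sub>R \<omega>) \<bullet> i)" for i
    unfolding inner_diff_left inner_scaleR_left
    by (intro smooth_fun_diff smooth_fun.mult smooth_fun.add smooth_fun.const smooth_fun_cos smooth_fun.sin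
        test_smooth[OF test] test_D_smooth[OF test])
  fix t x y
  define a where "a = \<omega> \<bullet> (t, x) + c"
  define a' where "a' = \<omega> \<bullet> (t, y) + c"
  have aa: "\<bar>a - a'\<bar> \<le> n * norm (x - y)"
    using Cauchy_Schwarz_ineq2[of "snd \<omega>" "x - y"] by (simp add: a_def a'_def inner_prod_def n_def inner_diff_right)
  have lc: "\<bar>cos a - cos a'\<bar> \<le> \<bar>a - a'\<bar>" "\<bar>sin a - sin a'\<bar> \<le> \<bar>a - a'\<bar>"
  proof -
    have "cmod (cis a - cis a') \<le> \<bar>a - a'\<bar>" by (rule norm_cis_diff_le)
    then show "\<bar>cos a - cos a'\<bar> \<le> \<bar>a - a'\<bar>" "\<bar>sin a - sin a'\<bar> \<le> \<bar>a - a'\<bar>"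
      using abs_Re_le_cmod[of "cis a - cis a'"] abs_Im_le_cmod[of "cis a - cis a'"] by auto
  qed
  have t1: "norm ((1 + cos a) *\<^sub>R snd (D (t, x)) - (1 + cos a') *\<^sub>R snd (D (t, y))) \<le> (2 * C + C * n) * norm (x - y)"
  proof -
    have "(1 + cos a) *\<^sub>R snd (D (t, x)) - (1 + cos a') *\<^sub>R snd (D (t, y)) =
       (1 + cos a) *\<^sub>R (snd (D (t, x)) - snd (D (t, y))) + (cos a - cos a') *\<^sub>R snd (D (t, y))"
      by (simp add: algebra_simps)
    also have "norm \<dots> \<le> \<bar>1 + cos a\<bar> * norm (snd (D (t, x)) - snd (D (t, y))) + \<bar>cos a - cos a'\<bar> * norm (snd (D (t, y)))"
      by (metis norm_scaleR norm_triangle_ineq)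
    also have "\<dots> \<le> 2 * (C * norm (x - y)) + (n * norm (x - y)) * C"
      using c1 test_lip[OF test] test_snd_le[OF test] order_trans[OF lc(1) aa] n0
      by (intro add_mono mult_mono) auto
    finally show ?thesis by (simp add: algebra_simps)
  qed
  have t2: "norm ((\<phi> (t, x) * sin a) *\<^sub>R snd \<omega> - (\<phi> (t, y) * sin a') *\<^sub>R snd \<omega>) \<le> (C + C * n) * norm (x - y) * n"
  proof -
    have "(\<phi> (t, x) * sin a) - (\<phi> (t, y) * sin a') = (\<phi> (t, x) - \<phi> (t, y)) * sin a + \<phi> (t, y) * (sin a - sin a')"
      by (simp add: algebra_simps)
    also have "\<bar>\<dots>\<bar> \<le> \<bar>\<phi> (t, x) - \<phi> (t, y)\<bar> * \<bar>sin a\<bar> + \<phi> (t, y) * \<bar>sin a - sin a'\<bar>"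
      by (rule order_trans[OF abs_triangle_ineq]) (simp add: abs_mult)
    also have "\<dots> \<le> (C * norm (x - y)) * 1 + C * (n * norm (x - y))"
      using test_space_lipschitz test_le[OF test] order_trans[OF lc(2) aa] n0
      by (intro add_mono mult_mono) auto
    finally have "\<bar>(\<phi> (t, x) * sin a) - (\<phi> (t, y) * sin a')\<bar> \<le> (C + C * n) * norm (x - y)" by (simp add: algebra_simps)
    then have "\<bar>(\<phi> (t, x) * sin a) - (\<phi> (t, y) * sin a')\<bar> * n \<le> (C + C * n) * norm (x - y) * n"
      using n0 by (intro mult_right_mono)
    moreover have "norm ((\<phi> (t, x) * sin a) *\<^sub>R snd \<omega> - (\<phi> (t, y) * sin a') *\<^sub>R snd \<omega>) =
        \<bar>(\<phi> (t, x) * sin a) - (\<phi> (t, y) * sin a')\<bar> * n"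
      by (simp only: scaleR_diff_left[symmetric] norm_scaleR n_def)
    ultimately show ?thesis by simp
  qed
  have "norm (snd ((1 + cos a) *\<^sub>R D (t, x) - (\<phi> (t, x) * sin a) *\<^sub>R \<omega>) - snd ((1 + cos a') *\<^sub>R D (t, y) - (\<phi> (t, y) * sin a') *\<^sub>R \<omega>))
     = norm (((1 + cos a) *\<^sub>R snd (D (t, x)) - (1 + cos a') *\<^sub>R snd (D (t, y)))
        - ((\<phi> (t, x) * sin a) *\<^sub>R snd \<omega> - (\<phi> (t, y) * sin a') *\<^sub>R snd \<omega>))"
    by (simp add: algebra_simps)
  also have "\<dots> \<le> (2 * C + C * n) * norm (x - y) + (C + C * n) * norm (x - y) * n"
    by (rule order_trans[OF norm_triangle_ineq4 add_mono[OF t1 t2]])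
  also have "\<dots> = C * (2 + 2 * n + n\<^sup>2) * norm (x - y)" by (simp add: algebra_simps power2_eq_square)
  finally show "norm (snd ((1 + cos (\<omega> \<bullet> (t, x) + c)) *\<^sub>R D (t, x) - (\<phi> (t, x) * sin (\<omega> \<bullet> (t, x) + c)) *\<^sub>R \<omega>) -
        snd ((1 + cos (\<omega> \<bullet> (t, y) + c)) *\<^sub>R D (t, y) - (\<phi> (t, y) * sin (\<omega> \<bullet> (t, y) + c)) *\<^sub>R \<omega>))
      \<le> C * (2 + 2 * norm (snd \<omega>) + (norm (snd \<omega>))\<^sup>2) * norm (x - y)"
    by (simp add: a_def a'_def n_def)
qed

lemma integrable_test: "integrable lborel \<phi>"
proof (rule integrable_Q[of _ C])
  show "\<bar>\<phi> p\<bar> \<le> C" for p using test_le[OF test, of p] test_nonneg[OF test, of p] by simp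
qed (use test_measurable[OF test] test_outside[OF test] in auto)

text \<open>Difference quotients in time have integral 0 by translation invariance, and they
  converge under a common majorant.\<close>

lemma integral_fst_D: "(LINT p|lborel. fst (D p)) = 0"
proof -
  note [measurable] = test_measurable[OF test] fst_D_measurable[OF test]
  obtain B where B: "\<And>p. \<bar>fst (D p)\<bar> \<le> B" using fst_D_bounded[OF test] by blast
  define h where "h j = 1 / (real j + 1)" for j
  have h: "h j > 0" "h j \<le> 1" for j by (simp_all add: h_def)
  have h0: "h \<longlonglongrightarrow> 0" unfolding h_def using LIMSEQ_inverse_real_of_nat by (simp add: inverse_eq_divide add.commute)
  \<comment> \<open>Time steps are at most 1, so all difference quotients vanish off this
    set.\<close>
  define R where "R = {- 1<..<T} \<times> ball (0::'a) (\<rho> + 1)"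
  have R: "bounded R" "R \<in> sets borel"
    unfolding R_def by (intro bounded_Times) (auto intro!: borel_open open_Times)
  have "(\<lambda>j. LINT p|lborel. (\<phi> (p + (h j, 0)) - \<phi> p) / h j) \<longlonglongrightarrow> (LINT p|lborel. fst (D p))"
  proof (rule Bochner_Integration.integral_dominated_convergence[where w = "\<lambda>p. B * indicator R p"])
    show "integrable lborel (\<lambda>p. B * indicator R p)"
      by (rule integrable_bounded_support[OF _ _ R(1), of _ "\<bar>B\<bar>"]) (use R(2) in \<open>auto simp: indicator_def\<close>)
    show "AE p in lborel. (\<lambda>j. (\<phi> (p + (h j, 0)) - \<phi> p) / h j) \<longlonglongrightarrow> fst (D p)"
    proof (rule AE_I2)
      fix p :: "real \<times> 'a"
      have "((\<lambda>k. (\<phi> (fst p + k, snd p) - \<phi> (fst p, snd p)) / k) \<longlongrightarrow> fst (D (fst p, snd p))) (at 0)"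
        using time_derivative[OF test, of "snd p" "fst p"] by (simp add: DERIV_def)
      moreover have "filterlim h (at 0) sequentially"
        using h h0 by (intro filterlim_atI) (auto intro!: always_eventually simp: less_imp_neq[symmetric])
      ultimately have "(\<lambda>j. (\<phi> (fst p + h j, snd p) - \<phi> (fst p, snd p)) / h j) \<longlonglongrightarrow> fst (D (fst p, snd p))"
        by (rule filterlim_compose)
      then show "(\<lambda>j. (\<phi> (p + (h j, 0)) - \<phi> p) / h j) \<longlonglongrightarrow> fst (D p)" by (cases p) simp
    qed
    show "AE p in lborel. norm ((\<phi> (p + (h j, 0)) - \<phi> p) / h j) \<le> B * indicator R p" for j
    proof (rule AE_I2)
      fix p :: "real \<times> 'a"
      show "norm ((\<phi> (p + (h j, 0)) - \<phi> p) / h j) \<le> B * indicator R p"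
      proof (cases "p \<in> R")
        case True
        have "norm ((\<lambda>\<tau>. \<phi> (\<tau>, snd p)) (fst p + h j) - (\<lambda>\<tau>. \<phi> (\<tau>, snd p)) (fst p)) \<le> B * norm (fst p + h j - fst p)"
        proof (rule differentiable_bound[of UNIV])
          show "((\<lambda>\<tau>. \<phi> (\<tau>, snd p)) has_derivative (\<lambda>h. fst (D (t, snd p)) * h)) (at t within UNIV)" for t
            using time_derivative[OF test, of "snd p" t] by (simp add: has_field_derivative_def)
          show "onorm (\<lambda>h. fst (D (t, snd p)) * h) \<le> B" for t
            by (rule onorm_le) (use B in \<open>simp add: abs_mult mult_right_mono\<close>)
        qed auto
        then have "\<bar>\<phi> (p + (h j, 0)) - \<phi> p\<bar> \<le> B * h j" using h[of j] by (cases p) simp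
        then show ?thesis using True h[of j] by (simp add: field_simps abs_mult)
      next
        case False
        have "p \<notin> Q" "p + (h j, 0) \<notin> Q"
          using False h[of j] \<Omega>_ball by (cases p; force simp: R_def)+
        then show ?thesis using False test_outside[OF test] by simp
      qed
    qed
  qed measurable
  moreover have "(LINT p|lborel. (\<phi> (p + (h j, 0)) - \<phi> p) / h j) = 0" for j
  proof -
    have "integrable lborel (\<lambda>p. \<phi> (p + (h j, 0)))" using integrable_test by (simp add: integrable_lborel_shift_iff)
    then show ?thesis using integrable_test integral_lborel_shift[of \<phi> "(h j, 0)"] by simp
  qed
  ultimately show ?thesis using LIMSEQ_unique by (metis (no_types, lifting) tendsto_const ext)
qed

text \<open>At k = - (K + 1) with s = 1 and at k = K + 1 with s = -1 the signed part of v - k is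
  affine in v, with slopes 1 and -1. Its constant term is removed by \<open>integral_fst_D\<close>,
  and the two entropy inequalities become a two-sided bound.\<close>

lemma time_estimate: "\<bar>LINT p|lborel. v p * fst (D p)\<bar> \<le> C * (G + 2 * bsup * \<Lambda> * vol)"
proof -
  note [measurable] = test_measurable[OF test] fst_D_measurable[OF test]
  obtain B where B: "\<And>p. \<bar>fst (D p)\<bar> \<le> B" using fst_D_bounded[OF test] by blast
  have i1: "integrable lborel (\<lambda>p. v p * fst (D p))"
  proof (rule integrable_Q[of _ "K * B"])
    show "\<bar>v p * fst (D p)\<bar> \<le> K * B" for p
      unfolding abs_mult by (rule mult_mono[OF v_bound B]) (use K_nonneg in auto)
  qed (use test_D_outside[OF test] in auto)
  have i2: "integrable lborel (\<lambda>p. fst (D p))"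
    by (rule integrable_Q[of _ B]) (use B test_D_outside[OF test] in auto)
  have jb: "\<bar>jump 1 W p\<bar> \<le> 2 * bsup * \<Lambda>" for p
    using jump_bound[OF zero_less_one W_measurable W_bsup, of p] by simp
  have J: "\<bar>LINT p|lborel. jump 1 W p * signed_sgn s (v p - k) * \<phi> p\<bar> \<le> (2 * bsup * \<Lambda> * 1 * C) * vol" if "s \<in> {1, - 1}" for s k
  proof (rule integral_Q_bound)
    show "\<bar>jump 1 W p * signed_sgn s (v p - k) * \<phi> p\<bar> \<le> 2 * bsup * \<Lambda> * 1 * C" for p
    proof -
      have "\<bar>signed_sgn s (v p - k)\<bar> \<le> 1" using that by (auto simp: signed_sgn_def)
      then show ?thesis
        unfolding abs_mult using jb test_nonneg[OF test, of p] test_le[OF test, of p] bsup_nonneg \<Lambda>_nonneg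
        by (intro mult_mono) auto
    qed
  qed (use test_outside[OF test] bsup_nonneg \<Lambda>_nonneg C_nonneg[OF test] in auto)
  have "signed_part 1 (v p - - (K + 1)) * fst (D p) = v p * fst (D p) + (K + 1) * fst (D p)" for p
    using v_bound[of p] by (simp add: signed_part_def abs_le_iff algebra_simps)
  then have p1: "(LINT p|lborel. signed_part 1 (v p - - (K + 1)) * fst (D p)) = (LINT p|lborel. v p * fst (D p))"
    using i1 i2 integral_fst_D by simp
  have "signed_part (- 1) (v p - (K + 1)) * fst (D p) = (K + 1) * fst (D p) - v p * fst (D p)" for p
    using v_bound[of p] by (simp add: signed_part_def abs_le_iff algebra_simps)
  then have p2: "(LINT p|lborel. signed_part (- 1) (v p - (K + 1)) * fst (D p)) = - (LINT p|lborel. v p * fst (D p))"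
    using i1 i2 integral_fst_D by simp
  have "- (LINT p|lborel. v p * fst (D p)) \<le> C * G + 2 * bsup * \<Lambda> * C * vol"
    using interior_inequality[OF test, of 1 1 "- (K + 1)"] K_nonneg J[of 1 "- (K + 1)"] unfolding p1 by simp
  moreover have "(LINT p|lborel. v p * fst (D p)) \<le> C * G + 2 * bsup * \<Lambda> * C * vol"
    using interior_inequality[OF test, of "- 1" 1 "K + 1"] K_nonneg J[of "- 1" "K + 1"] unfolding p2 by simp
  ultimately show ?thesis by (simp add: algebra_simps abs_le_iff)
qed

end

text \<open>Differentiating the wave in time brings down \<open>fst \<omega>\<close> times a sine;
  the remaining term, where \<phi> is differentiated, is bounded through \<open>B\<close>. The
  phases c = 0 and c = pi / 2 give the imaginary and the real part of the transform.\<close>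

lemma time_fourier_estimate:
  assumes test: "interior_test T \<Omega> \<phi> D C" and B: "\<And>p. \<bar>fst (D p)\<bar> \<le> B"
  shows "\<bar>fst \<omega>\<bar> * cmod (fourier (\<lambda>p. \<phi> p * v p) \<omega>)
     \<le> 2 * (C * (2 + 2 * norm (snd \<omega>) + (norm (snd \<omega>))\<^sup>2) * (G + 2 * bsup * \<Lambda> * vol) + 2 * K * B * vol)"
proof -
  note [measurable] = test_measurable[OF test] fst_D_measurable[OF test]
  note nn = test_nonneg[OF test]
  have B0: "0 \<le> B" using B[of 0] by linarith
  have iv: "integrable lborel (\<lambda>p. \<phi> p * v p)"
  proof (rule integrable_Q[of _ "C * K"])
    show "\<bar>\<phi> p * v p\<bar> \<le> C * K" for p
      unfolding abs_mult using nn[of p] test_le[OF test, of p] C_nonneg[OF test] by (intro mult_mono v_bound) auto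
  qed (use test_outside[OF test] in auto)
  have part: "\<bar>fst \<omega>\<bar> * \<bar>LINT p|lborel. \<phi> p * v p * sin (\<omega> \<bullet> p + c)\<bar>
     \<le> C * (2 + 2 * norm (snd \<omega>) + (norm (snd \<omega>))\<^sup>2) * (G + 2 * bsup * \<Lambda> * vol) + 2 * K * B * vol" for c
  proof -
    have split: "\<bar>a\<bar> * \<bar>Y\<bar> \<le> P + R" if "\<bar>X - a * Y\<bar> \<le> P" "\<bar>X\<bar> \<le> R" for a X Y P R :: real
    proof -
      have "\<bar>a * Y\<bar> \<le> P + R" using that by linarith
      then show ?thesis by (simp add: abs_mult)
    qed
    have c1: "\<bar>1 + cos x\<bar> \<le> 2" for x :: real
      using cos_ge_minus_one[of x] cos_le_one[of x] by linarith
    have i1: "integrable lborel (\<lambda>p. v p * (1 + cos (\<omega> \<bullet> p + c)) * fst (D p))"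
    proof (rule integrable_Q[of _ "K * 2 * B"])
      show "\<bar>v p * (1 + cos (\<omega> \<bullet> p + c)) * fst (D p)\<bar> \<le> K * 2 * B" for p
        unfolding abs_mult using v_bound B K_nonneg c1 by (intro mult_mono) auto
    qed (use test_D_outside[OF test] in auto)
    have b1: "\<bar>LINT p|lborel. v p * (1 + cos (\<omega> \<bullet> p + c)) * fst (D p)\<bar> \<le> (K * 2 * B) * vol"
    proof (rule integral_Q_bound)
      show "\<bar>v p * (1 + cos (\<omega> \<bullet> p + c)) * fst (D p)\<bar> \<le> K * 2 * B" for p
        unfolding abs_mult using v_bound B K_nonneg c1 by (intro mult_mono) auto
    qed (use test_D_outside[OF test] K_nonneg B0 in auto)
    have i2: "integrable lborel (\<lambda>p. \<phi> p * v p * sin (\<omega> \<bullet> p + c))"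
      by (rule Bochner_Integration.integrable_bound[OF iv]) (auto simp: abs_mult mult_left_le)
    have "(LINT p|lborel. v p * fst ((1 + cos (\<omega> \<bullet> p + c)) *\<^sub>R D p - (\<phi> p * sin (\<omega> \<bullet> p + c)) *\<^sub>R \<omega>)) =
       (LINT p|lborel. v p * (1 + cos (\<omega> \<bullet> p + c)) * fst (D p) - fst \<omega> * (\<phi> p * v p * sin (\<omega> \<bullet> p + c)))"
      by (rule Bochner_Integration.integral_cong) (auto simp: algebra_simps)
    also have "\<dots> = (LINT p|lborel. v p * (1 + cos (\<omega> \<bullet> p + c)) * fst (D p)) - fst \<omega> * (LINT p|lborel. \<phi> p * v p * sin (\<omega> \<bullet> p + c))"
      using i1 i2 by simp
    finally have eq: "(LINT p|lborel. v p * fst ((1 + cos (\<omega> \<bullet> p + c)) *\<^sub>R D p - (\<phi> p * sin (\<omega> \<bullet> p + c)) *\<^sub>R \<omega>)) =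
       (LINT p|lborel. v p * (1 + cos (\<omega> \<bullet> p + c)) * fst (D p)) - fst \<omega> * (LINT p|lborel. \<phi> p * v p * sin (\<omega> \<bullet> p + c))" .
    have "\<bar>(LINT p|lborel. v p * (1 + cos (\<omega> \<bullet> p + c)) * fst (D p)) - fst \<omega> * (LINT p|lborel. \<phi> p * v p * sin (\<omega> \<bullet> p + c))\<bar>
       \<le> C * (2 + 2 * norm (snd \<omega>) + (norm (snd \<omega>))\<^sup>2) * (G + 2 * bsup * \<Lambda> * vol)"
      using time_estimate[OF interior_test_modulated[OF test], of \<omega> c] by (simp only: eq)
    then have "\<bar>fst \<omega>\<bar> * \<bar>LINT p|lborel. \<phi> p * v p * sin (\<omega> \<bullet> p + c)\<bar>
       \<le> C * (2 + 2 * norm (snd \<omega>) + (norm (snd \<omega>))\<^sup>2) * (G + 2 * bsup * \<Lambda> * vol) + (K * 2 * B) * vol"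
      using b1 by (rule split)
    also have "K * 2 * B = 2 * K * B" by simp
    finally show ?thesis .
  qed
  define I where "I c = (LINT p|lborel. \<phi> p * v p * sin (\<omega> \<bullet> p + c))" for c
  note fi = fourier_integrable[OF iv, of \<omega>]
  have "Re (fourier (\<lambda>p. \<phi> p * v p) \<omega>) = (LINT p|lborel. Re (cis (\<omega> \<bullet> p) * complex_of_real (\<phi> p * v p)))"
    unfolding fourier_def using fi by (rule integral_Re[symmetric])
  also have "\<dots> = I (pi / 2)"
    unfolding I_def by (rule Bochner_Integration.integral_cong) (auto simp: sin_add)
  finally have re: "Re (fourier (\<lambda>p. \<phi> p * v p) \<omega>) = I (pi / 2)" .
  have "Im (fourier (\<lambda>p. \<phi> p * v p) \<omega>) = (LINT p|lborel. Im (cis (\<omega> \<bullet> p) * complex_of_real (\<phi> p * v p)))"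
    unfolding fourier_def using fi by (rule integral_Im[symmetric])
  also have "\<dots> = I 0"
    unfolding I_def by (rule Bochner_Integration.integral_cong) auto
  finally have im: "Im (fourier (\<lambda>p. \<phi> p * v p) \<omega>) = I 0" .
  have "cmod (fourier (\<lambda>p. \<phi> p * v p) \<omega>) \<le> \<bar>I (pi / 2)\<bar> + \<bar>I 0\<bar>"
    using cmod_le[of "fourier (\<lambda>p. \<phi> p * v p) \<omega>"] by (simp add: re im)
  then have "\<bar>fst \<omega>\<bar> * cmod (fourier (\<lambda>p. \<phi> p * v p) \<omega>) \<le> \<bar>fst \<omega>\<bar> * (\<bar>I (pi / 2)\<bar> + \<bar>I 0\<bar>)"
    by (intro mult_left_mono) auto
  then show ?thesis using part[of "pi / 2"] part[of 0] by (simp add: I_def algebra_simps)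
qed

end

section \<open>The local energy estimate for \<open>W\<close>\<close>

context interior_est
begin

text \<open>Shifted to vanish at v = - K, as do the averaged indicators of v > k that approximate
  it.\<close>

definition W0 :: "real \<times> 'a \<Rightarrow> real" where
  "W0 p = W p - b (- K)"

lemma W0_measurable [measurable]: "W0 \<in> borel_measurable borel"
  unfolding W0_def by measurable

lemma W0_nonneg: "0 \<le> W0 p" and W0_le: "W0 p \<le> b K - b (- K)"
  using v_bound[of p] monoD[OF b_mono, of "- K" "v p"] monoD[OF b_mono, of "v p" K]
  unfolding W0_def W_def by linarith+

lemma b_range: "0 \<le> b K - b (- K)" "b K - b (- K) \<le> 2 * bsup"
  using monoD[OF b_mono, of "- K" K] bsup[of K] bsup[of "- K"] K_nonneg by auto

lemma W0_le_bsup: "\<bar>W0 p\<bar> \<le> 2 * bsup"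
  using W0_nonneg[of p] W0_le[of p] b_range by linarith

text \<open>The entropies \<open>(v - k)\<^sup>+\<close> are averaged over levels \<open>k\<close> that are equidistant in \<open>b (k)\<close>; a
  Riemann sum avoids measurability in \<open>k\<close>.\<close>

lemma entropy_levels:
  assumes N: "N > 0"
  obtains k :: "nat \<Rightarrow> real" where "\<And>j. j < N \<Longrightarrow> \<bar>k j\<bar> \<le> K"
    "\<And>p. \<bar>(\<Sum>j<N. (b K - b (- K)) / real N * signed_sgn 1 (v p - k j)) - W0 p\<bar> \<le> (b K - b (- K)) / real N"
proof -
  define h where "h = (b K - b (- K)) / real N"
  have h0: "0 \<le> h" using b_range(1) by (simp add: h_def)
  have Nh: "real N * h = b K - b (- K)" using N by (simp add: h_def)
  define c where "c j = b (- K) + real j * h" for j :: nat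
  have c0: "c 0 = b (- K)" by (simp add: c_def)
  have cN: "c N = b K" using Nh by (simp add: c_def)
  have cS: "c (Suc j) = c j + h" for j by (simp add: c_def algebra_simps)
  have cle: "c j \<le> b K" if "j \<le> N" for j
    using mult_right_mono[OF _ h0, of "real j" "real N"] that Nh by (simp add: c_def)
  \<comment> \<open>The intermediate value theorem gives levels at which \<open>b\<close> takes the
    equidistant values \<open>c j\<close>; where \<open>b\<close> is flat any choice will
    do.\<close>
  have "\<exists>x. \<bar>x\<bar> \<le> K \<and> b x = c j" if "j \<le> N" for j
    using IVT'[of b "- K" "c j" K] cle[OF that] h0 K_nonneg continuous_on_subset[OF b_cont]
    by (auto simp: c_def abs_le_iff)
  then obtain k where k: "\<And>j. j \<le> N \<Longrightarrow> \<bar>k j\<bar> \<le> K" "\<And>j. j \<le> N \<Longrightarrow> b (k j) = c j" by metis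
  have bnd: "\<bar>(\<Sum>j<N. h * signed_sgn 1 (v p - k j)) - W0 p\<bar> \<le> h" for p
  proof -
    define y where "y = b (v p)"
    have y: "b (- K) \<le> y" "y \<le> b K" using W0_nonneg[of p] W0_le[of p] by (simp_all add: y_def W0_def W_def)
    have tele: "(\<Sum>j<N. min y (c (Suc j)) - min y (c j)) = W0 p"
      using sum_lessThan_telescope[of "\<lambda>j. min y (c j)" N] y by (simp add: c0 cN W0_def W_def y_def)
    \<comment> \<open>Each telescoping increment lies between h times the indicator of v > k (j + 1)
      and h times that of v > k j. After summation the two bounds differ by at most h.\<close>
    have up: "min y (c (Suc j)) - min y (c j) \<le> h * signed_sgn 1 (v p - k j)" if "j < N" for j
    proof (cases "v p > k j")
      case True then show ?thesis using h0 cS[of j] by (auto simp: signed_sgn_def)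
    next
      case False
      then have "y \<le> c j" using monoD[OF b_mono, of "v p" "k j"] k(2)[of j] that by (simp add: y_def)
      then show ?thesis using False cS[of j] h0 by (simp add: signed_sgn_def)
    qed
    have lo: "h * signed_sgn 1 (v p - k (Suc j)) \<le> min y (c (Suc j)) - min y (c j)" if "j < N" for j
    proof (cases "v p > k (Suc j)")
      case True
      then have "c (Suc j) \<le> y" using monoD[OF b_mono, of "k (Suc j)" "v p"] k(2)[of "Suc j"] that by (simp add: y_def)
      then show ?thesis using True cS[of j] h0 by (simp add: signed_sgn_def)
    next
      case False then show ?thesis using h0 cS[of j] by (simp add: signed_sgn_def)
    qed
    have "W0 p \<le> (\<Sum>j<N. h * signed_sgn 1 (v p - k j))"
      unfolding tele[symmetric] by (rule sum_mono) (use up in auto)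
    moreover have "(\<Sum>j<N. h * signed_sgn 1 (v p - k j)) \<le> h + W0 p"
    proof -
      obtain M where M: "N = Suc M" using N gr0_conv_Suc by blast
      have "(\<Sum>j<N. h * signed_sgn 1 (v p - k j)) = h * signed_sgn 1 (v p - k 0) + (\<Sum>j<M. h * signed_sgn 1 (v p - k (Suc j)))"
        unfolding M by (rule sum.lessThan_Suc_shift)
      also have "\<dots> \<le> h + (\<Sum>j<N. h * signed_sgn 1 (v p - k (Suc j)))"
        unfolding M using h0 by (intro add_mono) (auto simp: signed_sgn_def)
      also have "\<dots> \<le> h + W0 p"
        unfolding tele[symmetric] by (intro add_left_mono sum_mono) (use lo in auto)
      finally show ?thesis .
    qed
    ultimately show ?thesis using h0 by linarith
  qed
  show ?thesis by (rule that[of k]) (use k(1) bnd in \<open>auto simp: h_def\<close>)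
qed

lemma integral_tail_min_bound:
  assumes "g \<in> borel_measurable borel" "\<And>z. \<bar>g z\<bar> \<le> A * min ((norm z)\<^sup>2) 1"
  shows "\<bar>LINT z|tail r. g z\<bar> \<le> A * \<Lambda>"
proof -
  have "\<bar>indicator {z. r \<le> norm z} z * g z\<bar> \<le> A * min ((norm z)\<^sup>2) 1" for z
    using assms(2)[of z] abs_ge_zero[of "g z"] by (auto simp: indicator_def simp del: abs_ge_zero)
  from integrable_levy(2)[OF _ this] assms(1) show ?thesis
    by (simp add: integral_tail set_lebesgue_integral_def)
qed

context
  fixes \<phi> D C B
  assumes test: "interior_test T \<Omega> \<phi> D C" and B: "\<And>p. \<bar>fst (D p)\<bar> \<le> B"
begin

text \<open>Bound for a single level: \<open>C * G\<close> from \<open>interior_inequality\<close>,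
  and the time-derivative term, in which the signed part of v - k is at most 2 K.\<close>

definition E0 :: real where "E0 = C * G + 2 * K * B * vol"

lemma B_nonneg: "0 \<le> B" using B[of 0] by linarith

lemma E0_nonneg: "0 \<le> E0"
  using C_nonneg[OF test] G_nonneg K_nonneg B_nonneg vol_nonneg by (simp add: E0_def)

text \<open>Weighting the inequalities at the levels \<open>k j\<close> with h and adding them
  replaces the sign by \<open>W0\<close> up to an error of order h; the weights sum to at most
  \<open>2 * bsup\<close>. The error also contains \<open>Br\<close>, which blows up as r tends to
  0, but for fixed r it vanishes as the number of levels grows. Hence the bound is uniform in
  r.\<close>

lemma energy_jump:
  assumes r: "0 < r" "r \<le> 1"
  shows "- (LINT p|lborel. jump r W p * W0 p * \<phi> p) \<le> 2 * bsup * E0"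
proof -
  note [measurable] = test_measurable[OF test] fst_D_measurable[OF test] jump_measurable[OF r(1) W_measurable]
  note nn = test_nonneg[OF test]
  define Br where "Br = 2 * bsup * ((1 / min (r\<^sup>2) 1) * \<Lambda>)"
  have Br: "\<bar>jump r W p\<bar> \<le> Br" for p unfolding Br_def by (rule jump_bound[OF r(1) W_measurable W_bsup])
  have Br0: "0 \<le> Br" using Br[of 0] by linarith
  have int: "integrable lborel (\<lambda>p. jump r W p * g p * \<phi> p)"
    if "g \<in> borel_measurable borel" "\<And>p. \<bar>g p\<bar> \<le> c" for g c
  proof (rule integrable_Q[of _ "Br * c * C"])
    show "\<bar>jump r W p * g p * \<phi> p\<bar> \<le> Br * c * C" for p
      unfolding abs_mult using Br that(2) nn[of p] test_le[OF test, of p] Br0 order_trans[OF abs_ge_zero that(2)]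
      by (intro mult_mono mult_nonneg_nonneg) auto
    show "(\<lambda>p. jump r W p * g p * \<phi> p) \<in> borel_measurable borel" using that(1) by measurable
  qed (use test_outside[OF test] in auto)
  have key: "- (LINT p|lborel. jump r W p * W0 p * \<phi> p) \<le> 2 * bsup * E0 + (2 * bsup * Br * C * vol) * (1 / real (Suc M))" for M
  proof -
    define N where "N = Suc M"
    define h where "h = (b K - b (- K)) / real N"
    have N: "N > 0" by (simp add: N_def)
    have h0: "0 \<le> h" using b_range(1) by (simp add: h_def)
    obtain k where k: "\<And>j. j < N \<Longrightarrow> \<bar>k j\<bar> \<le> K"
      and S: "\<And>p. \<bar>(\<Sum>j<N. h * signed_sgn 1 (v p - k j)) - W0 p\<bar> \<le> h"
      using entropy_levels[OF N] unfolding h_def by blast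
    have one: "- (LINT p|lborel. jump r W p * signed_sgn 1 (v p - k j) * \<phi> p) \<le> E0" if j: "j < N" for j
    proof -
      have "\<bar>LINT p|lborel. signed_part 1 (v p - k j) * fst (D p)\<bar> \<le> (2 * K * B) * vol"
      proof (rule integral_Q_bound)
        have "\<bar>signed_part 1 (v p - k j)\<bar> \<le> 2 * K" for p
          using v_bound[of p] k[OF j] K_nonneg by (auto simp: signed_part_def)
        then show "\<bar>signed_part 1 (v p - k j) * fst (D p)\<bar> \<le> 2 * K * B" for p
          unfolding abs_mult by (rule mult_mono[OF _ B]) (use K_nonneg in auto)
      qed (use test_D_outside[OF test] K_nonneg B_nonneg in auto)
      then show ?thesis
        using interior_inequality[OF test, of 1 r "k j"] r k[OF j] unfolding E0_def by simp
    qed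
    have sgn_b: "\<bar>signed_sgn 1 x\<bar> \<le> 1" for x by (simp add: signed_sgn_def)
    have "- (LINT p|lborel. jump r W p * (\<Sum>j<N. h * signed_sgn 1 (v p - k j)) * \<phi> p) =
        - (LINT p|lborel. (\<Sum>j<N. h * (jump r W p * signed_sgn 1 (v p - k j) * \<phi> p)))"
      by (simp add: sum_distrib_left sum_distrib_right mult_ac)
    also have "\<dots> = (\<Sum>j<N. h * - (LINT p|lborel. jump r W p * signed_sgn 1 (v p - k j) * \<phi> p))"
      using int[OF _ sgn_b] by (subst Bochner_Integration.integral_sum) (auto simp: sum_negf)
    also have "\<dots> \<le> (\<Sum>j<N. h * E0)"
      using h0 by (intro sum_mono mult_left_mono one) auto
    also have "\<dots> = (b K - b (- K)) * E0" using N by (simp add: h_def)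
    also have "\<dots> \<le> 2 * bsup * E0" using b_range E0_nonneg by (intro mult_right_mono)
    finally have 1: "- (LINT p|lborel. jump r W p * (\<Sum>j<N. h * signed_sgn 1 (v p - k j)) * \<phi> p) \<le> 2 * bsup * E0" .
    have Sb: "\<bar>\<Sum>j<N. h * signed_sgn 1 (v p - k j)\<bar> \<le> 2 * bsup + h" for p
      using S[of p] W0_le_bsup[of p] by linarith
    have iS: "integrable lborel (\<lambda>p. jump r W p * (\<Sum>j<N. h * signed_sgn 1 (v p - k j)) * \<phi> p)"
      by (rule int[OF _ Sb]) measurable
    have iW: "integrable lborel (\<lambda>p. jump r W p * W0 p * \<phi> p)"
      by (rule int[OF _ W0_le_bsup]) measurable
    have "(LINT p|lborel. jump r W p * (\<Sum>j<N. h * signed_sgn 1 (v p - k j)) * \<phi> p) - (LINT p|lborel. jump r W p * W0 p * \<phi> p)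
       = (LINT p|lborel. jump r W p * ((\<Sum>j<N. h * signed_sgn 1 (v p - k j)) - W0 p) * \<phi> p)"
      by (subst Bochner_Integration.integral_diff[OF iS iW, symmetric]) (simp add: algebra_simps)
    moreover have "\<bar>LINT p|lborel. jump r W p * ((\<Sum>j<N. h * signed_sgn 1 (v p - k j)) - W0 p) * \<phi> p\<bar> \<le> (Br * h * C) * vol"
    proof (rule integral_Q_bound)
      show "\<bar>jump r W p * ((\<Sum>j<N. h * signed_sgn 1 (v p - k j)) - W0 p) * \<phi> p\<bar> \<le> Br * h * C" for p
        unfolding abs_mult using Br S nn[of p] test_le[OF test, of p] Br0 h0 by (intro mult_mono) auto
    qed (use test_outside[OF test] Br0 h0 C_nonneg[OF test] in auto)
    moreover have "(Br * h * C) * vol \<le> (2 * bsup * Br * C * vol) * (1 / real (Suc M))"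
    proof -
      have "h \<le> 2 * bsup / real N" unfolding h_def using b_range by (intro divide_right_mono) auto
      then have "h * (Br * C * vol) \<le> 2 * bsup / real N * (Br * C * vol)"
        using Br0 C_nonneg[OF test] vol_nonneg by (intro mult_right_mono) auto
      then show ?thesis by (simp add: N_def mult_ac)
    qed
    ultimately show ?thesis using 1 by linarith
  qed
  have "(\<lambda>M. 2 * bsup * E0 + (2 * bsup * Br * C * vol) * (1 / real (Suc M))) \<longlonglongrightarrow> 2 * bsup * E0 + (2 * bsup * Br * C * vol) * 0"
    using LIMSEQ_inverse_real_of_nat by (intro tendsto_intros) (simp add: inverse_eq_divide)
  then show ?thesis
    using key by (intro LIMSEQ_le_const) auto
qed

text \<open>Integrated in z against \<nu> this is a Dirichlet form of \<open>W0\<close> localised by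
  \<phi>.\<close>

definition en :: "'a \<Rightarrow> real" where
  "en z = (LINT p|lborel. \<phi> p * (W0 (p + (0, z)) - W0 p)\<^sup>2)"

lemma en_measurable [measurable]: "en \<in> borel_measurable borel"
proof -
  note [measurable] = test_measurable[OF test]
  show ?thesis unfolding en_def by measurable
qed

lemma en_nonneg: "0 \<le> en z"
  unfolding en_def by (intro Bochner_Integration.integral_nonneg mult_nonneg_nonneg test_nonneg[OF test]) simp

text \<open>The second term is twice the bound in \<open>energy_jump\<close>; the first dominates
  the second-difference contribution in \<open>energy_tail\<close>.\<close>

definition E1 :: real where "E1 = 32 * bsup\<^sup>2 * C * vol * \<Lambda> + 4 * bsup * E0"

text \<open>Opposite shifts cancel the gradient of \<phi> and leave two Taylor remainders for short
  jumps; for long jumps the total mass of four copies of \<phi> suffices.\<close>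

lemma second_difference_bound:
  "\<bar>LINT p|lborel. (W0 p)\<^sup>2 * (\<phi> (p + (0, - z)) + \<phi> (p + (0, z)) - 2 * \<phi> p)\<bar> \<le> (16 * bsup\<^sup>2 * C * vol) * min ((norm z)\<^sup>2) 1"
proof -
  note [measurable] = test_measurable[OF test]
  note nn = test_nonneg[OF test]
  have V: "0 \<le> (W0 p)\<^sup>2" "(W0 p)\<^sup>2 \<le> 4 * bsup\<^sup>2" for p
    using power_mono[OF W0_le_bsup[of p], of 2] by (simp_all add: power_mult_distrib)
  show ?thesis
  proof (cases "norm z < 1")
    case True
    have "\<bar>LINT p|lborel. (W0 p)\<^sup>2 * (\<phi> (p + (0, - z)) + \<phi> (p + (0, z)) - 2 * \<phi> p)\<bar>
       \<le> (LINT p|lborel. (4 * bsup\<^sup>2 * (2 * (C * (norm z)\<^sup>2))) * indicator big p)"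
    proof (rule abs_integral_le[OF AE_I2])
      fix p :: "real \<times> 'a"
      obtain t x where p: "p = (t, x)" by (cases p)
      show "\<bar>(W0 p)\<^sup>2 * (\<phi> (p + (0, - z)) + \<phi> (p + (0, z)) - 2 * \<phi> p)\<bar>
         \<le> (4 * bsup\<^sup>2 * (2 * (C * (norm z)\<^sup>2))) * indicator big p"
      proof (cases "p \<in> big")
        case True
        have "\<bar>\<phi> (t, x + - z) + \<phi> (t, x + z) - 2 * \<phi> (t, x)\<bar> \<le> 2 * (C * (norm z)\<^sup>2)"
          using test_taylor[OF test, of t x z] test_taylor[OF test, of t x "- z"] by (simp add: abs_le_iff)
        then have "\<bar>(W0 p)\<^sup>2\<bar> * \<bar>\<phi> (p + (0, - z)) + \<phi> (p + (0, z)) - 2 * \<phi> p\<bar> \<le> (4 * bsup\<^sup>2) * (2 * (C * (norm z)\<^sup>2))"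
          using V[of p] by (intro mult_mono) (auto simp: p)
        then show ?thesis using True by (simp add: abs_mult)
      next
        case False
        have "x \<notin> \<Omega> \<and> x + z \<notin> \<Omega> \<and> x + - z \<notin> \<Omega> \<or> t \<notin> {0<..<T}"
        proof (cases "t \<in> {0<..<T}")
          case True
          then have x: "\<rho> + 1 \<le> norm x" using False by (auto simp: p)
          have "norm x \<le> norm (x + z) + norm z" "norm x \<le> norm (x - z) + norm z"
            using norm_triangle_ineq4[of "x + z" z] norm_triangle_ineq[of "x - z" z] by simp_all
          then show ?thesis using x \<open>norm z < 1\<close> \<Omega>_ball by fastforce
        qed simp
        then have "\<phi> (t, x) = 0" "\<phi> (t, x + z) = 0" "\<phi> (t, x + - z) = 0"
          using test_outside[OF test] by auto
        then show ?thesis using False by (auto simp: p indicator_def)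
      qed
    qed (use integrable_big in simp)
    also have "\<dots> = (4 * bsup\<^sup>2 * (2 * (C * (norm z)\<^sup>2))) * vol" by (rule integral_big)
    also have "\<dots> \<le> (16 * bsup\<^sup>2 * C * vol) * (norm z)\<^sup>2"
      using mult_nonneg_nonneg[OF mult_nonneg_nonneg[OF mult_nonneg_nonneg[OF zero_le_power2[of bsup] C_nonneg[OF test]] vol_nonneg] zero_le_power2[of "norm z"]]
      by (simp add: mult_ac)
    also have "(norm z)\<^sup>2 = min ((norm z)\<^sup>2) 1"
      using True by (simp add: power_le_one min_absorb1)
    finally show ?thesis .
  next
    case False
    then have m: "min ((norm z)\<^sup>2) 1 = 1" by (simp add: one_le_power min_absorb2)
    have i: "integrable lborel (\<lambda>p. \<phi> (p + (0, z)))" for z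
      using integrable_test[OF test] by (simp add: integrable_lborel_shift_iff)
    have "\<bar>LINT p|lborel. (W0 p)\<^sup>2 * (\<phi> (p + (0, - z)) + \<phi> (p + (0, z)) - 2 * \<phi> p)\<bar>
       \<le> (LINT p|lborel. 4 * bsup\<^sup>2 * (\<phi> (p + (0, - z)) + \<phi> (p + (0, z)) + 2 * \<phi> p))"
    proof (rule abs_integral_le[OF AE_I2])
      fix p :: "real \<times> 'a"
      have "\<bar>\<phi> (p + (0, - z)) + \<phi> (p + (0, z)) - 2 * \<phi> p\<bar> \<le> \<phi> (p + (0, - z)) + \<phi> (p + (0, z)) + 2 * \<phi> p"
        using nn[of p] nn[of "p + (0, z)"] nn[of "p + (0, - z)"] by (simp add: abs_le_iff)
      then show "\<bar>(W0 p)\<^sup>2 * (\<phi> (p + (0, - z)) + \<phi> (p + (0, z)) - 2 * \<phi> p)\<bar>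
         \<le> 4 * bsup\<^sup>2 * (\<phi> (p + (0, - z)) + \<phi> (p + (0, z)) + 2 * \<phi> p)"
        unfolding abs_mult using V[of p] by (intro mult_mono) auto
    qed (use i[of z] i[of "- z"] integrable_test[OF test] in simp)
    also have "\<dots> = 4 * bsup\<^sup>2 * (4 * (LINT p|lborel. \<phi> p))"
      using i[of z] i[of "- z"] integrable_test[OF test]
        integral_lborel_shift[OF test_measurable[OF test], of "(0, z)"] integral_lborel_shift[OF test_measurable[OF test], of "(0, - z)"]
      by simp
    also have "\<dots> \<le> 4 * bsup\<^sup>2 * (4 * (C * vol))"
    proof -
      have "\<bar>LINT p|lborel. \<phi> p\<bar> \<le> C * vol"
      proof (rule integral_Q_bound)
        show "\<bar>\<phi> p\<bar> \<le> C" for p using nn[of p] test_le[OF test, of p] by simp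
      qed (use test_outside[OF test] C_nonneg[OF test] in auto)
      then show ?thesis by (intro mult_left_mono) auto
    qed
    finally show ?thesis by (simp add: m mult_ac)
  qed
qed

text \<open>By (x - y)^2 = (x^2 - y^2) - 2 y (x - y) the energy splits into increments of the square
  of \<open>W0\<close> and the term bounded in \<open>energy_jump\<close>. In the former, symmetry
  of the measure and translation invariance transfer a second difference to \<phi>, which gives a
  bound independent of r.\<close>

lemma energy_tail:
  assumes r: "0 < r" "r \<le> 1"
  shows "integrable (tail r) en" and "(LINT z|tail r. en z) \<le> E1"
proof -
  note [measurable] = test_measurable[OF test] jump_measurable[OF r(1) W_measurable]
  note nn = test_nonneg[OF test]
  interpret F: finite_measure "tail r" by (rule finite_measure_tail[OF r(1)])
  interpret P: pair_sigma_finite "tail r" "lborel :: (real \<times> 'a) measure" ..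
  define X where "X z = (LINT p|lborel. \<phi> p * W0 p * (W0 (p + (0, z)) - W0 p))" for z
  define V where "V p = (W0 p)\<^sup>2" for p
  define J where "J z = (LINT p|lborel. \<phi> p * (V (p + (0, z)) - V p))" for z
  have [measurable]: "V \<in> borel_measurable borel" unfolding V_def by measurable
  have [measurable]: "X \<in> borel_measurable borel" "J \<in> borel_measurable borel"
    unfolding X_def J_def by measurable
  have Vb: "\<bar>V p\<bar> \<le> 4 * bsup\<^sup>2" for p
    using power_mono[OF W0_le_bsup[of p], of 2] by (simp add: V_def power_mult_distrib)
  have d: "\<bar>W0 (p + (0, z)) - W0 p\<bar> \<le> 2 * bsup" for p z
    using W0_nonneg[of p] W0_le[of p] W0_nonneg[of "p + (0, z)"] W0_le[of "p + (0, z)"] b_range by linarith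
  have Xi: "\<bar>\<phi> p * W0 p * (W0 (p + (0, z)) - W0 p)\<bar> \<le> C * (2 * bsup) * (2 * bsup)" for p z
    unfolding abs_mult using nn[of p] test_le[OF test, of p] C_nonneg[OF test] bsup_nonneg
    by (intro mult_mono W0_le_bsup d) auto
  have Ei: "\<bar>\<phi> p * (W0 (p + (0, z)) - W0 p)\<^sup>2\<bar> \<le> C * (2 * bsup)\<^sup>2" for p z
    unfolding abs_mult using nn[of p] test_le[OF test, of p] C_nonneg[OF test] power_mono[OF d[of p z], of 2]
    by (intro mult_mono) auto
  have Ji: "\<bar>\<phi> p * (V (p + (0, z)) - V p)\<bar> \<le> C * (8 * bsup\<^sup>2)" for p z
    unfolding abs_mult using nn[of p] test_le[OF test, of p] C_nonneg[OF test] Vb[of p] Vb[of "p + (0, z)"]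
    by (intro mult_mono) auto
  note out = test_outside[OF test]
  have iX: "integrable lborel (\<lambda>p. \<phi> p * W0 p * (W0 (p + (0, z)) - W0 p))" for z
    by (rule integrable_Q[OF _ Xi]) (auto simp: out)
  have iJ: "integrable lborel (\<lambda>p. \<phi> p * (V (p + (0, z)) - V p))" for z
    by (rule integrable_Q[OF _ Ji]) (auto simp: out)
  have bX: "\<bar>X z\<bar> \<le> (C * (2 * bsup) * (2 * bsup)) * vol" for z
    unfolding X_def by (rule integral_Q_bound[OF Xi]) (use out C_nonneg[OF test] bsup_nonneg in auto)
  have bE: "\<bar>en z\<bar> \<le> (C * (2 * bsup)\<^sup>2) * vol" for z
    unfolding en_def by (rule integral_Q_bound[OF Ei]) (use out C_nonneg[OF test] bsup_nonneg in auto)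
  have bJ: "\<bar>J z\<bar> \<le> (C * (8 * bsup\<^sup>2)) * vol" for z
    unfolding J_def by (rule integral_Q_bound[OF Ji]) (use out C_nonneg[OF test] bsup_nonneg in auto)
  have tX: "integrable (tail r) X" by (rule F.integrable_const_bound[OF AE_I2]) (use bX in auto)
  show tE: "integrable (tail r) en" by (rule F.integrable_const_bound[OF AE_I2]) (use bE in auto)
  have tJ: "integrable (tail r) J" by (rule F.integrable_const_bound[OF AE_I2]) (use bJ in auto)
  have eq: "en z = J z - 2 * X z" for z
  proof -
    have "J z - 2 * X z = (LINT p|lborel. \<phi> p * (V (p + (0, z)) - V p) - 2 * (\<phi> p * W0 p * (W0 (p + (0, z)) - W0 p)))"
      unfolding J_def X_def using iJ[of z] iX[of z] by simp
    also have "\<dots> = en z"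
      unfolding en_def by (rule Bochner_Integration.integral_cong) (auto simp: V_def power2_eq_square algebra_simps)
    finally show ?thesis by simp
  qed
  have "(LINT p|lborel. jump r W p * W0 p * \<phi> p) = (LINT p|lborel. (LINT z|tail r. \<phi> p * W0 p * (W0 (p + (0, z)) - W0 p)))"
    by (rule Bochner_Integration.integral_cong) (auto simp: jump_def W0_def mult_ac)
  also have "\<dots> = (LINT z|tail r. X z)"
    unfolding X_def
  proof (rule P.Fubini_integral)
    show "integrable (tail r \<Otimes>\<^sub>M lborel) (\<lambda>(z, p). \<phi> p * W0 p * (W0 (p + (0, z)) - W0 p))"
    proof (rule P.Fubini_integrable)
      have m: "(\<lambda>z. LINT p|lborel. norm (\<phi> p * W0 p * (W0 (p + (0, z)) - W0 p))) \<in> borel_measurable borel" by measurable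
      have "\<bar>LINT p|lborel. norm (\<phi> p * W0 p * (W0 (p + (0, z)) - W0 p))\<bar> \<le> (C * (2 * bsup) * (2 * bsup)) * vol" for z
        by (rule integral_Q_bound) (use Xi out C_nonneg[OF test] bsup_nonneg in auto)
      then show "integrable (tail r) (\<lambda>z. LINT p|lborel. norm (case (z, p) of (z, p) \<Rightarrow> \<phi> p * W0 p * (W0 (p + (0, z)) - W0 p)))"
        using m by (intro F.integrable_const_bound[OF AE_I2]) auto
    qed (use iX in auto)
  qed
  finally have X_eq: "(LINT z|tail r. X z) = (LINT p|lborel. jump r W p * W0 p * \<phi> p)" by simp
  \<comment> \<open>Averaging over z and - z is what produces a second difference; a first
    difference of \<phi> would only be of order |z|, too weak near the origin.\<close>
  have Jsym: "(LINT z|tail r. J z) = (LINT z|tail r. J (- z))"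
  proof -
    have "(LINT z|tail r. J (- z)) = (LINT z|\<nu>. indicator {z. r \<le> norm z} (- z) * J (- z))"
      by (simp add: integral_tail set_lebesgue_integral_def indicator_def)
    also have "\<dots> = (LINT z|\<nu>. indicator {z. r \<le> norm z} z * J z)"
      by (rule integral_uminus[where f = "\<lambda>z. indicator {z. r \<le> norm z} z * J z"]) measurable
    finally show ?thesis by (simp add: integral_tail set_lebesgue_integral_def)
  qed
  have Vint: "integrable lborel (\<lambda>p. V p * \<phi> (p + (0, z)))" for z
  proof (rule Bochner_Integration.integrable_bound)
    show "integrable lborel (\<lambda>p. 4 * bsup\<^sup>2 * \<phi> (p + (0, z)))"
      using integrable_test[OF test] by (simp add: integrable_lborel_shift_iff)
    have "\<bar>V p\<bar> * \<bar>\<phi> (p + (0, z))\<bar> \<le> (4 * bsup\<^sup>2) * \<bar>\<phi> (p + (0, z))\<bar>" for p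
      using Vb by (intro mult_right_mono) auto
    then show "AE p in lborel. norm (V p * \<phi> (p + (0, z))) \<le> norm (4 * bsup\<^sup>2 * \<phi> (p + (0, z)))"
      by (simp add: abs_mult)
  qed measurable
  \<comment> \<open>The increment is moved from the merely bounded \<open>V\<close> to the smooth
    test.\<close>
  have Jshift: "J z = (LINT p|lborel. V p * \<phi> (p + (0, - z))) - (LINT p|lborel. V p * \<phi> p)" for z
  proof -
    have "integrable lborel (\<lambda>p. V (p + (0, z)) * \<phi> p)"
      using Vint[of "- z"] integrable_lborel_shift_iff[of "\<lambda>p. V p * \<phi> (p + (0, - z))" "(0, z)"] by (simp add: add.assoc zero_prod_def[symmetric])
    then have "J z = (LINT p|lborel. V (p + (0, z)) * \<phi> p) - (LINT p|lborel. V p * \<phi> p)"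
      unfolding J_def using Vint[of 0]
      by (subst Bochner_Integration.integral_diff[symmetric]) (simp_all add: algebra_simps zero_prod_def[symmetric])
    also have "(LINT p|lborel. V (p + (0, z)) * \<phi> p) = (LINT p|lborel. V p * \<phi> (p + (0, - z)))"
      using integral_lborel_shift[of "\<lambda>p. V p * \<phi> (p + (0, - z))" "(0, z)"] by (simp add: add.assoc zero_prod_def[symmetric])
    finally show ?thesis .
  qed
  have JJ: "J z + J (- z) = (LINT p|lborel. (W0 p)\<^sup>2 * (\<phi> (p + (0, - z)) + \<phi> (p + (0, z)) - 2 * \<phi> p))" for z
  proof -
    have "(LINT p|lborel. (W0 p)\<^sup>2 * (\<phi> (p + (0, - z)) + \<phi> (p + (0, z)) - 2 * \<phi> p)) =
      (LINT p|lborel. V p * \<phi> (p + (0, - z)) + V p * \<phi> (p + (0, z)) - 2 * (V p * \<phi> p))"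
      by (rule Bochner_Integration.integral_cong) (auto simp: V_def algebra_simps)
    also have "\<dots> = (LINT p|lborel. V p * \<phi> (p + (0, - z))) + (LINT p|lborel. V p * \<phi> (p + (0, z))) - 2 * (LINT p|lborel. V p * \<phi> p)"
      using Vint[of z] Vint[of "- z"] Vint[of 0] by (simp add: zero_prod_def[symmetric])
    finally show ?thesis by (simp add: Jshift)
  qed
  have tJ': "integrable (tail r) (\<lambda>z. J (- z))" by (rule F.integrable_const_bound[OF AE_I2]) (use bJ in auto)
  have "2 * (LINT z|tail r. J z) = (LINT z|tail r. J z + J (- z))"
    using tJ tJ' Jsym by simp
  also have "\<dots> \<le> (16 * bsup\<^sup>2 * C * vol) * \<Lambda>"
  proof -
    have "\<bar>LINT z|tail r. J z + J (- z)\<bar> \<le> (16 * bsup\<^sup>2 * C * vol) * \<Lambda>"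
      by (rule integral_tail_min_bound) (use second_difference_bound in \<open>auto simp: JJ\<close>)
    then show ?thesis by linarith
  qed
  finally have J2: "2 * (LINT z|tail r. J z) \<le> (16 * bsup\<^sup>2 * C * vol) * \<Lambda>" .
  have "(LINT z|tail r. en z) = (LINT z|tail r. J z) - 2 * (LINT z|tail r. X z)"
    unfolding eq using tJ tX by simp
  moreover have "0 \<le> bsup\<^sup>2 * C * vol * \<Lambda>"
    using C_nonneg[OF test] vol_nonneg \<Lambda>_nonneg by simp
  ultimately show "(LINT z|tail r. en z) \<le> E1"
    using J2 energy_jump[OF r] X_eq unfolding E1_def by linarith
qed

end

end

section \<open>From the local energy to the Fourier multiplier\<close>

context interior_est
begin

context
  fixes \<phi> D C B
  assumes test: "interior_test T \<Omega> \<phi> D C" and B: "\<And>p. \<bar>fst (D p)\<bar> \<le> B"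
begin

text \<open>The bound on the tails does not depend on r, so monotone convergence includes all jumps;
  at the origin \<open>en\<close> vanishes.\<close>

lemma energy_full: "(\<integral>\<^sup>+z. ennreal (en \<phi> z) \<partial>\<nu>) \<le> ennreal (E1 C B)"
proof -
  note [measurable] = en_measurable[OF test B]
  define r where "r j = 1 / (real j + 1)" for j
  have r: "0 < r j" "r j \<le> 1" for j by (simp_all add: r_def)
  have r0: "r \<longlonglongrightarrow> 0" unfolding r_def using LIMSEQ_inverse_real_of_nat by (simp add: inverse_eq_divide add.commute)
  define F where "F j z = ennreal (indicator {z. r j \<le> norm z} z) * ennreal (en \<phi> z)" for j z
  have bd: "(\<integral>\<^sup>+z. F j z \<partial>\<nu>) \<le> ennreal (E1 C B)" for j
  proof -
    have "(\<integral>\<^sup>+z. F j z \<partial>\<nu>) = (\<integral>\<^sup>+z. ennreal (en \<phi> z) \<partial>tail (r j))"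
      unfolding F_def tail_def by (subst nn_integral_density) auto
    also have "\<dots> = ennreal (LINT z|tail (r j). en \<phi> z)"
      by (rule nn_integral_eq_integral[OF energy_tail(1)[OF test B r]]) (simp add: en_nonneg[OF test B])
    also have "\<dots> \<le> ennreal (E1 C B)" by (rule ennreal_leI[OF energy_tail(2)[OF test B r]])
    finally show ?thesis .
  qed
  have "(\<lambda>j. \<integral>\<^sup>+z. F j z \<partial>\<nu>) \<longlonglongrightarrow> (\<integral>\<^sup>+z. ennreal (en \<phi> z) \<partial>\<nu>)"
  proof (rule nn_integral_LIMSEQ)
    show "incseq F"
    proof (intro monoI le_funI)
      fix i j :: nat and z :: 'a assume "i \<le> j"
      then have "r j \<le> r i" unfolding r_def by (intro divide_left_mono) auto
      then show "F i z \<le> F j z" unfolding F_def by (intro mult_right_mono) (auto simp: indicator_def)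
    qed
    show "(\<lambda>j. F j z) \<longlonglongrightarrow> ennreal (en \<phi> z)" for z
    proof (cases "z = 0")
      case True
      have "en \<phi> z = 0" by (simp add: True en_def[OF test B] zero_prod_def[symmetric])
      then show ?thesis by (simp add: F_def)
    next
      case False
      then have "\<forall>\<^sub>F j in sequentially. r j < norm z" using order_tendstoD(2)[OF r0] by simp
      then have "\<forall>\<^sub>F j in sequentially. F j z = ennreal (en \<phi> z)"
        by eventually_elim (simp add: F_def)
      then show ?thesis by (rule tendsto_eventually)
    qed
  qed (unfold F_def, measurable)
  then show ?thesis using bd by (intro LIMSEQ_le_const2) auto
qed

definition E2 :: real where "E2 = 2 * C * E1 C B + 16 * bsup\<^sup>2 * C\<^sup>2 * vol * \<Lambda>"

lemma E1_nonneg: "0 \<le> E1 C B"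
  unfolding E1_def[OF test B] using C_nonneg[OF test] vol_nonneg \<Lambda>_nonneg bsup_nonneg E0_nonneg[OF test B] by simp

lemma E2_nonneg: "0 \<le> E2"
  unfolding E2_def using C_nonneg[OF test] vol_nonneg \<Lambda>_nonneg E1_nonneg by simp

text \<open>Short shifts use the Lipschitz bound of \<phi>; long ones use (x - y)^2 \<le> x^2 + y^2
  for nonnegative x and y.\<close>

lemma difference_bound: "(LINT p|lborel. (\<phi> (p + (0, z)) - \<phi> p)\<^sup>2) \<le> (2 * C\<^sup>2 * vol) * min ((norm z)\<^sup>2) 1"
proof (cases "norm z < 1")
  case True
  have "\<bar>LINT p|lborel. (\<phi> (p + (0, z)) - \<phi> p)\<^sup>2\<bar> \<le> (LINT p|lborel. (C * norm z)\<^sup>2 * indicator big p)"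
  proof (rule abs_integral_le[OF AE_I2])
    fix p :: "real \<times> 'a"
    obtain t x where p: "p = (t, x)" by (cases p)
    show "\<bar>(\<phi> (p + (0, z)) - \<phi> p)\<^sup>2\<bar> \<le> (C * norm z)\<^sup>2 * indicator big p"
    proof (cases "p \<in> big")
      case True
      have "\<bar>\<phi> (t, x + z) - \<phi> (t, x)\<bar>\<^sup>2 \<le> (C * norm z)\<^sup>2"
        using test_space_lipschitz[OF test, of t "x + z" x] by (intro power_mono) auto
      then show ?thesis using True by (simp add: p)
    next
      case False
      have "x \<notin> \<Omega> \<and> x + z \<notin> \<Omega> \<or> t \<notin> {0<..<T}"
      proof (cases "t \<in> {0<..<T}")
        case True
        then have x: "\<rho> + 1 \<le> norm x" using False by (auto simp: p)
        have "norm x \<le> norm (x + z) + norm z" using norm_triangle_ineq4[of "x + z" z] by simp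
        then show ?thesis using x \<open>norm z < 1\<close> \<Omega>_ball by fastforce
      qed simp
      then have "\<phi> (t, x) = 0" "\<phi> (t, x + z) = 0" using test_outside[OF test] by auto
      then show ?thesis using False by (auto simp: p indicator_def)
    qed
  qed (use integrable_big in simp)
  also have "\<dots> = (C * norm z)\<^sup>2 * vol" by (rule integral_big)
  also have "\<dots> \<le> (2 * C\<^sup>2 * vol) * (norm z)\<^sup>2"
    using mult_nonneg_nonneg[OF mult_nonneg_nonneg[OF zero_le_power2[of C] vol_nonneg] zero_le_power2[of "norm z"]]
    by (simp add: power_mult_distrib mult_ac)
  also have "(norm z)\<^sup>2 = min ((norm z)\<^sup>2) 1"
    using True by (simp add: power_le_one min_absorb1)
  finally show ?thesis by linarith
next
  case False
  note [measurable] = test_measurable[OF test]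
  note nn = test_nonneg[OF test]
  have m: "min ((norm z)\<^sup>2) 1 = 1" using False by (simp add: one_le_power min_absorb2)
  have b: "\<bar>(\<phi> p)\<^sup>2\<bar> \<le> C\<^sup>2" for p using power_mono[OF test_le[OF test, of p] nn, of 2] by simp
  have i: "integrable lborel (\<lambda>p. (\<phi> p)\<^sup>2)"
    by (rule integrable_Q[OF _ b]) (auto simp: test_outside[OF test])
  then have i': "integrable lborel (\<lambda>p. (\<phi> (p + (0, z)))\<^sup>2)"
    by (subst integrable_lborel_shift_iff[where f = "\<lambda>p. (\<phi> p)\<^sup>2"]) auto
  have "\<bar>LINT p|lborel. (\<phi> (p + (0, z)) - \<phi> p)\<^sup>2\<bar> \<le> (LINT p|lborel. (\<phi> (p + (0, z)))\<^sup>2 + (\<phi> p)\<^sup>2)"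
  proof (rule abs_integral_le[OF AE_I2])
    show "\<bar>(\<phi> (p + (0, z)) - \<phi> p)\<^sup>2\<bar> \<le> (\<phi> (p + (0, z)))\<^sup>2 + (\<phi> p)\<^sup>2" for p
      using mult_nonneg_nonneg[OF nn[of p] nn[of "p + (0, z)"]]
      by (simp only: abs_power2) (simp add: power2_diff mult.commute)
  qed (use i i' in simp)
  also have "\<dots> = 2 * (LINT p|lborel. (\<phi> p)\<^sup>2)"
    using i i' integral_lborel_shift[of "\<lambda>p. (\<phi> p)\<^sup>2" "(0, z)"] by simp
  also have "\<dots> \<le> 2 * (C\<^sup>2 * vol)"
  proof -
    have "\<bar>LINT p|lborel. (\<phi> p)\<^sup>2\<bar> \<le> C\<^sup>2 * vol"
      by (rule integral_Q_bound[OF b]) (auto simp: test_outside[OF test])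
    then show ?thesis by simp
  qed
  finally show ?thesis by (simp add: m)
qed

lemma product_facts:
  shows product_measurable: "(\<lambda>p. \<phi> p * W0 p) \<in> borel_measurable borel"
    and product_bound: "\<bar>\<phi> p * W0 p\<bar> \<le> C * (2 * bsup)"
    and product_integrable: "integrable lborel (\<lambda>p. \<phi> p * W0 p)"
proof -
  note [measurable] = test_measurable[OF test]
  show m: "(\<lambda>p. \<phi> p * W0 p) \<in> borel_measurable borel" by measurable
  show b: "\<bar>\<phi> p * W0 p\<bar> \<le> C * (2 * bsup)" for p
    unfolding abs_mult using test_nonneg[OF test, of p] test_le[OF test, of p] C_nonneg[OF test]
    by (intro mult_mono W0_le_bsup) auto
  show "integrable lborel (\<lambda>p. \<phi> p * W0 p)"
    by (rule integrable_Q[OF m b]) (auto simp: test_outside[OF test])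
qed

text \<open>A discrete product rule: increments of \<open>\<phi> * W0\<close> split into those of
  \<open>W0\<close>, where \<phi>^2 \<le> C \<phi> restores the weight of \<open>en\<close>, and
  those of \<phi>. This places the cut-off inside the increment, as needed for the Fourier
  transform.\<close>

lemma product_difference_energy:
  "(\<integral>\<^sup>+z. ennreal (LINT p|lborel. (\<phi> (p + (0, z)) * W0 (p + (0, z)) - \<phi> p * W0 p)\<^sup>2) \<partial>\<nu>) \<le> ennreal E2"
proof -
  note [measurable] = test_measurable[OF test] en_measurable[OF test B]
  note nn = test_nonneg[OF test]
  have pt: "(LINT p|lborel. (\<phi> (p + (0, z)) * W0 (p + (0, z)) - \<phi> p * W0 p)\<^sup>2)
     \<le> 2 * C * en \<phi> z + (16 * bsup\<^sup>2 * C\<^sup>2 * vol) * min ((norm z)\<^sup>2) 1" for z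
  proof -
    have d: "\<bar>W0 (p + (0, z)) - W0 p\<bar> \<le> 2 * bsup" for p
      using W0_nonneg[of p] W0_le[of p] W0_nonneg[of "p + (0, z)"] W0_le[of "p + (0, z)"] b_range by linarith
    have i1: "integrable lborel (\<lambda>p. \<phi> p * (W0 (p + (0, z)) - W0 p)\<^sup>2)"
    proof (rule integrable_Q[of _ "C * (2 * bsup)\<^sup>2"])
      show "\<bar>\<phi> p * (W0 (p + (0, z)) - W0 p)\<^sup>2\<bar> \<le> C * (2 * bsup)\<^sup>2" for p
        unfolding abs_mult using nn[of p] test_le[OF test, of p] C_nonneg[OF test] power_mono[OF d[of p], of 2]
        by (intro mult_mono) auto
    qed (auto simp: test_outside[OF test])
    have i2: "integrable lborel (\<lambda>p. (\<phi> (p + (0, z)) - \<phi> p)\<^sup>2)"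
    proof -
      have "integrable lborel (\<lambda>p. \<phi> (p + (0, z)))"
        using integrable_test[OF test] by (simp add: integrable_lborel_shift_iff)
      then have "integrable lborel (\<lambda>p. C * (\<phi> (p + (0, z)) + \<phi> p))"
        using integrable_test[OF test] by simp
      then show ?thesis
      proof (rule Bochner_Integration.integrable_bound)
        have "(\<phi> (p + (0, z)) - \<phi> p)\<^sup>2 \<le> \<bar>C * (\<phi> (p + (0, z)) + \<phi> p)\<bar>" for p
        proof -
          have "\<bar>\<phi> (p + (0, z)) - \<phi> p\<bar> * \<bar>\<phi> (p + (0, z)) - \<phi> p\<bar> \<le> C * (\<phi> (p + (0, z)) + \<phi> p)"
            using nn[of p] nn[of "p + (0, z)"] test_le[OF test, of p] test_le[OF test, of "p + (0, z)"] C_nonneg[OF test]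
            by (intro mult_mono) auto
          then show ?thesis by (simp add: power2_eq_square abs_mult_self_eq)
        qed
        then show "AE p in lborel. norm ((\<phi> (p + (0, z)) - \<phi> p)\<^sup>2) \<le> norm (C * (\<phi> (p + (0, z)) + \<phi> p))" by simp
      qed measurable
    qed
    have "\<bar>LINT p|lborel. (\<phi> (p + (0, z)) * W0 (p + (0, z)) - \<phi> p * W0 p)\<^sup>2\<bar>
       \<le> (LINT p|lborel. 2 * C * (\<phi> p * (W0 (p + (0, z)) - W0 p)\<^sup>2) + 8 * bsup\<^sup>2 * (\<phi> (p + (0, z)) - \<phi> p)\<^sup>2)"
    proof (rule abs_integral_le[OF AE_I2])
      fix p
      define x y where "x = \<phi> p * (W0 (p + (0, z)) - W0 p)" and "y = W0 (p + (0, z)) * (\<phi> (p + (0, z)) - \<phi> p)"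
      have xy: "\<phi> (p + (0, z)) * W0 (p + (0, z)) - \<phi> p * W0 p = x + y" by (simp add: x_def y_def algebra_simps)
      have "(x + y)\<^sup>2 \<le> 2 * x\<^sup>2 + 2 * y\<^sup>2"
        using zero_le_power2[of "x - y"] by (simp add: power2_eq_square algebra_simps)
      moreover have "x\<^sup>2 \<le> C * (\<phi> p * (W0 (p + (0, z)) - W0 p)\<^sup>2)"
      proof -
        have "x\<^sup>2 = \<phi> p * (\<phi> p * (W0 (p + (0, z)) - W0 p)\<^sup>2)" by (simp add: x_def power2_eq_square)
        also have "\<dots> \<le> C * (\<phi> p * (W0 (p + (0, z)) - W0 p)\<^sup>2)"
          by (rule mult_right_mono[OF test_le[OF test]]) (use nn in simp)
        finally show ?thesis .
      qed
      moreover have "y\<^sup>2 \<le> 4 * bsup\<^sup>2 * (\<phi> (p + (0, z)) - \<phi> p)\<^sup>2"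
        unfolding y_def power_mult_distrib
        using power_mono[OF W0_le_bsup[of "p + (0, z)"], of 2] by (intro mult_right_mono) (auto simp: power_mult_distrib)
      ultimately have "(x + y)\<^sup>2 \<le> 2 * C * (\<phi> p * (W0 (p + (0, z)) - W0 p)\<^sup>2) + 8 * bsup\<^sup>2 * (\<phi> (p + (0, z)) - \<phi> p)\<^sup>2"
        by linarith
      then show "\<bar>(\<phi> (p + (0, z)) * W0 (p + (0, z)) - \<phi> p * W0 p)\<^sup>2\<bar>
         \<le> 2 * C * (\<phi> p * (W0 (p + (0, z)) - W0 p)\<^sup>2) + 8 * bsup\<^sup>2 * (\<phi> (p + (0, z)) - \<phi> p)\<^sup>2"
        unfolding xy by simp
    qed (use i1 i2 in simp)
    also have "\<dots> = 2 * C * en \<phi> z + 8 * bsup\<^sup>2 * (LINT p|lborel. (\<phi> (p + (0, z)) - \<phi> p)\<^sup>2)"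
      using i1 i2 by (simp add: en_def[OF test B])
    also have "\<dots> \<le> 2 * C * en \<phi> z + 8 * bsup\<^sup>2 * ((2 * C\<^sup>2 * vol) * min ((norm z)\<^sup>2) 1)"
      by (intro add_left_mono mult_left_mono difference_bound) auto
    also have "8 * bsup\<^sup>2 * ((2 * C\<^sup>2 * vol) * min ((norm z)\<^sup>2) 1) = (16 * bsup\<^sup>2 * C\<^sup>2 * vol) * min ((norm z)\<^sup>2) 1"
      by simp
    finally show ?thesis by linarith
  qed
  have k: "0 \<le> 16 * bsup\<^sup>2 * C\<^sup>2 * vol" using vol_nonneg by simp
  have e: "0 \<le> en \<phi> z" for z by (rule en_nonneg[OF test B])
  have "(\<integral>\<^sup>+z. ennreal (LINT p|lborel. (\<phi> (p + (0, z)) * W0 (p + (0, z)) - \<phi> p * W0 p)\<^sup>2) \<partial>\<nu>)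
     \<le> (\<integral>\<^sup>+z. ennreal (2 * C) * ennreal (en \<phi> z) + ennreal (16 * bsup\<^sup>2 * C\<^sup>2 * vol) * ennreal (min ((norm z)\<^sup>2) 1) \<partial>\<nu>)"
  proof (rule nn_integral_mono)
    fix z
    have "ennreal (2 * C) * ennreal (en \<phi> z) + ennreal (16 * bsup\<^sup>2 * C\<^sup>2 * vol) * ennreal (min ((norm z)\<^sup>2) 1)
       = ennreal (2 * C * en \<phi> z + (16 * bsup\<^sup>2 * C\<^sup>2 * vol) * min ((norm z)\<^sup>2) 1)"
      using C_nonneg[OF test] k e[of z]
      by (simp add: ennreal_mult[symmetric] ennreal_plus[symmetric] del: ennreal_plus)
    then show "ennreal (LINT p|lborel. (\<phi> (p + (0, z)) * W0 (p + (0, z)) - \<phi> p * W0 p)\<^sup>2)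
      \<le> ennreal (2 * C) * ennreal (en \<phi> z) + ennreal (16 * bsup\<^sup>2 * C\<^sup>2 * vol) * ennreal (min ((norm z)\<^sup>2) 1)"
      using pt[of z] by (simp add: ennreal_leI)
  qed
  also have "\<dots> = ennreal (2 * C) * (\<integral>\<^sup>+z. ennreal (en \<phi> z) \<partial>\<nu>) + ennreal (16 * bsup\<^sup>2 * C\<^sup>2 * vol) * (\<integral>\<^sup>+z. ennreal (min ((norm z)\<^sup>2) 1) \<partial>\<nu>)"
    by (subst nn_integral_add) (auto simp: nn_integral_cmult)
  also have "\<dots> \<le> ennreal (2 * C) * ennreal (E1 C B) + ennreal (16 * bsup\<^sup>2 * C\<^sup>2 * vol) * ennreal \<Lambda>"
    by (intro add_mono mult_left_mono energy_full nn_bound) auto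
  also have "\<dots> = ennreal E2"
    unfolding E2_def using C_nonneg[OF test] k E1_nonneg \<Lambda>_nonneg
    by (simp add: ennreal_mult[symmetric] ennreal_plus[symmetric] del: ennreal_plus)
  finally show ?thesis .
qed

text \<open>Plancherel's theorem for each shift z, followed by Tonelli's theorem: the factors 2 (1 -
  cos) integrate to twice the multiplier, of which half is given away.\<close>

lemma fourier_energy:
  "(\<integral>\<^sup>+\<omega>. ennreal (levy_multiplier \<nu> (snd \<omega>)) * ennreal ((cmod (fourier (\<lambda>p. \<phi> p * W0 p) \<omega>))\<^sup>2) \<partial>lborel)
    \<le> ennreal ((2 * pi) ^ DIM(real \<times> 'a) * E2)"
proof -
  interpret S: sigma_finite_measure \<nu> by (rule sigma_finite_\<nu>)
  interpret P: pair_sigma_finite \<nu> "lborel :: (real \<times> 'a) measure" ..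
  define g where "g p = \<phi> p * W0 p" for p
  have gm [measurable]: "g \<in> borel_measurable borel" and gb: "\<bar>g p\<bar> \<le> C * (2 * bsup)" and gi: "integrable lborel g" for p
    unfolding g_def using product_facts by auto
  have [measurable]: "fourier g \<in> borel_measurable borel" by (rule fourier_measurable[OF gi])
  have gi': "integrable lborel (\<lambda>p. g (p + (0, z)))" for z
    using gi by (simp add: integrable_lborel_shift_iff)
  define c where "c = (2 * pi) ^ DIM(real \<times> 'a)"
  have c0: "0 \<le> c" by (simp add: c_def)
  have pl: "(\<integral>\<^sup>+\<omega>. ennreal (2 * (1 - cos (snd \<omega> \<bullet> z)) * (cmod (fourier g \<omega>))\<^sup>2) \<partial>lborel) =
     ennreal (c * (LINT p|lborel. (g (p + (0, z)) - g p)\<^sup>2))" for z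
  proof -
    have "(\<integral>\<^sup>+\<omega>. ennreal ((cmod (fourier (\<lambda>p. g (p + (0, z)) - g p) \<omega>))\<^sup>2) \<partial>lborel) =
      ennreal (c * (LINT p|lborel. (g (p + (0, z)) - g p)\<^sup>2))"
      unfolding c_def
    proof (rule plancherel)
      show "integrable lborel (\<lambda>p. g (p + (0, z)) - g p)" using gi gi' by simp
      show "\<bar>g (p + (0, z)) - g p\<bar> \<le> 2 * (C * (2 * bsup))" for p
        using gb[of p] gb[of "p + (0, z)"] by linarith
    qed
    then show ?thesis by (simp add: norm_fourier_shift_diff[OF gi] inner_prod_def)
  qed
  have "(\<integral>\<^sup>+\<omega>. ennreal (levy_multiplier \<nu> (snd \<omega>)) * ennreal ((cmod (fourier g \<omega>))\<^sup>2) \<partial>lborel)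
     \<le> (\<integral>\<^sup>+\<omega>. (\<integral>\<^sup>+z. ennreal (2 * (1 - cos (snd \<omega> \<bullet> z)) * (cmod (fourier g \<omega>))\<^sup>2) \<partial>\<nu>) \<partial>lborel)"
  proof (rule nn_integral_mono)
    fix \<omega> :: "real \<times> 'a"
    have "(\<integral>\<^sup>+z. ennreal (2 * (1 - cos (snd \<omega> \<bullet> z)) * (cmod (fourier g \<omega>))\<^sup>2) \<partial>\<nu>)
       = (\<integral>\<^sup>+z. ennreal (2 * (cmod (fourier g \<omega>))\<^sup>2) * ennreal (1 - cos (snd \<omega> \<bullet> z)) \<partial>\<nu>)"
      by (rule nn_integral_cong) (simp add: ennreal_mult[symmetric] mult_ac)
    also have "\<dots> = ennreal (2 * (cmod (fourier g \<omega>))\<^sup>2) * ennreal (levy_multiplier \<nu> (snd \<omega>))"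
      by (simp add: nn_integral_cmult nn_integral_multiplier)
    finally show "ennreal (levy_multiplier \<nu> (snd \<omega>)) * ennreal ((cmod (fourier g \<omega>))\<^sup>2)
       \<le> (\<integral>\<^sup>+z. ennreal (2 * (1 - cos (snd \<omega> \<bullet> z)) * (cmod (fourier g \<omega>))\<^sup>2) \<partial>\<nu>)"
      using multiplier_nonneg[of "snd \<omega>"] by (simp add: ennreal_mult[symmetric] mult_ac)
  qed
  also have "\<dots> = (\<integral>\<^sup>+z. (\<integral>\<^sup>+\<omega>. ennreal (2 * (1 - cos (snd \<omega> \<bullet> z)) * (cmod (fourier g \<omega>))\<^sup>2) \<partial>lborel) \<partial>\<nu>)"
  proof (rule P.Fubini')
    have [measurable]: "snd \<in> borel_measurable (borel :: (real \<times> 'a) measure)"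
      by (intro borel_measurable_continuous_onI continuous_intros)
    have "(\<lambda>x. ennreal (2 * (1 - cos (snd (snd x) \<bullet> fst x)) * (cmod (fourier g (snd x)))\<^sup>2)) \<in> borel_measurable (\<nu> \<Otimes>\<^sub>M lborel)"
      by measurable
    then show "(\<lambda>(z, \<omega>). ennreal (2 * (1 - cos (snd \<omega> \<bullet> z)) * (cmod (fourier g \<omega>))\<^sup>2)) \<in> borel_measurable (\<nu> \<Otimes>\<^sub>M lborel)"
      by (simp add: split_beta')
  qed
  also have "\<dots> = (\<integral>\<^sup>+z. ennreal c * ennreal (LINT p|lborel. (g (p + (0, z)) - g p)\<^sup>2) \<partial>\<nu>)"
    unfolding pl using c0 by (simp add: ennreal_mult)
  also have "\<dots> = ennreal c * (\<integral>\<^sup>+z. ennreal (LINT p|lborel. (g (p + (0, z)) - g p)\<^sup>2) \<partial>\<nu>)"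
    by (rule nn_integral_cmult) measurable
  also have "\<dots> \<le> ennreal c * ennreal E2"
    using product_difference_energy unfolding g_def by (intro mult_left_mono) auto
  finally show ?thesis
    using c0 E2_nonneg by (simp add: ennreal_mult[symmetric] g_def[abs_def] c_def)
qed

end

end

section \<open>Precompactness in square-integrable functions\<close>

text \<open>\<open>L2_dist\<close> evaluates arbitrary representatives chosen by
  \<open>SOME\<close>; they differ from the given ones on null sets only.\<close>

lemma L2_dist_class:
  assumes f: "f \<in> L2_fun M" and g: "g \<in> L2_fun M"
  shows "L2_dist M (L2_class M f) (L2_class M g) = sqrt (LINT x|M. (f x - g x)\<^sup>2)"
proof -
  have rep: "(SOME h. h \<in> L2_class M f) \<in> L2_class M f" if "f \<in> L2_fun M" for f
    using someI[of "\<lambda>h. h \<in> L2_class M f" f] that by (simp add: L2_class_def)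
  define f' g' where "f' = (SOME h. h \<in> L2_class M f)" and "g' = (SOME h. h \<in> L2_class M g)"
  have f': "f' \<in> L2_class M f" "g' \<in> L2_class M g" using rep f g by (simp_all add: f'_def g'_def)
  then have ae: "AE x in M. f' x = f x" "AE x in M. g' x = g x" by (auto simp: L2_class_def)
  have [measurable]: "f \<in> borel_measurable M" "g \<in> borel_measurable M" "f' \<in> borel_measurable M" "g' \<in> borel_measurable M"
    using f g f' by (auto simp: L2_class_def L2_fun_def)
  have "(LINT x|M. (f' x - g' x)\<^sup>2) = (LINT x|M. (f x - g x)\<^sup>2)"
    by (rule integral_cong_AE) (use ae in auto)
  then show ?thesis by (simp add: L2_dist_def f'_def g'_def)
qed

lemma fast_subsequence:
  fixes d :: "nat \<Rightarrow> nat \<Rightarrow> real"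
  assumes "\<And>e. e > 0 \<Longrightarrow> \<exists>N. \<forall>m\<ge>N. \<forall>n\<ge>N. d m n < e" and e: "\<And>i. e i > 0"
  obtains k :: "nat \<Rightarrow> nat" where "strict_mono k" "\<And>i. d (k (Suc i)) (k i) < e i"
proof -
  have "\<forall>i. \<exists>N. \<forall>m\<ge>N. \<forall>n\<ge>N. d m n < e i" using assms by blast
  then obtain N where N: "\<And>i m n. m \<ge> N i \<Longrightarrow> n \<ge> N i \<Longrightarrow> d m n < e i" by metis
  have "\<exists>k. \<forall>i. N i \<le> k i \<and> k i < k (Suc i)"
  proof (rule dependent_nat_choice)
    show "\<exists>x. N 0 \<le> x" by blast
    show "\<exists>y. N (Suc n) \<le> y \<and> x < y" for x n by (rule exI[of _ "max (N (Suc n)) (Suc x)"]) auto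
  qed
  then obtain k where k: "\<And>i. N i \<le> k i" "\<And>i. k i < k (Suc i)" by blast
  show ?thesis
  proof (rule that[of k])
    show "strict_mono k" using k(2) by (simp add: strict_mono_Suc_iff)
    show "d (k (Suc i)) (k i) < e i" for i
      by (rule N) (use k[of i] in auto)
  qed
qed

text \<open>The argument of Riesz and Fischer. Along a subsequence with squared steps below (1/8)^i
  the weights 4^i still leave a summable (1/2)^i, so almost everywhere the steps are bounded by a
  geometric series and the subsequence converges. Fatou's lemma then transfers the Cauchy estimate
  to the limit.\<close>

lemma L2_complete:
  fixes f :: "nat \<Rightarrow> 'm \<Rightarrow> real"
  assumes f: "\<And>n. f n \<in> L2_fun M"
    and cauchy: "\<And>e. e > 0 \<Longrightarrow> \<exists>N. \<forall>m\<ge>N. \<forall>n\<ge>N. (LINT x|M. (f m x - f n x)\<^sup>2) < e"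
  obtains g where "g \<in> L2_fun M" "(\<lambda>n. LINT x|M. (f n x - g x)\<^sup>2) \<longlonglongrightarrow> 0"
proof -
  have [measurable]: "f n \<in> borel_measurable M" for n using f by (simp add: L2_fun_def)
  have sq: "integrable M (\<lambda>x. (f m x - f n x)\<^sup>2)" for m n
    using L2_diff[OF f[of m] f[of n]] by (simp add: L2_fun_def)
  obtain k where k: "strict_mono k" "\<And>i. (LINT x|M. (f (k (Suc i)) x - f (k i) x)\<^sup>2) < (1/8) ^ i"
    using fast_subsequence[of "\<lambda>m n. LINT x|M. (f m x - f n x)\<^sup>2" "\<lambda>i. (1/8) ^ i", OF cauchy] by auto
  define d where "d i x = f (k (Suc i)) x - f (k i) x" for i x
  have [measurable]: "d i \<in> borel_measurable M" for i unfolding d_def by measurable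
  have "(\<integral>\<^sup>+x. (\<Sum>i. ennreal (4 ^ i * (d i x)\<^sup>2)) \<partial>M) = (\<Sum>i. \<integral>\<^sup>+x. ennreal (4 ^ i * (d i x)\<^sup>2) \<partial>M)"
    by (rule nn_integral_suminf) measurable
  also have "\<dots> \<le> (\<Sum>i. ennreal ((1/2) ^ i))"
  proof (intro suminf_le allI)
    fix i
    have "(\<integral>\<^sup>+x. ennreal (4 ^ i * (d i x)\<^sup>2) \<partial>M) = ennreal (4 ^ i * (LINT x|M. (d i x)\<^sup>2))"
      using sq[of "k (Suc i)" "k i"] by (subst nn_integral_eq_integral) (auto simp: d_def)
    also have "\<dots> \<le> ennreal (4 ^ i * (1/8) ^ i)"
      using k(2)[of i] by (intro ennreal_leI mult_left_mono) (auto simp: d_def)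
    also have "(4::real) ^ i * (1/8) ^ i = (1/2) ^ i" by (simp flip: power_mult_distrib)
    finally show "(\<integral>\<^sup>+x. ennreal (4 ^ i * (d i x)\<^sup>2) \<partial>M) \<le> ennreal ((1/2) ^ i)" .
  qed auto
  also have "\<dots> = ennreal (\<Sum>i. (1/2) ^ i)"
    by (rule suminf_ennreal2) (simp_all add: summable_geometric)
  also have "\<dots> < \<infinity>" by simp
  finally have "AE x in M. (\<Sum>i. ennreal (4 ^ i * (d i x)\<^sup>2)) \<noteq> \<infinity>"
    by (intro nn_integral_PInf_AE) (auto simp: less_top)
  then have conv: "AE x in M. convergent (\<lambda>i. f (k i) x)"
  proof eventually_elim
    case (elim x)
    define S' where "S' = (\<Sum>i. ennreal (4 ^ i * (d i x)\<^sup>2))"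
    have "S' \<noteq> \<infinity>" using elim unfolding S'_def .
    then obtain S where S: "S' = ennreal S" "0 \<le> S" by (cases S') auto
    have four: "(4::real) ^ i = 2 ^ i * 2 ^ i" for i
      by (simp flip: power_mult_distrib)
    have "\<bar>d i x\<bar> \<le> sqrt S * (1/2) ^ i" for i
    proof -
      have "sum (\<lambda>i. ennreal (4 ^ i * (d i x)\<^sup>2)) {i} \<le> S'"
        unfolding S'_def by (rule sum_le_suminf) auto
      then have "ennreal (4 ^ i * (d i x)\<^sup>2) \<le> ennreal S" unfolding S(1) by simp
      then have "4 ^ i * (d i x)\<^sup>2 \<le> S" using S(2) by (simp add: ennreal_le_iff)
      then have "(2 ^ i * d i x)\<^sup>2 \<le> S" using four[of i] by (simp add: power2_eq_square mult_ac)
      then have "\<bar>2 ^ i * d i x\<bar> \<le> sqrt S" using real_le_rsqrt by (metis real_sqrt_abs real_sqrt_le_mono)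
      then show ?thesis by (simp add: abs_mult field_simps)
    qed
    then have db: "norm (d i x) \<le> sqrt S * (1/2) ^ i" for i by simp
    have "summable (\<lambda>i. sqrt S * (1/2) ^ i)"
      by (rule summable_mult, rule summable_geometric) simp
    then have "summable (\<lambda>i. d i x)"
      by (rule summable_comparison_test'[of _ 0]) (rule db)
    then have "convergent (\<lambda>n. \<Sum>i<n. d i x)"
      by (simp add: summable_iff_convergent)
    then have "convergent (\<lambda>n. f (k n) x - f (k 0) x)"
      using sum_lessThan_telescope[of "\<lambda>i. f (k i) x"] by (simp add: d_def)
    from convergent_add[OF this convergent_const[of "f (k 0) x"]] show ?case by simp
  qed
  define g where "g x = lim (\<lambda>i. f (k i) x)" for x
  have [measurable]: "g \<in> borel_measurable M" unfolding g_def by (rule borel_measurable_lim_metric) measurable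
  have lim: "AE x in M. (\<lambda>i. f (k i) x) \<longlonglongrightarrow> g x"
    using conv by eventually_elim (simp add: g_def convergent_LIMSEQ_iff)
  have close: "(\<integral>\<^sup>+x. ennreal ((f n x - g x)\<^sup>2) \<partial>M) \<le> ennreal e"
    if N: "\<forall>m\<ge>N. \<forall>n\<ge>N. (LINT x|M. (f m x - f n x)\<^sup>2) < e" and n: "n \<ge> N" for e N n
  proof -
    have "(\<integral>\<^sup>+x. ennreal ((f n x - g x)\<^sup>2) \<partial>M) = (\<integral>\<^sup>+x. liminf (\<lambda>i. ennreal ((f n x - f (k i) x)\<^sup>2)) \<partial>M)"
    proof (rule nn_integral_cong_AE)
      show "AE x in M. ennreal ((f n x - g x)\<^sup>2) = liminf (\<lambda>i. ennreal ((f n x - f (k i) x)\<^sup>2))"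
        using lim
      proof eventually_elim
        case (elim x)
        then have "(\<lambda>i. ennreal ((f n x - f (k i) x)\<^sup>2)) \<longlonglongrightarrow> ennreal ((f n x - g x)\<^sup>2)"
          by (intro tendsto_ennrealI tendsto_intros)
        then show ?case using lim_imp_Liminf by (metis trivial_limit_sequentially)
      qed
    qed
    also have "\<dots> \<le> liminf (\<lambda>i. \<integral>\<^sup>+x. ennreal ((f n x - f (k i) x)\<^sup>2) \<partial>M)"
      by (rule nn_integral_liminf) measurable
    also have "\<dots> \<le> ennreal e"
    proof (rule Liminf_le)
      have "(\<integral>\<^sup>+x. ennreal ((f n x - f (k i) x)\<^sup>2) \<partial>M) \<le> ennreal e" if "i \<ge> N" for i
      proof -
        have "k i \<ge> N" using seq_suble[OF k(1), of i] that by simp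
        then have "(LINT x|M. (f n x - f (k i) x)\<^sup>2) < e" using N n by blast
        then show ?thesis
          using sq[of n "k i"] by (subst nn_integral_eq_integral) (auto intro: ennreal_leI)
      qed
      then show "\<forall>\<^sub>F i in sequentially. (\<integral>\<^sup>+x. ennreal ((f n x - f (k i) x)\<^sup>2) \<partial>M) \<le> ennreal e"
        by (auto simp: eventually_sequentially)
    qed simp
    finally show ?thesis .
  qed
  obtain N1 where N1: "\<forall>m\<ge>N1. \<forall>n\<ge>N1. (LINT x|M. (f m x - f n x)\<^sup>2) < 1" using cauchy[of 1] by auto
  have "integrable M (\<lambda>x. (f n x - g x)\<^sup>2)" if "n \<ge> N1" for n
    using close[OF N1 that] by (intro integrableI_nonneg) (auto simp: le_less_trans)
  then have "(\<lambda>x. f N1 x - g x) \<in> L2_fun M" by (simp add: L2_fun_def)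
  from L2_diff[OF f[of N1] this] have gL: "g \<in> L2_fun M" by simp
  have diff': "integrable M (\<lambda>x. (f n x - g x)\<^sup>2)" for n
    using L2_diff[OF f[of n] gL] by (simp add: L2_fun_def)
  have "(\<lambda>n. LINT x|M. (f n x - g x)\<^sup>2) \<longlonglongrightarrow> 0"
  proof (rule tendstoI)
    fix e :: real assume "e > 0"
    then obtain N where N: "\<forall>m\<ge>N. \<forall>n\<ge>N. (LINT x|M. (f m x - f n x)\<^sup>2) < e / 2" using cauchy[of "e/2"] by auto
    have "(LINT x|M. (f n x - g x)\<^sup>2) < e" if "n \<ge> N" for n
    proof -
      have "ennreal (LINT x|M. (f n x - g x)\<^sup>2) \<le> ennreal (e / 2)"
        using close[OF N that] diff'[of n] by (subst (asm) nn_integral_eq_integral) auto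
      then show ?thesis using \<open>e > 0\<close> by (simp add: ennreal_le_iff)
    qed
    then show "\<forall>\<^sub>F n in sequentially. dist (LINT x|M. (f n x - g x)\<^sup>2) 0 < e"
      by (auto simp: eventually_sequentially dist_real_def)
  qed
  with gL show ?thesis by (rule that)
qed

lemma L2_mcomplete: "Metric_space.mcomplete (L2_space M) (L2_dist M)"
proof -
  interpret Metric_space "L2_space M" "L2_dist M" by (rule Metric_space_L2)
  show ?thesis
    unfolding mcomplete_def
  proof (intro allI impI)
    fix \<sigma> assume \<sigma>: "MCauchy \<sigma>"
    then have "range \<sigma> \<subseteq> L2_space M" unfolding MCauchy_def by blast
    then have "\<forall>n. \<exists>h. h \<in> L2_fun M \<and> \<sigma> n = L2_class M h" by (auto simp: L2_space_def)
    then obtain f where "\<forall>n. f n \<in> L2_fun M \<and> \<sigma> n = L2_class M (f n)"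
      unfolding choice_iff by blast
    then have f: "\<And>n. f n \<in> L2_fun M" "\<And>n. \<sigma> n = L2_class M (f n)" by blast+
    have dist: "L2_dist M (\<sigma> m) (\<sigma> n) = sqrt (LINT x|M. (f m x - f n x)\<^sup>2)" for m n
      by (simp add: f L2_dist_class)
    have "\<exists>N. \<forall>m\<ge>N. \<forall>n\<ge>N. (LINT x|M. (f m x - f n x)\<^sup>2) < e" if e: "e > 0" for e
    proof -
      have "sqrt e > 0" using e by simp
      then obtain N where "\<forall>m n. N \<le> m \<longrightarrow> N \<le> n \<longrightarrow> L2_dist M (\<sigma> m) (\<sigma> n) < sqrt e"
        using \<sigma> unfolding MCauchy_def by blast
      then show ?thesis unfolding dist by auto
    qed
    then obtain g where g: "g \<in> L2_fun M" "(\<lambda>n. LINT x|M. (f n x - g x)\<^sup>2) \<longlonglongrightarrow> 0"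
      using L2_complete[of f M] f(1) by blast
    have "(\<lambda>n. L2_dist M (\<sigma> n) (L2_class M g)) \<longlonglongrightarrow> 0"
      using tendsto_real_sqrt[OF g(2)] by (simp add: f L2_dist_class g(1))
    moreover have "L2_class M g \<in> L2_space M" using g(1) by (simp add: L2_space_def)
    moreover have "\<forall>\<^sub>F n in sequentially. \<sigma> n \<in> L2_space M" using f by (simp add: L2_space_def)
    ultimately have "limitin mtopology \<sigma> (L2_class M g) sequentially"
      unfolding limitin_metric by (auto simp: tendsto_iff dist_real_def elim: eventually_elim2)
    then show "\<exists>x. limitin mtopology \<sigma> x sequentially" by blast
  qed
qed

text \<open>A sequence drawn from the range of a family may repeat or permute its members. If no
  value recurs infinitely often, only finitely many indices carry values up to a given one, so
  larger values can always be found further on.\<close>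

lemma nat_sequence_cases:
  fixes \<iota> :: "nat \<Rightarrow> nat"
  obtains (const) g c where "strict_mono (g :: nat \<Rightarrow> nat)" "\<And>i. \<iota> (g i) = c"
  | (mono) g where "strict_mono (g :: nat \<Rightarrow> nat)" "strict_mono (\<lambda>i. \<iota> (g i))"
proof (cases "\<exists>c. infinite {i. \<iota> i = c}")
  case True
  then obtain c where c: "infinite {i. \<iota> i = c}" by blast
  show ?thesis
    by (rule const[of "enumerate {i. \<iota> i = c}" c])
      (use c enumerate_in_set[OF c] in \<open>auto simp: strict_mono_enumerate\<close>)
next
  case False
  have ex: "\<exists>j>i. \<iota> j > \<iota> i" for i
  proof -
    have "finite (\<Union>c\<in>{..\<iota> i}. {j. \<iota> j = c})" using False by auto
    then have "finite ({..i} \<union> (\<Union>c\<in>{..\<iota> i}. {j. \<iota> j = c}))" by simp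
    then obtain j where "j \<notin> {..i} \<union> (\<Union>c\<in>{..\<iota> i}. {j. \<iota> j = c})"
      using ex_new_if_finite infinite_UNIV_nat by blast
    then show ?thesis by (auto simp: not_le)
  qed
  have "\<exists>g. \<forall>i. True \<and> g i < g (Suc i) \<and> \<iota> (g i) < \<iota> (g (Suc i))"
    by (rule dependent_nat_choice) (use ex in auto)
  then obtain g where "\<And>i. g i < g (Suc i)" "\<And>i. \<iota> (g i) < \<iota> (g (Suc i))" by blast
  then show ?thesis by (intro mono[of g]) (auto simp: strict_mono_Suc_iff)
qed

text \<open>In a complete space precompactness is total boundedness, used here in sequential form. A
  constant subsequence of indices is trivially Cauchy; a strictly increasing one is covered by the
  hypothesis.\<close>

lemma L2_precompactI:
  fixes F :: "nat \<Rightarrow> 'm \<Rightarrow> real"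
  assumes F: "\<And>n. F n \<in> L2_fun M"
    and sub: "\<And>r. strict_mono (r :: nat \<Rightarrow> nat) \<Longrightarrow> \<exists>r' :: nat \<Rightarrow> nat. strict_mono r' \<and>
       (\<forall>e>0. \<exists>N. \<forall>i\<ge>N. \<forall>j\<ge>N. (LINT x|M. (F (r (r' i)) x - F (r (r' j)) x)\<^sup>2) < e)"
  shows "L2_precompact M (range F)"
proof -
  interpret Metric_space "L2_space M" "L2_dist M" by (rule Metric_space_L2)
  have cls: "L2_class M (F n) \<in> L2_space M" for n using F by (simp add: L2_space_def)
  have "mtotally_bounded (L2_class M ` range F)"
    unfolding mtotally_bounded_sequentially
  proof (intro conjI allI impI)
    show "L2_class M ` range F \<subseteq> L2_space M" using cls by auto
    fix \<sigma> :: "nat \<Rightarrow> ('m \<Rightarrow> real) set" assume "range \<sigma> \<subseteq> L2_class M ` range F"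
    then have "\<forall>n. \<exists>m. \<sigma> n = L2_class M (F m)" by auto
    then obtain \<iota> where \<iota>: "\<And>n. \<sigma> n = L2_class M (F (\<iota> n))" by metis
    show "\<exists>r. strict_mono r \<and> MCauchy (\<sigma> \<circ> r)"
    proof (cases rule: nat_sequence_cases[of \<iota>])
      case (const g c)
      have "MCauchy (\<sigma> \<circ> g)"
        unfolding MCauchy_def using cls by (auto simp: \<iota> const(2) image_subset_iff)
      with const(1) show ?thesis by blast
    next
      case (mono g)
      obtain r' :: "nat \<Rightarrow> nat" where r': "strict_mono r'"
        "\<forall>e>0. \<exists>N. \<forall>i\<ge>N. \<forall>j\<ge>N. (LINT x|M. (F (\<iota> (g (r' i))) x - F (\<iota> (g (r' j))) x)\<^sup>2) < e"
        using sub[OF mono(2)] by blast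
      have "MCauchy (\<sigma> \<circ> (g \<circ> r'))"
        unfolding MCauchy_def
      proof (intro conjI allI impI)
        show "range (\<sigma> \<circ> (g \<circ> r')) \<subseteq> L2_space M" using cls by (auto simp: \<iota>)
        fix e :: real assume "e > 0"
        then obtain N where N: "\<forall>i\<ge>N. \<forall>j\<ge>N. (LINT x|M. (F (\<iota> (g (r' i))) x - F (\<iota> (g (r' j))) x)\<^sup>2) < e\<^sup>2"
          using r'(2) by (meson zero_less_power)
        have "L2_dist M ((\<sigma> \<circ> (g \<circ> r')) i) ((\<sigma> \<circ> (g \<circ> r')) j) < e" if "N \<le> i" "N \<le> j" for i j
        proof -
          have "sqrt (LINT x|M. (F (\<iota> (g (r' i))) x - F (\<iota> (g (r' j))) x)\<^sup>2) < sqrt (e\<^sup>2)"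
            using N that by (intro real_sqrt_less_mono) auto
          then show ?thesis using \<open>e > 0\<close> by (simp add: \<iota> L2_dist_class F)
        qed
        then show "\<exists>N. \<forall>n n'. N \<le> n \<longrightarrow> N \<le> n' \<longrightarrow> L2_dist M ((\<sigma> \<circ> (g \<circ> r')) n) ((\<sigma> \<circ> (g \<circ> r')) n') < e" by blast
      qed
      then show ?thesis using strict_mono_o[OF mono(1) r'(1)] by blast
    qed
  qed
  then have "compactin mtopology (mtopology closure_of (L2_class M ` range F))"
    using mtotally_bounded_eq_compact_closure_of[OF L2_mcomplete] by blast
  then show ?thesis using F by (auto simp: L2_precompact_def L2_topology_def)
qed

section \<open>Compensated compactness\<close>

lemma
  fixes g :: "'b::euclidean_space \<Rightarrow> real"
  assumes g: "integrable lborel g" and B: "\<And>x. \<bar>g x\<bar> \<le> B"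
  shows fourier_L2_integrable: "integrable lborel (\<lambda>p. (cmod (fourier g p))\<^sup>2)"
    and plancherel_integral: "(LINT p|lborel. (cmod (fourier g p))\<^sup>2) = (2 * pi) ^ DIM('b) * (LINT x|lborel. (g x)\<^sup>2)"
proof -
  have [measurable]: "fourier g \<in> borel_measurable borel" by (rule fourier_measurable[OF g])
  note pl = plancherel[OF g B]
  show *: "integrable lborel (\<lambda>p. (cmod (fourier g p))\<^sup>2)"
    by (rule integrableI_nonneg) (auto simp: pl)
  have "ennreal (LINT p|lborel. (cmod (fourier g p))\<^sup>2) = ennreal ((2 * pi) ^ DIM('b) * (LINT x|lborel. (g x)\<^sup>2))"
    using pl nn_integral_eq_integral[OF *] by simp
  moreover have "0 \<le> (2 * pi) ^ DIM('b) * (LINT x|lborel. (g x)\<^sup>2)"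
    by (intro mult_nonneg_nonneg Bochner_Integration.integral_nonneg) auto
  moreover have "0 \<le> (LINT p|lborel. (cmod (fourier g p))\<^sup>2)"
    by (intro Bochner_Integration.integral_nonneg) auto
  ultimately show "(LINT p|lborel. (cmod (fourier g p))\<^sup>2) = (2 * pi) ^ DIM('b) * (LINT x|lborel. (g x)\<^sup>2)"
    using ennreal_inj by blast
qed

lemma complex_polarization: "(cmod (a + b))\<^sup>2 - (cmod (a - b))\<^sup>2 \<le> 4 * (cmod a * cmod b)"
proof -
  have "(cmod (a + b))\<^sup>2 - (cmod (a - b))\<^sup>2 = 4 * (a \<bullet> b)"
    by (simp add: power2_norm_eq_inner inner_add_left inner_add_right inner_diff_left inner_diff_right inner_commute)
  also have "\<dots> \<le> 4 * (cmod a * cmod b)" using norm_cauchy_schwarz[of a b] by simp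
  finally show ?thesis .
qed

text \<open>Polarisation and Plancherel's theorem move the pairing to frequencies. There Young's
  inequality is weighted so that the large factor 1 / l falls on a transform known to be small: that
  of \<open>G\<close> on \<open>D\<close>, that of \<open>A\<close> off \<open>D\<close>. Everything
  else carries the small factor l.\<close>

lemma fourier_pairing_bound:
  fixes A G :: "'b::euclidean_space \<Rightarrow> real"
  assumes A: "integrable lborel A" "\<And>x. \<bar>A x\<bar> \<le> a" and G: "integrable lborel G" "\<And>x. \<bar>G x\<bar> \<le> g"
    and D: "D \<in> sets borel" and l: "l > 0"
  shows "(2 * pi) ^ DIM('b) * (LINT x|lborel. A x * G x) \<le>
    l / 2 * ((2 * pi) ^ DIM('b) * ((LINT x|lborel. (A x)\<^sup>2) + (LINT x|lborel. (G x)\<^sup>2)))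
    + 1 / (2 * l) * ((LINT p|lborel. indicator D p * (cmod (fourier G p))\<^sup>2) + (LINT p|lborel. indicator (- D) p * (cmod (fourier A p))\<^sup>2))"
proof -
  have [measurable]: "A \<in> borel_measurable borel" "G \<in> borel_measurable borel" using A G by auto
  have [measurable]: "fourier A \<in> borel_measurable borel" "fourier G \<in> borel_measurable borel"
    using A G by (auto intro: fourier_measurable)
  define c where "c = (2 * pi) ^ DIM('b)"
  have S: "integrable lborel (\<lambda>x. A x + G x)" "\<And>x. \<bar>A x + G x\<bar> \<le> a + g"
    using A G by (auto intro: order_trans[OF abs_triangle_ineq] add_mono)
  have M: "integrable lborel (\<lambda>x. A x - G x)" "\<And>x. \<bar>A x - G x\<bar> \<le> a + g"
    using A G by (auto intro: order_trans[OF abs_triangle_ineq4] add_mono)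
  have sq: "integrable lborel (\<lambda>x. (f x)\<^sup>2)" if f: "integrable lborel f" "\<And>x. \<bar>f x\<bar> \<le> k" for f :: "'b \<Rightarrow> real" and k
  proof (rule Bochner_Integration.integrable_bound)
    show "integrable lborel (\<lambda>x. k * f x)" using f by simp
    have "\<bar>f x\<bar> * \<bar>f x\<bar> \<le> \<bar>k\<bar> * \<bar>f x\<bar>" for x
      using f(2)[of x] by (intro mult_right_mono) auto
    then show "AE x in lborel. norm ((f x)\<^sup>2) \<le> norm (k * f x)" by (simp add: power2_eq_square abs_mult)
  qed (use f in auto)
  have iS: "integrable lborel (\<lambda>x. (A x + G x)\<^sup>2)" and iM: "integrable lborel (\<lambda>x. (A x - G x)\<^sup>2)"
    using sq[OF S] sq[OF M] by auto
  have fS: "integrable lborel (\<lambda>p. (cmod (fourier A p + fourier G p))\<^sup>2)"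
    "(LINT p|lborel. (cmod (fourier A p + fourier G p))\<^sup>2) = c * (LINT x|lborel. (A x + G x)\<^sup>2)"
    using fourier_L2_integrable[OF S] plancherel_integral[OF S] by (simp_all add: fourier_add A G c_def)
  have fM: "integrable lborel (\<lambda>p. (cmod (fourier A p - fourier G p))\<^sup>2)"
    "(LINT p|lborel. (cmod (fourier A p - fourier G p))\<^sup>2) = c * (LINT x|lborel. (A x - G x)\<^sup>2)"
    using fourier_L2_integrable[OF M] plancherel_integral[OF M] by (simp_all add: fourier_diff A G c_def)
  note fA = fourier_L2_integrable[OF A] plancherel_integral[OF A, folded c_def]
  note fG = fourier_L2_integrable[OF G] plancherel_integral[OF G, folded c_def]
  have "4 * (LINT x|lborel. A x * G x) = (LINT x|lborel. 4 * (A x * G x))"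
    by (rule integral_mult_right_zero[symmetric])
  also have "\<dots> = (LINT x|lborel. (A x + G x)\<^sup>2 - (A x - G x)\<^sup>2)"
    by (rule Bochner_Integration.integral_cong) (auto simp: power2_eq_square algebra_simps)
  also have "\<dots> = (LINT x|lborel. (A x + G x)\<^sup>2) - (LINT x|lborel. (A x - G x)\<^sup>2)"
    by (rule Bochner_Integration.integral_diff[OF iS iM])
  finally have "4 * (c * (LINT x|lborel. A x * G x)) = c * (LINT x|lborel. (A x + G x)\<^sup>2) - c * (LINT x|lborel. (A x - G x)\<^sup>2)"
    by (simp only: mult.left_commute[of 4 c] right_diff_distrib)
  also have "\<dots> = (LINT p|lborel. (cmod (fourier A p + fourier G p))\<^sup>2 - (cmod (fourier A p - fourier G p))\<^sup>2)"
    using fS fM by simp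
  finally have pol: "4 * (c * (LINT x|lborel. A x * G x)) =
     (LINT p|lborel. (cmod (fourier A p + fourier G p))\<^sup>2 - (cmod (fourier A p - fourier G p))\<^sup>2)" .
  define P where "P p = (cmod (fourier A p))\<^sup>2" for p
  define R where "R p = (cmod (fourier G p))\<^sup>2" for p
  have PR: "integrable lborel P" "integrable lborel R" using fA(1) fG(1) by (simp_all add: P_def[abs_def] R_def[abs_def])
  have iD: "integrable lborel (\<lambda>p. indicator D p * R p)" "integrable lborel (\<lambda>p. indicator (- D) p * P p)"
    using D PR by (auto intro!: integrable_real_mult_indicator simp: mult.commute[of "indicator _ _"])
  have quarter: "(2 * l * x + 2 / l * y) / 4 = l / 2 * x + 1 / (2 * l) * y" for x y :: real
    using l by (simp add: field_simps)
  have am: "2 * (x * y) \<le> l * x\<^sup>2 + 1 / l * y\<^sup>2" for x y :: real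
  proof -
    have "0 \<le> (sqrt l * x - 1 / sqrt l * y)\<^sup>2" by simp
    also have "\<dots> = l * x\<^sup>2 + 1 / l * y\<^sup>2 - 2 * (x * y)"
      using l by (simp add: power2_diff power_mult_distrib power_divide)
    finally show ?thesis by simp
  qed
  have pt: "(cmod (fourier A p + fourier G p))\<^sup>2 - (cmod (fourier A p - fourier G p))\<^sup>2
      \<le> 2 * l * (P p + R p) + 2 / l * (indicator D p * R p + indicator (- D) p * P p)" for p
  proof -
    have PR0: "0 \<le> P p" "0 \<le> R p" by (simp_all add: P_def R_def)
    have gen: "4 * x \<le> 2 * (a + b) + 2 * c" if "2 * x \<le> a + b" "0 \<le> c" for a b c x :: real
    proof -
      have "4 * x = 2 * (2 * x)" by simp
      also have "\<dots> \<le> 2 * (a + b)" using that(1) by (intro mult_left_mono) auto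
      also have "\<dots> \<le> 2 * (a + b) + 2 * c" using that(2) by simp
      finally show ?thesis .
    qed
    have "(cmod (fourier A p + fourier G p))\<^sup>2 - (cmod (fourier A p - fourier G p))\<^sup>2 \<le> 4 * (cmod (fourier A p) * cmod (fourier G p))"
      by (rule complex_polarization)
    also have "\<dots> \<le> 2 * l * (P p + R p) + 2 / l * (indicator D p * R p + indicator (- D) p * P p)"
    proof (cases "p \<in> D")
      case True
      have "2 * (cmod (fourier A p) * cmod (fourier G p)) \<le> l * P p + 1 / l * R p"
        using am[of "cmod (fourier A p)" "cmod (fourier G p)"] by (simp add: P_def R_def)
      moreover have "0 \<le> l * R p" using PR0 l by simp
      ultimately have "4 * (cmod (fourier A p) * cmod (fourier G p)) \<le> 2 * (l * P p + 1 / l * R p) + 2 * (l * R p)"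
        by (rule gen)
      also have "\<dots> = 2 * l * (P p + R p) + 2 / l * (indicator D p * R p + indicator (- D) p * P p)"
        using True by (simp add: algebra_simps)
      finally show ?thesis .
    next
      case False
      have "2 * (cmod (fourier A p) * cmod (fourier G p)) \<le> l * R p + 1 / l * P p"
        using am[of "cmod (fourier G p)" "cmod (fourier A p)"] by (simp add: P_def R_def mult.commute)
      moreover have "0 \<le> l * P p" using PR0 l by simp
      ultimately have "4 * (cmod (fourier A p) * cmod (fourier G p)) \<le> 2 * (l * R p + 1 / l * P p) + 2 * (l * P p)"
        by (rule gen)
      also have "\<dots> = 2 * l * (P p + R p) + 2 / l * (indicator D p * R p + indicator (- D) p * P p)"
        using False by (simp add: algebra_simps)
      finally show ?thesis .
    qed
    finally show ?thesis .
  qed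
  have "4 * (c * (LINT x|lborel. A x * G x)) \<le> (LINT p|lborel. 2 * l * (P p + R p) + 2 / l * (indicator D p * R p + indicator (- D) p * P p))"
    unfolding pol by (rule integral_mono) (use fS fM PR iD pt in auto)
  also have "\<dots> = 2 * l * ((LINT p|lborel. P p) + (LINT p|lborel. R p)) + 2 / l * ((LINT p|lborel. indicator D p * R p) + (LINT p|lborel. indicator (- D) p * P p))"
    using PR iD by simp
  finally have "4 * (c * (LINT x|lborel. A x * G x)) \<le>
     2 * l * (c * ((LINT x|lborel. (A x)\<^sup>2) + (LINT x|lborel. (G x)\<^sup>2))) + 2 / l * ((LINT p|lborel. indicator D p * R p) + (LINT p|lborel. indicator (- D) p * P p))"
    using fA(2) fG(2) by (simp add: P_def R_def distrib_left)
  then have "c * (LINT x|lborel. A x * G x) \<le> (2 * l * (c * ((LINT x|lborel. (A x)\<^sup>2) + (LINT x|lborel. (G x)\<^sup>2))) + 2 / l * ((LINT p|lborel. indicator D p * R p) + (LINT p|lborel. indicator (- D) p * P p))) / 4"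
    by (simp only: pos_le_divide_eq[OF zero_less_numeral] mult.commute[of _ 4])
  also have "\<dots> = l / 2 * (c * ((LINT x|lborel. (A x)\<^sup>2) + (LINT x|lborel. (G x)\<^sup>2)))
      + 1 / (2 * l) * ((LINT p|lborel. indicator D p * R p) + (LINT p|lborel. indicator (- D) p * P p))"
    by (rule quarter)
  finally show ?thesis unfolding c_def P_def R_def .
qed

text \<open>A substitute for the Lipschitz bound on \<open>b\<close>, in which the first term can be made small.\<close>

lemma uniform_monotone_bound:
  fixes b :: "real \<Rightarrow> real"
  assumes b: "continuous_on UNIV b" "mono b" and e: "e > 0" and K: "0 \<le> K"
  obtains c where "c > 0" "\<And>x y. \<bar>x\<bar> \<le> K \<Longrightarrow> \<bar>y\<bar> \<le> K \<Longrightarrow> (b x - b y)\<^sup>2 \<le> e + c * ((x - y) * (b x - b y))"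
proof -
  have "uniformly_continuous_on {-K..K} b"
    using b(1) by (intro compact_uniformly_continuous continuous_on_subset[OF b(1)]) auto
  then obtain d where d: "d > 0" "\<And>x y. x \<in> {-K..K} \<Longrightarrow> y \<in> {-K..K} \<Longrightarrow> dist x y < d \<Longrightarrow> dist (b x) (b y) < sqrt e"
    using e unfolding uniformly_continuous_on_def by (metis dist_commute real_sqrt_gt_0_iff)
  define H where "H = b K - b (- K)"
  have H: "0 \<le> H" using monoD[OF b(2), of "-K" K] K by (simp add: H_def)
  have nn: "(x - y) * (b x - b y) = \<bar>x - y\<bar> * \<bar>b x - b y\<bar>" for x y
    using monoD[OF b(2), of x y] monoD[OF b(2), of y x] by (cases "x \<le> y") (auto simp: abs_real_def algebra_simps)
  show ?thesis
  \<comment> \<open>For |x - y| \<ge> d the oscillation H is at most (H / d) |x - y|, so the product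
    term dominates; the summand 1 makes the constant positive even if H = 0.\<close>
  proof (rule that[of "H / d + 1"])
    show "H / d + 1 > 0" using H d(1) by (simp add: add_nonneg_pos)
    fix x y :: real assume xy: "\<bar>x\<bar> \<le> K" "\<bar>y\<bar> \<le> K"
    show "(b x - b y)\<^sup>2 \<le> e + (H / d + 1) * ((x - y) * (b x - b y))"
    proof (cases "\<bar>x - y\<bar> < d")
      case True
      then have "\<bar>b x - b y\<bar> < sqrt e" using d(2)[of x y] xy by (simp add: dist_real_def abs_le_iff)
      then have "\<bar>b x - b y\<bar>\<^sup>2 \<le> (sqrt e)\<^sup>2" by (intro power_mono) auto
      then have "(b x - b y)\<^sup>2 \<le> e" using e by simp
      moreover have "0 \<le> (H / d + 1) * ((x - y) * (b x - b y))" unfolding nn using H d(1) by simp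
      ultimately show ?thesis by linarith
    next
      case False
      have "\<bar>b x - b y\<bar> \<le> H"
        using monoD[OF b(2), of "-K" x] monoD[OF b(2), of "-K" y] monoD[OF b(2), of x K] monoD[OF b(2), of y K] xy
        by (simp add: H_def abs_le_iff)
      then have "(b x - b y)\<^sup>2 \<le> H * \<bar>b x - b y\<bar>"
        using mult_right_mono[of "\<bar>b x - b y\<bar>" H "\<bar>b x - b y\<bar>"] by (simp add: power2_eq_square abs_mult_self_eq)
      also have "H \<le> (H / d) * \<bar>x - y\<bar>"
        using False d(1) H mult_left_mono[of d "\<bar>x - y\<bar>" "H / d"] by simp
      then have "H * \<bar>b x - b y\<bar> \<le> (H / d) * \<bar>x - y\<bar> * \<bar>b x - b y\<bar>" by (intro mult_right_mono) auto
      also have "\<dots> \<le> e + (H / d + 1) * ((x - y) * (b x - b y))"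
        unfolding nn using e by (simp add: algebra_simps)
      finally show ?thesis .
    qed
  qed
qed

lemma integrable_low_frequency:
  "integrable lborel (\<lambda>\<omega> :: real \<times> 'a::euclidean_space. c / (1 + (fst \<omega>)\<^sup>2) * indicator {\<omega>. norm (snd \<omega>) < R} \<omega>)"
proof -
  have "set_integrable lborel (einterval (-\<infinity>) \<infinity>) (\<lambda>x::real. inverse (1 + x\<^sup>2))"
    by (rule integrable_inverse_1_plus_square)
  then have 1: "integrable lborel (\<lambda>x::real. c * inverse (1 + x\<^sup>2))" by (simp add: set_integrable_def)
  have 2: "integrable lborel (indicator (ball (0::'a) R) :: 'a \<Rightarrow> real)"
    by (rule integrable_bounded_support[of _ 1 "ball 0 R"]) (simp_all add: borel_measurable_indicator indicator_def)
  from integrable_tensor[OF sigma_finite_lborel sigma_finite_lborel 1 2]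
  show ?thesis
    unfolding lborel_prod by (rule Bochner_Integration.integrable_cong[THEN iffD1, rotated 2])
      (auto simp: indicator_def divide_inverse)
qed

text \<open>The uniform bound and the decay 1 / |\<tau>| combine to a majorant of the form const /
  (1 + \<tau>^2), which is integrable over the slab |\<xi>| < R. Without the decay the slab would be
  too large for dominated convergence.\<close>

lemma L2_low_frequency_convergence:
  fixes z :: "nat \<Rightarrow> real \<times> 'a::euclidean_space \<Rightarrow> complex"
  assumes [measurable]: "\<And>i. z i \<in> borel_measurable borel"
    and lim: "\<And>\<omega>. (\<lambda>i. z i \<omega>) \<longlonglongrightarrow> l \<omega>"
    and bd: "\<And>i \<omega>. cmod (z i \<omega>) \<le> c1" "\<And>i \<omega>. norm (snd \<omega>) < R \<Longrightarrow> \<bar>fst \<omega>\<bar> * cmod (z i \<omega>) \<le> c2"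
  shows "(\<lambda>i. LINT \<omega>|lborel. indicator {\<omega>. norm (snd \<omega>) < R} \<omega> * (cmod (z i \<omega> - l \<omega>))\<^sup>2) \<longlonglongrightarrow> 0"
    and "\<And>i. integrable lborel (\<lambda>\<omega>. indicator {\<omega>. norm (snd \<omega>) < R} \<omega> * (cmod (z i \<omega> - l \<omega>))\<^sup>2)"
proof -
  let ?D = "{\<omega> :: real \<times> 'a. norm (snd \<omega>) < R}"
  have "open ?D" by (intro open_Collect_less continuous_intros)
  then have [measurable]: "?D \<in> sets borel" by simp
  have [measurable]: "l \<in> borel_measurable borel" by (rule borel_measurable_LIMSEQ_metric[OF _ lim]) measurable
  have [measurable]: "fst \<in> borel_measurable (borel :: (real \<times> 'a) measure)"
    by (intro borel_measurable_continuous_onI continuous_intros)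
  have lb: "cmod (l \<omega>) \<le> c1" for \<omega>
    by (rule LIMSEQ_le_const2[OF tendsto_norm[OF lim[of \<omega>]]]) (use bd(1)[of _ \<omega>] in auto)
  have lb2: "\<bar>fst \<omega>\<bar> * cmod (l \<omega>) \<le> c2" if "norm (snd \<omega>) < R" for \<omega>
  proof -
    have "(\<lambda>i. \<bar>fst \<omega>\<bar> * cmod (z i \<omega>)) \<longlonglongrightarrow> \<bar>fst \<omega>\<bar> * cmod (l \<omega>)" by (intro tendsto_intros lim)
    then show ?thesis by (rule LIMSEQ_le_const2) (use bd(2)[OF that] in auto)
  qed
  define w where "w \<omega> = (4 * c1\<^sup>2 + 4 * c2\<^sup>2) / (1 + (fst \<omega>)\<^sup>2) * indicator ?D \<omega>" for \<omega> :: "real \<times> 'a"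
  have w: "integrable lborel w" unfolding w_def[abs_def] by (rule integrable_low_frequency)
  have le: "indicator ?D \<omega> * (cmod (z i \<omega> - l \<omega>))\<^sup>2 \<le> w \<omega>" for i \<omega>
  proof (cases "\<omega> \<in> ?D")
    case True
    have n: "cmod (z i \<omega> - l \<omega>) \<le> cmod (z i \<omega>) + cmod (l \<omega>)" by (rule norm_triangle_ineq4)
    have "cmod (z i \<omega> - l \<omega>) \<le> 2 * c1" using n bd(1)[of i \<omega>] lb[of \<omega>] by linarith
    then have 1: "(cmod (z i \<omega> - l \<omega>))\<^sup>2 \<le> (2 * c1)\<^sup>2" by (intro power_mono) auto
    have "\<bar>fst \<omega>\<bar> * cmod (z i \<omega> - l \<omega>) \<le> \<bar>fst \<omega>\<bar> * (cmod (z i \<omega>) + cmod (l \<omega>))" by (intro mult_left_mono n) auto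
    also have "\<dots> \<le> 2 * c2" using bd(2)[of \<omega> i] lb2[of \<omega>] True by (simp add: distrib_left)
    finally have "(\<bar>fst \<omega>\<bar> * cmod (z i \<omega> - l \<omega>))\<^sup>2 \<le> (2 * c2)\<^sup>2" by (intro power_mono) auto
    then have "(fst \<omega>)\<^sup>2 * (cmod (z i \<omega> - l \<omega>))\<^sup>2 \<le> 4 * c2\<^sup>2" by (simp add: power_mult_distrib)
    with 1 have "(1 + (fst \<omega>)\<^sup>2) * (cmod (z i \<omega> - l \<omega>))\<^sup>2 \<le> 4 * c1\<^sup>2 + 4 * c2\<^sup>2"
      by (simp add: power_mult_distrib distrib_right)
    moreover have "0 < 1 + (fst \<omega>)\<^sup>2" by (simp add: add_pos_nonneg)
    ultimately show ?thesis using True by (simp add: w_def field_simps)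
  qed (simp add: w_def)
  have "(\<lambda>i. LINT \<omega>|lborel. indicator ?D \<omega> * (cmod (z i \<omega> - l \<omega>))\<^sup>2) \<longlonglongrightarrow> (LINT \<omega>|(lborel :: (real \<times> 'a) measure). 0 :: real)"
  proof (rule Bochner_Integration.integral_dominated_convergence[OF _ _ w])
    show "AE \<omega> in lborel. (\<lambda>i. indicator ?D \<omega> * (cmod (z i \<omega> - l \<omega>))\<^sup>2) \<longlonglongrightarrow> 0"
    proof (rule AE_I2)
      fix \<omega>
      have "(\<lambda>i. indicator ?D \<omega> * (cmod (z i \<omega> - l \<omega>))\<^sup>2) \<longlonglongrightarrow> indicator ?D \<omega> * (cmod (l \<omega> - l \<omega>))\<^sup>2"
        by (intro tendsto_intros lim)
      then show "(\<lambda>i. indicator ?D \<omega> * (cmod (z i \<omega> - l \<omega>))\<^sup>2) \<longlonglongrightarrow> 0" by simp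
    qed
  qed (use le in auto)
  then show "(\<lambda>i. LINT \<omega>|lborel. indicator ?D \<omega> * (cmod (z i \<omega> - l \<omega>))\<^sup>2) \<longlonglongrightarrow> 0" by simp
  show "integrable lborel (\<lambda>\<omega>. indicator ?D \<omega> * (cmod (z i \<omega> - l \<omega>))\<^sup>2)" for i
  proof (rule Bochner_Integration.integrable_bound[OF w])
    show "AE \<omega> in lborel. norm (indicator ?D \<omega> * (cmod (z i \<omega> - l \<omega>))\<^sup>2) \<le> norm (w \<omega>)"
    proof (rule AE_I2)
      fix \<omega>
      show "norm (indicator ?D \<omega> * (cmod (z i \<omega> - l \<omega>))\<^sup>2) \<le> norm (w \<omega>)"
        using le[of \<omega> i] by simp
    qed
  qed measurable
qed

text \<open>Chebyshev's inequality with the multiplier as weight.\<close>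

lemma high_frequency_bound:
  fixes g :: "real \<times> 'a::euclidean_space \<Rightarrow> real"
  assumes g: "integrable lborel g" "\<And>x. \<bar>g x\<bar> \<le> k"
    and energy: "(\<integral>\<^sup>+\<omega>. ennreal (m (snd \<omega>)) * ennreal ((cmod (fourier g \<omega>))\<^sup>2) \<partial>lborel) \<le> ennreal E"
    and Z: "Z > 0" "\<And>\<xi>. R \<le> norm \<xi> \<Longrightarrow> Z \<le> m \<xi>" and E: "0 \<le> E"
  shows "(LINT \<omega>|lborel. indicator {\<omega>. R \<le> norm (snd \<omega>)} \<omega> * (cmod (fourier g \<omega>))\<^sup>2) \<le> E / Z"
proof -
  let ?D = "{\<omega> :: real \<times> 'a. R \<le> norm (snd \<omega>)}"
  have "closed ?D" by (intro closed_Collect_le continuous_intros)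
  then have D: "?D \<in> sets borel" by simp
  have i: "integrable lborel (\<lambda>\<omega>. indicator ?D \<omega> * (cmod (fourier g \<omega>))\<^sup>2)"
    using D fourier_L2_integrable[OF g] by (auto intro!: integrable_real_mult_indicator simp: mult.commute[of "indicator _ _"])
  have "ennreal (Z * (LINT \<omega>|lborel. indicator ?D \<omega> * (cmod (fourier g \<omega>))\<^sup>2))
     = ennreal (LINT \<omega>|lborel. Z * (indicator ?D \<omega> * (cmod (fourier g \<omega>))\<^sup>2))" by simp
  also have "\<dots> = (\<integral>\<^sup>+\<omega>. ennreal (Z * (indicator ?D \<omega> * (cmod (fourier g \<omega>))\<^sup>2)) \<partial>lborel)"
    using i Z(1) by (intro nn_integral_eq_integral[symmetric]) auto
  also have "\<dots> \<le> (\<integral>\<^sup>+\<omega>. ennreal (m (snd \<omega>)) * ennreal ((cmod (fourier g \<omega>))\<^sup>2) \<partial>lborel)"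
  proof (rule nn_integral_mono)
    fix \<omega> :: "real \<times> 'a"
    show "ennreal (Z * (indicator ?D \<omega> * (cmod (fourier g \<omega>))\<^sup>2)) \<le> ennreal (m (snd \<omega>)) * ennreal ((cmod (fourier g \<omega>))\<^sup>2)"
    proof (cases "\<omega> \<in> ?D")
      case True
      then have "Z \<le> m (snd \<omega>)" using Z(2) by simp
      then have "ennreal (Z * (cmod (fourier g \<omega>))\<^sup>2) \<le> ennreal (m (snd \<omega>) * (cmod (fourier g \<omega>))\<^sup>2)"
        by (intro ennreal_leI mult_right_mono) auto
      then show ?thesis using True \<open>Z \<le> m (snd \<omega>)\<close> Z(1) by (simp add: ennreal_mult)
    qed simp
  qed
  also note energy
  finally have "Z * (LINT \<omega>|lborel. indicator ?D \<omega> * (cmod (fourier g \<omega>))\<^sup>2) \<le> E"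
    using E by (simp add: ennreal_le_iff)
  then show ?thesis using Z(1) by (simp add: field_simps)
qed

text \<open>The parameters are fixed in the order e1, c, l, \<eta>, Z, R, N. The time estimate is
  invoked only after R is known, so its constant may depend on R; the convergence of the transforms
  is used last, to choose N.\<close>

lemma local_compactness:
  fixes v :: "nat \<Rightarrow> real \<times> 'a::euclidean_space \<Rightarrow> real"
  assumes \<phi>: "\<phi> \<in> borel_measurable borel" "\<And>p. 0 \<le> \<phi> p" "\<And>p. \<phi> p \<le> C" "bounded S" "\<And>p. p \<notin> S \<Longrightarrow> \<phi> p = 0"
    and v: "\<And>n. v n \<in> borel_measurable borel" "\<And>n p. \<bar>v n p\<bar> \<le> K"
    and b: "continuous_on UNIV b" "mono b" and K: "0 \<le> K"
    and energy: "\<And>n. (\<integral>\<^sup>+\<omega>. ennreal (m n (snd \<omega>)) * ennreal ((cmod (fourier (\<lambda>p. \<phi> p * (b (v n p) - b (- K))) \<omega>))\<^sup>2) \<partial>lborel) \<le> ennreal E"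
    and E: "0 \<le> E"
    and mult: "\<And>Z. \<exists>R. \<forall>n \<xi>. R \<le> real n \<longrightarrow> R \<le> norm \<xi> \<longrightarrow> Z \<le> m n \<xi>"
    and time: "\<And>R. \<exists>c. \<forall>n \<omega>. norm (snd \<omega>) < R \<longrightarrow> \<bar>fst \<omega>\<bar> * cmod (fourier (\<lambda>p. \<phi> p * v n p) \<omega>) \<le> c"
    and r: "strict_mono r" and conv: "\<And>\<omega>. convergent (\<lambda>i. fourier (\<lambda>p. \<phi> p * v (r i) p) \<omega>)"
    and e: "e > 0"
  shows "\<exists>N. \<forall>i\<ge>N. \<forall>j\<ge>N. (LINT p|lborel. (\<phi> p)\<^sup>2 * (b (v (r i) p) - b (v (r j) p))\<^sup>2) < e"
proof -
  note [measurable] = \<phi>(1) v(1) borel_measurable_continuous_onI[OF b(1)]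
  have C0: "0 \<le> C" using \<phi>(2,3) order_trans by blast
  define H where "H = b K - b (- K)"
  have bw: "0 \<le> b x - b (- K)" "b x - b (- K) \<le> H" if "\<bar>x\<bar> \<le> K" for x
    using that monoD[OF b(2), of "- K" x] monoD[OF b(2), of x K] by (auto simp: H_def)
  have ig: "integrable lborel (\<lambda>p. \<phi> p * g p)" if "g \<in> borel_measurable borel" "\<And>p. \<bar>g p\<bar> \<le> k" for g k
  proof (rule integrable_bounded_support[OF _ _ \<phi>(4)])
    show "(\<lambda>p. \<phi> p * g p) \<in> borel_measurable borel" using that(1) by measurable
    show "\<bar>\<phi> p * g p\<bar> \<le> C * k" for p
      unfolding abs_mult using \<phi>(2)[of p] \<phi>(3)[of p] that(2)[of p] C0 by (intro mult_mono) auto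
  qed (use \<phi>(5) in auto)
  have bg: "\<bar>\<phi> p * g\<bar> \<le> C * k" if "\<bar>g\<bar> \<le> k" for p g k
    unfolding abs_mult using \<phi>(2)[of p] \<phi>(3)[of p] that C0 by (intro mult_mono) auto
  define I2 where "I2 = (LINT p|lborel. (\<phi> p)\<^sup>2)"
  have I2: "0 \<le> I2" unfolding I2_def by (intro Bochner_Integration.integral_nonneg) simp
  have i2: "integrable lborel (\<lambda>p. (\<phi> p)\<^sup>2)"
    using ig[of \<phi> C] \<phi>(2,3) by (simp add: power2_eq_square)
  have iv: "integrable lborel (\<lambda>p. \<phi> p * v n p)" for n by (rule ig[OF v])
  have iw: "integrable lborel (\<lambda>p. \<phi> p * (b (v n p) - b (- K)))" for n
    by (rule ig[of _ H]) (use bw v(2) in auto)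
  have bwb: "\<bar>\<phi> p * (b (v n p) - b (- K))\<bar> \<le> C * H" for n p
    by (rule bg) (use bw[OF v(2)[of n p]] in simp)
  define \<kappa> where "\<kappa> = (2 * pi) ^ DIM(real \<times> 'a)"
  have \<kappa>: "0 < \<kappa>" by (simp add: \<kappa>_def)
  \<comment> \<open>The budget: e/4 for the term without pairing, e/8 for the part of the pairing
    with factor l, e/4 for the frequency parts X and Y.\<close>
  define e1 where "e1 = e / (4 * (I2 + 1))"
  have e1: "e1 > 0" "e1 * I2 \<le> e / 4" using e I2 by (simp_all add: e1_def field_simps)
  obtain c where c: "c > 0" "\<And>x y. \<bar>x\<bar> \<le> K \<Longrightarrow> \<bar>y\<bar> \<le> K \<Longrightarrow> (b x - b y)\<^sup>2 \<le> e1 + c * ((x - y) * (b x - b y))"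
    using uniform_monotone_bound[OF b e1(1) K] by blast
  define V where "V = (4 * K\<^sup>2 + H\<^sup>2) * I2"
  have V: "0 \<le> V" unfolding V_def using I2 by (intro mult_nonneg_nonneg) auto
  define l where "l = e / (4 * c * (V + 1))"
  have l0: "l > 0" unfolding l_def using e c(1) V by (intro divide_pos_pos mult_pos_pos) auto
  have "c * (l / 2 * V) \<le> c * (l / 2 * (V + 1))"
    using c(1) l0 by (intro mult_left_mono) auto
  also have "\<dots> = c * (l * (V + 1)) / 2" by simp
  also have "l * (V + 1) = e / (4 * c)" using V by (simp add: l_def)
  also have "c * (e / (4 * c)) / 2 = e / 8" using c(1) by simp
  finally have l: "l > 0" "c * (l / 2 * V) \<le> e / 8" using l0 by simp_all
  define \<eta> where "\<eta> = e * l * \<kappa> / (2 * c)"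
  have \<eta>: "\<eta> > 0" "c * (\<eta> / (2 * l * \<kappa>)) = e / 4" using e c(1) l(1) \<kappa> by (simp_all add: \<eta>_def field_simps)
  \<comment> \<open>X involves two solutions, each with factor 2, so the energy bound gives X \<le>
    4 E / Z < \<eta> / 2; the summand 1 covers E = 0.\<close>
  define Z where "Z = 8 * (E + 1) / \<eta>"
  have Z: "Z > 0" using E \<eta>(1) by (simp add: Z_def)
  have EZ: "4 * (E / Z) < \<eta> / 2" using E \<eta>(1) by (simp add: Z_def field_simps)
  obtain R where R: "\<And>n \<xi>. R \<le> real n \<Longrightarrow> R \<le> norm \<xi> \<Longrightarrow> Z \<le> m n \<xi>" using mult[of Z] by blast
  let ?D = "{\<omega> :: real \<times> 'a. R \<le> norm (snd \<omega>)}"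
  have mD: "- ?D = {\<omega>. norm (snd \<omega>) < R}" by auto
  have "closed ?D" by (intro closed_Collect_le continuous_intros)
  then have D: "?D \<in> sets borel" by simp
  obtain c2 where c2: "\<And>n \<omega>. norm (snd \<omega>) < R \<Longrightarrow> \<bar>fst \<omega>\<bar> * cmod (fourier (\<lambda>p. \<phi> p * v n p) \<omega>) \<le> c2"
    using time[of R] by blast
  define z where "z i = fourier (\<lambda>p. \<phi> p * v (r i) p)" for i
  define lz where "lz \<omega> = lim (\<lambda>i. z i \<omega>)" for \<omega>
  have zlim: "(\<lambda>i. z i \<omega>) \<longlonglongrightarrow> lz \<omega>" for \<omega>
    using conv[of \<omega>] by (simp add: z_def lz_def convergent_LIMSEQ_iff)
  have zm: "z i \<in> borel_measurable borel" for i unfolding z_def by (rule fourier_measurable[OF iv])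
  have zb: "cmod (z i \<omega>) \<le> (LINT p|lborel. \<phi> p * K)" for i \<omega>
  proof -
    have "cmod (z i \<omega>) \<le> (LINT p|lborel. \<bar>\<phi> p * v (r i) p\<bar>)" unfolding z_def by (rule norm_fourier_le)
    also have "\<dots> \<le> (LINT p|lborel. \<phi> p * K)"
    proof (rule integral_mono)
      show "\<bar>\<phi> p * v (r i) p\<bar> \<le> \<phi> p * K" for p
        unfolding abs_mult using \<phi>(2)[of p] v(2)[of "r i" p] by (intro mult_mono) auto
    qed (use iv ig[of "\<lambda>_. K" K] K in auto)
    finally show ?thesis .
  qed
  define y where "y i = (LINT \<omega>|lborel. indicator (- ?D) \<omega> * (cmod (z i \<omega> - lz \<omega>))\<^sup>2)" for i
  have ylim: "y \<longlonglongrightarrow> 0" and yint: "\<And>i. integrable lborel (\<lambda>\<omega>. indicator (- ?D) \<omega> * (cmod (z i \<omega> - lz \<omega>))\<^sup>2)"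
    unfolding y_def mD using L2_low_frequency_convergence[OF zm zlim zb, of R c2] c2 by (auto simp: z_def)
  \<comment> \<open>Y is at most 2 y i + 2 y j, hence \<eta> / 8 leads to \<eta> / 2.\<close>
  obtain N1 where N1: "\<And>i. i \<ge> N1 \<Longrightarrow> y i < \<eta> / 8"
    using order_tendstoD(2)[OF ylim, of "\<eta> / 8"] \<eta>(1) by (auto simp: eventually_sequentially)
  \<comment> \<open>Beyond N the index r i exceeds R as well: the lower bound on the multipliers
    needs both n and \<xi> to be large.\<close>
  define N where "N = max N1 (nat \<lceil>R\<rceil>)"
  have main: "(LINT p|lborel. (\<phi> p)\<^sup>2 * (b (v (r i) p) - b (v (r j) p))\<^sup>2) < e" if ij: "i \<ge> N" "j \<ge> N" for i j
  proof -
    have Rr: "R \<le> real (r k)" if "k \<ge> N" for k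
    proof -
      have "nat \<lceil>R\<rceil> \<le> r k" using seq_suble[OF r, of k] that by (simp add: N_def)
      then show ?thesis by linarith
    qed
    define A where "A p = \<phi> p * v (r i) p - \<phi> p * v (r j) p" for p
    define Gf where "Gf p = \<phi> p * (b (v (r i) p) - b (- K)) - \<phi> p * (b (v (r j) p) - b (- K))" for p
    have A: "integrable lborel A" "\<And>p. \<bar>A p\<bar> \<le> C * (2 * K)"
    proof -
      show "integrable lborel A" unfolding A_def[abs_def] using iv by simp
      have "\<bar>v (r i) p - v (r j) p\<bar> \<le> 2 * K" for p using v(2)[of "r i" p] v(2)[of "r j" p] by linarith
      from bg[OF this] show "\<bar>A p\<bar> \<le> C * (2 * K)" for p by (simp add: A_def right_diff_distrib)
    qed
    have bd: "\<bar>b (v (r i) p) - b (v (r j) p)\<bar> \<le> H" for p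
      using bw[OF v(2)[of "r i" p]] bw[OF v(2)[of "r j" p]] by (simp add: abs_le_iff)
    have Gf: "integrable lborel Gf" "\<And>p. \<bar>Gf p\<bar> \<le> C * H"
    proof -
      show "integrable lborel Gf" unfolding Gf_def[abs_def] using iw by simp
      show "\<bar>Gf p\<bar> \<le> C * H" for p using bg[OF bd[of p], of p] by (simp add: Gf_def algebra_simps)
    qed
    have A2: "(LINT p|lborel. (A p)\<^sup>2) \<le> 4 * K\<^sup>2 * I2"
    proof -
      have "\<bar>LINT p|lborel. (A p)\<^sup>2\<bar> \<le> (LINT p|lborel. 4 * K\<^sup>2 * (\<phi> p)\<^sup>2)"
      proof (rule abs_integral_le[OF AE_I2])
        fix p
        have "\<bar>v (r i) p - v (r j) p\<bar> \<le> 2 * K" using v(2)[of "r i" p] v(2)[of "r j" p] by linarith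
        then have "\<bar>v (r i) p - v (r j) p\<bar>\<^sup>2 \<le> (2 * K)\<^sup>2" by (intro power_mono) auto
        then have "(v (r i) p - v (r j) p)\<^sup>2 * (\<phi> p)\<^sup>2 \<le> 4 * K\<^sup>2 * (\<phi> p)\<^sup>2"
          by (intro mult_right_mono) (auto simp: power_mult_distrib)
        moreover have "(A p)\<^sup>2 = (v (r i) p - v (r j) p)\<^sup>2 * (\<phi> p)\<^sup>2"
          by (simp add: A_def right_diff_distrib[symmetric] power_mult_distrib)
        ultimately show "\<bar>(A p)\<^sup>2\<bar> \<le> 4 * K\<^sup>2 * (\<phi> p)\<^sup>2" by simp
      qed (use i2 in simp)
      then show ?thesis by (simp add: I2_def)
    qed
    have Gsq: "(Gf p)\<^sup>2 = (b (v (r i) p) - b (v (r j) p))\<^sup>2 * (\<phi> p)\<^sup>2" for p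
      by (simp add: Gf_def right_diff_distrib[symmetric] power_mult_distrib)
    have G2: "(LINT p|lborel. (Gf p)\<^sup>2) \<le> H\<^sup>2 * I2"
    proof -
      have "\<bar>LINT p|lborel. (Gf p)\<^sup>2\<bar> \<le> (LINT p|lborel. H\<^sup>2 * (\<phi> p)\<^sup>2)"
      proof (rule abs_integral_le[OF AE_I2])
        fix p
        have "\<bar>b (v (r i) p) - b (v (r j) p)\<bar>\<^sup>2 \<le> H\<^sup>2" using bd by (intro power_mono) auto
        then have "(b (v (r i) p) - b (v (r j) p))\<^sup>2 * (\<phi> p)\<^sup>2 \<le> H\<^sup>2 * (\<phi> p)\<^sup>2" by (intro mult_right_mono) auto
        then show "\<bar>(Gf p)\<^sup>2\<bar> \<le> H\<^sup>2 * (\<phi> p)\<^sup>2" by (simp add: Gsq)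
      qed (use i2 in simp)
      then show ?thesis by (simp add: I2_def)
    qed
    define X where "X = (LINT \<omega>|lborel. indicator ?D \<omega> * (cmod (fourier Gf \<omega>))\<^sup>2)"
    define Y where "Y = (LINT \<omega>|lborel. indicator (- ?D) \<omega> * (cmod (fourier A \<omega>))\<^sup>2)"
    have sq2: "(cmod (x - y))\<^sup>2 \<le> 2 * (cmod x)\<^sup>2 + 2 * (cmod y)\<^sup>2" for x y
    proof -
      have "(cmod (x - y))\<^sup>2 \<le> (cmod x + cmod y)\<^sup>2" by (intro power_mono norm_triangle_ineq4) simp
      also have "\<dots> \<le> 2 * (cmod x)\<^sup>2 + 2 * (cmod y)\<^sup>2"
        using zero_le_power2[of "cmod x - cmod y"] by (simp add: power2_eq_square algebra_simps)
      finally show ?thesis .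
    qed
    have X: "X < \<eta> / 2"
    proof -
      define h where "h k \<omega> = indicator ?D \<omega> * (cmod (fourier (\<lambda>p. \<phi> p * (b (v (r k) p) - b (- K))) \<omega>))\<^sup>2" for k \<omega>
      have hi: "integrable lborel (h k)" for k
        unfolding h_def[abs_def] using D fourier_L2_integrable[OF iw bwb]
        by (auto intro!: integrable_real_mult_indicator simp: mult.commute[of "indicator _ _"])
      have hb: "(LINT \<omega>|lborel. h k \<omega>) \<le> E / Z" if "k \<ge> N" for k
        unfolding h_def by (rule high_frequency_bound[OF iw bwb energy Z _ E]) (rule R[OF Rr[OF that]])
      have "\<bar>X\<bar> \<le> (LINT \<omega>|lborel. 2 * h i \<omega> + 2 * h j \<omega>)"
        unfolding X_def
      proof (rule abs_integral_le[OF AE_I2])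
        fix \<omega>
        have "fourier Gf \<omega> = fourier (\<lambda>p. \<phi> p * (b (v (r i) p) - b (- K))) \<omega> - fourier (\<lambda>p. \<phi> p * (b (v (r j) p) - b (- K))) \<omega>"
          unfolding Gf_def[abs_def] by (rule fourier_diff[OF iw iw])
        then show "\<bar>indicator ?D \<omega> * (cmod (fourier Gf \<omega>))\<^sup>2\<bar> \<le> 2 * h i \<omega> + 2 * h j \<omega>"
          using sq2 by (simp add: h_def indicator_def)
      qed (use hi in simp)
      also have "\<dots> = 2 * (LINT \<omega>|lborel. h i \<omega>) + 2 * (LINT \<omega>|lborel. h j \<omega>)" using hi by simp
      finally show ?thesis using hb[OF ij(1)] hb[OF ij(2)] EZ by linarith
    qed
    have Y: "Y < \<eta> / 2"
    proof -
      have "\<bar>Y\<bar> \<le> (LINT \<omega>|lborel. 2 * (indicator (- ?D) \<omega> * (cmod (z i \<omega> - lz \<omega>))\<^sup>2) + 2 * (indicator (- ?D) \<omega> * (cmod (z j \<omega> - lz \<omega>))\<^sup>2))"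
        unfolding Y_def
      proof (rule abs_integral_le[OF AE_I2])
        fix \<omega>
        have "fourier A \<omega> = (z i \<omega> - lz \<omega>) - (z j \<omega> - lz \<omega>)"
          unfolding A_def[abs_def] z_def by (simp add: fourier_diff[OF iv iv])
        then show "\<bar>indicator (- ?D) \<omega> * (cmod (fourier A \<omega>))\<^sup>2\<bar>
           \<le> 2 * (indicator (- ?D) \<omega> * (cmod (z i \<omega> - lz \<omega>))\<^sup>2) + 2 * (indicator (- ?D) \<omega> * (cmod (z j \<omega> - lz \<omega>))\<^sup>2)"
          using sq2[of "z i \<omega> - lz \<omega>" "z j \<omega> - lz \<omega>"] by (simp add: indicator_def)
      qed (use yint in simp)
      also have "\<dots> = 2 * y i + 2 * y j" unfolding y_def using yint by simp
      finally show ?thesis using N1[of i] N1[of j] ij by (simp add: N_def)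
    qed
    have "\<kappa> * (LINT p|lborel. A p * Gf p) \<le> l / 2 * (\<kappa> * ((LINT p|lborel. (A p)\<^sup>2) + (LINT p|lborel. (Gf p)\<^sup>2))) + 1 / (2 * l) * (X + Y)"
      unfolding \<kappa>_def X_def Y_def by (rule fourier_pairing_bound[OF A Gf D l(1)])
    also have "\<dots> \<le> l / 2 * (\<kappa> * V) + 1 / (2 * l) * \<eta>"
      using A2 G2 X Y l(1) \<kappa> by (intro add_mono mult_left_mono) (auto simp: V_def algebra_simps)
    also have "\<dots> = \<kappa> * (l / 2 * V + \<eta> / (2 * l * \<kappa>))"
      using \<kappa> by (simp add: distrib_left)
    finally have "\<kappa> * (LINT p|lborel. A p * Gf p) \<le> \<kappa> * (l / 2 * V + \<eta> / (2 * l * \<kappa>))" .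
    then have AG: "(LINT p|lborel. A p * Gf p) \<le> l / 2 * V + \<eta> / (2 * l * \<kappa>)"
      using \<kappa> by simp
    have iAG: "integrable lborel (\<lambda>p. A p * Gf p)"
    proof (rule Bochner_Integration.integrable_bound)
      show "integrable lborel (\<lambda>p. (C * (2 * K)) * Gf p)" using Gf(1) by simp
      have "\<bar>A p\<bar> * \<bar>Gf p\<bar> \<le> \<bar>C * (2 * K)\<bar> * \<bar>Gf p\<bar>" for p
        using A(2)[of p] by (intro mult_right_mono) auto
      then show "AE p in lborel. norm (A p * Gf p) \<le> norm ((C * (2 * K)) * Gf p)" by (simp add: abs_mult)
    qed (use A Gf in auto)
    \<comment> \<open>The square of the cut-off is shared out, one factor to each member of the
      pairing; this is why both sequences are localised by the same \<phi>.\<close>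
    have "\<bar>LINT p|lborel. (\<phi> p)\<^sup>2 * (b (v (r i) p) - b (v (r j) p))\<^sup>2\<bar> \<le> (LINT p|lborel. e1 * (\<phi> p)\<^sup>2 + c * (A p * Gf p))"
    proof (rule abs_integral_le[OF AE_I2])
      fix p
      have "(\<phi> p)\<^sup>2 * (b (v (r i) p) - b (v (r j) p))\<^sup>2 \<le> (\<phi> p)\<^sup>2 * (e1 + c * ((v (r i) p - v (r j) p) * (b (v (r i) p) - b (v (r j) p))))"
        by (intro mult_left_mono c(2) v(2)) auto
      also have "\<dots> = e1 * (\<phi> p)\<^sup>2 + c * (A p * Gf p)"
        by (simp add: A_def Gf_def power2_eq_square algebra_simps)
      finally show "\<bar>(\<phi> p)\<^sup>2 * (b (v (r i) p) - b (v (r j) p))\<^sup>2\<bar> \<le> e1 * (\<phi> p)\<^sup>2 + c * (A p * Gf p)" by simp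
    qed (use i2 iAG in simp)
    also have "\<dots> = e1 * I2 + c * (LINT p|lborel. A p * Gf p)" using i2 iAG by (simp add: I2_def)
    also have "\<dots> \<le> e1 * I2 + c * (l / 2 * V + \<eta> / (2 * l * \<kappa>))"
      using AG c(1) by (intro add_left_mono mult_left_mono) auto
    also have "\<dots> = e1 * I2 + c * (l / 2 * V) + c * (\<eta> / (2 * l * \<kappa>))" by (simp add: distrib_left)
    also have "\<dots> \<le> e / 4 + e / 8 + e / 4" using e1(2) l(2) \<eta>(2) by linarith
    also have "\<dots> < e" using e by simp
    finally show ?thesis by linarith
  qed
  then show ?thesis by blast
qed

section \<open>Interior cut-offs, coverings and pointwise bounds of the data\<close>

definition bump :: "'b::euclidean_space \<Rightarrow> 'b \<Rightarrow> 'b \<Rightarrow> real" where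
  "bump a c x = (\<Prod>i\<in>Basis. flat 0 (i \<bullet> x + (- (a \<bullet> i))) * flat 0 ((- i) \<bullet> x + c \<bullet> i))"

lemma smooth_fun_bump: "smooth_fun (bump a c)"
  unfolding bump_def[abs_def] by (intro smooth_fun_prod smooth_fun.mult smooth_fun.flat)

lemma bump_nonneg: "0 \<le> bump a c x"
  unfolding bump_def by (intro prod_nonneg ballI mult_nonneg_nonneg flat_nonneg)

lemma bump_pos: "x \<in> box a c \<Longrightarrow> 0 < bump a c x"
  unfolding bump_def by (intro prod_pos mult_pos_pos) (auto simp: flat_pos_iff mem_box inner_commute)

lemma bump_eq_0: "x \<notin> cbox a c \<Longrightarrow> bump a c x = 0"
proof -
  assume "x \<notin> cbox a c"
  then obtain i where i: "i \<in> Basis" "x \<bullet> i < a \<bullet> i \<or> c \<bullet> i < x \<bullet> i" by (auto simp: mem_box not_le)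
  then have "flat 0 (i \<bullet> x + (- (a \<bullet> i))) * flat 0 ((- i) \<bullet> x + c \<bullet> i) = 0"
    by (auto simp: flat_zero_iff inner_commute)
  then show ?thesis unfolding bump_def using i(1) by (meson finite_Basis prod_zero_iff)
qed

lemma interior_test_bump:
  assumes "cbox a c \<subseteq> {0<..<T} \<times> \<Omega>"
  shows "\<exists>D C B. interior_test T \<Omega> (bump a c) D C \<and> (\<forall>p. \<bar>fst (D p)\<bar> \<le> B)"
proof -
  obtain D C where D: "\<And>x. (bump a c has_derivative (\<lambda>h. D x \<bullet> h)) (at x)" "\<And>i. smooth_fun (\<lambda>x. D x \<bullet> i)"
    "C > 0" "\<And>x. \<bar>bump a c x\<bar> \<le> C" "\<And>x. norm (D x) \<le> C" "\<And>x y. norm (D x - D y) \<le> C * norm (x - y)"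
    "\<And>x. x \<notin> cbox a c \<Longrightarrow> D x = 0"
    by (rule smooth_compact_support_bounds[OF smooth_fun_bump compact_cbox bump_eq_0, of a c a c]) blast+
  have s: "norm (snd (D x)) \<le> C" "\<bar>fst (D x)\<bar> \<le> C" for x
    using norm_snd_le[of "snd (D x)" "fst (D x)"] norm_fst_le[of "fst (D x)" "snd (D x)"] D(5)[of x] by auto
  have l: "norm (snd (D (t, x)) - snd (D (t, y))) \<le> C * norm (x - y)" for t x y
  proof -
    have "norm (snd (D (t, x) - D (t, y))) \<le> norm (D (t, x) - D (t, y))" by (metis norm_snd_le prod.collapse)
    also have "\<dots> \<le> C * norm ((t, x) - (t, y))" by (rule D(6))
    finally show ?thesis by (simp add: norm_Pair)
  qed
  have "interior_test T \<Omega> (bump a c) D C"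
    unfolding interior_test_def
    using assms D(1,2,7) s(1) l smooth_fun_bump bump_nonneg bump_eq_0 abs_le_D1[OF D(4)]
    by (intro conjI allI exI[of _ "cbox a c"]) auto
  then show ?thesis using s(2) by blast
qed

lemma Ck_on_continuous: "Ck_on k S f \<Longrightarrow> continuous_on S f"
proof (cases k)
  case (Suc m)
  moreover assume "Ck_on k S f"
  ultimately obtain D where "\<forall>x\<in>S. (f has_derivative (\<lambda>h. D x \<bullet> h)) (at x within S)" by auto
  then show ?thesis by (intro has_derivative_continuous_on[of S f "\<lambda>x h. D x \<bullet> h"]) auto
qed simp

text \<open>The set where a continuous function exceeds its essential bound is open and null, hence
  empty. Pointwise bounds are required because the datum is also integrated over the lateral
  boundary, a Lebesgue null set.\<close>

lemma continuous_Linf_bound: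
  fixes g :: "real \<times> 'a::euclidean_space \<Rightarrow> real"
  assumes g: "continuous_on ({0..T} \<times> UNIV) g" and L: "Linf ({0..T} \<times> UNIV) g"
  obtains c where "0 \<le> c" "\<And>p. fst p \<in> {0<..<T} \<Longrightarrow> \<bar>g p\<bar> \<le> c"
proof -
  have cl: "closed ({0..T} \<times> (UNIV :: 'a set))" by (intro closed_Times) auto
  obtain c where c: "AE p in restrict_space lborel ({0..T} \<times> UNIV). \<bar>g p\<bar> \<le> c" using L by (auto simp: Linf_def)
  have ae: "AE p in lborel. p \<in> {0..T} \<times> UNIV \<longrightarrow> \<bar>g p\<bar> \<le> c"
    using c cl by (subst (asm) AE_restrict_space_iff) auto
  define U where "U = ({0<..<T} \<times> UNIV) \<inter> g -` {y. c < \<bar>y\<bar>}"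
  have "continuous_on ({0<..<T} \<times> UNIV) g" by (rule continuous_on_subset[OF g]) auto
  moreover have "open ({0<..<T} \<times> (UNIV :: 'a set))" by (intro open_Times) auto
  moreover have "open {y::real. c < \<bar>y\<bar>}" by (intro open_Collect_less continuous_intros)
  ultimately have "open U" unfolding U_def by (rule continuous_open_preimage)
  have "AE p in lborel. p \<notin> U" using ae by eventually_elim (auto simp: U_def)
  then have "U \<in> null_sets lborel" using \<open>open U\<close> by (subst (asm) AE_iff_null_sets[symmetric]) auto
  then have "negligible U" by (simp add: negligible_iff_null_sets null_sets_completionI)
  then have "U = {}" using open_not_negligible[OF \<open>open U\<close>] by blast
  then have "\<bar>g p\<bar> \<le> max c 0" if "fst p \<in> {0<..<T}" for p
    using that by (force simp: U_def mem_Times_iff)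
  then show ?thesis by (intro that[of "max c 0"]) auto
qed

text \<open>The common Lipschitz constant makes the sequence equicontinuous, so the Cauchy property
  passes from a nearby point of the dense set.\<close>

lemma convergent_from_dense:
  fixes z :: "nat \<Rightarrow> 'b::metric_space \<Rightarrow> complex"
  assumes lip: "\<And>i x y. dist (z i x) (z i y) \<le> L * dist x y" and L: "0 \<le> L"
    and dense: "\<And>X. open X \<Longrightarrow> X \<noteq> {} \<Longrightarrow> \<exists>d\<in>D. d \<in> X"
    and conv: "\<And>x. x \<in> D \<Longrightarrow> convergent (\<lambda>i. z i x)"
  shows "convergent (\<lambda>i. z i x)"
proof (rule Cauchy_convergent, rule metric_CauchyI)
  fix e :: real assume e: "e > 0"
  define \<delta> where "\<delta> = e / (4 * (L + 1))"
  have \<delta>: "\<delta> > 0" unfolding \<delta>_def using e L by (intro divide_pos_pos) auto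
  obtain d where d: "d \<in> D" "dist x d < \<delta>"
    using dense[of "ball x \<delta>"] \<delta> by auto
  have Ld: "L * dist x d \<le> e / 4"
  proof -
    have "L * dist x d \<le> (L + 1) * \<delta>" using d(2) L by (intro mult_mono) auto
    also have "\<dots> = e / 4"
    proof -
      have "L + 1 \<noteq> 0" using L by simp
      then show ?thesis unfolding \<delta>_def by (metis nonzero_mult_divide_mult_cancel_right times_divide_eq_right mult.commute)
    qed
    finally show ?thesis .
  qed
  obtain N where N: "\<And>m n. m \<ge> N \<Longrightarrow> n \<ge> N \<Longrightarrow> dist (z m d) (z n d) < e / 2"
    using convergent_Cauchy[OF conv[OF d(1)]] e unfolding Cauchy_def by (meson half_gt_zero)
  have "dist (z m x) (z n x) < e" if "m \<ge> N" "n \<ge> N" for m n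
  proof -
    have "dist (z m x) (z n x) \<le> dist (z m x) (z m d) + dist (z m d) (z n d) + dist (z n x) (z n d)"
      using dist_triangle[of "z m x" "z n x" "z m d"] dist_triangle[of "z m d" "z n x" "z n d"]
      by (simp add: dist_commute)
    then show ?thesis using lip[of m x d] lip[of n x d] Ld N[OF that] by linarith
  qed
  then show "\<exists>N. \<forall>m\<ge>N. \<forall>n\<ge>N. dist (z m x) (z n x) < e" by blast
qed

text \<open>Lindelof's theorem reduces the cover by all admissible boxes to a countable one. The
  empty box \<open>box One (- One)\<close> is thrown in so that there is always something to
  enumerate.\<close>

lemma open_cover_cboxes:
  fixes Q :: "'b::euclidean_space set"
  assumes "open Q"
  obtains a c :: "nat \<Rightarrow> 'b" where "\<And>j. cbox (a j) (c j) \<subseteq> Q" "\<And>x. x \<in> Q \<Longrightarrow> \<exists>j. x \<in> box (a j) (c j)"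
proof -
  define U where "U = {box a c |a c. cbox a c \<subseteq> Q}"
  obtain U' where U': "U' \<subseteq> U" "countable U'" "\<Union>U' = \<Union>U"
    using Lindelof[of U] by (auto simp: U_def)
  obtain i :: 'b where "i \<in> Basis" using nonempty_Basis by blast
  then have "cbox One (- One :: 'b) = {}"
    unfolding box_eq_empty by (intro bexI[of _ i]) (simp_all add: inner_sum_left_Basis)
  then have "box One (- One :: 'b) \<in> U" unfolding U_def by blast
  define U'' where "U'' = insert (box One (- One :: 'b)) U'"
  have "U'' \<noteq> {}" "countable U''" "U'' \<subseteq> U" using U' \<open>box One (- One :: 'b) \<in> U\<close> by (auto simp: U''_def)
  then have X: "range (from_nat_into U'') = U''" by (simp add: range_from_nat_into)
  then have "\<forall>j. \<exists>a c. from_nat_into U'' j = box a c \<and> cbox a c \<subseteq> Q"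
    using \<open>U'' \<subseteq> U\<close> unfolding U_def by blast
  then obtain a c where ac: "\<And>j. from_nat_into U'' j = box (a j) (c j)" "\<And>j. cbox (a j) (c j) \<subseteq> Q"
    by metis
  show ?thesis
  proof (rule that[of a c])
    fix x assume "x \<in> Q"
    then obtain s t where st: "cbox s t \<subseteq> Q" "x \<in> box s t"
      using assms open_contains_cbox[of Q] by (metis)
    then have "x \<in> \<Union>U'" unfolding U'(3) U_def by blast
    then obtain Y where Y: "Y \<in> U'" "x \<in> Y" by (rule UnionE)
    then have "Y \<in> range (from_nat_into U'')" unfolding X by (simp add: U''_def)
    then obtain j where "Y = from_nat_into U'' j" by (rule imageE)
    then have "x \<in> box (a j) (c j)" using Y(2) by (simp only: ac(1))
    then show "\<exists>j. x \<in> box (a j) (c j)" ..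
  qed (rule ac(2))
qed

theorem corollary4p10:
  fixes T :: real
    and \<Omega> :: "'a::euclidean_space set"
    and f :: "real \<Rightarrow> 'a"
    and b :: "real \<Rightarrow> real"
    and uc uc_ext :: "real \<times> 'a \<Rightarrow> real"
    and u0 :: "'a \<Rightarrow> real"
    and \<mu> :: "'a measure"
    and \<mu>n :: "nat \<Rightarrow> 'a measure"
    and u :: "nat \<Rightarrow> real \<times> 'a \<Rightarrow> real"
  assumes T_pos: "0 < T"
    and dom: "open \<Omega>" "bounded \<Omega>" "C2_boundary \<Omega>"
    and f_reg: "W1inf_loc f"
    and b_reg: "W1inf_loc b" "mono b" "\<exists>b'. weak_derivative b b' \<and> BV_loc b'"
    and uc_reg: "Ck_on 2 ({0<..<T} \<times> (- \<Omega>)) uc" "Linf ({0<..<T} \<times> (- \<Omega>)) uc"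
    and uc_ext_reg: "Ck_on 2 ({0..T} \<times> UNIV) uc_ext" "Linf ({0..T} \<times> UNIV) uc_ext"
    and uc_ext_eq: "\<forall>p \<in> {0<..<T} \<times> (- \<Omega>). uc_ext p = uc p"
    and u0_reg: "Linf \<Omega> u0"
    and levy: "symmetric_levy_measure \<mu>" "\<forall>n. symmetric_levy_measure (\<mu>n n)"
    and levy_conv:
      "(\<lambda>n. \<integral>\<^sup>+z. ennreal (min ((norm z)\<^sup>2) 1) \<partial>variation_diff (\<mu>n n) \<mu>) \<longlonglongrightarrow> 0"
    and sol: "\<forall>n. entropy_solution T \<Omega> f b (\<mu>n n) uc uc_ext u0 (u n)"
    and multiplier:
      "filterlim (\<lambda>R::real. INF (n, \<xi>) \<in> {(n, \<xi>). R \<le> norm \<xi> \<and> R \<le> real n}.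
          levy_multiplier (\<mu>n n) \<xi>) at_top at_top"
  shows "L2_precompact (restrict_space lborel ({0<..<T} \<times> \<Omega>)) (range (\<lambda>n p. b (u n p)))"
proof -
  let ?Q = "{0<..<T} \<times> \<Omega>"
  have oQ: "open ?Q" using dom(1) by (intro open_Times) auto
  then have Qs [measurable]: "?Q \<in> sets borel" by simp
  have bQ: "bounded ?Q" using dom(2) by (intro bounded_Times) auto
  have f_cont: "continuous_on UNIV f" using f_reg by (simp add: W1inf_loc_def)
  have b_cont: "continuous_on UNIV b" using b_reg by (simp add: W1inf_loc_def)
  have [measurable]: "b \<in> borel_measurable borel" using b_cont by (rule borel_measurable_continuous_onI)
  obtain \<Lambda> where \<Lambda>: "\<And>n. levy_bound (\<mu>n n) \<Lambda>"
    using levy_uniform_bound[OF levy(1) _ levy_conv] levy(2) by blast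
  obtain c1 where c1: "0 \<le> c1" "\<And>p. fst p \<in> {0<..<T} \<Longrightarrow> \<bar>uc_ext p\<bar> \<le> c1"
    using continuous_Linf_bound[OF Ck_on_continuous[OF uc_ext_reg(1)] uc_ext_reg(2)] by blast
  obtain c2 where c2: "AE x in lborel. x \<in> \<Omega> \<longrightarrow> \<bar>u0 x\<bar> \<le> c2"
    using u0_reg dom(1) unfolding Linf_def by (subst (asm) AE_restrict_space_iff) auto
  define M where "M = max c1 c2"
  have M0: "0 \<le> M" using c1(1) by (simp add: M_def)
  \<comment> \<open>The bound K stays a parameter: the locale is entered first with a bound of the
    individual solution, which may depend on n, and again with the common bound M that the maximum
    principle then provides.\<close>
  have es: "entropy_sol (\<mu>n n) \<Lambda> T \<Omega> f b uc uc_ext u0 (u n) K"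
    if "AE p in lborel. fst p \<in> {0<..<T} \<longrightarrow> \<bar>u n p\<bar> \<le> K" "0 \<le> K" for n K
    using that T_pos dom(1) b_cont b_reg(2) sol \<Lambda> by (intro entropy_sol.intro entropy_sol_axioms.intro) auto
  have uM: "AE p in lborel. fst p \<in> {0<..<T} \<longrightarrow> \<bar>u n p\<bar> \<le> M" for n
  proof -
    have "Linf ({0<..<T} \<times> UNIV) (u n)" using sol by (simp add: entropy_solution_def)
    then obtain K where "AE p in restrict_space lborel ({0<..<T} \<times> UNIV). \<bar>u n p\<bar> \<le> K" by (auto simp: Linf_def)
    moreover have "open ({0<..<T} \<times> (UNIV :: 'a set))" by (intro open_Times) auto
    ultimately have "AE p in lborel. p \<in> {0<..<T} \<times> UNIV \<longrightarrow> \<bar>u n p\<bar> \<le> K"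
      by (subst (asm) AE_restrict_space_iff) auto
    then have K: "AE p in lborel. fst p \<in> {0<..<T} \<longrightarrow> \<bar>u n p\<bar> \<le> max K 0"
      by eventually_elim (auto simp: mem_Times_iff)
    interpret entropy_sol "\<mu>n n" \<Lambda> T \<Omega> f b uc uc_ext u0 "u n" "max K 0" by (rule es[OF K]) simp
    have "AE p in lborel. fst p \<in> {0<..<T} \<longrightarrow> 1 * (u n p - M) \<le> 0"
    proof (rule max_principle[OF dom(2)])
      show "AE x in lborel. x \<in> \<Omega> \<longrightarrow> 1 * (u0 x - M) \<le> 0" using c2 by eventually_elim (auto simp: M_def)
      show "1 * (uc_ext p - M) \<le> 0" if "fst p \<in> {0<..<T}" for p using c1(2)[OF that] by (simp add: M_def)
    qed (use uc_ext_eq in auto)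
    moreover have "AE p in lborel. fst p \<in> {0<..<T} \<longrightarrow> - 1 * (u n p - - M) \<le> 0"
    proof (rule max_principle[OF dom(2)])
      show "AE x in lborel. x \<in> \<Omega> \<longrightarrow> - 1 * (u0 x - - M) \<le> 0" using c2 by eventually_elim (auto simp: M_def)
      show "- 1 * (uc_ext p - - M) \<le> 0" if "fst p \<in> {0<..<T}" for p using c1(2)[OF that] by (simp add: M_def)
    qed (use uc_ext_eq in auto)
    ultimately show ?thesis by eventually_elim auto
  qed
  note esM = es[OF uM M0]
  have "compact (f ` {- (M + 1)..M + 1})" using continuous_on_subset[OF f_cont] by (intro compact_continuous_image) auto
  then obtain Mf where Mf: "\<And>y. \<bar>y\<bar> \<le> M + 1 \<Longrightarrow> norm (f y) \<le> Mf"
    using compact_imp_bounded bounded_iff by (metis (no_types, lifting) abs_le_iff atLeastAtMost_iff image_eqI minus_le_iff)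
  obtain \<rho> where \<rho>: "\<Omega> \<subseteq> ball 0 \<rho>" using bounded_subset_ballD[OF dom(2)] by blast
  have ie: "interior_est (\<mu>n n) \<Lambda> T \<Omega> f b uc uc_ext u0 (u n) M \<rho> Mf" for n
    using esM f_cont Mf \<rho> by (intro interior_est.intro interior_est_axioms.intro) auto
  define v where "v n = entropy_sol.v T (u n) M" for n
  have vm [measurable]: "v n \<in> borel_measurable borel" for n
    unfolding v_def by (rule entropy_sol.v_measurable[OF esM])
  have vb: "\<bar>v n p\<bar> \<le> M" for n p unfolding v_def by (rule entropy_sol.v_bound[OF esM])
  define u' where "u' n = entropy_sol.u' T (u n)" for n
  have u'm [measurable]: "u' n \<in> borel_measurable borel" for n
    unfolding u'_def by (rule entropy_sol.u'_measurable[OF esM])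
  have u'Q: "u' n p = u n p" if "p \<in> ?Q" for n p
    using that by (auto simp: u'_def entropy_sol.u'_def[OF esM])
  have u'v: "AE p in lborel. u' n p = v n p" for n
    unfolding u'_def v_def by (rule entropy_sol.v_eq_u'[OF esM])
  define H where "H = b M - b (- M)"
  have bH: "\<bar>b x - b y\<bar> \<le> H" if "\<bar>x\<bar> \<le> M" "\<bar>y\<bar> \<le> M" for x y
    using that monoD[OF b_reg(2), of "- M" x] monoD[OF b_reg(2), of x M]
      monoD[OF b_reg(2), of "- M" y] monoD[OF b_reg(2), of y M] unfolding H_def by (simp add: abs_le_iff)
  obtain a c :: "nat \<Rightarrow> real \<times> 'a" where ac: "\<And>j. cbox (a j) (c j) \<subseteq> ?Q"
    "\<And>x. x \<in> ?Q \<Longrightarrow> \<exists>j. x \<in> box (a j) (c j)"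
    using open_cover_cboxes[OF oQ] by blast
  define \<phi> where "\<phi> j = bump (a j) (c j)" for j
  have "\<forall>j. \<exists>D C B. interior_test T \<Omega> (\<phi> j) D C \<and> (\<forall>p. \<bar>fst (D p)\<bar> \<le> B)"
    unfolding \<phi>_def using interior_test_bump[OF ac(1)] by blast
  then obtain D C B where test: "\<And>j. interior_test T \<Omega> (\<phi> j) (D j) (C j)" and B: "\<And>j p. \<bar>fst (D j p)\<bar> \<le> B j"
    by metis
  \<comment> \<open>Facts about the tests alone do not involve the solution, so any index can supply
    them.\<close>
  note ie0 = ie[of 0]
  have \<phi>m [measurable]: "\<phi> j \<in> borel_measurable borel" for j by (rule interior_est.test_measurable[OF ie0 test])
  have \<phi>0: "0 \<le> \<phi> j p" for j p by (rule interior_est.test_nonneg[OF ie0 test])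
  have \<phi>C: "\<phi> j p \<le> C j" for j p by (rule interior_est.test_le[OF ie0 test])
  have \<phi>out: "\<phi> j p = 0" if "p \<notin> ?Q" for j p by (rule interior_est.test_outside[OF ie0 test that])
  have \<phi>i: "integrable lborel (\<phi> j)" for j by (rule interior_est.integrable_test[OF ie0 test])
  have \<phi>vM: "\<bar>\<phi> j p * v n p\<bar> \<le> M * \<phi> j p" for j n p
    using mult_left_mono[OF vb[of n p] \<phi>0[of j p]] \<phi>0[of j p] by (simp add: abs_mult mult.commute[of M])
  have \<phi>vi: "integrable lborel (\<lambda>p. \<phi> j p * v n p)" for j n
  proof (rule Bochner_Integration.integrable_bound[of _ "\<lambda>p. M * \<phi> j p"])
    show "AE p in lborel. norm (\<phi> j p * v n p) \<le> norm (M * \<phi> j p)"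
      using order_trans[OF \<phi>vM abs_ge_self] by (intro AE_I2) (simp only: real_norm_def)
  qed (use \<phi>i in auto)
  have \<phi>v1: "(LINT p|lborel. \<bar>\<phi> j p * v n p\<bar>) \<le> M * (LINT p|lborel. \<phi> j p)" for j n
  proof -
    have "(LINT p|lborel. \<bar>\<phi> j p * v n p\<bar>) \<le> (LINT p|lborel. M * \<phi> j p)"
      using \<phi>vi \<phi>i \<phi>vM by (intro integral_mono) auto
    then show ?thesis by simp
  qed
  \<comment> \<open>Normalises the transforms into the unit disc, as needed for extracting a
    convergent subsequence; the summand 1 keeps the divisor positive.\<close>
  define k where "k j = 1 + M * (LINT p|lborel. \<phi> j p)" for j
  have k: "k j > 0" for j unfolding k_def using M0 \<phi>0 by (intro add_pos_nonneg mult_nonneg_nonneg Bochner_Integration.integral_nonneg) auto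
  obtain R where R: "\<forall>p\<in>?Q. norm p \<le> R" using bQ[unfolded bounded_iff] by (rule exE)
  define R' where "R' = max R 0"
  \<comment> \<open>The infimum bounds its members only over a family bounded below; nonnegativity
    of the multipliers ensures this.\<close>
  have mult: "\<exists>R. \<forall>n \<xi>. R \<le> real n \<longrightarrow> R \<le> norm \<xi> \<longrightarrow> Z \<le> levy_multiplier (\<mu>n n) \<xi>" for Z
  proof -
    have "\<forall>\<^sub>F R in at_top. Z \<le> (INF (n, \<xi>) \<in> {(n, \<xi>). R \<le> norm \<xi> \<and> R \<le> real n}. levy_multiplier (\<mu>n n) \<xi>)"
      using multiplier by (simp add: filterlim_at_top)
    then obtain R where Z: "Z \<le> (INF (n, \<xi>) \<in> {(n, \<xi>). R \<le> norm \<xi> \<and> R \<le> real n}. levy_multiplier (\<mu>n n) \<xi>)"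
      by (auto simp: eventually_at_top_linorder)
    have "bdd_below ((\<lambda>(n, \<xi>). levy_multiplier (\<mu>n n) \<xi>) ` {(n, \<xi>). R \<le> norm \<xi> \<and> R \<le> real n})"
      using levy_bound.multiplier_nonneg[OF \<Lambda>] by (intro bdd_belowI[of _ 0]) auto
    then have "Z \<le> levy_multiplier (\<mu>n n) \<xi>" if "R \<le> real n" "R \<le> norm \<xi>" for n \<xi>
      using cINF_lower[of "\<lambda>(n, \<xi>). levy_multiplier (\<mu>n n) \<xi>" "{(n, \<xi>). R \<le> norm \<xi> \<and> R \<le> real n}" "(n, \<xi>)"] Z that
      by auto
    then show ?thesis by blast
  qed
  have W0: "interior_est.W0 T b (u n) M = (\<lambda>p. b (v n p) - b (- M))" for n
    by (rule ext) (simp add: interior_est.W0_def[OF ie] entropy_sol.W_def[OF esM] v_def)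
  show ?thesis
  proof (rule L2_precompactI)
    fix n
    have m: "(\<lambda>p. b (u n p)) \<in> borel_measurable (restrict_space lborel ?Q)"
    proof -
      have "(\<lambda>p. b (u' n p)) \<in> borel_measurable (restrict_space lborel ?Q)"
        by (rule measurable_restrict_space1) measurable
      then show ?thesis
        by (rule measurable_cong[THEN iffD1, rotated]) (use u'Q in \<open>auto simp: space_restrict_space\<close>)
    qed
    have "integrable lborel (\<lambda>p. indicator ?Q p *\<^sub>R (b (u n p))\<^sup>2)"
    proof (rule integrable_cong_AE_imp)
      show "integrable lborel (\<lambda>p. indicator ?Q p *\<^sub>R (b (v n p))\<^sup>2)"
      proof (rule integrable_bounded_support[OF _ _ bQ])
        have "\<bar>b (v n p)\<bar> \<le> \<bar>H\<bar> + \<bar>b 0\<bar>" for p using bH[OF vb[of n p], of 0] M0 by simp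
        then have "\<bar>b (v n p)\<bar>\<^sup>2 \<le> (\<bar>H\<bar> + \<bar>b 0\<bar>)\<^sup>2" for p by (intro power_mono) auto
        then show "\<bar>indicator ?Q p *\<^sub>R (b (v n p))\<^sup>2\<bar> \<le> (\<bar>H\<bar> + \<bar>b 0\<bar>)\<^sup>2" for p
          by (auto simp: indicator_def)
      qed (auto intro!: borel_measurable_times borel_measurable_indicator Qs)
      have "(\<lambda>p. indicator ?Q p *\<^sub>R (b (u n p))\<^sup>2) = (\<lambda>p. indicator ?Q p * (b (u' n p))\<^sup>2)"
        by (auto simp: fun_eq_iff indicator_def u'Q)
      moreover have "(\<lambda>p. indicator ?Q p * (b (u' n p))\<^sup>2) \<in> borel_measurable borel"
        by (intro borel_measurable_times borel_measurable_indicator Qs) measurable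
      ultimately show "(\<lambda>p. indicator ?Q p *\<^sub>R (b (u n p))\<^sup>2) \<in> borel_measurable lborel" by simp
      show "AE p in lborel. indicator ?Q p *\<^sub>R (b (v n p))\<^sup>2 = indicator ?Q p *\<^sub>R (b (u n p))\<^sup>2"
        using u'v[of n]
      proof eventually_elim
        case (elim p)
        then show ?case using u'Q[of p n] by (auto simp: indicator_def)
      qed
    qed
    then show "(\<lambda>p. b (u n p)) \<in> L2_fun (restrict_space lborel ?Q)"
      using m Qs by (simp add: L2_fun_def integrable_restrict_space)
  next
    fix r :: "nat \<Rightarrow> nat" assume r: "strict_mono r"
    obtain Dn :: "(real \<times> 'a) set" where Dn: "countable Dn" "\<And>X. open X \<Longrightarrow> X \<noteq> {} \<Longrightarrow> \<exists>d\<in>Dn. d \<in> X"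
      using countable_dense_setE by blast
    \<comment> \<open>Indexing by pairs of a cut-off and a frequency from the dense set yields a
      single diagonal subsequence that serves all cut-offs.\<close>
    define F where "F n x = fourier (\<lambda>p. \<phi> (fst x) p * v (r n) p) (snd x) / of_real (k (fst x))" for n x
    have "countable ((UNIV :: nat set) \<times> Dn)" using Dn(1) by simp
    moreover have "norm (F n x) \<le> 1" for n x
    proof -
      have "norm (fourier (\<lambda>p. \<phi> (fst x) p * v (r n) p) (snd x)) \<le> k (fst x)"
        using order_trans[OF norm_fourier_le \<phi>v1[of "fst x" "r n"]] by (simp add: k_def add_increasing)
      then show ?thesis using k[of "fst x"] by (simp add: F_def norm_divide)
    qed
    ultimately obtain q :: "nat \<Rightarrow> nat" where q: "strict_mono q" "\<And>x. x \<in> UNIV \<times> Dn \<Longrightarrow> \<exists>l. (\<lambda>n. F (q n) x) \<longlonglongrightarrow> l"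
      using function_convergent_subsequence[of "(UNIV :: nat set) \<times> Dn" F 1] by blast
    have convD: "convergent (\<lambda>i. fourier (\<lambda>p. \<phi> j p * v (r (q i)) p) \<omega>)" if \<omega>: "\<omega> \<in> Dn" for j \<omega>
    proof -
      obtain l where "(\<lambda>n. F (q n) (j, \<omega>)) \<longlonglongrightarrow> l" using q(2)[of "(j, \<omega>)"] \<omega> by auto
      then have "(\<lambda>n. F (q n) (j, \<omega>) * of_real (k j)) \<longlonglongrightarrow> l * of_real (k j)" by (intro tendsto_intros)
      then show ?thesis using k[of j] by (auto simp: F_def convergent_def)
    qed
    have conv: "convergent (\<lambda>i. fourier (\<lambda>p. \<phi> j p * v (r (q i)) p) \<omega>)" for j \<omega>
    proof (rule convergent_from_dense[OF _ _ Dn(2) convD])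
      show "dist (fourier (\<lambda>p. \<phi> j p * v (r (q i)) p) x) (fourier (\<lambda>p. \<phi> j p * v (r (q i)) p) y) \<le> (R' * k j) * dist x y" for i x y
      proof -
        have "dist (fourier (\<lambda>p. \<phi> j p * v (r (q i)) p) x) (fourier (\<lambda>p. \<phi> j p * v (r (q i)) p) y)
          \<le> norm (x - y) * R' * (LINT p|lborel. \<bar>\<phi> j p * v (r (q i)) p\<bar>)"
          unfolding dist_norm
        proof (rule fourier_lipschitz[OF \<phi>vi])
          show "norm p \<le> R'" if "\<phi> j p * v (r (q i)) p \<noteq> 0" for p
          proof -
            have "p \<in> ?Q" using that \<phi>out[of p j] by auto
            then show ?thesis using bspec[OF R, of p] by (simp add: R'_def)
          qed
        qed
        also have "\<dots> \<le> norm (x - y) * R' * k j"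
          using \<phi>v1[of j "r (q i)"] by (intro mult_left_mono) (auto simp: k_def R'_def)
        finally show ?thesis by (simp add: dist_norm mult_ac)
      qed
      show "0 \<le> R' * k j" using k[of j] by (simp add: R'_def)
    qed
    have loc: "\<exists>N. \<forall>i\<ge>N. \<forall>i'\<ge>N. (LINT p|lborel. (\<phi> j p)\<^sup>2 * (b (v (r (q i)) p) - b (v (r (q i')) p))\<^sup>2) < e"
      if e: "e > 0" for j e
    proof -
      \<comment> \<open>Free of n, since all solutions share \<Lambda>, M, \<rho> and Mf.\<close>
      define E where "E = (2 * pi) ^ DIM(real \<times> 'a) * interior_est.E2 TYPE('a) \<Lambda> T b M \<rho> Mf (C j) (B j)"
      have "\<exists>N. \<forall>i\<ge>N. \<forall>i'\<ge>N. (LINT p|lborel. (\<phi> j p)\<^sup>2 * (b (v ((r \<circ> q) i) p) - b (v ((r \<circ> q) i') p))\<^sup>2) < e"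
      proof (rule local_compactness[where \<phi> = "\<phi> j" and v = v and b = b and r = "r \<circ> q" and C = "C j" and S = ?Q and K = M and E = E and m = "\<lambda>n. levy_multiplier (\<mu>n n)"])
        show "(\<integral>\<^sup>+\<omega>. ennreal (levy_multiplier (\<mu>n n) (snd \<omega>)) * ennreal ((cmod (fourier (\<lambda>p. \<phi> j p * (b (v n p) - b (- M))) \<omega>))\<^sup>2) \<partial>lborel) \<le> ennreal E" for n
          using interior_est.fourier_energy[OF ie[of n] test B, of j] unfolding W0 E_def .
        show "0 \<le> E" unfolding E_def using interior_est.E2_nonneg[OF ie0 test B] by simp
        show "\<exists>c. \<forall>n \<omega>. norm (snd \<omega>) < S \<longrightarrow> \<bar>fst \<omega>\<bar> * cmod (fourier (\<lambda>p. \<phi> j p * v n p) \<omega>) \<le> c" for S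
        proof -
          define G' where "G' = interior_est.G TYPE('a) \<Lambda> T b M \<rho> Mf + 2 * interior_est.bsup b M * \<Lambda> * interior_est.vol TYPE('a) T \<rho>"
          define c where "c = 2 * (C j * (2 + 2 * S + S\<^sup>2) * G' + 2 * M * B j * interior_est.vol TYPE('a) T \<rho>)"
          have G'0: "0 \<le> G'"
            unfolding G'_def using interior_est.G_nonneg[OF ie0] interior_est.bsup_nonneg[OF ie0]
              levy_bound.\<Lambda>_nonneg[OF \<Lambda>] interior_est.vol_nonneg[OF ie0] by simp
          have C0: "0 \<le> C j" by (rule interior_est.C_nonneg[OF ie0 test])
          have "\<bar>fst \<omega>\<bar> * cmod (fourier (\<lambda>p. \<phi> j p * v n p) \<omega>) \<le> c" if S: "norm (snd \<omega>) < S" for n \<omega>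
          proof -
            have "\<bar>fst \<omega>\<bar> * cmod (fourier (\<lambda>p. \<phi> j p * v n p) \<omega>)
              \<le> 2 * (C j * (2 + 2 * norm (snd \<omega>) + (norm (snd \<omega>))\<^sup>2) * G' + 2 * M * B j * interior_est.vol TYPE('a) T \<rho>)"
              using interior_est.time_fourier_estimate[OF ie[of n] test B, where \<omega> = \<omega>] unfolding v_def G'_def .
            also have "\<dots> \<le> c"
            proof -
              have "(norm (snd \<omega>))\<^sup>2 \<le> S\<^sup>2" using S by (intro power_mono) auto
              then have "2 + 2 * norm (snd \<omega>) + (norm (snd \<omega>))\<^sup>2 \<le> 2 + 2 * S + S\<^sup>2" using S by linarith
              then show ?thesis unfolding c_def using C0 G'0
                by (intro mult_left_mono add_right_mono mult_right_mono) auto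
            qed
            finally show ?thesis .
          qed
          then show ?thesis by blast
        qed
        show "strict_mono (r \<circ> q)" by (rule strict_mono_o[OF r q(1)])
        show "convergent (\<lambda>i. fourier (\<lambda>p. \<phi> j p * v ((r \<circ> q) i) p) \<omega>)" for \<omega> using conv by simp
      qed (use \<phi>m \<phi>0 \<phi>C bQ \<phi>out vm vb b_cont b_reg(2) M0 mult e in auto)
      then show ?thesis by simp
    qed
    have int_eq: "(LINT p|restrict_space lborel ?Q. (b (u m p) - b (u n p))\<^sup>2)
        = (LINT p|lborel. indicator ?Q p * (b (v m p) - b (v n p))\<^sup>2)" for m n
    proof -
      have "(LINT p|restrict_space lborel ?Q. (b (u m p) - b (u n p))\<^sup>2)
         = (LINT p|lborel. indicator ?Q p *\<^sub>R (b (u m p) - b (u n p))\<^sup>2)"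
        using Qs by (subst integral_restrict_space) auto
      also have "\<dots> = (LINT p|lborel. indicator ?Q p * (b (u' m p) - b (u' n p))\<^sup>2)"
        by (rule Bochner_Integration.integral_cong) (auto simp: indicator_def u'Q)
      also have "\<dots> = (LINT p|lborel. indicator ?Q p * (b (v m p) - b (v n p))\<^sup>2)"
      proof (rule integral_cong_AE)
        show "AE p in lborel. indicator ?Q p * (b (u' m p) - b (u' n p))\<^sup>2 = indicator ?Q p * (b (v m p) - b (v n p))\<^sup>2"
          using u'v[of m] u'v[of n] by eventually_elim simp
      qed (simp_all add: borel_measurable_times borel_measurable_indicator Qs)
      finally show ?thesis .
    qed
    have "\<exists>N. \<forall>i\<ge>N. \<forall>i'\<ge>N. (LINT p|lborel. indicator ?Q p * (b (v (r (q i)) p) - b (v (r (q i')) p))\<^sup>2) < e"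
      if e: "e > 0" for e
    proof -
      \<comment> \<open>The part of \<open>Q\<close> where none of the cut-offs numbered up to i
        exceeds 1 / (i + 1). Since the boxes cover \<open>Q\<close>, every point leaves these sets
        eventually and their measure tends to 0.\<close>
      define P where "P i = {p \<in> ?Q. \<forall>j\<le>i. \<phi> j p \<le> 1 / (real i + 1)}" for i :: nat
      have P_alt: "P i = ?Q \<inter> (\<Inter>j\<in>{..i}. {p \<in> space borel. \<phi> j p \<le> 1 / (real i + 1)})" for i
        by (auto simp: P_def)
      have Pm [measurable]: "P i \<in> sets borel" for i
        unfolding P_alt by (intro sets.Int Qs sets.finite_INT) auto
      have iP: "integrable lborel (indicator (P i) :: _ \<Rightarrow> real)" for i
        by (rule integrable_bounded_support[OF _ _ bQ, of _ 1]) (use Pm in \<open>auto simp: indicator_def P_def\<close>)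
      have iQ: "integrable lborel (indicator ?Q :: _ \<Rightarrow> real)"
        by (rule integrable_bounded_support[OF _ _ bQ, of _ 1]) (use Qs in \<open>auto simp: indicator_def\<close>)
      have "(\<lambda>i. LINT p|lborel. indicator (P i) p :: real) \<longlonglongrightarrow> (LINT p|(lborel :: (real \<times> 'a) measure). 0 :: real)"
      proof (rule Bochner_Integration.integral_dominated_convergence[OF _ _ iQ])
        show "AE p in lborel. (\<lambda>i. indicator (P i) p :: real) \<longlonglongrightarrow> 0"
        proof (rule AE_I2)
          fix p :: "real \<times> 'a"
          show "(\<lambda>i. indicator (P i) p :: real) \<longlonglongrightarrow> 0"
          proof (cases "p \<in> ?Q")
            case True
            then obtain j where "p \<in> box (a j) (c j)" using ac(2) by blast
            then have pos: "\<phi> j p > 0" unfolding \<phi>_def by (rule bump_pos)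
            have "(\<lambda>i. 1 / (real i + 1)) \<longlonglongrightarrow> 0" using LIMSEQ_inverse_real_of_nat by (simp add: inverse_eq_divide add.commute)
            then have "\<forall>\<^sub>F i in sequentially. 1 / (real i + 1) < \<phi> j p" using pos by (rule order_tendstoD)
            then have "\<forall>\<^sub>F i in sequentially. indicator (P i) p = (0 :: real)"
              using eventually_ge_at_top[of j]
              by eventually_elim (auto simp: P_def indicator_def not_le)
            then show ?thesis by (rule tendsto_eventually)
          qed (simp add: P_def)
        qed
        show "AE p in lborel. norm (indicator (P i) p :: real) \<le> indicator ?Q p" for i
          by (intro AE_I2) (auto simp: indicator_def P_def)
      qed (use Pm in auto)
      then have Plim: "(\<lambda>i. LINT p|lborel. indicator (P i) p :: real) \<longlonglongrightarrow> 0" by simp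
      have "e / (2 * (H\<^sup>2 + 1)) > 0" using e by (intro divide_pos_pos mult_pos_pos add_nonneg_pos) auto
      from order_tendstoD(2)[OF Plim this] obtain i0 where i0: "(LINT p|lborel. indicator (P i0) p :: real) < e / (2 * (H\<^sup>2 + 1))"
        by (auto simp: eventually_sequentially)
      have HP: "H\<^sup>2 * (LINT p|lborel. indicator (P i0) p :: real) < e / 2"
      proof -
        have "H\<^sup>2 * (LINT p|lborel. indicator (P i0) p :: real) \<le> (H\<^sup>2 + 1) * (LINT p|lborel. indicator (P i0) p :: real)"
          by (intro mult_right_mono Bochner_Integration.integral_nonneg) auto
        also have "\<dots> < (H\<^sup>2 + 1) * (e / (2 * (H\<^sup>2 + 1)))"
          using i0 by (intro mult_strict_left_mono) (auto intro: add_nonneg_pos)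
        also have "\<dots> = e / 2"
        proof -
          have "x * (e / (2 * x)) = e / 2" if "x \<noteq> 0" for x :: real using that by simp
          moreover have "H\<^sup>2 + 1 \<noteq> 0" using zero_le_power2[of H] by linarith
          ultimately show ?thesis by blast
        qed
        finally show ?thesis .
      qed
      define s where "s = real i0 + 1"
      have s: "s > 0" by (simp add: s_def)
      \<comment> \<open>The cut-offs up to i0 are s in number and each enters with weight s^2, so
        together they contribute at most s^2 * s * e' = e / 2.\<close>
      define e' where "e' = e / (2 * s\<^sup>2 * s)"
      have e': "e' > 0" using e s by (simp add: e'_def)
      have "\<forall>j. \<exists>N. \<forall>i\<ge>N. \<forall>i'\<ge>N. (LINT p|lborel. (\<phi> j p)\<^sup>2 * (b (v (r (q i)) p) - b (v (r (q i')) p))\<^sup>2) < e'"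
        by (intro allI loc e')
      then obtain Nf where Nf: "\<And>j i i'. i \<ge> Nf j \<Longrightarrow> i' \<ge> Nf j \<Longrightarrow>
          (LINT p|lborel. (\<phi> j p)\<^sup>2 * (b (v (r (q i)) p) - b (v (r (q i')) p))\<^sup>2) < e'"
        unfolding choice_iff by blast
      define N where "N = (\<Sum>j\<le>i0. Nf j)"
      have NN: "Nf j \<le> N" if "j \<le> i0" for j unfolding N_def using that by (intro member_le_sum) auto
      have "(LINT p|lborel. indicator ?Q p * (b (v (r (q i)) p) - b (v (r (q i')) p))\<^sup>2) < e" if ii: "i \<ge> N" "i' \<ge> N" for i i'
      proof -
        define d where "d p = b (v (r (q i)) p) - b (v (r (q i')) p)" for p
        have dm [measurable]: "d \<in> borel_measurable borel" unfolding d_def by measurable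
        have dH: "(d p)\<^sup>2 \<le> H\<^sup>2" for p
        proof -
          have "\<bar>d p\<bar>\<^sup>2 \<le> H\<^sup>2" unfolding d_def by (intro power_mono bH vb) auto
          then show ?thesis by simp
        qed
        have i\<phi>: "integrable lborel (\<lambda>p. (\<phi> j p)\<^sup>2 * (d p)\<^sup>2)" for j
        proof (rule integrable_bounded_support[OF _ _ bQ])
          show "\<bar>(\<phi> j p)\<^sup>2 * (d p)\<^sup>2\<bar> \<le> (C j)\<^sup>2 * H\<^sup>2" for p
            using power_mono[OF \<phi>C \<phi>0, of j p 2] dH[of p] by (simp add: mult_mono)
        qed (use \<phi>out in auto)
        have "\<bar>LINT p|lborel. indicator ?Q p * (d p)\<^sup>2\<bar> \<le> (LINT p|lborel. H\<^sup>2 * indicator (P i0) p + s\<^sup>2 * (\<Sum>j\<le>i0. (\<phi> j p)\<^sup>2 * (d p)\<^sup>2))"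
        proof (rule abs_integral_le[OF AE_I2])
          fix p
          have sum0: "0 \<le> (\<Sum>j\<le>i0. (\<phi> j p)\<^sup>2 * (d p)\<^sup>2)" by (intro sum_nonneg) auto
          show "\<bar>indicator ?Q p * (d p)\<^sup>2\<bar> \<le> H\<^sup>2 * indicator (P i0) p + s\<^sup>2 * (\<Sum>j\<le>i0. (\<phi> j p)\<^sup>2 * (d p)\<^sup>2)"
          proof (cases "p \<in> ?Q \<and> p \<notin> P i0")
            case True
            \<comment> \<open>Off \<open>P i0\<close> some cut-off exceeds 1 / s, so the squared
              difference is at most s^2 times its localised version.\<close>
            then obtain j where j: "j \<le> i0" "1 / s < \<phi> j p" by (auto simp: P_def s_def not_le)
            then have "1 < s * \<phi> j p" using s by (simp add: field_simps)
            then have "1 \<le> (s * \<phi> j p)\<^sup>2" by (simp add: one_le_power)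
            then have "1 * (d p)\<^sup>2 \<le> (s * \<phi> j p)\<^sup>2 * (d p)\<^sup>2" by (intro mult_right_mono) auto
            also have "\<dots> = s\<^sup>2 * ((\<phi> j p)\<^sup>2 * (d p)\<^sup>2)" by (simp add: power_mult_distrib)
            also have "\<dots> \<le> s\<^sup>2 * (\<Sum>j\<le>i0. (\<phi> j p)\<^sup>2 * (d p)\<^sup>2)"
              using j(1) by (intro mult_left_mono member_le_sum) auto
            finally show ?thesis using True by (simp add: indicator_def)
          next
            case False
            then have "indicator ?Q p * (d p)\<^sup>2 \<le> H\<^sup>2 * indicator (P i0) p"
              using dH[of p] by (simp add: indicator_def)
            moreover have "0 \<le> indicator ?Q p * (d p)\<^sup>2" by simp
            moreover have "0 \<le> s\<^sup>2 * (\<Sum>j\<le>i0. (\<phi> j p)\<^sup>2 * (d p)\<^sup>2)"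
              using sum0 by (intro mult_nonneg_nonneg) auto
            ultimately show ?thesis by linarith
          qed
        qed (use iP i\<phi> in auto)
        also have "\<dots> = H\<^sup>2 * (LINT p|lborel. indicator (P i0) p) + s\<^sup>2 * (\<Sum>j\<le>i0. (LINT p|lborel. (\<phi> j p)\<^sup>2 * (d p)\<^sup>2))"
          using iP i\<phi> by (subst Bochner_Integration.integral_add) (simp_all add: Bochner_Integration.integral_sum del: lebesgue_integral_const)
        also have "\<dots> < e / 2 + s\<^sup>2 * (\<Sum>j\<le>i0. e')"
        proof (intro add_less_le_mono HP mult_left_mono sum_mono)
          fix j assume "j \<in> {..i0}"
          then have "Nf j \<le> i" "Nf j \<le> i'" using NN[of j] ii by auto
          then show "(LINT p|lborel. (\<phi> j p)\<^sup>2 * (d p)\<^sup>2) \<le> e'" unfolding d_def by (intro less_imp_le[OF Nf])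
        qed simp
        also have "s\<^sup>2 * (\<Sum>j\<le>i0. e') = s\<^sup>2 * (s * e')" by (simp add: s_def add.commute)
        also have "\<dots> = e / 2" using s by (simp add: e'_def)
        finally show ?thesis by (simp add: d_def)
      qed
      then show ?thesis by blast
    qed
    then show "\<exists>r' :: nat \<Rightarrow> nat. strict_mono r' \<and> (\<forall>e>0. \<exists>N. \<forall>i\<ge>N. \<forall>j\<ge>N.
        (LINT x|restrict_space lborel ?Q. (b (u (r (r' i)) x) - b (u (r (r' j)) x))\<^sup>2) < e)"
      unfolding int_eq using q(1) by blast
  qed
qed

end
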